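(* Assume Hypothesis (H) below. Let $t_1,\dots,t_d\ge 0$, $T=\sum_{k=1}^d t_k$, and let $(n_k,f^{(k)})_{k\ge1}$ be a sequence with $n_k\in\mathbb N$, $n_k\to\infty$, $f^{(k)}\in\mathcal K$, $\rho(f^{(k)})\to1$; write $n=n_k$, $\rho=\rho(f^{(k)})$ and evaluate all $f$-dependent quantities ($\rho_\mu,u,v,Q,\theta_n$, the law of the process) at $f=f^{(k)}$. For a vector $m_n=(m_{n,1},\dots,m_{n,d})'$ specified below, put $$\Phi_{n,j}=E\Big(\exp\Big\{-\sum_{l=1}^d \tfrac{t_l\,Y_{n,l}}{m_{n,l}}\Big\}\,\Big|\,Z_n>\mathbf 0,\ Z_0=e_j\Big),\qquad j\in\{1,\dots,d\}.$$ Then for every $j$, as $k\to\infty$: (1) if $n|1-\rho|\to -\ln r$ with $r\in(0,1)$ and $\rho>1$ for all $k$, and $m_n=\frac{Q(1-\rho_\mu^n)^2h_+(\theta_n)}{(1-\rho_\mu)^2}v$, then with $D=d_+(T,r)$, $\Phi_{n,j}\to \frac{2(1-r)r^{D}D^2}{(1-r^{D})\,(D-1+(D+1)r^{D})}$; if instead $\rho<1$ for all $k$ and $m_n=\frac{Q(1-\rho_\mu^n)^2h_-(\theta_n)}{(1-\rho_\mu)^2}v$, then with $D=d_-(T,r)$, $\Phi_{n,j}\to \frac{2(1-r)r^{D}D^2}{r(1-r^{D})\,(D+1+(D-1)r^{D})}$; (2) if $n|1-\rho|\to0$ and $m_n=\frac{2Qn^2}{3}v$, then $\Phi_{n,j}\to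 \frac{\sqrt{6T}}{\sinh\sqrt{6T}}$; (3) if $\rho<1$ for all $k$, $n(1-\rho)\to\infty$ and $m_n=\frac{2Qn}{1-\rho}v$, then $\Phi_{n,j}\to e^{-T}$; (4) if $\rho>1$ for all $k$, $n(\rho-1)\to\infty$ and $m_n=\frac{Q\rho^n}{(1-\rho)^2}v$, then $\Phi_{n,j}\to \frac{1}{1+T}$.
   Context: Fix $d\ge1$, $X=\mathbb Z_{\ge0}^d$, $C=[0,1]^d$; for $s\in C$, $\alpha\in X$, $s^\alpha=\prod_i s_i^{\alpha_i}$; vector inequalities and the product $sw=(s_1w_1,\dots,s_dw_d)'$ are componentwise; $\mathbf 1,\mathbf 0$ are the all-ones/all-zeros vectors, $e_k$ the $k$-th unit vector. A $d$-type Galton–Watson process $(Z_n)_{n\ge0}$, $Z_n=(Z_{n,1},\dots,Z_{n,d})'\in X$, has offspring p.g.f. $f=(f_1,\dots,f_d)'$, $f_k(s)=\sum_{i\in X}p_k(i)s^i$ (each type-$k$ particle independently produces offspring vector with law $p_k$). $Y_n=\sum_{l=0}^nZ_l$ is the total progeny. $M(s)=(\partial f_k(s)/\partial s_l)_{k,l}$, $M=M(\mathbf 1)$, $b^k_{lm}=\partial^2f_k(\mathbf 1)/\partial s_l\partial s_m$, $c^k_{lmj}=\partial^3 f_k(\mathbf 1)/\partial s_l\partial s_m\partial s_j$. For fixed $a,b,c>0$, $U\in\mathbb N$, $\mathcal K=\mathcal K(a,b,c,U)$ is the class of such $f$ with $[M^U]_{kl}\ge a$ for all $k,l$, $\sum_{k,l,m}b^k_{lm}\ge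 b$, $\sum_{k,l,m,j}c^k_{lmj}\le c$. For $f\in\mathcal K$, $\rho=\rho(f)$ is the Perron root of $M$, $u$ and $v$ the right and left (column) eigenvectors of $M$ for $\rho$ normalized by $\sum_ku_k=1$, $\sum_ku_kv_k=1$; $Q=\frac12\sum_kv_k\sum_{l,m}b^k_{lm}u_lu_m$. $\mu$ is the vector of extinction probabilities $\mu_j=P(Z_n=\mathbf 0\text{ for some }n\mid Z_0=e_j)$, $\rho_\mu$ the Perron root of $M(\mu)$ (so $\rho_\mu=\rho$ if $\rho\le1$), $\theta_n=n\ln\rho_\mu$. Define $I_+(x)=e^x$, $I_-(x)=1$, $h_\pm(x)=\frac{(1-e^x)(e^{\mp x}-3)-2xI_\pm(x)}{(1-e^x)^3}$, $d_\pm(y,x)=\sqrt{1+\frac{4y}{(1-x)^2h_\pm(\ln x)}}$. Hypothesis (H): for $f\in\mathcal K$ and $s\in C$ let $h_0(s)=\mathbf 0$, $h_n(s)=sf(h_{n-1}(s))$, and $h^*(s)=\lim_nh_n(s)$, the unique solution in $C$ of $h=sf(h)$; let $v_{h^*}$ be the left Perron eigenvector of $M(h^*(s))$, normalized with the right one $u_{h^*}$ by $\sum_k u_{h^*,k}=1$, $\sum_ku_{h^*,k}v_{h^*,k}=1$. (H) asserts: for every sequence $(n_k,f^{(k)},s^{(k)})$ with $n_k\to\infty$, $f^{(k)}\in\mathcal K$, $\rho(f^{(k)})\to1$, $s^{(k)}\in C$, $s^{(k)}\to\mathbf 1$, one has $v_{h^*}'(h^*(s^{(k)})-h_{n_k}(s^{(k)}))\to0$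 (all computed for $f^{(k)}$). *)

theory Defs
  imports "HOL-Analysis.Analysis" "HOL-Probability.Probability"
begin

text \<open>Types: the set of particle types is a finite type 'd (so d = CARD('d)).
  An offspring law is p :: 'd => (nat^'d) pmf; p k is the law of the offspring
  vector of a type-k particle.  Real vectors are real^'d, matrices real^'d^'d.\<close>

type_synonym 'd offspring = "'d \<Rightarrow> (nat^'d) pmf"

definition unitv :: "'d::finite \<Rightarrow> nat^'d" where
  "unitv j = (\<chi> i. if i = j then 1 else 0)"

definition cube :: "(real^'d::finite) set" where
  "cube = {s. \<forall>i. 0 \<le> s$i \<and> s$i \<le> 1}"

fun iid_sum :: "(nat^'d::finite) pmf \<Rightarrow> nat \<Rightarrow> (nat^'d) pmf" where
  "iid_sum q 0 = return_pmf 0"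
| "iid_sum q (Suc m) = bind_pmf q (\<lambda>x. map_pmf (\<lambda>y. x + y) (iid_sum q m))"

definition next_gen :: "'d::finite offspring \<Rightarrow> nat^'d \<Rightarrow> (nat^'d) pmf" where
  "next_gen p z = map_pmf (\<lambda>g. \<Sum>k\<in>UNIV. g k) (Pi_pmf UNIV 0 (\<lambda>k. iid_sum (p k) (z$k)))"

fun gw_law :: "'d::finite offspring \<Rightarrow> 'd \<Rightarrow> nat \<Rightarrow> ((nat^'d) \<times> (nat^'d)) pmf" where
  "gw_law p j 0 = return_pmf (unitv j, unitv j)"
| "gw_law p j (Suc n) =
     bind_pmf (gw_law p j n) (\<lambda>(z, y). map_pmf (\<lambda>z'. (z', y + z')) (next_gen p z))"

text \<open>Extinction probabilities: P(exists n. Z_n = 0) = sup_n P(Z_n = 0) (increasing events).\<close>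
definition ext_prob :: "'d::finite offspring \<Rightarrow> real^'d" where
  "ext_prob p = (\<chi> j. SUP n. measure_pmf.prob (gw_law p j n) {zy. fst zy = 0})"

text \<open>Phi_{n,j} = E(exp(- sum_l t_l Y_{n,l}/m_l) | Z_n > 0, Z_0 = e_j), where Z_n > 0
  means Z_n is not the zero vector (non-extinction at time n).\<close>
definition Phi :: "'d::finite offspring \<Rightarrow> nat \<Rightarrow> real^'d \<Rightarrow> real^'d \<Rightarrow> 'd \<Rightarrow> real" where
  "Phi p n m t j =
    measure_pmf.expectation (gw_law p j n)
       (\<lambda>zy. exp (- (\<Sum>l\<in>UNIV. t$l * real (snd zy $ l) / m$l)) * (if fst zy \<noteq> 0 then 1 else 0))
    / measure_pmf.prob (gw_law p j n) {zy. fst zy \<noteq> 0}"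

definition pgf :: "'d::finite offspring \<Rightarrow> real^'d \<Rightarrow> real^'d" where
  "pgf p s = (\<chi> k. infsum (\<lambda>i. pmf (p k) i * (\<Prod>l\<in>UNIV. s$l ^ (i$l))) UNIV)"

text \<open>M(s)_{kl} = d f_k / d s_l (s), by termwise differentiation of the power series.\<close>
definition jac :: "'d::finite offspring \<Rightarrow> real^'d \<Rightarrow> real^'d^'d" where
  "jac p s = (\<chi> k l. infsum (\<lambda>i. pmf (p k) i * real (i$l) *
        (\<Prod>m\<in>UNIV. s$m ^ (if m = l then i$m - 1 else i$m))) UNIV)"

definition ff1 :: "nat^'d::finite \<Rightarrow> 'd \<Rightarrow> real" where
  "ff1 i l = real (i$l)"

definition ff2 :: "nat^'d::finite \<Rightarrow> 'd \<Rightarrow> 'd \<Rightarrow> real" where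
  "ff2 i l m = real (i$l) * (real (i$m) - (if m = l then 1 else 0))"

definition ff3 :: "nat^'d::finite \<Rightarrow> 'd \<Rightarrow> 'd \<Rightarrow> 'd \<Rightarrow> real" where
  "ff3 i l m j = real (i$l) * (real (i$m) - (if m = l then 1 else 0))
                  * (real (i$j) - (if j = l then 1 else 0) - (if j = m then 1 else 0))"

text \<open>b^k_{lm} and c^k_{lmj}: the derivatives of s^i at s = 1, summed against p_k.\<close>
definition bcoef :: "'d::finite offspring \<Rightarrow> 'd \<Rightarrow> 'd \<Rightarrow> 'd \<Rightarrow> real" where
  "bcoef p k l m = infsum (\<lambda>i. pmf (p k) i * ff2 i l m) UNIV"

definition ccoef :: "'d::finite offspring \<Rightarrow> 'd \<Rightarrow> 'd \<Rightarrow> 'd \<Rightarrow> 'd \<Rightarrow> real" where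
  "ccoef p k l m j = infsum (\<lambda>i. pmf (p k) i * ff3 i l m j) UNIV"

fun mpow :: "real^'n^'n \<Rightarrow> nat \<Rightarrow> real^'n^'n" where
  "mpow A 0 = mat 1"
| "mpow A (Suc n) = A ** mpow A n"

text \<open>The class K(a,b,c,U).  The summability conditions express that the derivatives
  of f at 1 up to order three exist (are finite).\<close>
definition classK :: "real \<Rightarrow> real \<Rightarrow> real \<Rightarrow> nat \<Rightarrow> 'd::finite offspring set" where
  "classK a b c U = {p.
     (\<forall>k l. (\<lambda>i. pmf (p k) i * ff1 i l) summable_on UNIV) \<and>
     (\<forall>k l m. (\<lambda>i. pmf (p k) i * ff2 i l m) summable_on UNIV) \<and>
     (\<forall>k l m j. (\<lambda>i. pmf (p k) i * ff3 i l m j) summable_on UNIV) \<and>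
     (\<forall>k l. mpow (jac p 1) U $ k $ l \<ge> a) \<and>
     (\<Sum>k\<in>UNIV. \<Sum>l\<in>UNIV. \<Sum>m\<in>UNIV. bcoef p k l m) \<ge> b \<and>
     (\<Sum>k\<in>UNIV. \<Sum>l\<in>UNIV. \<Sum>m\<in>UNIV. \<Sum>j\<in>UNIV. ccoef p k l m j) \<le> c}"

definition perron_root :: "real^'n::finite^'n \<Rightarrow> real" where
  "perron_root A = Max {cmod z | z.
      det ((\<chi> i j. (if i = j then z else 0) - complex_of_real (A$i$j)) :: complex^'n^'n) = 0}"

definition perron_rvec :: "real^'n::finite^'n \<Rightarrow> real^'n" where
  "perron_rvec A = (THE u. A *v u = perron_root A *\<^sub>R u \<and> (\<Sum>k\<in>UNIV. u$k) = 1)"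

definition perron_lvec :: "real^'n::finite^'n \<Rightarrow> real^'n" where
  "perron_lvec A = (THE v. v v* A = perron_root A *\<^sub>R v \<and>
                          (\<Sum>k\<in>UNIV. perron_rvec A $ k * v$k) = 1)"

definition rho :: "'d::finite offspring \<Rightarrow> real" where
  "rho p = perron_root (jac p 1)"

definition uvec :: "'d::finite offspring \<Rightarrow> real^'d" where
  "uvec p = perron_rvec (jac p 1)"

definition vvec :: "'d::finite offspring \<Rightarrow> real^'d" where
  "vvec p = perron_lvec (jac p 1)"

definition Qpar :: "'d::finite offspring \<Rightarrow> real" where
  "Qpar p = (1/2) * (\<Sum>k\<in>UNIV. vvec p $ k *
              (\<Sum>l\<in>UNIV. \<Sum>m\<in>UNIV. bcoef p k l m * uvec p $ l * uvec p $ m))"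

definition rho_mu :: "'d::finite offspring \<Rightarrow> real" where
  "rho_mu p = perron_root (jac p (ext_prob p))"

definition theta :: "'d::finite offspring \<Rightarrow> nat \<Rightarrow> real" where
  "theta p n = real n * ln (rho_mu p)"

definition h_plus :: "real \<Rightarrow> real" where
  "h_plus x = ((1 - exp x) * (exp (- x) - 3) - 2 * x * exp x) / (1 - exp x) ^ 3"

definition h_minus :: "real \<Rightarrow> real" where
  "h_minus x = ((1 - exp x) * (exp x - 3) - 2 * x) / (1 - exp x) ^ 3"

definition d_plus :: "real \<Rightarrow> real \<Rightarrow> real" where
  "d_plus y x = sqrt (1 + 4 * y / ((1 - x)^2 * h_plus (ln x)))"

definition d_minus :: "real \<Rightarrow> real \<Rightarrow> real" where
  "d_minus y x = sqrt (1 + 4 * y / ((1 - x)^2 * h_minus (ln x)))"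

fun hseq :: "'d::finite offspring \<Rightarrow> real^'d \<Rightarrow> nat \<Rightarrow> real^'d" where
  "hseq p s 0 = 0"
| "hseq p s (Suc n) = s * pgf p (hseq p s n)"

definition hstar :: "'d::finite offspring \<Rightarrow> real^'d \<Rightarrow> real^'d" where
  "hstar p s = lim (hseq p s)"

definition hypH :: "'d::finite itself \<Rightarrow> real \<Rightarrow> real \<Rightarrow> real \<Rightarrow> nat \<Rightarrow> bool" where
  "hypH (_::'d itself) a b c U \<longleftrightarrow>
    (\<forall>(nk::nat \<Rightarrow> nat) (P::nat \<Rightarrow> 'd offspring) (S::nat \<Rightarrow> real^'d).
       filterlim nk at_top sequentially \<and> (\<forall>k. P k \<in> classK a b c U) \<and>
       ((\<lambda>k. rho (P k)) \<longlongrightarrow> 1) sequentially \<and> (\<forall>k. S k \<in> cube) \<and> (S \<longlonglongrightarrow> 1)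
       \<longrightarrow> ((\<lambda>k. perron_lvec (jac (P k) (hstar (P k) (S k))) \<bullet>
                 (hstar (P k) (S k) - hseq (P k) (S k) (nk k))) \<longlonglongrightarrow> 0))"

definition m_pm :: "(real \<Rightarrow> real) \<Rightarrow> 'd::finite offspring \<Rightarrow> nat \<Rightarrow> real^'d" where
  "m_pm hf p n = (Qpar p * (1 - rho_mu p ^ n)^2 * hf (theta p n) / (1 - rho_mu p)^2) *\<^sub>R vvec p"

end

theory Submission
  imports Defs
begin

text \<open>Put \<open>G(x) = 1 - f(1 - x)\<close>, let \<open>s\<close> have the components \<open>exp (- t_l / m_l)\<close>, and iterate
  \<open>x \<mapsto> (1 - s) + s G(x)\<close>.  If \<open>y_n\<close> and \<open>x_n\<close> are the iterates started at \<open>1\<close> and \<open>1 - s\<close>, and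
  \<open>D_n = P(Z_n \<noteq> 0)\<close> are the iterates of \<open>G\<close> started at \<open>1\<close>, then \<open>\<Phi>_{n,j} = (y_n - x_n)_j / (D_n)_j\<close>.

  Near criticality all these trajectories align with the Perron eigenvector \<open>u\<close>, uniformly over the
  class, and their projections on \<open>v\<close> follow a perturbed Riccati recursion
  \<open>z \<mapsto> \<rho> z - Q z\<^sup>2 + \<sigma>\<close> with \<open>\<sigma> = v'(1 - s)\<close>.  After a shift by its negative fixed point the reciprocal
  of the recursion is linear, which gives the asymptotics of \<open>y\<close> (started far above the scale of
  interest), of \<open>x\<close> (started far below it) and of \<open>D\<close> (\<open>\<sigma> = 0\<close>), hence the limits for bounded
  \<open>n(\<rho> - 1)\<close> and for \<open>n(\<rho> - 1) \<rightarrow> \<infinity>\<close>.  If \<open>n(1 - \<rho>) \<rightarrow> \<infinity>\<close>, then \<open>y\<close> and \<open>x\<close> agree to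
  leading order; there \<open>y - x\<close> is compared with \<open>D\<close> step by step, the ratio losing a factor
  \<open>1 - 2Qx/\<rho>\<close> at each step while \<open>x\<close> sits at the plateau \<open>\<sigma> / (1 - \<rho>)\<close>.  Finally
  \<open>1 - \<rho>_\<mu> \<sim> \<rho> - 1\<close> in the supercritical case, by projecting the eigenvector equation of \<open>M(\<mu>)\<close> on \<open>v\<close>.\<close>

section \<open>Perron roots of primitive matrices\<close>

text \<open>Each index \<open>k\<close> carries a different law, so every estimate must hold with
  constants depending only on a, b, c, U and the number of types. For the linear part they come from
  \<open>M^U \<ge> a\<close>, which bounds the eigenvectors below and gives a fixed contraction
  towards u; for the nonlinear part from the third moments. For a fixed precision the expansions
  hold after a burn-in independent of k. A diagonal choice lets the precision tend to zero while the
  burn-in stays negligible on the relevant time scale, so exact limits follow by sandwiching. The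
  shift uses the negative fixed point because z plus the shift is positive whether z starts above or
  below the positive one; reciprocals then reverse inequalities at every step, and one pair of
  bounds serves x, y and D. Separate asymptotics of y and x determine y - x only if the difference
  has their common order. Deep in the subcritical range it is bounded by D, which is much smaller
  than x and y, so its ratio to D has to be followed multiplicatively, with errors o(1/n) per
  step.\<close>

lemma mpow_commute: "mpow A n ** A = A ** mpow A n"
  by (induction n) (simp_all add: matrix_mul_assoc[symmetric])

lemma mpow_transpose: "transpose (mpow A n) = mpow (transpose (A::real^'n::finite^'n)) n"
  by (induction n) (simp_all add: transpose_mat matrix_transpose_mul mpow_commute)

lemma mpow_eigenvector:
  fixes A :: "real^'n::finite^'n"
  assumes "A *v u = r *\<^sub>R u"
  shows "mpow A n *v u = r ^ n *\<^sub>R u"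
  by (induction n)
    (simp_all add: matrix_vector_mul_assoc[symmetric] assms matrix_vector_mult_scaleR)

lemma matrix_vec_nth: "(A *v x) $ i = (\<Sum>j\<in>UNIV. A$i$j * x$j)"
  by (simp add: matrix_vector_mult_def)

lemma scaleR_vec_mat: "(c *\<^sub>R v) v* (A::real^'n::finite^'n) = c *\<^sub>R (v v* A)"
  by (simp add: vec_eq_iff vector_matrix_mult_def sum_distrib_left mult_ac)

lemma sum_nonneg_pos:
  fixes f :: "'n::finite \<Rightarrow> real"
  assumes "\<And>i. f i \<ge> 0" "f k > 0" shows "sum f UNIV > 0"
  using assms by (intro sum_pos2[of _ k]) auto

locale primitive_matrix =
  fixes A :: "real^'n::finite^'n" and a :: real and U :: nat
  assumes nonneg: "\<And>i j. A$i$j \<ge> 0" and a_pos: "a > 0" and U_pos: "U \<ge> 1"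
    and mpow_ge: "\<And>i j. mpow A U $ i $ j \<ge> a"
begin

lemma transpose_primitive: "primitive_matrix (transpose A) a U"
  using nonneg a_pos U_pos mpow_ge
  by unfold_locales (auto simp: transpose_def mpow_transpose[symmetric, unfolded transpose_def])

lemma mpow_vec_ge:
  assumes "\<And>i. x$i \<ge> 0"
  shows "(mpow A U *v x) $ i \<ge> a * (\<Sum>j\<in>UNIV. x$j)"
  unfolding matrix_vec_nth sum_distrib_left
  by (intro sum_mono mult_right_mono mpow_ge assms)

lemma vec_nonneg: "(\<And>i. x$i \<ge> 0) \<Longrightarrow> (A *v x) $ i \<ge> 0"
  unfolding matrix_vec_nth by (intro sum_nonneg mult_nonneg_nonneg nonneg) auto

text \<open>Here \<open>U \<ge> 1\<close> enters: the power factors through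
  \<open>A\<close>.\<close>

lemma vec_nonzero:
  assumes "A *v x = 0" shows "mpow A U *v x = 0"
proof -
  obtain m where "U = Suc m" using U_pos by (cases U) auto
  then have "mpow A U = mpow A m ** A" using mpow_commute[of A m] by simp
  then show ?thesis using assms by (simp add: matrix_vector_mul_assoc[symmetric])
qed

text \<open>Brouwer's theorem for the normalised map \<open>x \<mapsto> A x / N x\<close> on the
  simplex. The normalisation is legitimate because \<open>A x = 0\<close> would kill
  \<open>A^U x\<close>, whose entries are at least \<open>a\<close>; the same lower bound makes the
  fixed point strictly positive.\<close>

lemma eigenvector_exists:
  "\<exists>r u. r > 0 \<and> (\<forall>i. u$i > 0) \<and> (\<Sum>i\<in>UNIV. u$i) = 1 \<and> A *v u = r *\<^sub>R u"
proof -
  define S :: "(real^'n) set" where "S = {x. (\<forall>i. 0 \<le> x$i) \<and> (\<Sum>i\<in>UNIV. x$i) = 1}"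
  define N where "N x = (\<Sum>i\<in>UNIV. (A *v x)$i)" for x
  have Npos: "N x > 0" if "x \<in> S" for x
  proof -
    have x: "\<And>i. 0 \<le> x$i" "(\<Sum>i\<in>UNIV. x$i) = 1" using that by (auto simp: S_def)
    have "N x \<ge> 0" unfolding N_def by (intro sum_nonneg vec_nonneg x)
    moreover have "N x \<noteq> 0"
    proof
      assume "N x = 0"
      then have "\<And>i. (A *v x)$i = 0" unfolding N_def
        using sum_nonneg_eq_0_iff[of UNIV "\<lambda>i. (A *v x)$i"] vec_nonneg[of x] x by auto
      then have "A *v x = 0" by (simp add: vec_eq_iff)
      then have "mpow A U *v x = 0" by (rule vec_nonzero)
      then show False using mpow_vec_ge[of x undefined] x a_pos by simp
    qed
    ultimately show ?thesis by simp
  qed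
  have comp: "compact S"
  proof (rule compact_eq_bounded_closed[THEN iffD2], intro conjI)
    show "bounded S" unfolding bounded_iff
    proof (intro exI ballI)
      fix x assume "x \<in> S"
      then show "norm x \<le> 1" using norm_le_l1_cart[of x] by (auto simp: S_def)
    qed
    have "closed {x::real^'n. (\<Sum>i\<in>UNIV. x$i) = 1}"
      by (intro closed_Collect_eq continuous_intros)
    moreover have "closed {x::real^'n. \<forall>i. 0 \<le> x$i}"
      by (intro closed_Collect_all closed_Collect_le continuous_intros)
    ultimately show "closed S" unfolding S_def by (simp add: Collect_conj_eq closed_Int)
  qed
  have conv: "convex S" unfolding convex_def S_def
    by (auto simp: sum.distrib sum_distrib_left[symmetric])
  have ne: "S \<noteq> {}"
  proof -
    have "(\<chi> i. 1 / real CARD('n)) \<in> S" by (auto simp: S_def)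
    then show ?thesis by blast
  qed
  have N_cont: "continuous_on S N" unfolding N_def matrix_vec_nth by (intro continuous_intros)
  have cont: "continuous_on S (\<lambda>x. (1 / N x) *\<^sub>R (A *v x))"
    using Npos by (intro continuous_intros N_cont linear_continuous_on linear_conv_bounded_linear[THEN iffD1]
        matrix_vector_mul_linear) force
  have self: "(\<lambda>x. (1 / N x) *\<^sub>R (A *v x)) \<in> S \<rightarrow> S"
  proof
    fix x assume x: "x \<in> S"
    then have "\<And>i. 0 \<le> (A *v x)$i" by (intro vec_nonneg) (auto simp: S_def)
    moreover have "(\<Sum>i\<in>UNIV. ((1 / N x) *\<^sub>R (A *v x)) $ i) = 1"
      using Npos[OF x] by (simp add: sum_divide_distrib[symmetric] N_def)
    ultimately show "(1 / N x) *\<^sub>R (A *v x) \<in> S" using Npos[OF x] by (auto simp: S_def)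
  qed
  obtain u where u: "u \<in> S" "(1 / N u) *\<^sub>R (A *v u) = u"
    using brouwer[OF comp conv ne cont self] by blast
  define r where "r = N u"
  have r: "r > 0" using Npos u r_def by auto
  have "r *\<^sub>R u = r *\<^sub>R ((1 / N u) *\<^sub>R (A *v u))" using u(2) by simp
  also have "\<dots> = A *v u" using r by (simp add: r_def)
  finally have eig: "A *v u = r *\<^sub>R u" ..
  have nn: "\<And>i. 0 \<le> u$i" and s1: "(\<Sum>i\<in>UNIV. u$i) = 1" using u by (auto simp: S_def)
  have "u$i > 0" for i
  proof -
    have "a \<le> r ^ U * u$i"
      using mpow_vec_ge[of u i] nn s1 by (simp add: mpow_eigenvector[OF eig])
    then show ?thesis using a_pos r nn[of i] by (cases "u$i = 0") (auto simp: less_le)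
  qed
  then show ?thesis using r s1 eig by blast
qed

end

lemma sum_vec_mult:
  fixes A :: "real^'n::finite^'n"
  shows "(\<Sum>i\<in>UNIV. v$i * (A *v x)$i) = (\<Sum>j\<in>UNIV. (v v* A)$j * x$j)"
proof -
  have "(\<Sum>i\<in>UNIV. \<Sum>j\<in>UNIV. v$i * (A$i$j * x$j)) = (\<Sum>j\<in>UNIV. \<Sum>i\<in>UNIV. v$i * (A$i$j * x$j))"
    by (rule sum.swap)
  then show ?thesis
    unfolding matrix_vec_nth vector_matrix_mult_def by (simp add: sum_distrib_left sum_distrib_right mult_ac)
qed

locale primitive_eigen = primitive_matrix +
  fixes r :: real and u v :: "real^'a"
  assumes r_pos: "r > 0" and u_pos: "\<And>i. u$i > 0" and v_pos: "\<And>i. v$i > 0"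
    and u_sum: "(\<Sum>i\<in>UNIV. u$i) = 1" and u_eig: "A *v u = r *\<^sub>R u" and v_eig: "v v* A = r *\<^sub>R v"
begin

lemma left_sum: "(\<Sum>i\<in>UNIV. v$i * (A *v x)$i) = r * (\<Sum>i\<in>UNIV. v$i * x$i)"
  by (simp add: sum_vec_mult v_eig sum_distrib_left mult.assoc)

text \<open>Absolute values give \<open>r |w| \<le> A |w|\<close>, and pairing with the positive
  left eigenvector forces equality. So \<open>|w| - w\<close> and \<open>|w| + w\<close> are
  nonnegative eigenvectors, hence zero or strictly positive; both cannot be positive, so
  \<open>w\<close> has constant sign and orthogonality to a positive vector kills it. A free
  \<open>y\<close> serves both normalisations, that of u and that of v.\<close>

lemma eigen_unique_0:
  assumes w: "A *v w = r *\<^sub>R w" and y: "\<And>i. y$i > 0" "(\<Sum>i\<in>UNIV. y$i * w$i) = 0"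
  shows "w = 0"
proof -
  define w' where "w' = (\<chi> i. \<bar>w$i\<bar>)"
  have le: "r * w'$i \<le> (A *v w')$i" for i
  proof -
    have "r * w'$i = \<bar>(A *v w)$i\<bar>" using r_pos by (simp add: w w'_def abs_mult)
    also have "\<dots> \<le> (\<Sum>j\<in>UNIV. \<bar>A$i$j * w$j\<bar>)" unfolding matrix_vec_nth by (rule sum_abs)
    also have "\<dots> = (A *v w')$i" by (simp add: matrix_vec_nth w'_def abs_mult nonneg)
    finally show ?thesis .
  qed
  have "(\<Sum>i\<in>UNIV. v$i * ((A *v w')$i - r * w'$i)) = 0"
    using left_sum[of w'] by (simp add: right_diff_distrib sum_subtractf sum_distrib_left mult_ac)
  then have "\<And>i. v$i * ((A *v w')$i - r * w'$i) = 0"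
    using sum_nonneg_eq_0_iff[of UNIV "\<lambda>i. v$i * ((A *v w')$i - r * w'$i)"] le v_pos
    by (simp add: less_imp_le)
  then have w': "A *v w' = r *\<^sub>R w'"
    using v_pos by (simp add: vec_eq_iff) (metis less_irrefl)
  have pos: "\<And>i. p$i > 0" if p: "A *v p = r *\<^sub>R p" "\<And>i. p$i \<ge> 0" "p \<noteq> 0" for p
  proof -
    fix i
    obtain k where "p$k \<noteq> 0" using p(3) by (auto simp: vec_eq_iff)
    then have "(\<Sum>j\<in>UNIV. p$j) > 0" using p(2) by (intro sum_nonneg_pos[of _ k]) (auto simp: less_le)
    then have "0 < r ^ U * p$i"
      using mpow_vec_ge[of p i] p(2) a_pos by (simp add: mpow_eigenvector[OF p(1)])
       (meson less_le_trans mult_pos_pos)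
    then show "p$i > 0" using r_pos by (simp add: zero_less_mult_iff)
  qed
  have 1: "A *v (w' - w) = r *\<^sub>R (w' - w)" "A *v (w' + w) = r *\<^sub>R (w' + w)"
    by (simp_all add: matrix_vector_mult_diff_distrib matrix_vector_right_distrib w w' algebra_simps)
  have "w' - w = 0 \<or> w' + w = 0"
  proof (rule ccontr)
    assume "\<not> ?thesis"
    then have "(w' - w)$undefined > 0" "(w' + w)$undefined > 0"
      using pos[OF 1(1)] pos[OF 1(2)] by (auto simp: w'_def)
    then show False by (auto simp: w'_def)
  qed
  then have sgn: "(\<forall>i. w$i \<ge> 0) \<or> (\<forall>i. w$i \<le> 0)"
  proof
    assume "w' - w = 0"
    then have "w'$i - w$i = 0" for i by (metis vector_minus_component zero_index)
    then have "w$i = \<bar>w$i\<bar>" for i by (simp add: w'_def)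
    then show ?thesis by (metis abs_ge_zero)
  next
    assume "w' + w = 0"
    then have "w'$i + w$i = 0" for i by (metis vector_add_component zero_index)
    then have "w$i = - \<bar>w$i\<bar>" for i by (simp add: w'_def eq_neg_iff_add_eq_0 add.commute)
    then show ?thesis by (metis abs_ge_zero neg_le_0_iff_le)
  qed
  have "\<And>i. y$i * w$i = 0"
    using sgn
  proof
    assume "\<forall>i. w$i \<ge> 0"
    then show "\<And>i. y$i * w$i = 0" using y sum_nonneg_eq_0_iff[of UNIV "\<lambda>i. y$i * w$i"]
      by (simp add: less_imp_le)
  next
    assume "\<forall>i. w$i \<le> 0"
    then show "\<And>i. y$i * w$i = 0" using y sum_nonneg_eq_0_iff[of UNIV "\<lambda>i. - (y$i * w$i)"]
      by (simp add: less_imp_le mult_nonneg_nonpos sum_negf)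
  qed
  then show ?thesis using y(1) by (simp add: vec_eq_iff) (metis less_irrefl)
qed

text \<open>Moduli turn the eigenvector equation into \<open>cmod z * y \<le> A y\<close> with
  \<open>y\<close> nonnegative and nonzero; pairing with the positive left eigenvector replaces
  \<open>A\<close> by \<open>r\<close>.\<close>

lemma complex_eigen_le:
  fixes z :: complex
  assumes "det ((\<chi> i j. (if i = j then z else 0) - complex_of_real (A$i$j)) :: complex^'a^'a) = 0"
  shows "cmod z \<le> r"
proof -
  let ?B = "(\<chi> i j. (if i = j then z else 0) - complex_of_real (A$i$j)) :: complex^'a^'a"
  have "\<not> invertible ?B" using assms by (simp add: invertible_det_nz)
  then have "\<not> (\<exists>C. C ** ?B = mat 1)" using invertible_left_inverse by blast
  then obtain x where x: "?B *v x = 0" "x \<noteq> 0" unfolding matrix_left_invertible_ker by blast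
  have eq: "z * x$i = (\<Sum>j\<in>UNIV. complex_of_real (A$i$j) * x$j)" for i
  proof -
    have "0 = (?B *v x)$i" using x by simp
    also have "\<dots> = (\<Sum>j\<in>UNIV. (if i = j then z else 0) * x$j - complex_of_real (A$i$j) * x$j)"
      by (simp add: matrix_vector_mult_def left_diff_distrib)
    also have "\<dots> = z * x$i - (\<Sum>j\<in>UNIV. complex_of_real (A$i$j) * x$j)"
      by (simp add: sum_subtractf if_distrib[of "\<lambda>c. c * _"] cong: if_cong)
    finally show ?thesis by simp
  qed
  define y where "y = (\<chi> i. cmod (x$i))"
  have le: "cmod z * y$i \<le> (A *v y)$i" for i
  proof -
    have "cmod z * y$i = cmod (\<Sum>j\<in>UNIV. complex_of_real (A$i$j) * x$j)"
      by (simp add: y_def norm_mult[symmetric] eq)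
    also have "\<dots> \<le> (\<Sum>j\<in>UNIV. cmod (complex_of_real (A$i$j) * x$j))" by (rule norm_sum)
    also have "\<dots> = (A *v y)$i" by (simp add: matrix_vec_nth y_def norm_mult nonneg)
    finally show ?thesis .
  qed
  have "cmod z * (\<Sum>i\<in>UNIV. v$i * y$i) \<le> (\<Sum>i\<in>UNIV. v$i * (A *v y)$i)"
    unfolding sum_distrib_left using le v_pos
    by (intro sum_mono) (simp add: mult.left_commute less_imp_le)
  also have "\<dots> = r * (\<Sum>i\<in>UNIV. v$i * y$i)" by (rule left_sum)
  finally have *: "cmod z * (\<Sum>i\<in>UNIV. v$i * y$i) \<le> r * (\<Sum>i\<in>UNIV. v$i * y$i)" .
  obtain k where "x$k \<noteq> 0" using x(2) by (auto simp: vec_eq_iff)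
  then have "(\<Sum>i\<in>UNIV. v$i * y$i) > 0" using v_pos
    by (intro sum_nonneg_pos[of _ k]) (auto simp: y_def less_imp_le)
  then show ?thesis using * by simp
qed

lemma r_complex_eigen:
  "det ((\<chi> i j. (if i = j then complex_of_real r else 0) - complex_of_real (A$i$j)) :: complex^'a^'a) = 0"
proof -
  let ?B = "(\<chi> i j. (if i = j then complex_of_real r else 0) - complex_of_real (A$i$j)) :: complex^'a^'a"
  define x where "x = (\<chi> i. complex_of_real (u$i))"
  have "(?B *v x)$i = 0" for i
  proof -
    have "(?B *v x)$i = (\<Sum>j\<in>UNIV. (if i = j then complex_of_real r else 0) * x$j - complex_of_real (A$i$j) * x$j)"
      by (simp add: matrix_vector_mult_def left_diff_distrib)
    also have "\<dots> = complex_of_real r * x$i - complex_of_real ((A *v u)$i)"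
      by (simp add: sum_subtractf if_distrib[of "\<lambda>c. c * _"] matrix_vec_nth x_def cong: if_cong)
    also have "\<dots> = 0" by (simp add: u_eig x_def)
    finally show ?thesis .
  qed
  then have "?B *v x = 0" by (simp add: vec_eq_iff)
  moreover have "x \<noteq> 0" using u_pos[of undefined] by (auto simp: x_def vec_eq_iff intro!: exI[of _ undefined])
  ultimately have "\<not> (\<exists>C. C ** ?B = mat 1)" unfolding matrix_left_invertible_ker by blast
  then have "\<not> invertible ?B" using invertible_left_inverse by blast
  then show ?thesis by (simp add: invertible_det_nz)
qed

text \<open>The \<open>Max\<close> in \<open>perron_root\<close> needs a finite set. The
  characteristic polynomial is not the zero polynomial, since the bound just proved excludes the
  root \<open>r + 1\<close>.\<close>

lemma finite_complex_eigen:
  "finite {z. det ((\<chi> i j. (if i = j then z else 0) - complex_of_real (A$i$j)) :: complex^'a^'a) = 0}"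
proof -
  define p :: "complex poly" where "p = (\<Sum>\<pi> | \<pi> permutes (UNIV::'a set). [:of_int (sign \<pi>):] *
     (\<Prod>i\<in>UNIV. if i = \<pi> i then [:- complex_of_real (A$i$\<pi> i), 1:] else [:- complex_of_real (A$i$\<pi> i):]))"
  have p: "poly p z = det ((\<chi> i j. (if i = j then z else 0) - complex_of_real (A$i$j)) :: complex^'a^'a)" for z
    unfolding p_def det_def poly_sum poly_mult poly_prod
    by (intro sum.cong refl arg_cong2[where f="(*)"] prod.cong) auto
  have "p \<noteq> 0"
  proof
    assume "p = 0"
    then have "cmod (complex_of_real (r + 1)) \<le> r"
      by (intro complex_eigen_le) (simp add: p[symmetric])
    then show False using r_pos by simp
  qed
  then show ?thesis using poly_roots_finite[of p] by (simp add: p)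
qed

lemma perron_root_eq: "perron_root A = r"
  unfolding perron_root_def
proof (rule Max_eqI)
  show "finite {cmod z |z. det ((\<chi> i j. (if i = j then z else 0) - complex_of_real (A$i$j)) :: complex^'a^'a) = 0}"
    using finite_imageI[OF finite_complex_eigen, of cmod] by (simp add: setcompr_eq_image)
  show "r \<in> {cmod z |z. det ((\<chi> i j. (if i = j then z else 0) - complex_of_real (A$i$j)) :: complex^'a^'a) = 0}"
    using r_complex_eigen r_pos by (intro CollectI exI[of _ "complex_of_real r"]) simp
  fix y assume "y \<in> {cmod z |z. det ((\<chi> i j. (if i = j then z else 0) - complex_of_real (A$i$j)) :: complex^'a^'a) = 0}"
  then show "y \<le> r" using complex_eigen_le by auto
qed

lemma perron_rvec_eq: "perron_rvec A = u"
  unfolding perron_rvec_def perron_root_eq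
proof (rule the_equality)
  show "A *v u = r *\<^sub>R u \<and> (\<Sum>k\<in>UNIV. u$k) = 1" using u_eig u_sum by simp
  fix w assume w: "A *v w = r *\<^sub>R w \<and> (\<Sum>k\<in>UNIV. w$k) = 1"
  have "w - u = 0"
    by (rule eigen_unique_0[where y = 1])
      (use w u_eig u_sum in \<open>auto simp: matrix_vector_mult_diff_distrib algebra_simps sum_subtractf\<close>)
  then show "w = u" by simp
qed

end

locale primitive_eigen_norm = primitive_eigen +
  assumes uv_sum: "(\<Sum>i\<in>UNIV. u$i * v$i) = 1"
begin

lemma perron_lvec_eq: "perron_lvec A = v"
  unfolding perron_lvec_def perron_root_eq perron_rvec_eq
proof (rule the_equality)
  show "v v* A = r *\<^sub>R v \<and> (\<Sum>k\<in>UNIV. u$k * v$k) = 1" using v_eig uv_sum by simp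
  fix w assume w: "w v* A = r *\<^sub>R w \<and> (\<Sum>k\<in>UNIV. u$k * w$k) = 1"
  define c where "c = (\<Sum>i\<in>UNIV. v$i)"
  have c: "c > 0" unfolding c_def using v_pos by (intro sum_pos) auto
  \<comment> \<open>Uniqueness of the left eigenvector is uniqueness of the right one for the
    transpose, whose positive eigenvector \<open>v\<close> has to be rescaled to sum one to fit the
    locale.\<close>
  interpret T: primitive_eigen "transpose A" a U r "v /\<^sub>R c" u
  proof -
    interpret P: primitive_matrix "transpose A" a U by (rule transpose_primitive)
    show "primitive_eigen (transpose A) a U r (v /\<^sub>R c) u"
    proof
      show "\<And>i. 0 < (v /\<^sub>R c) $ i" using v_pos c by simp
      show "(\<Sum>i\<in>UNIV. (v /\<^sub>R c) $ i) = 1" using c unfolding c_def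
        by (simp add: sum_distrib_left[symmetric])
      show "transpose A *v (v /\<^sub>R c) = r *\<^sub>R (v /\<^sub>R c)"
        by (simp add: scaleR_vec_mat v_eig mult.commute)
      show "u v* transpose A = r *\<^sub>R u" using u_eig by simp
    qed (use r_pos u_pos in auto)
  qed
  have "w - v = 0"
  proof (rule T.eigen_unique_0[where y = u])
    show "transpose A *v (w - v) = r *\<^sub>R (w - v)"
      using w v_eig unfolding matrix_vector_mult_diff_distrib by (simp add: algebra_simps)
    show "(\<Sum>i\<in>UNIV. u$i * (w - v)$i) = 0" using w uv_sum by (simp add: right_diff_distrib sum_subtractf)
  qed (rule u_pos)
  then show "w = v" by simp
qed

end

text \<open>The matrix and its transpose yield positive eigenvectors with a priori different
  eigenvalues; evaluating \<open>v1 A u1\<close> in both orders identifies them.\<close>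

lemma (in primitive_matrix) eigen_triple_exists:
  "\<exists>r u v. primitive_eigen_norm A a U r u v"
proof -
  obtain r1 u1 where 1: "r1 > 0" "\<And>i. u1$i > 0" "(\<Sum>i\<in>UNIV. u1$i) = 1" "A *v u1 = r1 *\<^sub>R u1"
    using eigenvector_exists by blast
  obtain r2 v1 where 2: "r2 > 0" "\<And>i. v1$i > 0" "transpose A *v v1 = r2 *\<^sub>R v1"
    using primitive_matrix.eigenvector_exists[OF transpose_primitive] by blast
  have 3: "v1 v* A = r2 *\<^sub>R v1" using 2(3) by simp
  define c where "c = (\<Sum>i\<in>UNIV. u1$i * v1$i)"
  have c: "c > 0" unfolding c_def using 1(2) 2(2) by (intro sum_pos) auto
  have "(\<Sum>i\<in>UNIV. v1$i * (A *v u1)$i) = (\<Sum>j\<in>UNIV. (v1 v* A)$j * u1$j)" by (rule sum_vec_mult)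
  then have "r1 * c = r2 * c" unfolding c_def 1(4) 3 by (simp add: sum_distrib_left mult_ac)
  then have r12: "r2 = r1" using c by simp
  have "primitive_eigen_norm A a U r1 u1 (v1 /\<^sub>R c)"
  proof
    show "(v1 /\<^sub>R c) v* A = r1 *\<^sub>R (v1 /\<^sub>R c)"
      by (simp add: scaleR_vec_mat 3 r12 mult.commute)
    show "(\<Sum>i\<in>UNIV. u1$i * (v1 /\<^sub>R c)$i) = 1" using c
      by (simp add: sum_distrib_left[symmetric] mult.left_commute c_def[symmetric])
    show "\<And>i. (v1 /\<^sub>R c)$i > 0" using 2(2) c by simp
  qed (fact 1)+
  then show ?thesis by blast
qed

lemma (in primitive_matrix) perron:
  "primitive_eigen_norm A a U (perron_root A) (perron_rvec A) (perron_lvec A)"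
proof -
  obtain r u v where E: "primitive_eigen_norm A a U r u v" using eigen_triple_exists by blast
  have "perron_root A = r" "perron_rvec A = u" "perron_lvec A = v"
    using primitive_eigen.perron_root_eq primitive_eigen.perron_rvec_eq
      primitive_eigen_norm.perron_lvec_eq[OF E] primitive_eigen_norm.axioms(1)[OF E] by metis+
  then show ?thesis using E by simp
qed

section \<open>Expansions of the offspring generating functions\<close>

text \<open>For a list of particle types: the probability that no particle is marked when a particle
  of type l is marked independently with probability \<open>f l\<close>. Working with lists adds one
  particle at a time, so each remainder estimate becomes a short recursion.\<close>

definition thin :: "('d \<Rightarrow> real) \<Rightarrow> 'd list \<Rightarrow> real" where
  "thin f xs = prod_list (map (\<lambda>l. 1 - f l) xs)"

definition lsum :: "('d \<Rightarrow> real) \<Rightarrow> 'd list \<Rightarrow> real" where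
  "lsum f xs = sum_list (map f xs)"

lemma thin_simps [simp]: "thin f [] = 1" "thin f (x # xs) = (1 - f x) * thin f xs"
  and lsum_simps [simp]: "lsum f [] = 0" "lsum f (x # xs) = f x + lsum f xs"
  by (simp_all add: thin_def lsum_def)

lemma thin_bounds:
  assumes "\<And>l. 0 \<le> f l" "\<And>l. f l \<le> 1" shows "0 \<le> thin f xs" "thin f xs \<le> 1"
  by (induction xs) (use assms in \<open>auto intro: mult_le_one\<close>)

text \<open>Concavity of \<open>1 - thin\<close> along rays from the origin; the induction step
  drops a product of nonnegative factors.\<close>

lemma thin_scale:
  assumes f: "\<And>l. 0 \<le> f l" "\<And>l. f l \<le> 1" and h: "0 \<le> h" "h \<le> 1"
  shows "thin (\<lambda>l. h * f l) xs \<le> 1 - h + h * thin f xs"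
proof (induction xs)
  case (Cons x xs)
  have hf: "0 \<le> h * f x" "h * f x \<le> 1" using f h by (auto intro: mult_le_one)
  have "thin (\<lambda>l. h * f l) (x # xs) \<le> (1 - h * f x) * (1 - h + h * thin f xs)"
    using Cons hf by (simp add: mult_left_mono)
  also have "\<dots> = 1 - h + h * ((1 - f x) * thin f xs) - h * f x * ((1 - h) * (1 - thin f xs))"
    by (simp add: algebra_simps)
  also have "\<dots> \<le> 1 - h + h * ((1 - f x) * thin f xs)"
    using hf h thin_bounds[of f xs] f by simp
  finally show ?case by simp
qed simp

context
  fixes a b :: "'d \<Rightarrow> real" and ra rb :: real
  assumes a: "\<And>l. 0 \<le> a l" "\<And>l. a l \<le> ra" and b: "\<And>l. 0 \<le> b l" "\<And>l. b l \<le> rb"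
    and ab: "\<And>l. a l + b l \<le> 1"
begin

private abbreviation (input) "fa \<equiv> thin a"
private abbreviation (input) "fb \<equiv> thin b"
private abbreviation (input) "fab \<equiv> thin (\<lambda>l. a l + b l)"
private abbreviation (input) "sa \<equiv> lsum a"
private abbreviation (input) "sb \<equiv> lsum b"
private abbreviation (input) "saa \<equiv> lsum (\<lambda>l. a l * a l)"
private abbreviation (input) "sab \<equiv> lsum (\<lambda>l. a l * b l)"
private abbreviation (input) "len \<equiv> \<lambda>xs. real (length xs)"

private lemma a_le1: "a l \<le> 1" and b_le1: "b l \<le> 1" and ra_nn: "0 \<le> ra" and rb_nn: "0 \<le> rb"
  using a[of l] b[of l] ab[of l] by linarith+

private lemma ab_nn: "0 \<le> a l + b l" using a[of l] b[of l] by linarith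

private lemmas fa_bounds = thin_bounds[of a, OF a(1) a_le1]
private lemmas fab_bounds = thin_bounds[of "\<lambda>l. a l + b l", OF ab_nn ab]

lemma thin_order0: "1 - fa xs \<le> len xs * ra"
proof (induction xs)
  case (Cons x xs)
  have "1 - fa (x # xs) = (1 - fa xs) + a x * fa xs" by (simp add: algebra_simps)
  also have "\<dots> \<le> len xs * ra + ra * 1"
    using Cons fa_bounds a ra_nn by (intro add_mono mult_mono) auto
  finally show ?case by (simp add: algebra_simps)
qed simp

lemma thin_order1: "0 \<le> fa xs - 1 + sa xs" "fa xs - 1 + sa xs \<le> (len xs * ra)^2"
proof (induction xs)
  case (Cons x xs)
  have eq: "fa (x # xs) - 1 + sa (x # xs) = (fa xs - 1 + sa xs) + a x * (1 - fa xs)"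
    by (simp add: algebra_simps)
  { case 1 show ?case unfolding eq using Cons(1) a fa_bounds by simp }
  { case 2
    have "a x * (1 - fa xs) \<le> ra * (len xs * ra)"
      using thin_order0 a fa_bounds ra_nn by (intro mult_mono) auto
    then have "fa (x # xs) - 1 + sa (x # xs) \<le> (len xs * ra)^2 + ra * (len xs * ra)"
      unfolding eq using Cons(2) by linarith
    also have "\<dots> \<le> (len (x # xs) * ra)^2" using ra_nn
      by (simp add: power2_eq_square algebra_simps)
    finally show ?case . }
qed simp_all

text \<open>\<open>(sa * sa - saa) / 2\<close> is the second elementary symmetric polynomial:
  subtracting the squares removes the pairs of a particle with itself.\<close>

lemma thin_order2: "\<bar>fa xs - 1 + sa xs - (sa xs * sa xs - saa xs) / 2\<bar> \<le> (len xs * ra)^3"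
proof (induction xs)
  case (Cons x xs)
  have eq: "fa (x # xs) - 1 + sa (x # xs) - (sa (x # xs) * sa (x # xs) - saa (x # xs)) / 2
     = (fa xs - 1 + sa xs - (sa xs * sa xs - saa xs) / 2) - a x * (fa xs - 1 + sa xs)"
    by (simp add: field_simps)
  have "\<bar>a x * (fa xs - 1 + sa xs)\<bar> \<le> ra * (len xs * ra)^2"
    using thin_order1[of xs] a[of x] ra_nn unfolding abs_mult by (intro mult_mono) auto
  then have "\<bar>fa (x # xs) - 1 + sa (x # xs) - (sa (x # xs) * sa (x # xs) - saa (x # xs)) / 2\<bar>
     \<le> (len xs * ra)^3 + ra * (len xs * ra)^2"
    unfolding eq using Cons by linarith
  also have "\<dots> \<le> (len (x # xs) * ra)^3" using ra_nn
    by (simp add: power2_eq_square power3_eq_cube algebra_simps)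
  finally show ?case .
qed simp

lemma thin_diff: "0 \<le> fa xs - fab xs" "fa xs - fab xs \<le> len xs * rb"
proof (induction xs)
  case (Cons x xs)
  have eq: "fa (x # xs) - fab (x # xs) = (1 - a x) * (fa xs - fab xs) + b x * fab xs"
    by (simp add: algebra_simps)
  { case 1 show ?case unfolding eq
      using Cons(1) a_le1[of x] b(1)[of x] fab_bounds(1)[of xs] by simp }
  { case 2
    have "(1 - a x) * (fa xs - fab xs) \<le> 1 * (len xs * rb)"
      using Cons a a_le1 by (intro mult_mono) auto
    moreover have "b x * fab xs \<le> rb * 1"
      using b rb_nn fab_bounds by (intro mult_mono) auto
    ultimately show ?case unfolding eq by (simp add: algebra_simps) }
qed simp_all

lemma thin_diff_order1: "\<bar>fa xs - fab xs - sb xs\<bar> \<le> (len xs)^2 * (rb * (ra + rb))"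
proof (induction xs)
  case (Cons x xs)
  have eq: "fa (x # xs) - fab (x # xs) - sb (x # xs)
      = (fa xs - fab xs - sb xs) - a x * (fa xs - fab xs) - b x * ((1 - fa xs) + (fa xs - fab xs))"
    by (simp add: algebra_simps)
  have 1: "a x * (fa xs - fab xs) \<le> ra * (len xs * rb)" "0 \<le> a x * (fa xs - fab xs)"
    using thin_diff[of xs] a[of x] ra_nn by (auto intro!: mult_mono)
  have 2: "b x * ((1 - fa xs) + (fa xs - fab xs)) \<le> rb * (len xs * ra + len xs * rb)"
      "0 \<le> b x * ((1 - fa xs) + (fa xs - fab xs))"
    using thin_diff[of xs] b[of x] rb_nn thin_order0[of xs] fa_bounds[of xs] by (auto intro!: mult_mono)
  have "\<bar>fa (x # xs) - fab (x # xs) - sb (x # xs)\<bar>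
     \<le> (len xs)^2 * (rb * (ra + rb)) + ra * (len xs * rb) + rb * (len xs * ra + len xs * rb)"
    unfolding eq using Cons 1 2 by linarith
  also have "\<dots> \<le> (len (x # xs))^2 * (rb * (ra + rb))" using ra_nn rb_nn
    by (simp add: power2_eq_square algebra_simps)
  finally show ?case .
qed simp

end

text \<open>A fresh context, because the difference bounds are now applied in both directions, also
  with \<open>a\<close> and \<open>b\<close> exchanged.\<close>

context
  fixes a b :: "'d \<Rightarrow> real" and ra rb :: real
  assumes a: "\<And>l. 0 \<le> a l" "\<And>l. a l \<le> ra" and b: "\<And>l. 0 \<le> b l" "\<And>l. b l \<le> rb"
    and ab: "\<And>l. a l + b l \<le> 1"
begin

private abbreviation (input) "gfa \<equiv> thin a"
private abbreviation (input) "gfb \<equiv> thin b"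
private abbreviation (input) "gfab \<equiv> thin (\<lambda>l. a l + b l)"
private abbreviation (input) "gsa \<equiv> lsum a"
private abbreviation (input) "gsb \<equiv> lsum b"
private abbreviation (input) "gsab \<equiv> lsum (\<lambda>l. a l * b l)"
private abbreviation (input) "glen \<equiv> \<lambda>xs. real (length xs)"

private lemma ba: "b l + a l \<le> 1" using ab[of l] by linarith

private lemmas d1 = thin_diff[of a ra b rb, OF a b ab] thin_diff[of b rb a ra, OF b a ba, simplified add.commute[of "b _" "a _"]]
private lemmas d2 = thin_diff_order1[of a ra b rb, OF a b ab] thin_diff_order1[of b rb a ra, OF b a ba, simplified add.commute[of "b _" "a _"]]

private lemma r_nn: "0 \<le> ra" "0 \<le> rb"
  using a b by (meson order_trans)+

text \<open>A mixed second difference. A new particle contributes \<open>a x\<close> times a first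
  difference in direction \<open>b\<close> plus the symmetric term, so the first-order bounds close
  the induction.\<close>

lemma thin_mixed: "0 \<le> gfab xs - gfa xs - gfb xs + 1" "gfab xs - gfa xs - gfb xs + 1 \<le> (glen xs)^2 * (ra * rb)"
proof (induction xs)
  case (Cons x xs)
  have eq: "gfab (x # xs) - gfa (x # xs) - gfb (x # xs) + 1
     = (gfab xs - gfa xs - gfb xs + 1) + a x * (gfa xs - gfab xs) + b x * (gfb xs - gfab xs)"
    by (simp add: algebra_simps)
  { case 1 show ?case unfolding eq using Cons(1) d1[of xs] a(1)[of x] b(1)[of x] by simp }
  { case 2
    have "a x * (gfa xs - gfab xs) \<le> ra * (glen xs * rb)" "b x * (gfb xs - gfab xs) \<le> rb * (glen xs * ra)"
      using d1[of xs] a[of x] b[of x] r_nn by (auto intro!: mult_mono)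
    then have "gfab (x # xs) - gfa (x # xs) - gfb (x # xs) + 1
       \<le> (glen xs)^2 * (ra * rb) + ra * (glen xs * rb) + rb * (glen xs * ra)"
      unfolding eq using Cons(2) by linarith
    also have "\<dots> \<le> (glen (x # xs))^2 * (ra * rb)" using r_nn
      by (simp add: power2_eq_square algebra_simps)
    finally show ?case . }
qed simp_all

lemma thin_mixed_order2:
  "\<bar>gfab xs - gfa xs - gfb xs + 1 - (gsa xs * gsb xs - gsab xs)\<bar> \<le> (glen xs)^3 * (ra * rb * (ra + rb))"
proof (induction xs)
  case (Cons x xs)
  have eq: "gfab (x # xs) - gfa (x # xs) - gfb (x # xs) + 1 - (gsa (x # xs) * gsb (x # xs) - gsab (x # xs))
     = (gfab xs - gfa xs - gfb xs + 1 - (gsa xs * gsb xs - gsab xs)) + a x * (gfa xs - gfab xs - gsb xs) + b x * (gfb xs - gfab xs - gsa xs)"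
    by (simp add: algebra_simps)
  have "\<bar>a x * (gfa xs - gfab xs - gsb xs)\<bar> \<le> ra * ((glen xs)^2 * (rb * (ra + rb)))"
      "\<bar>b x * (gfb xs - gfab xs - gsa xs)\<bar> \<le> rb * ((glen xs)^2 * (ra * (rb + ra)))"
    unfolding abs_mult using d2[of xs] a[of x] b[of x] r_nn by (auto intro!: mult_mono)
  then have "\<bar>gfab (x # xs) - gfa (x # xs) - gfb (x # xs) + 1 - (gsa (x # xs) * gsb (x # xs) - gsab (x # xs))\<bar>
     \<le> (glen xs)^3 * (ra * rb * (ra + rb)) + ra * ((glen xs)^2 * (rb * (ra + rb))) + rb * ((glen xs)^2 * (ra * (rb + ra)))"
    unfolding eq using Cons by linarith
  also have "\<dots> = ((glen xs)^3 + 2 * (glen xs)^2) * (ra * rb * (ra + rb))" by (simp add: algebra_simps)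
  also have "\<dots> \<le> (glen (x # xs))^3 * (ra * rb * (ra + rb))" using r_nn
    by (intro mult_right_mono) (auto simp: power2_eq_square power3_eq_cube algebra_simps)
  finally show ?case .
qed simp

end

text \<open>A vector of counts is the count vector of some list, which turns the products and sums over
  types into products and sums over the particles.\<close>

lemma count_vector_list:
  fixes i :: "nat^'d::finite"
  obtains xs where "\<And>f. (\<Prod>l\<in>UNIV. (1 - f l) ^ (i$l)) = thin f xs"
    "\<And>f. (\<Sum>l\<in>UNIV. real (i$l) * f l) = lsum f xs" "length xs = (\<Sum>l\<in>UNIV. i$l)"
proof -
  obtain us :: "'d list" where us: "set us = UNIV" "distinct us"
    using finite_distinct_list[OF finite[of "UNIV :: 'd set"]] by blast
  define xs where "xs = concat (map (\<lambda>l. replicate (i$l) l) us)"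
  have 1: "thin f (concat (map (\<lambda>l. replicate (i$l) l) vs)) = prod_list (map (\<lambda>l. (1 - f l) ^ (i$l)) vs)" for f vs
    by (induction vs) (simp_all add: thin_def)
  have 2: "lsum f (concat (map (\<lambda>l. replicate (i$l) l) vs)) = sum_list (map (\<lambda>l. real (i$l) * f l) vs)" for f vs
    by (induction vs) (simp_all add: lsum_def sum_list_replicate)
  have 3: "length (concat (map (\<lambda>l. replicate (i$l) l) vs)) = sum_list (map (\<lambda>l. i$l) vs)" for vs
    by (induction vs) simp_all
  show thesis
  proof (rule that[of xs])
    show "(\<Prod>l\<in>UNIV. (1 - f l) ^ (i$l)) = thin f xs" for f
      unfolding xs_def 1 using prod.distinct_set_conv_list[OF us(2), of "\<lambda>l. (1 - f l) ^ (i$l)"] us(1) by simp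
    show "(\<Sum>l\<in>UNIV. real (i$l) * f l) = lsum f xs" for f
      unfolding xs_def 2 using sum.distinct_set_conv_list[OF us(2), of "\<lambda>l. real (i$l) * f l"] us(1) by simp
    show "length xs = (\<Sum>l\<in>UNIV. i$l)"
      unfolding xs_def 3 using sum.distinct_set_conv_list[OF us(2), of "\<lambda>l. i$l"] us(1) by simp
  qed
qed

text \<open>The class and the derivatives are given by unordered sums, the estimates work with
  expectations; absolute summability links the two.\<close>

lemma expectation_conv_infsum:
  fixes f :: "'a \<Rightarrow> real"
  assumes "integrable (measure_pmf p) f"
  shows "infsum (\<lambda>x. pmf p x * f x) UNIV = measure_pmf.expectation p f"
proof -
  have "integrable (count_space UNIV) (\<lambda>x. pmf p x * f x)"
    using assms by (simp add: measure_pmf_eq_density integrable_density)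
  then have "Infinite_Set_Sum.abs_summable_on (\<lambda>x. pmf p x * f x) UNIV"
    by (simp add: Infinite_Set_Sum.abs_summable_on_def)
  from infsetsum_infsum[OF this] show ?thesis by (simp add: pmf_expectation_eq_infsetsum)
qed

lemma integrable_measure_pmf_if_summable:
  fixes f :: "'a \<Rightarrow> real"
  assumes "(\<lambda>x. pmf p x * f x) summable_on UNIV"
  shows "integrable (measure_pmf p) f"
proof -
  have "Infinite_Set_Sum.abs_summable_on (\<lambda>x. pmf p x * f x) UNIV"
    by (rule abs_summable_equivalent[THEN iffD1], rule summable_on_iff_abs_summable_on_real[THEN iffD1], rule assms)
  then show ?thesis
    by (simp add: Infinite_Set_Sum.abs_summable_on_def measure_pmf_eq_density integrable_density)
qed

section \<open>Polynomials of a count vector and their remainders\<close>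

definition deg :: "nat^'d::finite \<Rightarrow> real" where "deg i = real (\<Sum>l\<in>UNIV. i$l)"

text \<open>The monomial of the generating function at \<open>1 - x\<close>: the probability that no
  member of \<open>i\<close> has a surviving line when type l survives with probability
  \<open>x$l\<close>.\<close>

definition surv :: "nat^'d::finite \<Rightarrow> real^'d \<Rightarrow> real" where
  "surv i x = (\<Prod>l\<in>UNIV. (1 - x$l) ^ (i$l))"

definition lin :: "nat^'d::finite \<Rightarrow> real^'d \<Rightarrow> real" where
  "lin i x = (\<Sum>l\<in>UNIV. real (i$l) * x$l)"

definition quad :: "nat^'d::finite \<Rightarrow> real^'d \<Rightarrow> real^'d \<Rightarrow> real" where
  "quad i x y = (\<Sum>l\<in>UNIV. \<Sum>m\<in>UNIV. ff2 i l m * x$l * y$m)"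

abbreviation vsum :: "real^'d::finite \<Rightarrow> real" where "vsum x \<equiv> (\<Sum>l\<in>UNIV. x$l)"

lemma deg_nonneg: "0 \<le> deg i"
  by (simp add: deg_def sum_nonneg)

lemma quad_eq: "quad i x y = lin i x * lin i y - (\<Sum>l\<in>UNIV. real (i$l) * (x$l * y$l))"
proof -
  have "(\<Sum>m\<in>UNIV. ff2 i l m * x$l * y$m) = real (i$l) * x$l * lin i y - real (i$l) * (x$l * y$l)" for l
  proof -
    have "(\<Sum>m\<in>UNIV. ff2 i l m * x$l * y$m)
       = (\<Sum>m\<in>UNIV. real (i$l) * x$l * (real (i$m) * y$m) - (if m = l then real (i$l) * (x$l * y$l) else 0))"
      by (intro sum.cong refl) (auto simp: ff2_def algebra_simps)
    also have "\<dots> = real (i$l) * x$l * lin i y - real (i$l) * (x$l * y$l)"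
      by (simp add: sum_subtractf sum_distrib_left[symmetric] lin_def)
    finally show ?thesis .
  qed
  then show ?thesis by (simp add: quad_def sum_subtractf lin_def sum_distrib_right)
qed

text \<open>Makes \<open>vsum x\<close> available as the uniform coordinate bound \<open>ra\<close>
  or \<open>rb\<close> of the list estimates.\<close>

lemma nth_le_vsum: "(\<And>l. 0 \<le> x$l) \<Longrightarrow> x$l \<le> vsum (x::real^'d::finite)"
  by (intro member_le_sum) auto

lemma count_vector_poly:
  fixes i :: "nat^'d::finite"
  obtains xs where "\<And>x. surv i x = thin (\<lambda>l. x$l) xs"
    "\<And>x. lin i x = lsum (\<lambda>l. x$l) xs"
    "\<And>x y. quad i x y = lsum (\<lambda>l. x$l) xs * lsum (\<lambda>l. y$l) xs - lsum (\<lambda>l. x$l * y$l) xs"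
    "real (length xs) = deg i"
proof -
  obtain xs where *: "\<And>f. (\<Prod>l\<in>UNIV. (1 - f l) ^ (i$l)) = thin f xs"
    "\<And>f. (\<Sum>l\<in>UNIV. real (i$l) * f l) = lsum f xs" "length xs = (\<Sum>l\<in>UNIV. i$l)"
    by (rule count_vector_list[of i]) (rule that; assumption)
  show thesis by (rule that[of xs]) (simp_all add: surv_def lin_def quad_eq deg_def *)
qed

context
  fixes x y :: "real^'d::finite" and i :: "nat^'d"
  assumes x: "\<And>l. 0 \<le> x$l" and y: "\<And>l. 0 \<le> y$l" and xy: "\<And>l. x$l + y$l \<le> 1"
begin

private lemma x1: "x$l \<le> 1" using y[of l] xy[of l] by linarith

private lemma x0: "x$l + (0::real^'d)$l \<le> 1" using x1 by simp

lemma surv_bounds: "0 \<le> surv i x" "surv i x \<le> 1"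
proof -
  obtain xs where "\<And>x. surv i x = thin (\<lambda>l. x$l) xs" by (rule count_vector_poly[of i]) (rule that; assumption)
  then show "0 \<le> surv i x" "surv i x \<le> 1" using thin_bounds[of "\<lambda>l. x$l" xs] x x1 by auto
qed

lemma surv_antimono: "surv i (x + y) \<le> surv i x"
proof -
  obtain xs where "\<And>x. surv i x = thin (\<lambda>l. x$l) xs" by (rule count_vector_poly[of i]) (rule that; assumption)
  then show ?thesis
    using thin_diff(1)[of "\<lambda>l. x$l" "vsum x" "\<lambda>l. y$l" "vsum y" xs, OF x nth_le_vsum[OF x] y nth_le_vsum[OF y] xy]
    by simp
qed

lemma surv_order1: "0 \<le> surv i x - 1 + lin i x" "surv i x - 1 + lin i x \<le> (deg i * vsum x)^2"
proof -
  obtain xs where "\<And>x. surv i x = thin (\<lambda>l. x$l) xs" "\<And>x. lin i x = lsum (\<lambda>l. x$l) xs" "real (length xs) = deg i"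
    by (rule count_vector_poly[of i]) (rule that; assumption)
  then show "0 \<le> surv i x - 1 + lin i x" "surv i x - 1 + lin i x \<le> (deg i * vsum x)^2"
    using thin_order1[of "\<lambda>l. x$l" "vsum x" "\<lambda>l. (0::real^'d)$l" 0 xs, OF x nth_le_vsum[OF x] _ _ x0] by simp_all
qed

lemma surv_order2: "\<bar>surv i x - 1 + lin i x - quad i x x / 2\<bar> \<le> (deg i * vsum x)^3"
proof -
  obtain xs where "\<And>x. surv i x = thin (\<lambda>l. x$l) xs" "\<And>x. lin i x = lsum (\<lambda>l. x$l) xs" "real (length xs) = deg i"
    "\<And>x y. quad i x y = lsum (\<lambda>l. x$l) xs * lsum (\<lambda>l. y$l) xs - lsum (\<lambda>l. x$l * y$l) xs"
    by (rule count_vector_poly[of i]) (rule that; assumption)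
  then show ?thesis
    using thin_order2[of "\<lambda>l. x$l" "vsum x" "\<lambda>l. (0::real^'d)$l" 0 xs, OF x nth_le_vsum[OF x] _ _ x0] by simp
qed

lemma surv_mixed: "0 \<le> surv i (x + y) - surv i x - surv i y + 1"
  "surv i (x + y) - surv i x - surv i y + 1 \<le> (deg i)^2 * (vsum x * vsum y)"
  and surv_mixed_order2: "\<bar>surv i (x + y) - surv i x - surv i y + 1 - quad i x y\<bar>
     \<le> (deg i)^3 * (vsum x * vsum y * (vsum x + vsum y))"
proof -
  obtain xs where "\<And>x. surv i x = thin (\<lambda>l. x$l) xs" "\<And>x. lin i x = lsum (\<lambda>l. x$l) xs" "real (length xs) = deg i"
    "\<And>x y. quad i x y = lsum (\<lambda>l. x$l) xs * lsum (\<lambda>l. y$l) xs - lsum (\<lambda>l. x$l * y$l) xs"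
    by (rule count_vector_poly[of i]) (rule that; assumption)
  note xs = this
  note ass = x nth_le_vsum[OF x] y nth_le_vsum[OF y] xy
  show "0 \<le> surv i (x + y) - surv i x - surv i y + 1"
    "surv i (x + y) - surv i x - surv i y + 1 \<le> (deg i)^2 * (vsum x * vsum y)"
    using thin_mixed[of "\<lambda>l. x$l" "vsum x" "\<lambda>l. y$l" "vsum y" xs, OF ass] xs by simp_all
  show "\<bar>surv i (x + y) - surv i x - surv i y + 1 - quad i x y\<bar>
     \<le> (deg i)^3 * (vsum x * vsum y * (vsum x + vsum y))"
    using thin_mixed_order2[of "\<lambda>l. x$l" "vsum x" "\<lambda>l. y$l" "vsum y" xs, OF ass] xs by simp
qed

lemma surv_scale: "0 \<le> h \<Longrightarrow> h \<le> 1 \<Longrightarrow> surv i (h *\<^sub>R x) \<le> 1 - h + h * surv i x"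
proof -
  assume h: "0 \<le> h" "h \<le> 1"
  obtain xs where "\<And>x. surv i x = thin (\<lambda>l. x$l) xs" by (rule count_vector_poly[of i]) (rule that; assumption)
  then show ?thesis using thin_scale[of "\<lambda>l. x$l" h xs, OF x x1 h] by simp
qed

text \<open>Differentiation in \<open>s_l\<close> removes one particle of type l. The derivative is
  \<open>i$l\<close> times the monomial of the reduced vector, and \<open>ff2 i l m\<close> is
  \<open>i$l\<close> times its m-th entry, so the first-order bound for the reduced vector
  applies.\<close>

lemma deriv_order1:
  "\<bar>real (i$l) * (\<Prod>m\<in>UNIV. (1 - x$m) ^ (if m = l then i$m - 1 else i$m)) - real (i$l)
     + (\<Sum>m\<in>UNIV. ff2 i l m * x$m)\<bar> \<le> (deg i)^3 * (vsum x)^2"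
proof (cases "i$l = 0")
  case True
  then show ?thesis by (simp add: ff2_def deg_def sum_nonneg)
next
  case False
  define i' where "i' = (\<chi> m. if m = l then i$m - 1 else i$m)"
  obtain xs where xs: "\<And>x. surv i' x = thin (\<lambda>l. x$l) xs" "\<And>x. lin i' x = lsum (\<lambda>l. x$l) xs" "real (length xs) = deg i'"
    by (rule count_vector_poly[of i']) (rule that; assumption)
  have s: "0 \<le> surv i' x - 1 + lin i' x" "surv i' x - 1 + lin i' x \<le> (deg i' * vsum x)^2"
    using thin_order1[of "\<lambda>l. x$l" "vsum x" "\<lambda>l. (0::real^'d)$l" 0 xs, OF x nth_le_vsum[OF x] _ _ x0] xs by simp_all
  have e1: "surv i' x = (\<Prod>m\<in>UNIV. (1 - x$m) ^ (if m = l then i$m - 1 else i$m))"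
    by (simp add: surv_def i'_def)
  have e2: "(\<Sum>m\<in>UNIV. ff2 i l m * x$m) = real (i$l) * lin i' x"
    unfolding lin_def sum_distrib_left using False
    by (intro sum.cong refl) (auto simp: ff2_def i'_def of_nat_diff)
  have deg': "deg i' \<le> deg i" "0 \<le> deg i'" unfolding i'_def by (auto simp: deg_nonneg) (auto simp: deg_def intro!: sum_mono)
  have il: "real (i$l) \<le> deg i" unfolding deg_def of_nat_le_iff by (intro member_le_sum) auto
  have "\<bar>real (i$l) * surv i' x - real (i$l) + real (i$l) * lin i' x\<bar> = real (i$l) * (surv i' x - 1 + lin i' x)"
    using s(1) mult_nonneg_nonneg[OF _ s(1), of "real (i$l)"] by (simp add: algebra_simps)
  also have "\<dots> \<le> deg i * (deg i * vsum x)^2"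
    using s il deg' x by (intro mult_mono order_trans[OF s(2)] power_mono mult_right_mono sum_nonneg) (auto simp: sum_nonneg)
  also have "\<dots> = (deg i)^3 * (vsum x)^2" by (simp add: power2_eq_square power3_eq_cube)
  finally show ?thesis unfolding e1 e2 .
qed

end


section \<open>Third moments from factorial moments\<close>

lemma ff3_sum: "(\<Sum>l\<in>UNIV. \<Sum>m\<in>UNIV. \<Sum>j\<in>UNIV. ff3 i l m j) = deg i * (deg i - 1) * (deg i - 2)"
proof -
  have "(\<Sum>j\<in>UNIV. ff3 i l m j) = real (i$l) * (real (i$m) - (if m = l then 1 else 0)) * (deg i - 2)" for l m
    unfolding ff3_def sum_distrib_left[symmetric]
    by (simp add: sum_subtractf deg_def)
  moreover have "(\<Sum>m\<in>UNIV. real (i$l) * (real (i$m) - (if m = l then 1 else 0)) * (deg i - 2))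
     = real (i$l) * (deg i - 1) * (deg i - 2)" for l
    unfolding sum_distrib_left[symmetric] sum_distrib_right[symmetric]
    by (simp add: sum_subtractf deg_def)
  moreover have "(\<Sum>l\<in>UNIV. real (i$l) * (deg i - 1) * (deg i - 2)) = deg i * (deg i - 1) * (deg i - 2)"
    unfolding sum_distrib_right[symmetric] by (simp add: deg_def)
  ultimately show ?thesis by simp
qed

text \<open>The constant 8 is the cube at n = 2, the last point where the falling factorial
  vanishes; 9/2 = 27/6 is the ratio of the cube to the falling factorial at n = 3, after which this
  ratio decreases.\<close>

lemma fact3_bounds:
  fixes n :: nat
  shows "0 \<le> real n * (real n - 1) * (real n - 2)"
    and "real n ^ 3 \<le> 8 + 9/2 * (real n * (real n - 1) * (real n - 2))"
proof -
  have "n = 0 \<or> n = 1 \<or> n = 2 \<or> (\<exists>m. n = m + 3)" by presburger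
  then consider "n = 0" | "n = 1" | "n = 2" | m where "n = m + 3" by blast
  then have "0 \<le> real n * (real n - 1) * (real n - 2) \<and>
    real n ^ 3 \<le> 8 + 9/2 * (real n * (real n - 1) * (real n - 2))"
  proof cases
    case 4
    define x where "x = real m"
    have x: "0 \<le> x" "real n = x + 3" by (simp_all add: x_def 4)
    have "8 + 9/2 * ((x + 3) * (x + 3 - 1) * (x + 3 - 2)) - (x + 3)^3 = 7/2 * x^3 + 18 * x^2 + 45/2 * x + 8"
      by (simp add: power2_eq_square power3_eq_cube field_simps)
    moreover have "0 \<le> 7/2 * x^3 + 18 * x^2 + 45/2 * x + 8" using x by simp
    ultimately have "(x + 3)^3 \<le> 8 + 9/2 * ((x + 3) * (x + 3 - 1) * (x + 3 - 2))" by linarith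
    moreover have "0 \<le> (x + 3) * (x + 3 - 1) * (x + 3 - 2)" using x by simp
    ultimately show ?thesis unfolding x(2) by blast
  qed simp_all
  then show "0 \<le> real n * (real n - 1) * (real n - 2)"
    "real n ^ 3 \<le> 8 + 9/2 * (real n * (real n - 1) * (real n - 2))" by auto
qed

lemma ff_bounds: "\<bar>ff1 i l\<bar> \<le> deg i" "0 \<le> ff2 i l m" "ff2 i l m \<le> (deg i)^2" "real (i$l) \<le> deg i"
proof -
  have *: "real (i$l) \<le> deg i" for l unfolding deg_def of_nat_le_iff by (intro member_le_sum) auto
  then show "\<bar>ff1 i l\<bar> \<le> deg i" "real (i$l) \<le> deg i" by (simp_all add: ff1_def)
  show "0 \<le> ff2 i l m" by (cases "i$l = 0") (auto simp: ff2_def)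
  have "ff2 i l m \<le> real (i$l) * real (i$m)" by (simp add: ff2_def algebra_simps)
  also have "\<dots> \<le> deg i * deg i" by (intro mult_mono *) (auto simp: deg_nonneg)
  finally show "ff2 i l m \<le> (deg i)^2" by (simp add: power2_eq_square)
qed

text \<open>\<open>deg i\<close> is a natural number, hence 0 or at least 1, so one third moment
  dominates all lower ones.\<close>

lemma deg_powers: "deg i \<le> (deg i)^3" "(deg i)^2 \<le> (deg i)^3" "1 \<le> 1 + (deg i)^3"
proof -
  have "deg i = 0 \<or> 1 \<le> deg i" unfolding deg_def
    by (metis of_nat_0 of_nat_1 of_nat_le_iff less_one linorder_not_less)
  then show "deg i \<le> (deg i)^3" "(deg i)^2 \<le> (deg i)^3"
    using power_increasing[of 1 3 "deg i"] power_increasing[of 2 3 "deg i"] by auto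
  show "1 \<le> 1 + (deg i)^3" by (simp add: deg_nonneg)
qed

lemma nth_le_deg3: "real (i$l) \<le> (deg i)^3" and ff2_le_deg3: "\<bar>ff2 i l m\<bar> \<le> (deg i)^3"
  using ff_bounds(2)[of i l m] ff_bounds(3)[of i l m] ff_bounds(4)[of i l] deg_powers(1,2)[of i] by linarith+

lemmas pmf_integrable = Bochner_Integration.integrable_sum Bochner_Integration.integrable_add
  Bochner_Integration.integrable_mult_right Bochner_Integration.integrable_mult_left

section \<open>Expansions of the survival map under a third moment bound\<close>

definition gmap :: "'d::finite offspring \<Rightarrow> real^'d \<Rightarrow> real^'d" where
  "gmap p x = 1 - pgf p (1 - x)"

definition bform :: "'d::finite offspring \<Rightarrow> real^'d \<Rightarrow> real^'d \<Rightarrow> real^'d" where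
  "bform p x y = (\<chi> k. \<Sum>l\<in>UNIV. \<Sum>m\<in>UNIV. bcoef p k l m * x$l * y$m)"

locale offspring_moments =
  fixes p :: "'d::finite offspring" and K :: real
  assumes integrable_deg3: "\<And>k. integrable (measure_pmf (p k)) (\<lambda>i. (deg i)^3)"
    and deg3_le: "\<And>k. measure_pmf.expectation (p k) (\<lambda>i. (deg i)^3) \<le> K"
begin

abbreviation Ex :: "'d \<Rightarrow> (nat^'d \<Rightarrow> real) \<Rightarrow> real" where
  "Ex k f \<equiv> measure_pmf.expectation (p k) f"

lemma integrable_deg_bound:
  assumes "\<And>i. \<bar>f i\<bar> \<le> C * (1 + (deg i)^3)" shows "integrable (measure_pmf (p k)) (f :: nat^'d \<Rightarrow> real)"
proof (rule Bochner_Integration.integrable_bound)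
  show "integrable (measure_pmf (p k)) (\<lambda>i. C * (1 + (deg i)^3))"
    by (intro pmf_integrable integrable_deg3) simp
  show "AE x in measure_pmf (p k). norm (f x) \<le> norm (C * (1 + deg x ^ 3))"
    using assms by (intro AE_I2) (metis abs_ge_self order_trans real_norm_def)
qed simp

lemma Ex_mono: "integrable (measure_pmf (p k)) f \<Longrightarrow> integrable (measure_pmf (p k)) g \<Longrightarrow> (\<And>i. f i \<le> g i) \<Longrightarrow> Ex k f \<le> Ex k g"
  by (intro integral_mono) auto

text \<open>All remainders are pointwise at most a factor times \<open>deg^3\<close>; hence
  \<open>K\<close> is the only constant through which the law enters them.\<close>

lemma Ex_deg_bound:
  assumes "\<And>i. \<bar>f i\<bar> \<le> C * (deg i)^3" "0 \<le> C"
  shows "integrable (measure_pmf (p k)) (f :: nat^'d \<Rightarrow> real)" "\<bar>Ex k f\<bar> \<le> K * C"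
proof -
  have "\<bar>f i\<bar> \<le> C * (1 + (deg i)^3)" for i
    using assms by (simp add: order_trans[OF assms(1)] mult_left_mono)
  then show i: "integrable (measure_pmf (p k)) f" by (rule integrable_deg_bound)
  have "\<bar>Ex k f\<bar> \<le> Ex k (\<lambda>i. \<bar>f i\<bar>)" by (rule integral_abs_bound)
  also have "\<dots> \<le> Ex k (\<lambda>i. C * (deg i)^3)"
    by (intro integral_mono pmf_integrable integrable_deg3 integrable_abs i assms)
  also have "\<dots> \<le> K * C" using mult_left_mono[OF deg3_le[of k] assms(2)] by (simp add: mult.commute)
  finally show "\<bar>Ex k f\<bar> \<le> K * C" .
qed

lemma integrable_lin: "integrable (measure_pmf (p k)) (\<lambda>i. lin i x)"
proof -
  have "integrable (measure_pmf (p k)) (\<lambda>i. real (i$l))" for l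
    by (rule Ex_deg_bound(1)[of _ 1]) (simp_all add: nth_le_deg3)
  note i = this
  show ?thesis unfolding lin_def by (intro pmf_integrable i)
qed

lemma integrable_nth: "integrable (measure_pmf (p k)) (\<lambda>i. real (i$l))"
  by (rule Ex_deg_bound(1)[of _ 1]) (simp_all add: nth_le_deg3)

lemma integrable_ff2: "integrable (measure_pmf (p k)) (\<lambda>i. ff2 i l m)"
  by (rule Ex_deg_bound(1)[of _ 1]) (simp_all add: ff2_le_deg3)

lemma integrable_quad: "integrable (measure_pmf (p k)) (\<lambda>i. quad i x y)"
  unfolding quad_def by (intro pmf_integrable integrable_ff2)

lemma bcoef_Ex: "bcoef p k l m = Ex k (\<lambda>i. ff2 i l m)"
  unfolding bcoef_def by (rule expectation_conv_infsum[OF integrable_ff2])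

lemma bcoef_bounds: "0 \<le> bcoef p k l m" "bcoef p k l m \<le> K"
proof -
  show "0 \<le> bcoef p k l m" unfolding bcoef_Ex by (intro integral_nonneg_AE AE_I2 ff_bounds(2))
  have "\<bar>Ex k (\<lambda>i. ff2 i l m)\<bar> \<le> K * 1"
    by (rule Ex_deg_bound(2)) (simp_all add: ff2_le_deg3)
  then show "bcoef p k l m \<le> K" by (simp add: bcoef_Ex)
qed

lemma jac1_Ex: "jac p 1 $ k $ l = Ex k (\<lambda>i. real (i$l))"
  unfolding jac_def using expectation_conv_infsum[OF integrable_nth[of k l]] by simp

lemma jac1_bounds: "0 \<le> jac p 1 $ k $ l" "jac p 1 $ k $ l \<le> K"
proof -
  show "0 \<le> jac p 1 $ k $ l" unfolding jac1_Ex by (intro integral_nonneg_AE AE_I2) simp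
  have "\<bar>Ex k (\<lambda>i. real (i$l))\<bar> \<le> K * 1"
    by (rule Ex_deg_bound(2)) (simp_all add: nth_le_deg3)
  then show "jac p 1 $ k $ l \<le> K" by (simp add: jac1_Ex)
qed

lemma jac1_vec: "(jac p 1 *v x) $ k = Ex k (\<lambda>i. lin i x)"
  unfolding lin_def by (simp add: matrix_vector_mult_def jac1_Ex integrable_nth Bochner_Integration.integral_sum)

lemma bform_Ex: "bform p x y $ k = Ex k (\<lambda>i. quad i x y)"
  unfolding quad_def bform_def by (simp add: bcoef_Ex integrable_ff2 Bochner_Integration.integral_sum)

context
  fixes x :: "real^'d"
  assumes x: "\<And>l. 0 \<le> x$l" "\<And>l. x$l \<le> 1"
begin

lemma integrable_surv: "integrable (measure_pmf (p k)) (\<lambda>i. surv i x)"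
  by (rule measure_pmf.integrable_const_bound[where B = 1])
    (use surv_bounds[of x 0] x in auto)

lemma gmap_Ex: "gmap p x $ k = 1 - Ex k (\<lambda>i. surv i x)"
  using expectation_conv_infsum[OF integrable_surv[of k]]
  by (simp add: gmap_def pgf_def surv_def)

lemma gmap_bounds: "0 \<le> gmap p x $ k" "gmap p x $ k \<le> 1"
proof -
  have "Ex k (\<lambda>i. surv i x) \<le> Ex k (\<lambda>i. 1)"
    using surv_bounds[of x 0] x by (intro Ex_mono integrable_surv) auto
  then show "0 \<le> gmap p x $ k" by (simp add: gmap_Ex)
  show "gmap p x $ k \<le> 1" unfolding gmap_Ex
    using surv_bounds[of x 0] x by (simp add: integral_nonneg_AE)
qed

lemma gmap_le_linear: "gmap p x $ k \<le> (jac p 1 *v x) $ k"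
  and gmap_order1: "(jac p 1 *v x) $ k - gmap p x $ k \<le> K * (vsum x)^2"
  and gmap_order2: "\<bar>(jac p 1 *v x) $ k - gmap p x $ k - bform p x x $ k / 2\<bar> \<le> K * (vsum x)^3"
proof -
  have s: "0 \<le> surv i x - 1 + lin i x" "surv i x - 1 + lin i x \<le> (deg i * vsum x)^2"
    "\<bar>surv i x - 1 + lin i x - quad i x x / 2\<bar> \<le> (deg i * vsum x)^3" for i
    using surv_order1[of x 0 i] surv_order2[of x 0 i] x by auto
  have eq: "(jac p 1 *v x) $ k - gmap p x $ k = Ex k (\<lambda>i. surv i x - 1 + lin i x)"
    by (simp add: jac1_vec gmap_Ex integrable_surv integrable_lin)
  have "0 \<le> Ex k (\<lambda>i. surv i x - 1 + lin i x)" by (intro integral_nonneg_AE AE_I2 s)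
  then show "gmap p x $ k \<le> (jac p 1 *v x) $ k" using eq by linarith
  have "\<bar>surv i x - 1 + lin i x\<bar> \<le> (vsum x)^2 * (deg i)^3" for i
  proof -
    have "\<bar>surv i x - 1 + lin i x\<bar> \<le> (vsum x)^2 * (deg i)^2" using s[of i] by (simp add: power_mult_distrib mult.commute)
    also have "\<dots> \<le> (vsum x)^2 * (deg i)^3" by (intro mult_left_mono deg_powers) simp
    finally show ?thesis .
  qed
  then have "\<bar>Ex k (\<lambda>i. surv i x - 1 + lin i x)\<bar> \<le> K * (vsum x)^2" by (rule Ex_deg_bound(2)) simp
  then show "(jac p 1 *v x) $ k - gmap p x $ k \<le> K * (vsum x)^2" using eq by linarith
  have "\<bar>surv i x - 1 + lin i x - quad i x x / 2\<bar> \<le> (vsum x)^3 * (deg i)^3" for i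
    using s(3)[of i] by (simp add: power_mult_distrib mult.commute)
  then have "\<bar>Ex k (\<lambda>i. surv i x - 1 + lin i x - quad i x x / 2)\<bar> \<le> K * (vsum x)^3"
    by (rule Ex_deg_bound(2)) (simp add: sum_nonneg x)
  moreover have "Ex k (\<lambda>i. surv i x - 1 + lin i x - quad i x x / 2) = Ex k (\<lambda>i. surv i x - 1 + lin i x) - bform p x x $ k / 2"
    by (simp add: bform_Ex integrable_surv integrable_lin integrable_quad)
  ultimately show "\<bar>(jac p 1 *v x) $ k - gmap p x $ k - bform p x x $ k / 2\<bar> \<le> K * (vsum x)^3"
    using eq by simp
qed

lemma gmap_scale: "0 \<le> h \<Longrightarrow> h \<le> 1 \<Longrightarrow> h * gmap p x $ k \<le> gmap p (h *\<^sub>R x) $ k"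
proof -
  assume h: "0 \<le> h" "h \<le> 1"
  have hx: "\<And>l. 0 \<le> (h *\<^sub>R x) $ l" "\<And>l. (h *\<^sub>R x) $ l \<le> 1" using x h by (auto intro: mult_le_one)
  have "integrable (measure_pmf (p k)) (\<lambda>i. surv i (h *\<^sub>R x))"
    by (rule measure_pmf.integrable_const_bound[where B = 1])
      (use surv_bounds[of "h *\<^sub>R x" 0] hx in auto)
  then have "Ex k (\<lambda>i. surv i (h *\<^sub>R x)) \<le> Ex k (\<lambda>i. 1 - h + h * surv i x)"
    using x h surv_scale[of x 0 h] by (intro Ex_mono pmf_integrable integrable_surv) auto
  then have *: "Ex k (\<lambda>i. surv i (h *\<^sub>R x)) \<le> 1 - h + h * Ex k (\<lambda>i. surv i x)"
    by (simp add: integrable_surv)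
  have "gmap p (h *\<^sub>R x) $ k = 1 - Ex k (\<lambda>i. surv i (h *\<^sub>R x))"
    using expectation_conv_infsum[OF \<open>integrable (measure_pmf (p k)) (\<lambda>i. surv i (h *\<^sub>R x))\<close>]
    by (simp add: gmap_def pgf_def surv_def)
  then show ?thesis using * by (simp add: gmap_Ex algebra_simps)
qed

lemma jac_order1: "\<bar>jac p (1 - x) $ k $ l - jac p 1 $ k $ l + (\<Sum>m\<in>UNIV. bcoef p k l m * x$m)\<bar> \<le> K * (vsum x)^2"
  and jac_nonneg: "0 \<le> jac p (1 - x) $ k $ l"
proof -
  define d where "d i = real (i$l) * (\<Prod>m\<in>UNIV. (1 - x$m) ^ (if m = l then i$m - 1 else i$m))" for i :: "nat^'d"
  have d: "0 \<le> d i" "d i \<le> real (i$l)" for i unfolding d_def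
    using x by (auto intro!: mult_nonneg_nonneg prod_nonneg mult_left_le prod_le_1 power_le_one)
  have int: "integrable (measure_pmf (p k)) d"
    by (rule Bochner_Integration.integrable_bound[OF integrable_nth[of k l]]) (use d in auto)
  have jac: "jac p (1 - x) $ k $ l = Ex k d"
    using expectation_conv_infsum[OF int] by (simp add: jac_def d_def mult.assoc)
  show "0 \<le> jac p (1 - x) $ k $ l" unfolding jac by (intro integral_nonneg_AE AE_I2 d)
  have intS: "integrable (measure_pmf (p k)) (\<lambda>i. \<Sum>m\<in>UNIV. ff2 i l m * x$m)"
    by (intro pmf_integrable integrable_ff2)
  have "\<bar>d i - real (i$l) + (\<Sum>m\<in>UNIV. ff2 i l m * x$m)\<bar> \<le> (vsum x)^2 * (deg i)^3" for i
    using deriv_order1[of x 0 i l] x by (simp add: d_def mult.commute)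
  then have "\<bar>Ex k (\<lambda>i. d i - real (i$l) + (\<Sum>m\<in>UNIV. ff2 i l m * x$m))\<bar> \<le> K * (vsum x)^2"
    by (rule Ex_deg_bound(2)) simp
  then show "\<bar>jac p (1 - x) $ k $ l - jac p 1 $ k $ l + (\<Sum>m\<in>UNIV. bcoef p k l m * x$m)\<bar> \<le> K * (vsum x)^2"
    by (simp add: jac jac1_Ex bcoef_Ex int intS integrable_nth integrable_ff2 Bochner_Integration.integral_sum)
qed

end

context
  fixes x y :: "real^'d"
  assumes x: "\<And>l. 0 \<le> x$l" and y: "\<And>l. 0 \<le> y$l" and xy: "\<And>l. x$l + y$l \<le> 1"
begin

private lemma x1: "x$l \<le> 1" and y1: "y$l \<le> 1"
  using x[of l] y[of l] xy[of l] by linarith+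

private lemma xy0: "0 \<le> (x + y)$l" and xy1: "(x + y)$l \<le> 1"
  using x[of l] y[of l] xy[of l] by simp_all

lemma gmap_mono: "gmap p x $ k \<le> gmap p (x + y) $ k"
  unfolding gmap_Ex[OF x x1] gmap_Ex[OF xy0 xy1]
  using Ex_mono[OF integrable_surv[OF xy0 xy1] integrable_surv[OF x x1] surv_antimono[OF x y xy]] by simp

lemma gmap_subadditive: "gmap p (x + y) $ k \<le> gmap p x $ k + gmap p y $ k"
  and gmap_mixed: "gmap p x $ k + gmap p y $ k - gmap p (x + y) $ k \<le> K * (vsum x * vsum y)"
  and gmap_mixed_order2: "\<bar>gmap p x $ k + gmap p y $ k - gmap p (x + y) $ k - bform p x y $ k\<bar>
    \<le> K * (vsum x * vsum y * (vsum x + vsum y))"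
proof -
  note int = integrable_surv[OF xy0 xy1] integrable_surv[OF x x1] integrable_surv[OF y y1]
  have eq: "gmap p x $ k + gmap p y $ k - gmap p (x + y) $ k = Ex k (\<lambda>i. surv i (x + y) - surv i x - surv i y + 1)"
    unfolding gmap_Ex[OF x x1] gmap_Ex[OF y y1] gmap_Ex[OF xy0 xy1] by (simp add: int)
  have "0 \<le> Ex k (\<lambda>i. surv i (x + y) - surv i x - surv i y + 1)"
    by (intro integral_nonneg_AE AE_I2 surv_mixed x y xy)
  then show "gmap p (x + y) $ k \<le> gmap p x $ k + gmap p y $ k" using eq by linarith
  have vs: "0 \<le> vsum x" "0 \<le> vsum y" using x y by (auto simp: sum_nonneg)
  have "\<bar>surv i (x + y) - surv i x - surv i y + 1\<bar> \<le> vsum x * vsum y * (deg i)^3" for i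
  proof -
    have "\<bar>surv i (x + y) - surv i x - surv i y + 1\<bar> \<le> (deg i)^2 * (vsum x * vsum y)"
      using surv_mixed[OF x y xy, of i] by simp
    also have "\<dots> \<le> (deg i)^3 * (vsum x * vsum y)" using vs by (intro mult_right_mono deg_powers) simp
    finally show ?thesis by (simp add: mult.commute)
  qed
  then have "\<bar>Ex k (\<lambda>i. surv i (x + y) - surv i x - surv i y + 1)\<bar> \<le> K * (vsum x * vsum y)"
    by (rule Ex_deg_bound(2)) (simp add: vs)
  then show "gmap p x $ k + gmap p y $ k - gmap p (x + y) $ k \<le> K * (vsum x * vsum y)"
    using eq by linarith
  have "\<bar>surv i (x + y) - surv i x - surv i y + 1 - quad i x y\<bar> \<le> (vsum x * vsum y * (vsum x + vsum y)) * (deg i)^3" for i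
    using surv_mixed_order2[OF x y xy, of i] by (simp add: mult.commute)
  then have "\<bar>Ex k (\<lambda>i. surv i (x + y) - surv i x - surv i y + 1 - quad i x y)\<bar> \<le> K * (vsum x * vsum y * (vsum x + vsum y))"
    by (rule Ex_deg_bound(2)) (simp add: vs)
  moreover have "Ex k (\<lambda>i. surv i (x + y) - surv i x - surv i y + 1 - quad i x y)
      = Ex k (\<lambda>i. surv i (x + y) - surv i x - surv i y + 1) - bform p x y $ k"
    by (simp add: bform_Ex int integrable_quad)
  ultimately show "\<bar>gmap p x $ k + gmap p y $ k - gmap p (x + y) $ k - bform p x y $ k\<bar>
    \<le> K * (vsum x * vsum y * (vsum x + vsum y))" using eq by simp
qed

end

end

lemma classK_moments:
  assumes "p \<in> classK a b c U"
  shows "offspring_moments p (8 + 9/2 * c)"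
proof
  fix k
  have s3: "(\<lambda>i. pmf (p k) i * ff3 i l m j) summable_on UNIV" for k l m j
    using assms by (simp add: classK_def)
  note i3 = integrable_measure_pmf_if_summable[OF s3]
  define D where "D i = deg i * (deg i - 1) * (deg i - 2)" for i :: "nat^'a"
  have D: "D = (\<lambda>i. \<Sum>l\<in>UNIV. \<Sum>m\<in>UNIV. \<Sum>j\<in>UNIV. ff3 i l m j)" unfolding ff3_sum by (rule ext) (simp add: D_def)
  have intD: "integrable (measure_pmf (p k)) D" for k unfolding D by (intro pmf_integrable i3)
  have ED: "measure_pmf.expectation (p k) D = (\<Sum>l\<in>UNIV. \<Sum>m\<in>UNIV. \<Sum>j\<in>UNIV. ccoef p k l m j)" for k
    unfolding D ccoef_def expectation_conv_infsum[OF i3]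
    by (simp add: Bochner_Integration.integral_sum i3)
  have D0: "0 \<le> D i" and Db: "(deg i)^3 \<le> 8 + 9/2 * D i" for i
    unfolding D_def deg_def using fact3_bounds by blast+
  \<comment> \<open>The factorial moment of one type is a nonnegative summand of the total that
    \<open>c\<close> bounds.\<close>
  have "measure_pmf.expectation (p k) D \<le> (\<Sum>k\<in>UNIV. measure_pmf.expectation (p k) D)"
    by (intro member_le_sum) (auto intro!: integral_nonneg_AE AE_I2 D0)
  also have "\<dots> \<le> c" unfolding ED using assms by (simp add: classK_def)
  finally have le: "measure_pmf.expectation (p k) D \<le> c" .
  have intB: "integrable (measure_pmf (p k)) (\<lambda>i. 8 + 9/2 * D i)" by (intro pmf_integrable intD) simp
  show int: "integrable (measure_pmf (p k)) (\<lambda>i. (deg i)^3)"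
    by (rule Bochner_Integration.integrable_bound[OF intB]) (auto intro!: AE_I2 simp: abs_of_nonneg deg_nonneg Db[simplified] D0 power_abs)
  have "measure_pmf.expectation (p k) (\<lambda>i. (deg i)^3) \<le> measure_pmf.expectation (p k) (\<lambda>i. 8 + 9/2 * D i)"
    by (intro integral_mono int intB Db)
  also have "\<dots> \<le> 8 + 9/2 * c" using le intD by simp
  finally show "measure_pmf.expectation (p k) (\<lambda>i. (deg i)^3) \<le> 8 + 9/2 * c" .
qed

section \<open>The Laplace transform as a difference of trajectories\<close>

text \<open>Values in [0, 1] make every integral finite, so the rule for nonnegative integrals over
  a bind transfers.\<close>

lemma expectation_bind_unit:
  fixes f :: "'b \<Rightarrow> real"
  assumes f: "\<And>x. 0 \<le> f x" "\<And>x. f x \<le> 1"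
  shows "measure_pmf.expectation (bind_pmf p N) f = measure_pmf.expectation p (\<lambda>x. measure_pmf.expectation (N x) f)"
proof -
  have int: "integrable (measure_pmf q) f" for q
    by (rule measure_pmf.integrable_const_bound[where B = 1]) (use f in auto)
  have nn: "(\<integral>\<^sup>+x. ennreal (f x) \<partial>measure_pmf q) = ennreal (measure_pmf.expectation q f)" for q
    by (rule nn_integral_eq_integral[OF int]) (use f in auto)
  have E01: "0 \<le> measure_pmf.expectation q f" "measure_pmf.expectation q f \<le> 1" for q
  proof -
    show "0 \<le> measure_pmf.expectation q f" using f by (intro integral_nonneg_AE AE_I2) auto
    have "measure_pmf.expectation q f \<le> measure_pmf.expectation q (\<lambda>_. 1)"
      by (intro integral_mono int) (use f in auto)
    then show "measure_pmf.expectation q f \<le> 1" by simp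
  qed
  have int2: "integrable (measure_pmf p) (\<lambda>x. measure_pmf.expectation (N x) f)"
    by (rule measure_pmf.integrable_const_bound[where B = 1]) (use E01 in auto)
  have "ennreal (measure_pmf.expectation (bind_pmf p N) f) = (\<integral>\<^sup>+x. \<integral>\<^sup>+y. ennreal (f y) \<partial>N x \<partial>p)"
    unfolding nn[symmetric] by (rule nn_integral_bind_pmf)
  also have "\<dots> = ennreal (measure_pmf.expectation p (\<lambda>x. measure_pmf.expectation (N x) f))"
    unfolding nn by (rule nn_integral_eq_integral[OF int2]) (use E01 in auto)
  finally show ?thesis using E01 by (simp add: integral_nonneg_AE AE_I2)
qed

definition vpow :: "real^'d::finite \<Rightarrow> nat^'d \<Rightarrow> real" where
  "vpow w z = (\<Prod>l\<in>UNIV. w$l ^ (z$l))"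

lemma vpow_bounds: "w \<in> cube \<Longrightarrow> 0 \<le> vpow w z" "w \<in> cube \<Longrightarrow> vpow w z \<le> 1"
  by (auto simp: vpow_def cube_def prod_nonneg power_le_one intro!: prod_le_1)

lemma vpow_0 [simp]: "vpow w 0 = 1"
  by (simp add: vpow_def)

lemma vpow_add: "vpow w (x + y) = vpow w x * vpow w y"
  by (simp add: vpow_def power_add prod.distrib)

lemma vpow_sum: "finite A \<Longrightarrow> vpow w (\<Sum>k\<in>A. g k) = (\<Prod>k\<in>A. vpow w (g k))"
  by (induction A rule: finite_induct) (simp_all add: vpow_add)

lemma vpow_mult: "vpow (s * w) z = vpow s z * vpow w z"
  by (simp add: vpow_def power_mult_distrib prod.distrib)

lemma vpow_unitv: "vpow w (unitv j) = w$j"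
  by (simp add: vpow_def unitv_def if_distrib[of "\<lambda>n. _ ^ n"] prod.delta cong: if_cong)

lemma vpow_zero: "vpow 0 z = (if z = 0 then 1 else 0)"
proof (cases "z = 0")
  case False
  then obtain l where "z$l \<noteq> 0" by (auto simp: vec_eq_iff)
  then show ?thesis using False by (auto simp: vpow_def)
qed simp

lemma cube_mult: "s \<in> cube \<Longrightarrow> w \<in> cube \<Longrightarrow> s * w \<in> cube"
  by (auto simp: cube_def mult_le_one)

lemma integrable_vpow: "w \<in> cube \<Longrightarrow> integrable (measure_pmf q) (vpow w)"
  by (rule measure_pmf.integrable_const_bound[where B = 1]) (use vpow_bounds[of w] in auto)

lemma pgf_Ex: "w \<in> cube \<Longrightarrow> pgf p w $ k = measure_pmf.expectation (p k) (vpow w)"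
  using expectation_conv_infsum[OF integrable_vpow[of w "p k"]] by (simp add: pgf_def vpow_def)

lemma pgf_cube: "w \<in> cube \<Longrightarrow> pgf p w \<in> cube"
proof -
  assume w: "w \<in> cube"
  have "0 \<le> pgf p w $ k \<and> pgf p w $ k \<le> 1" for k
  proof
    show "0 \<le> pgf p w $ k" unfolding pgf_Ex[OF w] using vpow_bounds[OF w] by (intro integral_nonneg_AE AE_I2) auto
    have "measure_pmf.expectation (p k) (vpow w) \<le> measure_pmf.expectation (p k) (\<lambda>_. 1)"
      by (intro integral_mono integrable_vpow w) (use vpow_bounds[OF w] in auto)
    then show "pgf p w $ k \<le> 1" by (simp add: pgf_Ex[OF w])
  qed
  then show ?thesis by (simp add: cube_def)
qed

lemma iid_sum_vpow:
  assumes w: "w \<in> cube"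
  shows "measure_pmf.expectation (iid_sum q m) (vpow w) = measure_pmf.expectation q (vpow w) ^ m"
  by (induction m) (simp_all add: expectation_bind_unit vpow_bounds[OF w] vpow_add)

lemma next_gen_vpow:
  assumes w: "w \<in> cube"
  shows "measure_pmf.expectation (next_gen p z) (vpow w) = vpow (pgf p w) z"
proof -
  have "measure_pmf.expectation (next_gen p z) (vpow w)
      = measure_pmf.expectation (Pi_pmf UNIV 0 (\<lambda>k. iid_sum (p k) (z$k))) (\<lambda>g. \<Prod>k\<in>UNIV. vpow w (g k))"
    by (simp add: next_gen_def vpow_sum)
  also have "\<dots> = (\<Prod>k\<in>UNIV. measure_pmf.expectation (iid_sum (p k) (z$k)) (vpow w))"
    by (rule expectation_prod_Pi_pmf) (auto simp: integrable_vpow w vpow_bounds)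
  finally show ?thesis by (simp add: iid_sum_vpow[OF w] vpow_def[of "pgf p w"] pgf_Ex[OF w])
qed

text \<open>Integrating out the last generation replaces the weight \<open>w\<close> on it by
  \<open>pgf p (s * w)\<close>, which is why the induction is over all \<open>w\<close>. The product
  \<open>s * w\<close> appears because a particle of the last generation is counted both in Z and in
  Y.\<close>

lemma gw_law_vpow:
  assumes s: "s \<in> cube" and w: "w \<in> cube"
  shows "measure_pmf.expectation (gw_law p j n) (\<lambda>zy. vpow w (fst zy) * vpow s (snd zy))
     = s$j * ((\<lambda>w. pgf p (s * w)) ^^ n) w $ j"
  using w
proof (induction n arbitrary: w)
  case 0
  then show ?case by (simp add: vpow_unitv mult.commute)
next
  case (Suc n)
  have sw: "s * w \<in> cube" by (rule cube_mult[OF s Suc.prems])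
  have "measure_pmf.expectation (gw_law p j (Suc n)) (\<lambda>zy. vpow w (fst zy) * vpow s (snd zy))
     = measure_pmf.expectation (gw_law p j n) (\<lambda>zy. vpow (pgf p (s * w)) (fst zy) * vpow s (snd zy))"
    unfolding gw_law.simps
  proof (subst expectation_bind_unit)
    have "measure_pmf.expectation (next_gen p z) (\<lambda>z'. vpow w z' * vpow s (y + z'))
       = vpow (pgf p (s * w)) z * vpow s y" for z y
    proof -
      have "(\<lambda>z'. vpow w z' * vpow s (y + z')) = (\<lambda>z'. vpow s y * vpow (s * w) z')"
        by (rule ext) (simp add: vpow_add vpow_mult mult_ac)
      then show ?thesis by (simp add: next_gen_vpow[OF sw] mult.commute)
    qed
    then show "measure_pmf.expectation (gw_law p j n)
      (\<lambda>x. measure_pmf.expectation (case x of (z, y) \<Rightarrow> map_pmf (\<lambda>z'. (z', y + z')) (next_gen p z))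
            (\<lambda>zy. vpow w (fst zy) * vpow s (snd zy))) =
      measure_pmf.expectation (gw_law p j n) (\<lambda>zy. vpow (pgf p (s * w)) (fst zy) * vpow s (snd zy))"
      by (intro Bochner_Integration.integral_cong refl) (simp add: case_prod_beta)
  qed (use vpow_bounds[OF s] vpow_bounds[OF Suc.prems] in \<open>auto intro: mult_le_one\<close>)
  also have "\<dots> = s$j * ((\<lambda>w. pgf p (s * w)) ^^ n) (pgf p (s * w)) $ j"
    by (rule Suc.IH[OF pgf_cube[OF sw]])
  also have "\<dots> = s$j * ((\<lambda>w. pgf p (s * w)) ^^ Suc n) w $ j"
    using funpow_swap1[of "\<lambda>w. pgf p (s * w)" n w] by simp
  finally show ?case .
qed

text \<open>The map \<open>w \<mapsto> pgf p (s * w)\<close> in the coordinate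
  \<open>1 - s * w\<close>.\<close>

definition gs :: "'d::finite offspring \<Rightarrow> real^'d \<Rightarrow> real^'d \<Rightarrow> real^'d" where
  "gs p s x = (1 - s) + s * gmap p x"

lemma gs_conj: "(gs p s ^^ n) (1 - s * w) = 1 - s * ((\<lambda>w. pgf p (s * w)) ^^ n) w"
proof (induction n)
  case (Suc n)
  have "gs p s (1 - y) = 1 - s * pgf p y" for y
    by (simp add: gs_def gmap_def vec_eq_iff algebra_simps)
  then show ?case using Suc by simp
qed simp

lemma gs_one: "gs p 1 = gmap p"
  by (rule ext) (simp add: gs_def)

lemma cube_0_1: "(0::real^'d::finite) \<in> cube" "(1::real^'d::finite) \<in> cube"
  by (simp_all add: cube_def)

lemma prob_extinct:
  "measure_pmf.prob (gw_law p j n) {zy. fst zy = 0} = 1 - (gmap p ^^ n) 1 $ j"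
proof -
  have "measure_pmf.prob (gw_law p j n) {zy. fst zy = 0}
     = measure_pmf.expectation (gw_law p j n) (indicator {zy. fst zy = 0})" by simp
  also have "indicator {zy. fst zy = 0} = (\<lambda>zy::(nat^'a)\<times>(nat^'a). vpow 0 (fst zy) * vpow 1 (snd zy) :: real)"
    by (rule ext) (auto simp: vpow_zero indicator_def vpow_def[of 1])
  also have "measure_pmf.expectation (gw_law p j n) (\<lambda>zy. vpow 0 (fst zy) * vpow 1 (snd zy))
     = 1 - (gmap p ^^ n) 1 $ j"
    using gw_law_vpow[OF cube_0_1(2) cube_0_1(1), of p j n] gs_conj[where p = p and s = 1 and n = n and w = 0] by (simp add: gs_one)
  finally show ?thesis .
qed

lemma prob_survive:
  "measure_pmf.prob (gw_law p j n) {zy. fst zy \<noteq> 0} = (gmap p ^^ n) 1 $ j"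
proof -
  have "measure_pmf.prob (gw_law p j n) {zy. fst zy \<noteq> 0} = 1 - measure_pmf.prob (gw_law p j n) {zy. fst zy = 0}"
    using measure_pmf.prob_compl[of "{zy. fst zy = 0}" "gw_law p j n"] by (simp add: Compl_eq_Diff_UNIV[symmetric] Collect_neg_eq)
  then show ?thesis by (simp add: prob_extinct)
qed

text \<open>The indicator of survival is \<open>vpow 1 - vpow 0\<close> at the last generation. The
  weights \<open>w = 1\<close> and \<open>w = 0\<close> correspond to the starting points
  \<open>1 - s\<close> and \<open>1\<close>, and the assumption on t and m only serves to put
  \<open>s\<close> into the cube.\<close>

lemma Phi_eq:
  assumes "\<And>l. t$l / m$l \<ge> 0"
  defines "s \<equiv> (\<chi> l. exp (- t$l / m$l))"
  shows "Phi p n m t j = ((gs p s ^^ n) 1 $ j - (gs p s ^^ n) (1 - s) $ j) / (gmap p ^^ n) 1 $ j"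
proof -
  have s: "s \<in> cube" using assms(1) by (simp add: s_def cube_def)
  have e: "exp (- (\<Sum>l\<in>UNIV. t$l * real (y$l) / m$l)) = vpow s y" for y
    by (simp add: vpow_def s_def exp_of_nat_mult[symmetric] exp_sum[symmetric] sum_negf[symmetric] mult_ac)
  have i: "integrable (measure_pmf (gw_law p j n)) (\<lambda>zy. vpow w (fst zy) * vpow s (snd zy))" if "w \<in> cube" for w
    by (rule measure_pmf.integrable_const_bound[where B = 1])
      (use vpow_bounds[OF s] vpow_bounds[OF that] in \<open>auto intro!: mult_le_one AE_I2\<close>)
  have "measure_pmf.expectation (gw_law p j n)
       (\<lambda>zy. exp (- (\<Sum>l\<in>UNIV. t$l * real (snd zy $ l) / m$l)) * (if fst zy \<noteq> 0 then 1 else 0))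
     = measure_pmf.expectation (gw_law p j n) (\<lambda>zy. vpow 1 (fst zy) * vpow s (snd zy) - vpow 0 (fst zy) * vpow s (snd zy))"
    unfolding e by (intro Bochner_Integration.integral_cong refl) (simp add: vpow_zero vpow_def[of 1])
  also have "\<dots> = s$j * ((\<lambda>w. pgf p (s * w)) ^^ n) 1 $ j - s$j * ((\<lambda>w. pgf p (s * w)) ^^ n) 0 $ j"
    by (simp add: i cube_0_1 gw_law_vpow[OF s])
  also have "\<dots> = (gs p s ^^ n) 1 $ j - (gs p s ^^ n) (1 - s) $ j"
    using gs_conj[where p = p and s = s and n = n and w = 0] gs_conj[where p = p and s = s and n = n and w = 1] by simp
  finally show ?thesis by (simp add: Phi_def prob_survive)
qed

lemma ext_prob_eq: "ext_prob p $ j = (SUP n. 1 - (gmap p ^^ n) 1 $ j)"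
  by (simp add: ext_prob_def prob_extinct)

section \<open>Trajectories of nearly critical maps\<close>

lemma inner_vec_real: "x \<bullet> y = (\<Sum>i\<in>UNIV. x$i * (y::real^'d::finite)$i)"
  by (simp add: inner_vec_def)

lemma mpow_add_vec: "mpow A (m + n) *v x = mpow A m *v (mpow A n *v x)"
  by (induction m) (simp_all add: matrix_vector_mul_assoc[symmetric])

text \<open>In the application \<open>G k x = 1 - f(1 - x)\<close> for the \<open>k\<close>-th offspring law, \<open>M k\<close> is its mean matrix and
  \<open>bb k\<close> is the second derivative of \<open>f\<close> at \<open>1\<close> contracted with \<open>v k\<close>; all constants are uniform in \<open>k\<close>.\<close>

locale near_critical =
  fixes G :: "nat \<Rightarrow> real^'d::finite \<Rightarrow> real^'d" and M :: "nat \<Rightarrow> real^'d^'d"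
    and bb :: "nat \<Rightarrow> real^'d \<Rightarrow> real^'d \<Rightarrow> real" and u v :: "nat \<Rightarrow> real^'d"
    and \<rho> Q :: "nat \<Rightarrow> real" and a c0 C :: real and U :: nat
  assumes a_pos: "a > 0" and c0_pos: "c0 > 0" and C_ge1: "C \<ge> 1"
    and v_lo: "c0 \<le> v k $ j" and v_hi: "v k $ j \<le> C" and u_lo: "c0 \<le> u k $ j"
    and vu: "v k \<bullet> u k = 1"
    and M_nonneg: "0 \<le> M k $ i $ j" and M_hi: "M k $ i $ j \<le> C"
    and v_M: "v k \<bullet> (M k *v x) = \<rho> k * (v k \<bullet> x)" and M_u: "M k *v u k = \<rho> k *\<^sub>R u k"
    and M_pow: "mpow (M k) U $ i $ j \<ge> a"
    and rho_lo: "1/2 \<le> \<rho> k" and rho_hi: "\<rho> k \<le> 2" and rho_lim: "\<rho> \<longlonglongrightarrow> 1"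
    and G_cube: "x \<in> cube \<Longrightarrow> G k x \<in> cube"
    and G_mono: "0 \<le> x \<Longrightarrow> x \<le> y \<Longrightarrow> y \<le> 1 \<Longrightarrow> G k x \<le> G k y"
    and G_lin: "x \<in> cube \<Longrightarrow> G k x \<le> M k *v x"
    and G_order1: "x \<in> cube \<Longrightarrow> (M k *v x - G k x) $ j \<le> C * (v k \<bullet> x)^2"
    and G_order2: "x \<in> cube \<Longrightarrow> \<bar>v k \<bullet> (M k *v x - G k x) - bb k x x / 2\<bar> \<le> C * (v k \<bullet> x)^3"
    and G_sub: "0 \<le> x \<Longrightarrow> 0 \<le> y \<Longrightarrow> x + y \<le> 1 \<Longrightarrow> G k (x + y) \<le> G k x + G k y"
    and G_mix1: "0 \<le> x \<Longrightarrow> 0 \<le> y \<Longrightarrow> x + y \<le> 1 \<Longrightarrow>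
        (G k x + G k y - G k (x + y)) $ j \<le> C * ((v k \<bullet> x) * (v k \<bullet> y))"
    and G_mix2: "0 \<le> x \<Longrightarrow> 0 \<le> y \<Longrightarrow> x + y \<le> 1 \<Longrightarrow>
        \<bar>v k \<bullet> (G k x + G k y - G k (x + y)) - bb k x y\<bar>
          \<le> C * ((v k \<bullet> x) * (v k \<bullet> y) * (v k \<bullet> x + v k \<bullet> y))"
    and G_scale: "x \<in> cube \<Longrightarrow> 0 \<le> h \<Longrightarrow> h \<le> 1 \<Longrightarrow> h *\<^sub>R G k x \<le> G k (h *\<^sub>R x)"
    and bb_bilinear: "bilinear (bb k)"
    and bb_bound: "\<bar>bb k x y\<bar> \<le> C * ((\<Sum>i\<in>UNIV. v k$i * \<bar>x$i\<bar>) * (\<Sum>i\<in>UNIV. v k$i * \<bar>y$i\<bar>))"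
    and bb_u: "bb k (u k) (u k) = 2 * Q k" and Q_lo: "c0 \<le> Q k" and Q_hi: "Q k \<le> C"
    and bb_1: "c0 \<le> bb k 1 1"
begin

text \<open>The l1 norm weighted by the left eigenvector. It equals \<open>v k \<bullet> x\<close>
  on nonnegative vectors, and \<open>M k\<close> has norm at most \<open>\<rho> k\<close> for it,
  with no further constant.\<close>

definition vn :: "nat \<Rightarrow> real^'d \<Rightarrow> real" where "vn k x = (\<Sum>i\<in>UNIV. v k$i * \<bar>x$i\<bar>)"

text \<open>The size of the component of \<open>x\<close> complementary to the Perron direction: the
  projection along u onto the kernel of v is measured.\<close>

definition dev :: "nat \<Rightarrow> real^'d \<Rightarrow> real" where "dev k x = vn k (x - (v k \<bullet> x) *\<^sub>R u k)"

definition Cd :: real where "Cd = C * real CARD('d)"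

lemma v_pos: "0 < v k $ j" using v_lo[of k j] c0_pos by linarith

lemma u_pos: "0 < u k $ j" using u_lo[of k j] c0_pos by linarith

lemma Cd_pos: "0 < Cd" "1 \<le> Cd"
proof -
  have "1 \<le> real CARD('d)" by (metis One_nat_def Suc_leI of_nat_1 of_nat_le_iff zero_less_card_finite)
  then show "1 \<le> Cd" unfolding Cd_def using C_ge1 mult_mono[of 1 C 1 "real CARD('d)"] by simp
  then show "0 < Cd" by simp
qed

lemma cube_iff: "x \<in> cube \<longleftrightarrow> 0 \<le> x \<and> x \<le> (1::real^'d)"
  by (auto simp: cube_def less_eq_vec_def)

lemma ip_nonneg: "0 \<le> x \<Longrightarrow> 0 \<le> v k \<bullet> x"
  unfolding inner_vec_real using v_pos by (intro sum_nonneg mult_nonneg_nonneg) (auto simp: less_eq_vec_def less_imp_le)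

lemma ip_mono: "x \<le> y \<Longrightarrow> v k \<bullet> x \<le> v k \<bullet> y"
  using ip_nonneg[of "y - x" k] by (simp add: inner_diff_right less_eq_vec_def)

lemma ip_le_sum: "0 \<le> x \<Longrightarrow> v k \<bullet> x \<le> C * (\<Sum>i\<in>UNIV. x$i)"
  unfolding inner_vec_real sum_distrib_left
  by (intro sum_mono mult_right_mono v_hi) (auto simp: less_eq_vec_def)

lemma ip_const_le: "(\<And>j. x$j \<le> B) \<Longrightarrow> 0 \<le> B \<Longrightarrow> v k \<bullet> x \<le> Cd * B"
proof -
  assume x: "\<And>j. x$j \<le> B" and B: "0 \<le> B"
  have "v k \<bullet> x \<le> (\<Sum>i\<in>(UNIV::'d set). C * B)" unfolding inner_vec_real
  proof (rule sum_mono)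
    fix i
    have "v k $ i * x $ i \<le> v k $ i * B" using x v_pos by (intro mult_left_mono) (auto simp: less_imp_le)
    also have "\<dots> \<le> C * B" using v_hi B by (intro mult_right_mono)
    finally show "v k $ i * x $ i \<le> C * B" .
  qed
  then show ?thesis by (simp add: Cd_def mult_ac)
qed

lemma ip_cube_le: "x \<in> cube \<Longrightarrow> v k \<bullet> x \<le> Cd"
  using ip_const_le[of x 1 k] by (simp add: cube_def)

lemma comp_le: "0 \<le> x \<Longrightarrow> x$j \<le> (v k \<bullet> x) / c0"
proof -
  assume x: "0 \<le> x"
  have "c0 * x$j \<le> v k$j * x$j" using x v_lo by (intro mult_right_mono) (auto simp: less_eq_vec_def)
  also have "\<dots> \<le> v k \<bullet> x" unfolding inner_vec_real
    using x v_pos by (intro member_le_sum) (auto simp: less_eq_vec_def less_imp_le)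
  finally show ?thesis using c0_pos by (simp add: pos_le_divide_eq mult.commute)
qed

lemma vn_eq: "0 \<le> x \<Longrightarrow> vn k x = v k \<bullet> x"
  by (simp add: vn_def inner_vec_real less_eq_vec_def)

lemma vn_nonneg: "0 \<le> vn k x"
  unfolding vn_def using v_pos by (intro sum_nonneg mult_nonneg_nonneg) (auto simp: less_imp_le)

lemma vn_triangle: "vn k (x + y) \<le> vn k x + vn k y"
  unfolding vn_def sum.distrib[symmetric] distrib_left[symmetric]
  using v_pos by (intro sum_mono mult_left_mono) (auto simp: less_imp_le)

lemma vn_scale: "vn k (h *\<^sub>R x) = \<bar>h\<bar> * vn k x"
  by (simp add: vn_def abs_mult sum_distrib_left mult_ac)

lemma vn_minus: "vn k (- x) = vn k x"
  by (simp add: vn_def)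

lemma vn_diff: "vn k (x - y) \<le> vn k x + vn k y"
  using vn_triangle[of k x "- y"] by (simp add: vn_minus)

lemma ip_le_vn: "\<bar>v k \<bullet> x\<bar> \<le> vn k x"
  unfolding vn_def inner_vec_real
  by (rule order_trans[OF sum_abs]) (simp add: abs_mult v_pos less_imp_le)

lemma nth_le_vn: "\<bar>x$j\<bar> \<le> vn k x / c0"
  using comp_le[of "\<chi> i. \<bar>x$i\<bar>" j k] vn_eq[of "\<chi> i. \<bar>x$i\<bar>" k]
  by (simp add: less_eq_vec_def vn_def)

lemma vn_u: "vn k (u k) = 1"
  using vn_eq[of "u k" k] u_pos vu by (simp add: less_eq_vec_def less_imp_le)

lemma vn_M: "vn k (M k *v x) \<le> \<rho> k * vn k x"
proof -
  define y where "y = (\<chi> i. \<bar>x$i\<bar>)"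
  have "\<bar>(M k *v x)$i\<bar> \<le> (M k *v y)$i" for i
    unfolding matrix_vec_nth y_def
    by (rule order_trans[OF sum_abs]) (simp add: abs_mult M_nonneg)
  then have "vn k (M k *v x) \<le> v k \<bullet> (M k *v y)"
    unfolding vn_def inner_vec_real using v_pos by (intro sum_mono mult_left_mono) (auto simp: less_imp_le)
  also have "\<dots> = \<rho> k * vn k x" using v_M[of k y] by (simp add: vn_def inner_vec_real y_def)
  finally show ?thesis .
qed

lemma rho_pos: "0 < \<rho> k" using rho_lo[of k] by linarith

lemma v_mpow: "v k \<bullet> (mpow (M k) n *v x) = \<rho> k ^ n * (v k \<bullet> x)"
  by (induction n) (simp_all add: matrix_vector_mul_assoc[symmetric] v_M)

lemma mpow_u: "mpow (M k) n *v u k = \<rho> k ^ n *\<^sub>R u k"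
  by (rule mpow_eigenvector[OF M_u])

lemma dev_nonneg: "0 \<le> dev k x" by (simp add: dev_def vn_nonneg)

lemma dev_le: "0 \<le> x \<Longrightarrow> dev k x \<le> 2 * (v k \<bullet> x)"
  using vn_diff[of k x "(v k \<bullet> x) *\<^sub>R u k"] ip_nonneg[of x k]
  by (simp add: dev_def vn_scale vn_u vn_eq)

lemma dev_comp: "\<bar>x$j - (v k \<bullet> x) * u k $ j\<bar> \<le> dev k x / c0"
  using nth_le_vn[of "x - (v k \<bullet> x) *\<^sub>R u k" j k] by (simp add: dev_def)

text \<open>A Doeblin constant: since u is at most 1/c0, v at most C and \<open>\<rho>^U\<close> at
  most \<open>2^U\<close>, the matrix \<open>M^U\<close> dominates entrywise
  \<open>\<rho>^U * \<epsilon>0\<close> times the rank-one matrix u v'.\<close>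

definition \<epsilon>0 :: real where "\<epsilon>0 = min (1/2) (a * c0 / (C * 2 ^ U))"

lemma eps0: "0 < \<epsilon>0" "\<epsilon>0 \<le> 1/2"
proof -
  show "0 < \<epsilon>0" using a_pos c0_pos C_ge1 by (auto simp: \<epsilon>0_def)
  show "\<epsilon>0 \<le> 1/2" unfolding \<epsilon>0_def by (rule min.cobounded1)
qed

text \<open>On the kernel of v the rank-one part acts as zero, so it may be subtracted before
  absolute values are taken; this gains the factor \<open>1 - \<epsilon>0\<close> over the trivial
  bound.\<close>

lemma contraction:
  assumes x: "v k \<bullet> x = 0"
  shows "vn k (mpow (M k) U *v x) \<le> \<rho> k ^ U * (1 - \<epsilon>0) * vn k x"
proof -
  define A where "A = mpow (M k) U"
  define e where "e = \<rho> k ^ U * \<epsilon>0"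
  define y where "y = (\<chi> i. \<bar>x$i\<bar>)"
  have e0: "0 \<le> e" using eps0 rho_pos[of k] by (simp add: e_def)
  have le: "e * u k $ i * v k $ j \<le> A $ i $ j" for i j
  proof -
    have "c0 * u k $ i \<le> v k $ i * u k $ i" using v_lo u_pos by (intro mult_right_mono) (auto simp: less_imp_le)
    also have "\<dots> \<le> v k \<bullet> u k" unfolding inner_vec_real
      using v_pos u_pos by (intro member_le_sum) (auto simp: less_imp_le)
    finally have ui: "u k $ i \<le> 1 / c0" using c0_pos by (simp add: vu pos_le_divide_eq mult.commute)
    have "e \<le> 2 ^ U * (a * c0 / (C * 2 ^ U))" unfolding e_def
      using rho_hi[of k] rho_pos[of k] eps0 by (intro mult_mono power_mono) (auto simp: \<epsilon>0_def)
    also have "\<dots> = a * c0 / C" by simp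
    finally have "e * u k $ i * v k $ j \<le> (a * c0 / C) * (1 / c0) * C"
      using ui v_hi[of k j] u_pos v_pos e0 a_pos c0_pos C_ge1 by (intro mult_mono) (auto simp: less_imp_le)
    also have "\<dots> = a" using c0_pos C_ge1 by simp
    also have "\<dots> \<le> A $ i $ j" unfolding A_def by (rule M_pow)
    finally show ?thesis .
  qed
  have abs: "\<bar>(A *v x)$i\<bar> \<le> (A *v y)$i - e * u k$i * (v k \<bullet> y)" for i
  proof -
    have "(A *v x)$i = (\<Sum>j\<in>UNIV. (A$i$j - e * u k$i * v k$j) * x$j)"
      using x by (simp add: matrix_vec_nth left_diff_distrib sum_subtractf inner_vec_real sum_distrib_left[symmetric] mult.assoc)
    also have "\<bar>\<dots>\<bar> \<le> (\<Sum>j\<in>UNIV. (A$i$j - e * u k$i * v k$j) * y$j)"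
      by (rule order_trans[OF sum_abs]) (simp add: abs_mult le y_def)
    also have "\<dots> = (A *v y)$i - e * u k$i * (v k \<bullet> y)"
      by (simp add: matrix_vec_nth left_diff_distrib sum_subtractf inner_vec_real sum_distrib_left[symmetric] mult.assoc)
    finally show ?thesis .
  qed
  have "vn k (A *v x) \<le> (\<Sum>i\<in>UNIV. v k$i * ((A *v y)$i - e * u k$i * (v k \<bullet> y)))"
    unfolding vn_def using v_pos by (intro sum_mono mult_left_mono abs) (auto simp: less_imp_le)
  also have "\<dots> = v k \<bullet> (A *v y) - e * (v k \<bullet> y) * (v k \<bullet> u k)"
  proof -
    have "(\<Sum>i\<in>UNIV. v k$i * ((A *v y)$i - e * u k$i * c)) = v k \<bullet> (A *v y) - e * c * (v k \<bullet> u k)" for c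
      by (simp add: inner_vec_real right_diff_distrib sum_subtractf sum_distrib_left mult_ac)
    then show ?thesis .
  qed
  also have "\<dots> = \<rho> k ^ U * (1 - \<epsilon>0) * (v k \<bullet> y)"
    unfolding A_def v_mpow vu e_def by (simp add: algebra_simps)
  also have "v k \<bullet> y = vn k x" by (simp add: vn_def inner_vec_real y_def)
  finally show ?thesis by (simp add: A_def)
qed

lemma contraction_iter:
  assumes x: "v k \<bullet> x = 0"
  shows "vn k (mpow (M k) (n * U) *v x) \<le> \<rho> k ^ (n * U) * (1 - \<epsilon>0) ^ n * vn k x"
proof (induction n)
  case (Suc n)
  have "vn k (mpow (M k) (Suc n * U) *v x) = vn k (mpow (M k) U *v (mpow (M k) (n * U) *v x))"
    by (simp add: mpow_add_vec)
  also have "\<dots> \<le> \<rho> k ^ U * (1 - \<epsilon>0) * vn k (mpow (M k) (n * U) *v x)"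
    by (rule contraction) (simp add: v_mpow x)
  also have "\<dots> \<le> \<rho> k ^ U * (1 - \<epsilon>0) * (\<rho> k ^ (n * U) * (1 - \<epsilon>0) ^ n * vn k x)"
    using eps0 rho_pos[of k] by (intro mult_left_mono Suc) auto
  finally show ?case by (simp add: power_add mult_ac)
qed simp

text \<open>A crude Gronwall estimate: 3 bounds \<open>\<rho> + e\<close>, and 4 absorbs the sum of
  the propagated and the new error. It is used over a fixed number of steps, so exponential
  constants are harmless.\<close>

lemma iterate_error:
  assumes z: "\<And>i. i \<le> L \<Longrightarrow> 0 \<le> z i" "\<And>i. i < L \<Longrightarrow> vn k (z (Suc i) - M k *v z i) \<le> e * (v k \<bullet> z i)"
    and e: "0 \<le> e" "e \<le> 1"
  shows "n \<le> L \<Longrightarrow> v k \<bullet> z n \<le> 3 ^ n * (v k \<bullet> z 0) \<and> vn k (z n - mpow (M k) n *v z 0) \<le> e * 4 ^ n * (v k \<bullet> z 0)"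
proof (induction n)
  case 0
  have "vn k 0 = 0" by (simp add: vn_def)
  then show ?case using e ip_nonneg[OF z(1)[of 0], of k] by simp
next
  case (Suc n)
  then have n: "n < L" and IH: "v k \<bullet> z n \<le> 3 ^ n * (v k \<bullet> z 0)"
    "vn k (z n - mpow (M k) n *v z 0) \<le> e * 4 ^ n * (v k \<bullet> z 0)" by auto
  have z0: "0 \<le> v k \<bullet> z 0" using n z(1)[of 0] ip_nonneg by auto
  have zn: "0 \<le> v k \<bullet> z n" using n z(1)[of n] ip_nonneg by auto
  have "v k \<bullet> z (Suc n) = v k \<bullet> (M k *v z n) + v k \<bullet> (z (Suc n) - M k *v z n)" by (simp add: inner_diff_right)
  also have "\<dots> \<le> \<rho> k * (v k \<bullet> z n) + e * (v k \<bullet> z n)"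
    using ip_le_vn[of k "z (Suc n) - M k *v z n"] z(2)[OF n] by (simp add: v_M)
  also have "\<dots> = (\<rho> k + e) * (v k \<bullet> z n)" by (simp add: algebra_simps)
  also have "\<dots> \<le> 3 * (3 ^ n * (v k \<bullet> z 0))" using rho_hi[of k] e IH zn rho_pos[of k] by (intro mult_mono) auto
  finally have 1: "v k \<bullet> z (Suc n) \<le> 3 ^ Suc n * (v k \<bullet> z 0)" by simp
  have "z (Suc n) - mpow (M k) (Suc n) *v z 0 = M k *v (z n - mpow (M k) n *v z 0) + (z (Suc n) - M k *v z n)"
    by (simp add: matrix_vector_mult_diff_distrib matrix_vector_mul_assoc)
  note eq = this
  have "vn k (z (Suc n) - mpow (M k) (Suc n) *v z 0)
     \<le> \<rho> k * vn k (z n - mpow (M k) n *v z 0) + e * (v k \<bullet> z n)"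
    unfolding eq using vn_triangle[of k "M k *v (z n - mpow (M k) n *v z 0)" "z (Suc n) - M k *v z n"]
      vn_M[of k "z n - mpow (M k) n *v z 0"] z(2)[OF n] by linarith
  also have "\<dots> \<le> 2 * (e * 4 ^ n * (v k \<bullet> z 0)) + e * (3 ^ n * (v k \<bullet> z 0))"
    using rho_hi[of k] IH e vn_nonneg rho_pos[of k] by (intro add_mono mult_mono mult_left_mono) auto
  also have "\<dots> \<le> 2 * (e * 4 ^ n * (v k \<bullet> z 0)) + e * (4 ^ n * (v k \<bullet> z 0))"
    using e z0 by (intro add_left_mono mult_left_mono mult_right_mono power_mono) auto
  also have "\<dots> \<le> e * 4 ^ Suc n * (v k \<bullet> z 0)" using e z0 by (simp add: algebra_simps mult_nonneg_nonneg)
  finally show ?case using 1 by simp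
qed

text \<open>Over L steps the contraction makes the transversal part of any nonnegative start
  negligible, and \<open>e\<close> is so small that the perturbation cannot restore it. Only
  near-linearity over L steps is assumed, so the lemma applies to trajectories, to their differences
  and to eigenvectors of nearby matrices.\<close>

lemma alignment:
  assumes "\<epsilon> > 0"
  obtains L e where "e > 0" "\<And>k z. \<forall>i\<le>L. 0 \<le> z i \<Longrightarrow>
     \<forall>i<L. vn k (z (Suc i) - M k *v z i) \<le> e * (v k \<bullet> z i) \<Longrightarrow> dev k (z L) \<le> \<epsilon> * (v k \<bullet> z L)"
proof -
  have "(\<lambda>n. (1 - \<epsilon>0) ^ n) \<longlonglongrightarrow> 0" using eps0 by (intro LIMSEQ_realpow_zero) auto
  then obtain n where n: "(1 - \<epsilon>0) ^ n < \<epsilon> / 8"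
    using assms by (metis (no_types, lifting) eventually_sequentially order_tendstoD(2) zero_less_divide_iff zero_less_numeral order_refl)
  define L where "L = n * U"
  \<comment> \<open>The error grows at most like 4^L while the linear part may shrink like 2^-L
    because \<open>\<rho> \<ge> 1/2\<close>; 8^L covers both, and the last 8 leaves room for the
    halving below and for the final constant.\<close>
  define e where "e = min 1 \<epsilon> / (8 * 8 ^ L)"
  have e: "0 < e" "e \<le> 1"
  proof -
    show "0 < e" using assms by (simp add: e_def)
    have "min 1 \<epsilon> / (8 * 8 ^ L) \<le> 1 / 1" by (rule frac_le) (auto intro: order_trans[of 1 8])
    then show "e \<le> 1" by (simp add: e_def)
  qed
  show thesis
  proof (rule that[of e L])
    show "0 < e" by (rule e)
    fix k z
    assume "\<forall>i\<le>L. 0 \<le> z i" "\<forall>i<L. vn k (z (Suc i) - M k *v z i) \<le> e * (v k \<bullet> z i)"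
    then have z: "\<And>i. i \<le> L \<Longrightarrow> 0 \<le> z i" "\<And>i. i < L \<Longrightarrow> vn k (z (Suc i) - M k *v z i) \<le> e * (v k \<bullet> z i)"
      by auto
    define V where "V = v k \<bullet> z 0"
    define r where "r = z L - mpow (M k) L *v z 0"
    have V0: "0 \<le> V" using z(1)[of 0] ip_nonneg by (simp add: V_def)
    have pw: "(1/2) ^ L \<le> \<rho> k ^ L" using rho_lo[of k] by (intro power_mono) auto
    have e4: "e * 4 ^ L = min 1 \<epsilon> / 8 * (1/2) ^ L"
    proof -
      have "(8::real) ^ L = 4 ^ L * 2 ^ L" by (simp flip: power_mult_distrib)
      then show ?thesis unfolding e_def by (simp add: power_one_over field_simps)
    qed
    have "vn k r \<le> e * 4 ^ L * V" unfolding r_def V_def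
      using iterate_error[of L z k e L] z e by simp
    also have "\<dots> \<le> min 1 \<epsilon> / 8 * \<rho> k ^ L * V"
      unfolding e4 using pw V0 assms by (intro mult_right_mono mult_left_mono) auto
    finally have r: "vn k r \<le> min 1 \<epsilon> / 8 * (\<rho> k ^ L * V)" by (simp only: mult.assoc)
    have VL: "v k \<bullet> z L = \<rho> k ^ L * V + v k \<bullet> r" by (simp add: r_def inner_diff_right v_mpow V_def)
    have "vn k r \<le> 1 / 8 * (\<rho> k ^ L * V)"
    proof -
      have "min 1 \<epsilon> / 8 * (\<rho> k ^ L * V) \<le> 1 / 8 * (\<rho> k ^ L * V)"
        using V0 rho_pos[of k] by (intro mult_right_mono) auto
      then show ?thesis using r by linarith
    qed
    \<comment> \<open>The projection keeps at least half of its linear prediction, so bounds in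
      terms of \<open>V\<close> become bounds in terms of the final projection.\<close>
    then have half: "\<rho> k ^ L * V \<le> 2 * (v k \<bullet> z L)"
      using VL ip_le_vn[of k r] mult_nonneg_nonneg[OF zero_le_power[OF less_imp_le[OF rho_pos[of k]], of L] V0] by linarith
    have eq: "z L - (v k \<bullet> z L) *\<^sub>R u k = mpow (M k) L *v (z 0 - V *\<^sub>R u k) + (r - (v k \<bullet> r) *\<^sub>R u k)"
      unfolding matrix_vector_mult_diff_distrib matrix_vector_mult_scaleR mpow_u VL
      by (simp add: r_def algebra_simps)
    have "v k \<bullet> (z 0 - V *\<^sub>R u k) = 0" by (simp add: inner_diff_right vu V_def)
    then have "vn k (mpow (M k) L *v (z 0 - V *\<^sub>R u k)) \<le> \<rho> k ^ L * (1 - \<epsilon>0) ^ n * vn k (z 0 - V *\<^sub>R u k)"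
      unfolding L_def by (rule contraction_iter)
    also have "\<dots> \<le> \<rho> k ^ L * (\<epsilon> / 8) * (2 * V)"
      using n dev_le[OF z(1)[of 0], of k] rho_pos[of k] vn_nonneg eps0 V0 assms
      by (intro mult_mono) (auto simp: dev_def V_def)
    finally have 1: "vn k (mpow (M k) L *v (z 0 - V *\<^sub>R u k)) \<le> \<epsilon> / 4 * (\<rho> k ^ L * V)" by (simp add: mult_ac)
    have "vn k (r - (v k \<bullet> r) *\<^sub>R u k) \<le> 2 * vn k r"
      using vn_diff[of k r "(v k \<bullet> r) *\<^sub>R u k"] ip_le_vn[of k r] by (simp add: vn_scale vn_u)
    also have "\<dots> \<le> 2 * (\<epsilon> / 8 * (\<rho> k ^ L * V))"
    proof -
      have "min 1 \<epsilon> / 8 * (\<rho> k ^ L * V) \<le> \<epsilon> / 8 * (\<rho> k ^ L * V)"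
        using V0 rho_pos[of k] by (intro mult_right_mono) auto
      then show ?thesis using r by linarith
    qed
    finally have 2: "vn k (r - (v k \<bullet> r) *\<^sub>R u k) \<le> \<epsilon> / 4 * (\<rho> k ^ L * V)" by (simp add: mult_ac)
    have "dev k (z L) \<le> \<epsilon> / 2 * (\<rho> k ^ L * V)"
      unfolding dev_def eq using vn_triangle[of k "mpow (M k) L *v (z 0 - V *\<^sub>R u k)" "r - (v k \<bullet> r) *\<^sub>R u k"] 1 2
      by simp
    also have "\<dots> \<le> \<epsilon> / 2 * (2 * (v k \<bullet> z L))" using half assms by (intro mult_left_mono) auto
    finally show "dev k (z L) \<le> \<epsilon> * (v k \<bullet> z L)" by simp
  qed
qed

end

section \<open>Iteration with a source and uniform one-step bounds\<close>

context near_critical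
begin

definition C2 :: real where "C2 = Cd * C"

lemma C2_ge1: "1 \<le> C2"
  unfolding C2_def using Cd_pos C_ge1 mult_mono[of 1 Cd 1 C] by simp

definition step :: "nat \<Rightarrow> real^'d \<Rightarrow> real^'d \<Rightarrow> real^'d" where
  "step k s x = (1 - s) + s * G k x"

definition traj :: "nat \<Rightarrow> real^'d \<Rightarrow> real^'d \<Rightarrow> nat \<Rightarrow> real^'d" where
  "traj k s x m = (step k s ^^ m) x"

lemma traj_0 [simp]: "traj k s x 0 = x" and traj_Suc: "traj k s x (Suc m) = step k s (traj k s x m)"
  by (simp_all add: traj_def)

lemma traj_add: "traj k s x (m + n) = traj k s (traj k s x n) m"
  by (simp add: traj_def funpow_add)

lemma G_nth_bounds: "x \<in> cube \<Longrightarrow> 0 \<le> G k x $ i" "x \<in> cube \<Longrightarrow> G k x $ i \<le> 1"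
  using G_cube[of x k] by (auto simp: cube_def)

lemma step_eq: "step k s x = (1 - s) * (1 - G k x) + G k x"
  by (simp add: step_def vec_eq_iff algebra_simps)

lemma step_one [simp]: "step k 1 x = G k x"
  by (simp add: step_def)

lemma G_le_step: "s \<in> cube \<Longrightarrow> x \<in> cube \<Longrightarrow> G k x \<le> step k s x"
  unfolding step_eq less_eq_vec_def using G_nth_bounds[of x k] by (auto simp: cube_def)

lemma src_le_step: "s \<in> cube \<Longrightarrow> x \<in> cube \<Longrightarrow> 1 - s \<le> step k s x"
  unfolding step_def less_eq_vec_def using G_nth_bounds[of x k] by (auto simp: cube_def)

lemma step_cube: "s \<in> cube \<Longrightarrow> x \<in> cube \<Longrightarrow> step k s x \<in> cube"
proof -
  assume s: "s \<in> cube" and x: "x \<in> cube"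
  have "0 \<le> step k s x $ i \<and> step k s x $ i \<le> 1" for i
  proof
    show "0 \<le> step k s x $ i" using src_le_step[OF s x, of k] s by (auto simp: less_eq_vec_def cube_def) (smt (verit))
    have "s $ i * G k x $ i \<le> s $ i * 1" using s G_nth_bounds[OF x] by (intro mult_left_mono) (auto simp: cube_def)
    then show "step k s x $ i \<le> 1" by (simp add: step_def)
  qed
  then show ?thesis by (simp add: cube_def)
qed

lemma step_mono: "s \<in> cube \<Longrightarrow> 0 \<le> x \<Longrightarrow> x \<le> y \<Longrightarrow> y \<le> 1 \<Longrightarrow> step k s x \<le> step k s y"
  using G_mono[of x y k] by (auto simp: step_def less_eq_vec_def cube_def intro: mult_left_mono)

lemma one_cube: "(1::real^'d) \<in> cube" and one_minus_cube: "s \<in> cube \<Longrightarrow> 1 - s \<in> (cube :: (real^'d) set)"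
  by (auto simp: cube_def)

lemma cubeD: "x \<in> cube \<Longrightarrow> 0 \<le> x" "x \<in> cube \<Longrightarrow> x \<le> (1::real^'d)"
  by (simp_all add: cube_iff)

lemma traj_cube: "s \<in> cube \<Longrightarrow> x \<in> cube \<Longrightarrow> traj k s x m \<in> cube"
  by (induction m) (auto simp: traj_Suc intro: step_cube)

lemma traj_mono: "s \<in> cube \<Longrightarrow> x \<in> cube \<Longrightarrow> y \<in> cube \<Longrightarrow> x \<le> y \<Longrightarrow> traj k s x m \<le> traj k s y m"
proof (induction m)
  case (Suc m)
  then show ?case using traj_cube[of s x k m] traj_cube[of s y k m]
    by (simp add: traj_Suc step_mono cubeD)
qed simp

lemma traj_one_le: "s \<in> cube \<Longrightarrow> x \<in> cube \<Longrightarrow> traj k 1 x m \<le> traj k s x m"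
proof (induction m)
  case (Suc m)
  have "traj k 1 x (Suc m) \<le> G k (traj k s x m)"
    using Suc traj_cube[of 1 x k m] traj_cube[of s x k m] by (simp add: traj_Suc G_mono cubeD one_cube)
  also have "\<dots> \<le> traj k s x (Suc m)"
    using Suc traj_cube[of s x k m] by (simp add: traj_Suc G_le_step)
  finally show ?case .
qed simp

text \<open>\<open>y\<close> starts at the top of the cube and \<open>x\<close> starts below its own
  image, so order preservation makes \<open>y\<close> decrease and, in the next lemma,
  \<open>x\<close> increase.\<close>

lemma y_Suc_le: "s \<in> cube \<Longrightarrow> traj k s 1 (Suc m) \<le> traj k s 1 m"
  using traj_mono[of s "step k s 1" 1 k m] step_cube[of s 1 k] traj_add[of k s 1 m 1]
  by (simp add: traj_Suc one_cube cubeD)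

lemma x_le_Suc: "s \<in> cube \<Longrightarrow> traj k s (1 - s) m \<le> traj k s (1 - s) (Suc m)"
  using traj_mono[of s "1 - s" "step k s (1 - s)" k m] step_cube[of s "1 - s" k] traj_add[of k s "1 - s" m 1]
  by (simp add: traj_Suc one_minus_cube src_le_step)

lemma y_antimono: "s \<in> cube \<Longrightarrow> i \<le> m \<Longrightarrow> traj k s 1 m \<le> traj k s 1 i"
  by (rule lift_Suc_antimono_le) (simp_all add: y_Suc_le)

lemma x_mono: "s \<in> cube \<Longrightarrow> i \<le> m \<Longrightarrow> traj k s (1 - s) i \<le> traj k s (1 - s) m"
  by (rule lift_Suc_mono_le) (simp_all add: x_le_Suc)

lemma x_le_y: "s \<in> cube \<Longrightarrow> traj k s (1 - s) m \<le> traj k s 1 m"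
  by (rule traj_mono) (auto simp: one_cube one_minus_cube cubeD)

lemma ip_mult_le: "0 \<le> x \<Longrightarrow> (\<And>j. y$j \<le> B) \<Longrightarrow> v k \<bullet> (x * y) \<le> B * (v k \<bullet> x)"
proof -
  assume x: "0 \<le> x" and y: "\<And>j. y$j \<le> B"
  have "x * y \<le> B *\<^sub>R x" using x y by (auto simp: less_eq_vec_def mult.commute[of B] intro: mult_left_mono)
  then show ?thesis using ip_mono[of "x * y" "B *\<^sub>R x" k] by simp
qed

lemma G_nth_le: "x \<in> cube \<Longrightarrow> G k x $ j \<le> 2 * (v k \<bullet> x) / c0"
proof -
  assume x: "x \<in> cube"
  have "G k x $ j \<le> (v k \<bullet> G k x) / c0" using G_cube[OF x] by (intro comp_le cubeD)
  also have "\<dots> \<le> (\<rho> k * (v k \<bullet> x)) / c0"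
    using ip_mono[OF G_lin[OF x, of k], of k] c0_pos by (simp add: v_M divide_right_mono)
  also have "\<dots> \<le> 2 * (v k \<bullet> x) / c0"
    using rho_hi[of k] c0_pos ip_nonneg[OF cubeD(1)[OF x], of k] by (intro divide_right_mono mult_right_mono) auto
  finally show ?thesis .
qed

lemma defect_bounds:
  assumes x: "x \<in> cube"
  shows "0 \<le> M k *v x - G k x" "0 \<le> v k \<bullet> (M k *v x - G k x)" "v k \<bullet> (M k *v x - G k x) \<le> C2 * (v k \<bullet> x)^2"
proof -
  show "0 \<le> M k *v x - G k x" using G_lin[OF x, of k] by (simp add: less_eq_vec_def)
  then show "0 \<le> v k \<bullet> (M k *v x - G k x)" by (rule ip_nonneg)
  show "v k \<bullet> (M k *v x - G k x) \<le> C2 * (v k \<bullet> x)^2"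
    using ip_const_le[of "M k *v x - G k x" "C * (v k \<bullet> x)^2" k] G_order1[OF x] C_ge1 by (simp add: C2_def mult.assoc)
qed

lemma src_bounds:
  assumes s: "s \<in> cube" and x: "x \<in> cube"
  shows "0 \<le> (1 - s) * (1 - G k x)" "v k \<bullet> ((1 - s) * (1 - G k x)) \<le> v k \<bullet> (1 - s)"
    "v k \<bullet> (1 - s) * (1 - 2 * (v k \<bullet> x) / c0) \<le> v k \<bullet> ((1 - s) * (1 - G k x))"
proof -
  have s': "0 \<le> 1 - s" using s by (auto simp: cube_def less_eq_vec_def)
  show "0 \<le> (1 - s) * (1 - G k x)" using s G_nth_bounds[OF x] by (auto simp: cube_def less_eq_vec_def)
  show "v k \<bullet> ((1 - s) * (1 - G k x)) \<le> v k \<bullet> (1 - s)"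
    using ip_mult_le[OF s', of "1 - G k x" 1 k] G_nth_bounds[OF x, of k] by simp
  have "(1 - s) * (1 - G k x) = (1 - s) - (1 - s) * G k x" by (simp add: vec_eq_iff algebra_simps)
  moreover have "v k \<bullet> ((1 - s) * G k x) \<le> 2 * (v k \<bullet> x) / c0 * (v k \<bullet> (1 - s))"
    by (rule ip_mult_le[OF s' G_nth_le[OF x]])
  ultimately show "v k \<bullet> (1 - s) * (1 - 2 * (v k \<bullet> x) / c0) \<le> v k \<bullet> ((1 - s) * (1 - G k x))"
    by (simp add: inner_diff_right algebra_simps)
qed

lemma step_split: "step k s x = (1 - s) * (1 - G k x) + M k *v x - (M k *v x - G k x)"
  by (simp add: step_eq)

context
  fixes s x :: "real^'d" assumes s: "s \<in> cube" and x: "x \<in> cube"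
begin

lemma ip_step: "v k \<bullet> step k s x = v k \<bullet> ((1 - s) * (1 - G k x)) + \<rho> k * (v k \<bullet> x) - v k \<bullet> (M k *v x - G k x)"
  unfolding step_split[of k s x] inner_diff_right inner_add_right v_M by simp

lemma step_upper: "v k \<bullet> step k s x \<le> v k \<bullet> (1 - s) + \<rho> k * (v k \<bullet> x)"
  unfolding ip_step using src_bounds[OF s x, of k] defect_bounds[OF x, of k] by linarith

lemma step_lower: "v k \<bullet> (1 - s) * (1 - 2 * (v k \<bullet> x) / c0) + \<rho> k * (v k \<bullet> x) - C2 * (v k \<bullet> x)^2 \<le> v k \<bullet> step k s x"
  unfolding ip_step using src_bounds[OF s x, of k] defect_bounds[OF x, of k] by linarith

lemma step_vn: "vn k (step k s x - M k *v x) \<le> v k \<bullet> (1 - s) + C2 * (v k \<bullet> x)^2"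
proof -
  have eq: "step k s x - M k *v x = (1 - s) * (1 - G k x) - (M k *v x - G k x)" by (simp add: step_split)
  show ?thesis unfolding eq
    using vn_diff[of k "(1 - s) * (1 - G k x)" "M k *v x - G k x"] src_bounds(2)[OF s x, of k] defect_bounds(3)[OF x, of k]
      vn_eq[OF src_bounds(1)[OF s x], of k k] vn_eq[OF defect_bounds(1)[OF x], of k k] by linarith
qed

lemma step_order2: "\<bar>v k \<bullet> step k s x - (v k \<bullet> (1 - s) + \<rho> k * (v k \<bullet> x) - bb k x x / 2)\<bar>
    \<le> 2 / c0 * (v k \<bullet> (1 - s)) * (v k \<bullet> x) + C * (v k \<bullet> x)^3"
proof -
  have "b * (1 - 2 * c / c0) = b - 2 / c0 * b * c" for b c by (simp add: right_diff_distrib mult_ac)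
  from this[of "v k \<bullet> (1 - s)" "v k \<bullet> x"]
  have "v k \<bullet> (1 - s) * (1 - 2 * (v k \<bullet> x) / c0) = v k \<bullet> (1 - s) - 2 / c0 * (v k \<bullet> (1 - s)) * (v k \<bullet> x)" .
  then show ?thesis
    unfolding ip_step using src_bounds[OF s x, of k] G_order2[OF x, of k] unfolding abs_le_iff by linarith
qed

end

text \<open>One argument at a time is replaced by its multiple of u, where the form equals 2 Q; each
  replacement costs one deviation.\<close>

lemma bb_align:
  assumes x: "0 \<le> x" and y: "0 \<le> y"
  shows "\<bar>bb k x y - 2 * Q k * (v k \<bullet> x) * (v k \<bullet> y)\<bar> \<le> C * (dev k x * (v k \<bullet> y) + (v k \<bullet> x) * dev k y)"
proof -
  let ?X = "v k \<bullet> x" and ?Y = "v k \<bullet> y"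
  have b: "bilinear (bb k)" by (rule bb_bilinear)
  have eq: "bb k x y - 2 * Q k * ?X * ?Y = bb k (x - ?X *\<^sub>R u k) y + bb k (?X *\<^sub>R u k) (y - ?Y *\<^sub>R u k)"
    by (simp add: bilinear_lsub[OF b] bilinear_rsub[OF b] bilinear_lmul[OF b] bilinear_rmul[OF b] bb_u)
  have B: "\<bar>bb k z w\<bar> \<le> C * (vn k z * vn k w)" for z w using bb_bound[of k z w] by (simp add: vn_def)
  show ?thesis unfolding eq
    using B[of "x - ?X *\<^sub>R u k" y] B[of "?X *\<^sub>R u k" "y - ?Y *\<^sub>R u k"] ip_nonneg[OF x, of k]
    by (simp add: dev_def vn_eq[OF y] vn_scale vn_u distrib_left)
qed

text \<open>The quadratic remainder accumulated over i steps. \<open>K\<close> depends on i but not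
  on k, and the powers of 4 are squares of the crude growth bound \<open>2^i\<close> for the
  projection.\<close>

lemma Gpow_lower_aux: "\<exists>K\<ge>0. \<forall>k. \<forall>x\<in>cube. \<forall>j. (mpow (M k) i *v x) $ j - K * (v k \<bullet> x)^2 \<le> (traj k 1 x i) $ j"
proof (induction i)
  case 0
  show ?case by (intro exI[of _ 0]) simp
next
  case (Suc i)
  then obtain K where K: "0 \<le> K" "\<And>k x j. x \<in> cube \<Longrightarrow> (mpow (M k) i *v x) $ j - K * (v k \<bullet> x)^2 \<le> (traj k 1 x i) $ j"
    by blast
  show ?case
  proof (intro exI conjI allI ballI)
    show "0 \<le> C * 4 ^ i + Cd * K" using K(1) C_ge1 Cd_pos by simp
    fix k x j assume x: "x \<in> (cube :: (real^'d) set)"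
    define z where "z = traj k 1 x i"
    have z: "z \<in> cube" unfolding z_def by (intro traj_cube one_cube x)
    have X: "0 \<le> v k \<bullet> x" using x by (intro ip_nonneg cubeD)
    have zb: "v k \<bullet> traj k 1 x n \<le> 2 ^ n * (v k \<bullet> x)" for n
    proof (induction n)
      case (Suc n)
      have t: "traj k 1 x n \<in> cube" by (intro traj_cube one_cube x)
      have "v k \<bullet> traj k 1 x (Suc n) \<le> \<rho> k * (v k \<bullet> traj k 1 x n)"
        using ip_mono[OF G_lin[OF t, of k], of k] by (simp add: traj_Suc v_M)
      also have "\<dots> \<le> 2 * (2 ^ n * (v k \<bullet> x))"
        using rho_hi[of k] rho_pos[of k] Suc ip_nonneg[OF cubeD(1)[OF t], of k] by (intro mult_mono) auto
      finally show ?case by simp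
    qed simp
    have "(mpow (M k) (Suc i) *v x) $ j = (M k *v (mpow (M k) i *v x)) $ j" by (simp add: matrix_vector_mul_assoc)
    also have "\<dots> \<le> (M k *v z) $ j + Cd * (K * (v k \<bullet> x)^2)"
    proof -
      have "(\<Sum>l\<in>UNIV. M k $ j $ l * (mpow (M k) i *v x) $ l) \<le> (\<Sum>l\<in>UNIV. M k $ j $ l * z $ l + C * (K * (v k \<bullet> x)^2))"
      proof (rule sum_mono)
        fix l
        have "M k $ j $ l * (mpow (M k) i *v x) $ l \<le> M k $ j $ l * (z $ l + K * (v k \<bullet> x)^2)"
          using K(2)[OF x, of k l] M_nonneg by (intro mult_left_mono) (auto simp: z_def)
        also have "\<dots> \<le> M k $ j $ l * z $ l + C * (K * (v k \<bullet> x)^2)"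
          using M_hi K(1) by (simp add: distrib_left mult_right_mono)
        finally show "M k $ j $ l * (mpow (M k) i *v x) $ l \<le> M k $ j $ l * z $ l + C * (K * (v k \<bullet> x)^2)" .
      qed
      then show ?thesis by (simp add: matrix_vec_nth sum.distrib Cd_def mult_ac)
    qed
    also have "(M k *v z) $ j \<le> G k z $ j + C * (v k \<bullet> z)^2" using G_order1[OF z, of k j] by simp
    also have "C * (v k \<bullet> z)^2 \<le> C * (2 ^ i * (v k \<bullet> x))^2"
      using zb[of i] ip_nonneg[OF cubeD(1)[OF z], of k] C_ge1 by (intro mult_left_mono power_mono) (auto simp: z_def)
    also have "(2 ^ i * (v k \<bullet> x))^2 = 4 ^ i * (v k \<bullet> x)^2"
      by (simp add: power_mult_distrib flip: power_mult) (simp add: mult.commute[of i] power_mult)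
    finally show "(mpow (M k) (Suc i) *v x) $ j - (C * 4 ^ i + Cd * K) * (v k \<bullet> x)^2 \<le> traj k 1 x (Suc i) $ j"
      by (simp add: traj_Suc z_def algebra_simps)
  qed
qed

text \<open>Monotonicity reduces the bound to a small multiple of \<open>x\<close>, where \<open>G\<close> is nearly linear.\<close>

lemma Gpow_lower:
  obtains c where "c > 0" "\<And>k x j. x \<in> cube \<Longrightarrow> c * (v k \<bullet> x) \<le> (traj k 1 x U) $ j"
proof -
  obtain K where K: "0 \<le> K" "\<And>k x j. x \<in> cube \<Longrightarrow> (mpow (M k) U *v x) $ j - K * (v k \<bullet> x)^2 \<le> (traj k 1 x U) $ j"
    using Gpow_lower_aux[of U] by blast
  \<comment> \<open>The gain from \<open>M^U\<close> is at least \<open>a X / C\<close>; at scale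
    \<open>h\<close> the quadratic loss is at most half of it.\<close>
  define h where "h = min 1 (a / (2 * C * (K * Cd + 1)))"
  have KC: "0 < K * Cd + 1" using K(1) Cd_pos by (simp add: add_nonneg_pos)
  have h: "0 < h" "h \<le> 1" using a_pos C_ge1 KC by (auto simp: h_def)
  have hK: "K * h * Cd \<le> a / (2 * C)"
  proof -
    have "K * h * Cd \<le> (K * Cd + 1) * h" using h by (simp add: algebra_simps)
    also have "\<dots> \<le> (K * Cd + 1) * (a / (2 * C * (K * Cd + 1)))" using KC by (intro mult_left_mono) (auto simp: h_def)
    also have "\<dots> = a / (2 * C)" using KC by simp
    finally show ?thesis .
  qed
  show thesis
  proof (rule that[of "h * (a / (2 * C))"])
    show "0 < h * (a / (2 * C))" using h a_pos C_ge1 by simp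
    fix k x j assume x: "x \<in> (cube :: (real^'d) set)"
    define X where "X = v k \<bullet> x"
    have X: "0 \<le> X" "X \<le> Cd" using x by (auto simp: X_def intro: ip_nonneg cubeD ip_cube_le)
    have hx: "h *\<^sub>R x \<in> cube" using x h by (auto simp: cube_def intro: mult_le_one)
    have le: "h *\<^sub>R x \<le> x" using x h by (auto simp: cube_def less_eq_vec_def mult_left_le_one_le)
    have "X / C \<le> (\<Sum>i\<in>UNIV. x$i)" using ip_le_sum[OF cubeD(1)[OF x], of k] C_ge1
      by (simp add: X_def pos_divide_le_eq mult.commute)
    then have "a * (X / C) \<le> a * (\<Sum>i\<in>UNIV. x$i)" using a_pos by (intro mult_left_mono) auto
    also have "\<dots> \<le> (mpow (M k) U *v x) $ j"
      unfolding matrix_vec_nth sum_distrib_left using x by (intro sum_mono mult_right_mono M_pow) (auto simp: cube_def)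
    finally have A: "a * (X / C) \<le> (mpow (M k) U *v x) $ j" .
    have "h * (a / (2 * C)) * X \<le> h * X * (a / C - K * h * X)"
    proof -
      have "K * h * X \<le> K * h * Cd" using K h X by (intro mult_left_mono) auto
      then have "a / (2 * C) \<le> a / C - K * h * X" using hK by (simp add: field_simps)
      then have "h * X * (a / (2 * C)) \<le> h * X * (a / C - K * h * X)" using h X by (intro mult_left_mono) auto
      then show ?thesis by (simp add: mult_ac)
    qed
    also have "\<dots> = h * (a * (X / C)) - K * (h * X)^2" by (simp add: power2_eq_square algebra_simps)
    also have "\<dots> \<le> h * (mpow (M k) U *v x) $ j - K * (h * X)^2" using mult_left_mono[OF A, of h] h by linarith
    also have "\<dots> \<le> traj k 1 (h *\<^sub>R x) U $ j"
      using K(2)[OF hx, of k j] by (simp add: matrix_vector_mult_scaleR X_def)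
    also have "\<dots> \<le> traj k 1 x U $ j"
      using traj_mono[OF one_cube hx x le, of k U] by (simp add: less_eq_vec_def)
    finally show "h * (a / (2 * C)) * (v k \<bullet> x) \<le> traj k 1 x U $ j" by (simp add: X_def)
  qed
qed

text \<open>One step cannot destroy the projection, even for large \<open>x\<close>: shrink to scale
  \<open>h\<close>, where the quadratic defect costs at most 1/4 of the factor
  \<open>\<rho> \<ge> 1/2\<close>, and return by monotonicity.\<close>

lemma G_ip_lower:
  obtains c where "c > 0" "\<And>k x. x \<in> cube \<Longrightarrow> c * (v k \<bullet> x) \<le> v k \<bullet> G k x"
proof -
  define h where "h = 1 / (4 * C2 * Cd)"
  have CC: "1 \<le> C2 * Cd" using C2_ge1 Cd_pos mult_mono[of 1 C2 1 Cd] by simp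
  have h: "0 < h" "h \<le> 1" using CC by (auto simp: h_def mult.assoc)
  show thesis
  proof (rule that[of "h / 4"])
    show "0 < h / 4" using h by simp
    fix k x assume x: "x \<in> (cube :: (real^'d) set)"
    define X where "X = v k \<bullet> x"
    have X: "0 \<le> X" "X \<le> Cd" using x by (auto simp: X_def intro: ip_nonneg cubeD ip_cube_le)
    have hx: "h *\<^sub>R x \<in> cube" using x h by (auto simp: cube_def intro: mult_le_one)
    have le: "h *\<^sub>R x \<le> x" using x h by (auto simp: cube_def less_eq_vec_def mult_left_le_one_le)
    have "C2 * h * X \<le> C2 * h * Cd" using C2_ge1 h X by (intro mult_left_mono) auto
    also have "\<dots> = 1/4" using C2_ge1 Cd_pos by (simp add: h_def)
    finally have "h * X * (1/4) \<le> h * X * (\<rho> k - C2 * h * X)" using rho_lo[of k] h X by (intro mult_left_mono) auto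
    also have "\<dots> = \<rho> k * (h * X) - C2 * (h * X)^2" by (simp add: power2_eq_square algebra_simps)
    also have "\<dots> \<le> v k \<bullet> G k (h *\<^sub>R x)"
      using defect_bounds(3)[OF hx, of k] by (simp add: inner_diff_right v_M X_def)
    also have "\<dots> \<le> v k \<bullet> G k x" by (intro ip_mono G_mono le cubeD hx x)
    finally show "h / 4 * (v k \<bullet> x) \<le> v k \<bullet> G k x" by (simp add: X_def)
  qed
qed

text \<open>Subadditivity bounds the increment of G by G of the increment, and this is at most its
  linearisation.\<close>

lemma defect_mono:
  assumes "0 \<le> z" "z \<le> x" "x \<le> 1"
  shows "v k \<bullet> (M k *v z - G k z) \<le> v k \<bullet> (M k *v x - G k x)"
proof -
  have h: "0 \<le> x - z" "x - z \<in> cube" using assms by (auto simp: less_eq_vec_def cube_def) (smt (verit))+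
  have "G k x \<le> G k z + G k (x - z)" using G_sub[of z "x - z" k] assms h by simp
  then have "v k \<bullet> G k x \<le> v k \<bullet> G k z + v k \<bullet> G k (x - z)"
    using ip_mono[of "G k x" "G k z + G k (x - z)" k] by (simp add: inner_add_right)
  also have "v k \<bullet> G k (x - z) \<le> v k \<bullet> (M k *v (x - z))" by (intro ip_mono G_lin h)
  finally show ?thesis by (simp add: inner_diff_right v_M algebra_simps)
qed

text \<open>Uniform strict concavity. Monotonicity of the defect reduces it to the vector
  \<open>h * e\<close> times 1, where the second derivative is at least \<open>c0\<close>;
  \<open>h\<close> makes the cubic remainder at most half of the quadratic term.\<close>

lemma defect_lower:
  obtains c where "c > 0" "\<And>k x e. x \<in> cube \<Longrightarrow> 0 \<le> e \<Longrightarrow> \<forall>j. e \<le> x$j \<Longrightarrow> c * e^2 \<le> v k \<bullet> (M k *v x - G k x)"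
proof -
  define h where "h = min 1 (c0 / (4 * C * Cd^3))"
  have h: "0 < h" "h \<le> 1" using c0_pos C_ge1 Cd_pos by (auto simp: h_def)
  have hC: "C * h * Cd^3 \<le> c0 / 4"
  proof -
    have "C * h * Cd^3 \<le> C * (c0 / (4 * C * Cd^3)) * Cd^3"
      using C_ge1 Cd_pos by (intro mult_right_mono mult_left_mono) (auto simp: h_def)
    also have "\<dots> = c0 / 4" using C_ge1 Cd_pos by simp
    finally show ?thesis .
  qed
  show thesis
  proof (rule that[of "h^2 * (c0 / 4)"])
    show "0 < h^2 * (c0 / 4)" using h c0_pos by simp
    fix k x e assume x: "x \<in> (cube :: (real^'d) set)" and e: "0 \<le> e" "\<forall>j. e \<le> x$j"
    have e1: "e \<le> 1" using spec[OF e(2), of undefined] x by (auto simp: cube_def intro: order_trans)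
    define w where "w = v k \<bullet> (1::real^'d)"
    have w: "0 \<le> w" "w \<le> Cd" unfolding w_def by (auto intro: ip_nonneg ip_cube_le one_cube cubeD)
    define z where "z = (h * e) *\<^sub>R (1::real^'d)"
    have z: "z \<in> cube" using h e e1 by (auto simp: z_def cube_def intro: mult_le_one)
    have zx: "z \<le> x" unfolding z_def less_eq_vec_def
    proof
      fix i show "((h * e) *\<^sub>R 1) $ i \<le> x $ i" using mult_left_le_one_le[of e h] h e by (simp add: order_trans[OF _ spec[OF e(2), of i]])
    qed
    have b: "bb k z z = (h * e)^2 * bb k 1 1"
      by (simp add: z_def bilinear_lmul[OF bb_bilinear] bilinear_rmul[OF bb_bilinear] power2_eq_square)
    have vz: "v k \<bullet> z = h * e * w" by (simp add: z_def w_def)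
    have "C * (h * e * w)^3 \<le> C * ((h * e)^2 * (h * 1) * Cd^3)"
    proof -
      have "(h * e * w)^3 = (h * e)^2 * (h * e) * w^3" by (simp add: power3_eq_cube power2_eq_square mult_ac)
      also have "\<dots> \<le> (h * e)^2 * (h * 1) * Cd^3"
        using h e e1 w by (intro mult_mono power_mono) auto
      finally show ?thesis using C_ge1 by simp
    qed
    also have "\<dots> = (h * e)^2 * (C * h * Cd^3)" by (simp add: mult_ac)
    also have "\<dots> \<le> (h * e)^2 * (c0 / 4)" using hC by (intro mult_left_mono) auto
    finally have 1: "C * (h * e * w)^3 \<le> (h * e)^2 * (c0 / 4)" .
    have 2: "(h * e)^2 * (c0 / 2) \<le> bb k z z / 2" unfolding b
      using mult_left_mono[OF bb_1[of k], of "(h * e)^2"] by simp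
    have "h^2 * (c0 / 4) * e^2 = (h * e)^2 * (c0 / 2) - (h * e)^2 * (c0 / 4)" by (simp add: power_mult_distrib)
    also have "\<dots> \<le> v k \<bullet> (M k *v z - G k z)" using 1 2 G_order2[OF z, of k] unfolding vz abs_le_iff by linarith
    also have "\<dots> \<le> v k \<bullet> (M k *v x - G k x)" by (rule defect_mono) (use z zx x in \<open>auto intro: cubeD\<close>)
    finally show "h^2 * (c0 / 4) * e^2 \<le> v k \<bullet> (M k *v x - G k x)" .
  qed
qed

end

section \<open>Descent to the small regime, alignment and the scalar expansion\<close>

context near_critical
begin

text \<open>Apply the componentwise lower bound for U source-free steps to the iterate U steps
  earlier: \<open>y\<close> was larger then, and a source only increases the result.\<close>

lemma y_comparable:
  obtains c where "c > 0" "\<And>k s m j. s \<in> cube \<Longrightarrow> U \<le> m \<Longrightarrow> c * (v k \<bullet> traj k s 1 m) \<le> traj k s 1 m $ j"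
proof -
  obtain c where c: "c > 0" "\<And>k x j. x \<in> cube \<Longrightarrow> c * (v k \<bullet> x) \<le> (traj k 1 x U) $ j"
    by (rule Gpow_lower) (rule that; assumption)
  show thesis
  proof (rule that[OF c(1)])
    fix k s m j assume s: "s \<in> (cube :: (real^'d) set)" and m: "U \<le> m"
    have t: "traj k s 1 (m - U) \<in> cube" by (intro traj_cube s one_cube)
    have "c * (v k \<bullet> traj k s 1 m) \<le> c * (v k \<bullet> traj k s 1 (m - U))"
      using c(1) ip_mono[OF y_antimono[OF s, of "m - U" m k], of k] by simp
    also have "\<dots> \<le> traj k 1 (traj k s 1 (m - U)) U $ j" by (rule c(2)[OF t])
    also have "\<dots> \<le> traj k s (traj k s 1 (m - U)) U $ j"
      using traj_one_le[OF s t, of k U] by (simp add: less_eq_vec_def)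
    also have "\<dots> = traj k s 1 m $ j" using traj_add[of k s 1 U "m - U"] m by simp
    finally show "c * (v k \<bullet> traj k s 1 m) \<le> traj k s 1 m $ j" .
  qed
qed

text \<open>Holds for \<open>y\<close> of any size, before alignment or expansion are available; it
  is what brings \<open>y\<close> down to where they apply.\<close>

lemma y_drop:
  obtains c where "c > 0" "\<And>k s m. s \<in> cube \<Longrightarrow> U \<le> m \<Longrightarrow>
    v k \<bullet> traj k s 1 (Suc m) \<le> v k \<bullet> (1 - s) + \<rho> k * (v k \<bullet> traj k s 1 m) - c * (v k \<bullet> traj k s 1 m)^2"
proof -
  obtain c where c: "c > 0" "\<And>k s m j. s \<in> cube \<Longrightarrow> U \<le> m \<Longrightarrow> c * (v k \<bullet> traj k s 1 m) \<le> traj k s 1 m $ j"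
    by (rule y_comparable) (rule that; assumption)
  obtain c1 where c1: "c1 > 0" "\<And>k x e. x \<in> cube \<Longrightarrow> 0 \<le> e \<Longrightarrow> \<forall>j. e \<le> x$j \<Longrightarrow> c1 * e^2 \<le> v k \<bullet> (M k *v x - G k x)"
    by (rule defect_lower) (rule that; assumption)
  show thesis
  proof (rule that[of "c1 * c^2"])
    show "0 < c1 * c^2" using c c1 by simp
    fix k s m assume s: "s \<in> (cube :: (real^'d) set)" and m: "U \<le> m"
    define y where "y = traj k s 1 m"
    have y: "y \<in> cube" unfolding y_def by (intro traj_cube s one_cube)
    have "c1 * (c * (v k \<bullet> y))^2 \<le> v k \<bullet> (M k *v y - G k y)"
      by (rule c1(2)[OF y]) (use c ip_nonneg[OF cubeD(1)[OF y], of k] c(2)[OF s m, of k] in \<open>auto simp: y_def\<close>)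
    then show "v k \<bullet> traj k s 1 (Suc m) \<le> v k \<bullet> (1 - s) + \<rho> k * (v k \<bullet> traj k s 1 m) - c1 * c^2 * (v k \<bullet> traj k s 1 m)^2"
      using ip_step[OF s y, of k] src_bounds(2)[OF s y, of k]
      by (simp add: traj_Suc y_def[symmetric] power_mult_distrib mult_ac)
  qed
qed

text \<open>While the projection exceeds \<open>e\<close> it eventually loses at least
  \<open>h\<close> per step, and it starts below \<open>Cd\<close>; so the number of steps needed
  does not depend on k.\<close>

lemma y_small:
  assumes s: "\<And>k. s k \<in> cube" and sig: "(\<lambda>k. v k \<bullet> (1 - s k)) \<longlonglongrightarrow> 0" and e: "e > 0"
  shows "\<exists>N. \<forall>\<^sub>F k in sequentially. \<forall>m\<ge>N. v k \<bullet> traj k (s k) 1 m \<le> e"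
proof -
  obtain c where c: "c > 0" "\<And>k s m. s \<in> cube \<Longrightarrow> U \<le> m \<Longrightarrow>
    v k \<bullet> traj k s 1 (Suc m) \<le> v k \<bullet> (1 - s) + \<rho> k * (v k \<bullet> traj k s 1 m) - c * (v k \<bullet> traj k s 1 m)^2"
    by (rule y_drop) (rule that; assumption)
  \<comment> \<open>Half of the guaranteed quadratic drop; the other half pays for the source and
    for \<open>\<rho> - 1\<close>.\<close>
  define h where "h = c * e^2 / 2"
  have h: "0 < h" using c e by (simp add: h_def)
  obtain n :: nat where n: "Cd / h < real n" using reals_Archimedean2 by blast
  have "(\<lambda>k. v k \<bullet> (1 - s k) + \<bar>\<rho> k - 1\<bar> * Cd) \<longlonglongrightarrow> 0 + \<bar>1 - 1\<bar> * Cd"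
    by (intro tendsto_intros sig rho_lim)
  then have "\<forall>\<^sub>F k in sequentially. v k \<bullet> (1 - s k) + \<bar>\<rho> k - 1\<bar> * Cd < h"
    using h by (intro order_tendstoD(2)) auto
  then show ?thesis
  proof (intro exI[of _ "U + n"], eventually_elim)
    case (elim k)
    define Y where "Y m = v k \<bullet> traj k (s k) 1 m" for m
    have dec: "Y m \<le> Y i" if "i \<le> m" for i m unfolding Y_def using s that by (intro ip_mono y_antimono)
    have Yb: "0 \<le> Y m" "Y m \<le> Cd" for m
      unfolding Y_def using traj_cube[OF s one_cube, of k k m] by (auto intro: ip_nonneg cubeD ip_cube_le)
    have "Y (U + n) \<le> e"
    proof (rule ccontr)
      assume "\<not> ?thesis"
      then have big: "e < Y i" if "i \<le> U + n" for i using dec[OF that] by simp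
      have "i \<le> n \<Longrightarrow> Y (U + i) \<le> Cd - real i * h" for i
      proof (induction i)
        case (Suc i)
        have "c * e^2 \<le> c * (Y (U + i))^2" using c e big[of "U + i"] Suc by (intro mult_left_mono power_mono) auto
        then have "Y (Suc (U + i)) \<le> v k \<bullet> (1 - s k) + \<rho> k * Y (U + i) - 2 * h"
          using c(2)[OF s, of "U + i" k k] unfolding Y_def h_def by simp
        also have "\<rho> k * Y (U + i) \<le> Y (U + i) + \<bar>\<rho> k - 1\<bar> * Cd"
        proof -
          have "(\<rho> k - 1) * Y (U + i) \<le> \<bar>\<rho> k - 1\<bar> * Cd" using Yb by (intro mult_mono) auto
          then show ?thesis by (simp add: algebra_simps)
        qed
        finally have "Y (Suc (U + i)) \<le> Y (U + i) - h" using elim by linarith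
        then show ?case using Suc by (simp add: algebra_simps)
      qed (use Yb in simp)
      from this[of n] have "Y (U + n) \<le> Cd - real n * h" by simp
      moreover have "Cd < real n * h" using n h by (simp add: pos_divide_less_eq)
      ultimately show False using Yb(1)[of "U + n"] by linarith
    qed
    then show ?case using dec order_trans unfolding Y_def by blast
  qed
qed

text \<open>The two conditions make a step nearly linear relative to the current size: a small
  projection controls the quadratic defect, and the second condition makes the source negligible.
  The burn-in \<open>N\<close> may depend on \<open>e\<close> but not on \<open>k\<close>.\<close>

definition regular :: "(nat \<Rightarrow> real^'d) \<Rightarrow> (nat \<Rightarrow> nat \<Rightarrow> real^'d) \<Rightarrow> bool" where
  "regular s z \<longleftrightarrow> (\<forall>k. s k \<in> cube) \<and> (\<forall>k m. z k m \<in> cube \<and> z k (Suc m) = step k (s k) (z k m)) \<and>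
    (\<forall>e>0. \<exists>N. \<forall>\<^sub>F k in sequentially. \<forall>m\<ge>N.
       v k \<bullet> z k m \<le> e \<and> v k \<bullet> (1 - s k) \<le> e * (v k \<bullet> z k m))"

text \<open>Alignment is applied to the window of the last L steps before \<open>m\<close>.\<close>

lemma regular_alignment:
  assumes r: "regular s z" and e: "e > 0"
  shows "\<exists>N. \<forall>\<^sub>F k in sequentially. \<forall>m\<ge>N. dev k (z k m) \<le> e * (v k \<bullet> z k m)"
proof -
  have s: "\<And>k. s k \<in> cube" and z: "\<And>k m. z k m \<in> cube" "\<And>k m. z k (Suc m) = step k (s k) (z k m)"
    using r by (auto simp: regular_def)
  obtain L e' where e': "e' > 0" and L: "\<And>k z. \<forall>i\<le>L. 0 \<le> z i \<Longrightarrow>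
     \<forall>i<L. vn k (z (Suc i) - M k *v z i) \<le> e' * (v k \<bullet> z i) \<Longrightarrow> dev k (z L) \<le> e * (v k \<bullet> z L)"
    by (rule alignment[OF e]) (rule that; assumption)
  \<comment> \<open>One half of \<open>e'\<close> covers the source, the other half the quadratic
    defect.\<close>
  define e2 where "e2 = min (e'/2) (e'/(2*C2))"
  have "e2 > 0" using e' C2_ge1 by (simp add: e2_def)
  then obtain N where N: "\<forall>\<^sub>F k in sequentially. \<forall>m\<ge>N. v k \<bullet> z k m \<le> e2 \<and> v k \<bullet> (1 - s k) \<le> e2 * (v k \<bullet> z k m)"
    using r unfolding regular_def by blast
  show ?thesis
  proof (rule exI[of _ "N + L"], rule eventually_mono[OF N], intro allI impI)
    fix k m assume *: "\<forall>m\<ge>N. v k \<bullet> z k m \<le> e2 \<and> v k \<bullet> (1 - s k) \<le> e2 * (v k \<bullet> z k m)" and m: "N + L \<le> m"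
    have "dev k ((\<lambda>i. z k (m - L + i)) L) \<le> e * (v k \<bullet> (\<lambda>i. z k (m - L + i)) L)"
    proof (rule L[where z = "\<lambda>i. z k (m - L + i)" and k = k]; intro allI impI)
      fix i
      show "0 \<le> z k (m - L + i)" using z(1) by (rule cubeD)
    next
      fix i
      define Z where "Z = v k \<bullet> z k (m - L + i)"
      have Z: "0 \<le> Z" "Z \<le> e2" "v k \<bullet> (1 - s k) \<le> e2 * Z" using * m ip_nonneg[OF cubeD(1)[OF z(1)]] by (auto simp: Z_def)
      have "vn k (z k (m - L + Suc i) - M k *v z k (m - L + i)) \<le> v k \<bullet> (1 - s k) + C2 * Z^2"
        using step_vn[OF s z(1)] by (simp add: z(2) Z_def)
      also have "\<dots> \<le> e'/2 * Z + e'/2 * Z"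
      proof (rule add_mono)
        have "e2 * Z \<le> e'/2 * Z" using Z by (intro mult_right_mono) (auto simp: e2_def)
        then show "v k \<bullet> (1 - s k) \<le> e'/2 * Z" using Z by linarith
        have "C2 * Z \<le> C2 * (e'/(2*C2))" using Z C2_ge1 by (intro mult_left_mono) (auto simp: e2_def)
        also have "\<dots> = e'/2" using C2_ge1 by simp
        finally have "C2 * Z * Z \<le> e'/2 * Z" using Z by (intro mult_right_mono) auto
        then show "C2 * Z^2 \<le> e'/2 * Z" by (simp add: power2_eq_square)
      qed
      finally show "vn k (z k (m - L + Suc i) - M k *v z k (m - L + i)) \<le> e' * (v k \<bullet> z k (m - L + i))"
        by (simp add: Z_def)
    qed
    then show "dev k (z k m) \<le> e * (v k \<bullet> z k m)" using m by simp
  qed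
qed

text \<open>The error is relative to the two small terms and not to \<open>\<rho> z\<close>, which
  nearly cancels against z. It therefore amounts to multiplying Q and the source by factors close to
  1.\<close>

lemma regular_expansion:
  assumes r: "regular s z" and e: "e > 0"
  shows "\<exists>N. \<forall>\<^sub>F k in sequentially. \<forall>m\<ge>N. \<bar>v k \<bullet> z k (Suc m) - (\<rho> k * (v k \<bullet> z k m) - Q k * (v k \<bullet> z k m)^2 + v k \<bullet> (1 - s k))\<bar>
      \<le> e * (Q k * (v k \<bullet> z k m)^2 + v k \<bullet> (1 - s k))"
proof -
  have s: "\<And>k. s k \<in> cube" and z: "\<And>k m. z k m \<in> cube" "\<And>k m. z k (Suc m) = step k (s k) (z k m)"
    using r by (auto simp: regular_def)
  define e1 where "e1 = e * c0 / (2 * C)"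
  define e2 where "e2 = min (e * c0 / 2) e1"
  have e1: "0 < e1" and e2: "0 < e2" using e c0_pos C_ge1 by (auto simp: e1_def e2_def)
  obtain N1 where N1: "\<forall>\<^sub>F k in sequentially. \<forall>m\<ge>N1. dev k (z k m) \<le> e1 * (v k \<bullet> z k m)"
    using regular_alignment[OF r e1] by blast
  obtain N2 where N2: "\<forall>\<^sub>F k in sequentially. \<forall>m\<ge>N2. v k \<bullet> z k m \<le> e2 \<and> v k \<bullet> (1 - s k) \<le> e2 * (v k \<bullet> z k m)"
    using r e2 unfolding regular_def by blast
  show ?thesis
  proof (rule exI[of _ "max N1 N2"], use N1 N2 in eventually_elim, intro allI impI)
    fix k m
    assume *: "\<forall>m\<ge>N1. dev k (z k m) \<le> e1 * (v k \<bullet> z k m)"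
      "\<forall>m\<ge>N2. v k \<bullet> z k m \<le> e2 \<and> v k \<bullet> (1 - s k) \<le> e2 * (v k \<bullet> z k m)" and m: "max N1 N2 \<le> m"
    define Z where "Z = v k \<bullet> z k m"
    define \<sigma> where "\<sigma> = v k \<bullet> (1 - s k)"
    have Z: "0 \<le> Z" "Z \<le> e2" "dev k (z k m) \<le> e1 * Z" using * m ip_nonneg[OF cubeD(1)[OF z(1)]] by (auto simp: Z_def)
    have \<sigma>: "0 \<le> \<sigma>" unfolding \<sigma>_def using s by (intro ip_nonneg cubeD one_minus_cube)
    have "\<bar>bb k (z k m) (z k m) - 2 * Q k * Z * Z\<bar> \<le> C * (dev k (z k m) * Z + Z * dev k (z k m))"
      unfolding Z_def using z(1) by (intro bb_align cubeD)
    also have "\<dots> \<le> C * (e1 * Z * Z + Z * (e1 * Z))"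
      using Z C_ge1 by (intro mult_left_mono add_mono mult_right_mono) auto
    also have "\<dots> = e * c0 * Z^2" using C_ge1 by (simp add: e1_def power2_eq_square field_simps)
    finally have 1: "\<bar>bb k (z k m) (z k m) - 2 * Q k * Z * Z\<bar> \<le> e * c0 * Z^2" .
    have "2 / c0 * \<sigma> * Z \<le> 2 / c0 * \<sigma> * (e * c0 / 2)"
      using Z \<sigma> c0_pos by (intro mult_left_mono) (auto simp: e2_def)
    also have "\<dots> = e * \<sigma>" using c0_pos by simp
    finally have 2: "2 / c0 * \<sigma> * Z \<le> e * \<sigma>" .
    have "C * Z \<le> C * e1" using Z C_ge1 by (intro mult_left_mono) (auto simp: e2_def)
    also have "\<dots> = e * c0 / 2" using C_ge1 by (simp add: e1_def)
    finally have "C * Z * Z^2 \<le> e * c0 / 2 * Z^2" by (intro mult_right_mono) auto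
    then have 3: "C * Z^3 \<le> e * c0 / 2 * Z^2" by (simp add: power3_eq_cube power2_eq_square mult.assoc)
    have 4: "e * c0 * Z^2 \<le> e * (Q k * Z^2)" using Q_lo[of k] e by (simp add: mult.assoc mult_left_mono mult_right_mono)
    define q where "q = Q k * Z^2"
    have 5: "\<bar>v k \<bullet> z k (Suc m) - (\<sigma> + \<rho> k * Z - bb k (z k m) (z k m) / 2)\<bar> \<le> 2 / c0 * \<sigma> * Z + C * Z^3"
      unfolding z(2) Z_def \<sigma>_def by (rule step_order2[OF s z(1)])
    have eq: "2 * Q k * Z * Z = 2 * q" by (simp add: power2_eq_square q_def)
    have "e * c0 * Z^2 \<le> e * q" "e * c0 / 2 * Z^2 = (e * c0 * Z^2) / 2" using 4 by (simp_all add: q_def)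
    then have "\<bar>v k \<bullet> z k (Suc m) - (\<rho> k * Z - q + \<sigma>)\<bar> \<le> e * q + e * \<sigma>"
      using 1[unfolded eq] 2 3 5 unfolding abs_le_iff by linarith
    then have "\<bar>v k \<bullet> z k (Suc m) - (\<rho> k * Z - Q k * Z^2 + \<sigma>)\<bar> \<le> e * (Q k * Z^2 + \<sigma>)"
      by (simp add: q_def distrib_left)
    then show "\<bar>v k \<bullet> z k (Suc m) - (\<rho> k * (v k \<bullet> z k m) - Q k * (v k \<bullet> z k m)^2 + v k \<bullet> (1 - s k))\<bar>
      \<le> e * (Q k * (v k \<bullet> z k m)^2 + v k \<bullet> (1 - s k))" by (simp add: Z_def \<sigma>_def)
  qed
qed

lemma regular_survival: "regular (\<lambda>_. 1) (\<lambda>k. traj k 1 1)"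
proof -
  have "\<exists>N. \<forall>\<^sub>F k in sequentially. \<forall>m\<ge>N. v k \<bullet> traj k 1 1 m \<le> e \<and> v k \<bullet> (1 - 1) \<le> e * (v k \<bullet> traj k 1 1 m)" if "e > 0" for e
  proof -
    have "0 \<le> e * (v k \<bullet> traj k 1 1 m)" for k m
      using that traj_cube[OF one_cube one_cube, of k m] by (simp add: ip_nonneg cubeD)
    then show ?thesis using y_small[of "\<lambda>_. 1", OF one_cube _ that] by simp
  qed
  then show ?thesis by (simp add: regular_def one_cube traj_cube traj_Suc)
qed

context
  fixes s :: "nat \<Rightarrow> real^'d"
  assumes s: "\<And>k. s k \<in> cube" and sig: "(\<lambda>k. v k \<bullet> (1 - s k)) \<longlonglongrightarrow> 0" 
begin

lemma ip_src_nonneg: "0 \<le> v k \<bullet> (1 - s k)"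
  using s by (intro ip_nonneg cubeD one_minus_cube)

lemma x_crude_upper: "v k \<bullet> traj k (s k) (1 - s k) m \<le> (2 ^ (m + 1) - 1) * (v k \<bullet> (1 - s k))"
proof (induction m)
  case (Suc m)
  have t: "traj k (s k) (1 - s k) m \<in> cube" by (intro traj_cube one_minus_cube s)
  have "v k \<bullet> traj k (s k) (1 - s k) (Suc m) \<le> v k \<bullet> (1 - s k) + \<rho> k * (v k \<bullet> traj k (s k) (1 - s k) m)"
    unfolding traj_Suc by (rule step_upper[OF s t])
  also have "\<rho> k * (v k \<bullet> traj k (s k) (1 - s k) m) \<le> 2 * (v k \<bullet> traj k (s k) (1 - s k) m)"
    using rho_hi[of k] ip_nonneg[OF cubeD(1)[OF t], of k] by (intro mult_right_mono) auto
  finally have "v k \<bullet> traj k (s k) (1 - s k) (Suc m) \<le> v k \<bullet> (1 - s k) + 2 * ((2 ^ (m + 1) - 1) * (v k \<bullet> (1 - s k)))"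
    using Suc by linarith
  then show ?case by (simp add: algebra_simps)
qed simp

text \<open>During the first N steps \<open>x\<close> accumulates at least a quarter of the source
  per step, so after long enough the source is negligible against \<open>x\<close>.\<close>

lemma x_crude_lower: "\<forall>\<^sub>F k in sequentially. \<forall>m\<le>N. (real m + 1) / 4 * (v k \<bullet> (1 - s k)) \<le> v k \<bullet> traj k (s k) (1 - s k) m"
proof -
  \<comment> \<open>Below \<open>h\<close> the source keeps half its strength, and quadratic loss
    together with the drift of \<open>\<rho>\<close> costs at most the fraction 1/(N + 1). Applied
    to the inductive lower bound this is at most a quarter of the source, which leaves a quarter as
    gain.\<close>
  define h where "h = min (c0 / 4) (1 / (2 * C2 * (real N + 1)))"
  have h: "0 < h" using c0_pos C2_ge1 by (simp add: h_def)
  have "(\<lambda>k. 2 ^ (N + 1) * (v k \<bullet> (1 - s k))) \<longlonglongrightarrow> 2 ^ (N + 1) * 0" by (intro tendsto_intros sig)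
  then have 1: "\<forall>\<^sub>F k in sequentially. 2 ^ (N + 1) * (v k \<bullet> (1 - s k)) < h" using h by (intro order_tendstoD(2)) auto
  have 2: "\<forall>\<^sub>F k in sequentially. 1 - 1 / (2 * (real N + 1)) < \<rho> k"
    by (rule order_tendstoD(1)[OF rho_lim]) simp
  show ?thesis using 1 2
  proof (eventually_elim, intro allI impI)
    fix k m assume *: "2 ^ (N + 1) * (v k \<bullet> (1 - s k)) < h" "1 - 1 / (2 * (real N + 1)) < \<rho> k"
    define \<sigma> where "\<sigma> = v k \<bullet> (1 - s k)"
    define X where "X m = v k \<bullet> traj k (s k) (1 - s k) m" for m
    have \<sigma>: "0 \<le> \<sigma>" using ip_src_nonneg by (simp add: \<sigma>_def)
    assume "m \<le> N"
    then have "(real m + 1) / 4 * \<sigma> \<le> X m"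
    proof (induction m)
      case 0
      then show ?case using \<sigma> by (simp add: X_def \<sigma>_def)
    next
      case (Suc m)
      have t: "traj k (s k) (1 - s k) m \<in> cube" by (intro traj_cube one_minus_cube s)
      have X0: "0 \<le> X m" unfolding X_def by (intro ip_nonneg cubeD t)
      have "X m \<le> (2 ^ (m + 1) - 1) * \<sigma>" using x_crude_upper[of k m] by (simp add: X_def \<sigma>_def)
      also have "\<dots> \<le> 2 ^ (N + 1) * \<sigma>" using Suc(2) \<sigma>
        by (intro mult_right_mono order_trans[of "2 ^ (m + 1) - 1" "2 ^ (m + 1)" "2 ^ (N + 1)"] power_increasing) auto
      finally have Xh: "X m \<le> h" using *(1) by (simp add: \<sigma>_def)
      have "\<sigma> * (1 - 2 * X m / c0) \<ge> \<sigma> * (1/2)"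
        using Xh \<sigma> c0_pos by (intro mult_left_mono) (auto simp: h_def field_simps)
      moreover have "C2 * X m \<le> 1 / (2 * (real N + 1))"
      proof -
        have "C2 * X m \<le> C2 * (1 / (2 * C2 * (real N + 1)))" using Xh C2_ge1 by (intro mult_left_mono) (auto simp: h_def)
        also have "\<dots> = 1 / (2 * (real N + 1))" using C2_ge1 by simp
        finally show ?thesis .
      qed
      then have "X m * (1 - 1 / (real N + 1)) \<le> X m * (\<rho> k - C2 * X m)"
        using *(2) X0 by (intro mult_left_mono) (auto simp: field_simps)
      moreover have "(real m + 1) / 4 * \<sigma> * (1 - 1 / (real N + 1)) \<le> X m * (1 - 1 / (real N + 1))"
        using Suc by (intro mult_right_mono) (auto simp: field_simps)
      moreover have "(real m + 2) / 4 * \<sigma> \<le> \<sigma> * (1/2) + (real m + 1) / 4 * \<sigma> * (1 - 1 / (real N + 1))"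
      proof -
        have "(real m + 1) / (real N + 1) * \<sigma> \<le> 1 * \<sigma>" using Suc(2) \<sigma> by (intro mult_right_mono) (auto simp: field_simps)
        then show ?thesis by (simp add: field_simps)
      qed
      moreover have "\<sigma> * (1 - 2 * X m / c0) + \<rho> k * X m - C2 * (X m)^2 \<le> X (Suc m)"
        unfolding X_def \<sigma>_def traj_Suc by (rule step_lower[OF s t])
      moreover have "X m * (\<rho> k - C2 * X m) = \<rho> k * X m - C2 * (X m)^2" by (simp add: power2_eq_square algebra_simps)
      ultimately have "(real m + 2) / 4 * \<sigma> \<le> X (Suc m)" by linarith
      then show ?case by (simp add: add.commute)
    qed
    then show "(real m + 1) / 4 * (v k \<bullet> (1 - s k)) \<le> v k \<bullet> traj k (s k) (1 - s k) m" by (simp add: X_def \<sigma>_def)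
  qed
qed

lemma src_small: "e > 0 \<Longrightarrow> \<exists>N. \<forall>\<^sub>F k in sequentially. \<forall>m\<ge>N. v k \<bullet> (1 - s k) \<le> e * (v k \<bullet> traj k (s k) (1 - s k) m)"
proof -
  assume e: "e > 0"
  obtain N :: nat where N: "4 / e < real N" using reals_Archimedean2 by blast
  have eN: "1 \<le> e * ((real N + 1) / 4)" using N e by (simp add: field_simps)
  show ?thesis
  proof (rule exI[of _ N], rule eventually_mono[OF x_crude_lower[of N]], intro allI impI)
    fix k m assume *: "\<forall>m\<le>N. (real m + 1) / 4 * (v k \<bullet> (1 - s k)) \<le> v k \<bullet> traj k (s k) (1 - s k) m" and m: "N \<le> m"
    have "v k \<bullet> (1 - s k) \<le> e * ((real N + 1) / 4) * (v k \<bullet> (1 - s k))"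
      using mult_right_mono[OF eN ip_src_nonneg[of k]] by simp
    also have "\<dots> = e * ((real N + 1) / 4 * (v k \<bullet> (1 - s k)))" by simp
    also have "\<dots> \<le> e * (v k \<bullet> traj k (s k) (1 - s k) N)" using * e by (intro mult_left_mono) auto
    also have "\<dots> \<le> e * (v k \<bullet> traj k (s k) (1 - s k) m)" using e m s by (intro mult_left_mono ip_mono x_mono) auto
    finally show "v k \<bullet> (1 - s k) \<le> e * (v k \<bullet> traj k (s k) (1 - s k) m)" .
  qed
qed

text \<open>Since \<open>x \<le> y\<close>, smallness passes from \<open>y\<close> to
  \<open>x\<close> and dominance over the source from \<open>x\<close> to \<open>y\<close>.\<close>

lemma regular_xy: "regular s (\<lambda>k. traj k (s k) (1 - s k))" "regular s (\<lambda>k. traj k (s k) 1)"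
proof -
  have xy: "v k \<bullet> traj k (s k) (1 - s k) m \<le> v k \<bullet> traj k (s k) 1 m" for k m
    by (intro ip_mono x_le_y s)
  have "\<exists>N. \<forall>\<^sub>F k in sequentially. \<forall>m\<ge>N. v k \<bullet> traj k (s k) (1 - s k) m \<le> e \<and> v k \<bullet> traj k (s k) 1 m \<le> e
     \<and> v k \<bullet> (1 - s k) \<le> e * (v k \<bullet> traj k (s k) (1 - s k) m) \<and> v k \<bullet> (1 - s k) \<le> e * (v k \<bullet> traj k (s k) 1 m)" if e: "e > 0" for e
  proof -
    obtain N1 N2 where N: "\<forall>\<^sub>F k in sequentially. \<forall>m\<ge>N1. v k \<bullet> (1 - s k) \<le> e * (v k \<bullet> traj k (s k) (1 - s k) m)"
       "\<forall>\<^sub>F k in sequentially. \<forall>m\<ge>N2. v k \<bullet> traj k (s k) 1 m \<le> e"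
      using src_small[OF e] y_small[OF s sig e] by blast
    show ?thesis
    proof (rule exI[of _ "max N1 N2"], use N in eventually_elim, intro allI impI conjI)
      fix k m assume *: "\<forall>m\<ge>N1. v k \<bullet> (1 - s k) \<le> e * (v k \<bullet> traj k (s k) (1 - s k) m)"
        "\<forall>m\<ge>N2. v k \<bullet> traj k (s k) 1 m \<le> e" and m: "max N1 N2 \<le> m"
      show 1: "v k \<bullet> traj k (s k) 1 m \<le> e" "v k \<bullet> (1 - s k) \<le> e * (v k \<bullet> traj k (s k) (1 - s k) m)"
        using * m by auto
      show "v k \<bullet> traj k (s k) (1 - s k) m \<le> e" using 1(1) xy[of k m] by linarith
      show "v k \<bullet> (1 - s k) \<le> e * (v k \<bullet> traj k (s k) 1 m)"
        using 1(2) mult_left_mono[OF xy[of k m], of e] e by linarith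
    qed
  qed
  note * = this
  show "regular s (\<lambda>k. traj k (s k) (1 - s k))" "regular s (\<lambda>k. traj k (s k) 1)"
    unfolding regular_def
    by (intro conjI allI impI s traj_cube one_cube one_minus_cube traj_Suc; use * in \<open>fast elim: eventually_mono\<close>)+
qed

end

text \<open>After any fixed number of steps survival is still of order one, uniformly in k. Started
  from there, the recursion behaves as if it came down from infinity on the scale 1/n.\<close>

lemma survival_lower: "\<exists>c>0. \<forall>k. c \<le> v k \<bullet> traj k 1 1 m"
proof -
  obtain c where c: "c > 0" "\<And>k x. x \<in> cube \<Longrightarrow> c * (v k \<bullet> x) \<le> v k \<bullet> G k x"
    by (rule G_ip_lower) (rule that; assumption)
  show ?thesis
  proof (induction m)
    case 0
    have "c0 \<le> v k \<bullet> 1" for k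
      using comp_le[OF cubeD(1)[OF one_cube], of undefined k] c0_pos by (simp add: pos_le_divide_eq)
    then show ?case using c0_pos by (intro exI[of _ c0]) simp
  next
    case (Suc m)
    then obtain c' where c': "c' > 0" "\<And>k. c' \<le> v k \<bullet> traj k 1 1 m" by blast
    have "c * c' \<le> v k \<bullet> traj k 1 1 (Suc m)" for k
    proof -
      have "c * c' \<le> c * (v k \<bullet> traj k 1 1 m)" using c c' by (intro mult_left_mono) auto
      also have "\<dots> \<le> v k \<bullet> traj k 1 1 (Suc m)"
        using c(2)[OF traj_cube[OF one_cube one_cube], of k k m] by (simp add: traj_Suc)
      finally show ?thesis .
    qed
    then show ?case using c c' by (intro exI[of _ "c * c'"]) simp
  qed
qed

end

section \<open>Perturbed Riccati recursions\<close>

text \<open>The root of the discriminant of the fixed point equation; \<open>1 + rgap\<close> is the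
  derivative of the map at its negative fixed point.\<close>

definition rgap :: "real \<Rightarrow> real \<Rightarrow> real \<Rightarrow> real" where
  "rgap \<tau> q \<sigma> = sqrt (\<tau>^2 + 4 * q * \<sigma>)"

text \<open>\<open>- rshift\<close> is the negative fixed point of \<open>z \<mapsto> (1 + \<tau>) z - q z\<^sup>2 + \<sigma>\<close>; shifting by it removes
  the source term, and then the reciprocal satisfies an almost linear recursion.\<close>

definition rshift :: "real \<Rightarrow> real \<Rightarrow> real \<Rightarrow> real" where
  "rshift \<tau> q \<sigma> = (rgap \<tau> q \<sigma> - \<tau>) / (2 * q)"

text \<open>Kept as a sum so that \<open>g = 0\<close> is included.\<close>

definition geom :: "real \<Rightarrow> nat \<Rightarrow> real" where
  "geom g n = (\<Sum>j<n. 1 / (1 + g) ^ j)"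

text \<open>The solution after n steps of the linear recursion for the reciprocals, transformed
  back. \<open>B\<close> is separate from \<open>q\<close> because the lower bound needs a slightly
  larger increment.\<close>

definition rbound :: "real \<Rightarrow> real \<Rightarrow> real \<Rightarrow> real \<Rightarrow> real \<Rightarrow> nat \<Rightarrow> real" where
  "rbound \<tau> q \<sigma> B z n = 1 / (1 / (z + rshift \<tau> q \<sigma>) / (1 + rgap \<tau> q \<sigma>) ^ n
     + B / (1 + rgap \<tau> q \<sigma>)^2 * geom (rgap \<tau> q \<sigma>) n) - rshift \<tau> q \<sigma>"

lemma rgap_nonneg: "0 \<le> q \<Longrightarrow> 0 \<le> \<sigma> \<Longrightarrow> 0 \<le> rgap \<tau> q \<sigma>"
  by (simp add: rgap_def)

lemma rgap_ge: "0 \<le> q \<Longrightarrow> 0 \<le> \<sigma> \<Longrightarrow> \<bar>\<tau>\<bar> \<le> rgap \<tau> q \<sigma>"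
  unfolding rgap_def by (rule real_le_rsqrt) simp

lemma rshift_nonneg: "0 < q \<Longrightarrow> 0 \<le> \<sigma> \<Longrightarrow> 0 \<le> rshift \<tau> q \<sigma>"
  using rgap_ge[of q \<sigma> \<tau>] by (simp add: rshift_def)

lemma riccati_shift:
  fixes \<tau> q \<sigma> z :: real
  assumes "0 < q" "0 \<le> \<sigma>"
  defines "g \<equiv> rgap \<tau> q \<sigma>" and "h \<equiv> rshift \<tau> q \<sigma>"
  shows "(1 + \<tau>) * z - q * z^2 + \<sigma> + h = (1 + g) * (z + h) - q * (z + h)^2"
proof -
  have g2: "g^2 = \<tau>^2 + 4 * q * \<sigma>" using assms(1,2) by (simp add: g_def rgap_def)
  have qh: "2 * q * h = g - \<tau>" using assms(1) by (simp add: h_def g_def rshift_def)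
  have "4 * q * (g * h - q * h^2) = (2 * q * h) * (2 * g - 2 * q * h)" by (simp add: power2_eq_square algebra_simps)
  also have "\<dots> = g^2 - \<tau>^2" unfolding qh by (simp add: power2_eq_square algebra_simps)
  also have "\<dots> = 4 * q * \<sigma>" by (simp add: g2)
  finally have s: "g * h - q * h^2 = \<sigma>" using assms(1) by simp
  have "(1 + g) * (z + h) - q * (z + h)^2 = z + g * z - (2 * q * h) * z - q * z^2 + h + (g * h - q * h^2)"
    by (simp add: power2_eq_square algebra_simps)
  then show ?thesis unfolding qh s by (simp add: algebra_simps)
qed

text \<open>With \<open>w = q \<theta> / R\<close> the reciprocal gains the factor
  \<open>1 / (1 - w)\<close>, which is at least \<open>1 + w\<close>; the term with \<open>w\<close>
  no longer depends on \<open>\<theta>\<close>.\<close>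

lemma recip_step_upper:
  fixes \<theta> :: real
  assumes "0 < \<theta>" "0 < \<theta>'" "0 < R" "0 < q" "\<theta>' \<le> R * \<theta> - q * \<theta>^2"
  shows "1 / \<theta> / R + q / R^2 \<le> 1 / \<theta>'"
proof -
  define w where "w = q * \<theta> / R"
  have w: "0 < w" using assms by (simp add: w_def)
  have eq: "R * \<theta> - q * \<theta>^2 = R * \<theta> * (1 - w)" using assms by (simp add: w_def power2_eq_square field_simps)
  have "0 < R * \<theta> * (1 - w)" using assms eq by linarith
  moreover have "0 < R * \<theta>" using assms by simp
  ultimately have "0 < 1 - w" by (rule zero_less_mult_pos)
  then have w1: "w < 1" by simp
  have "1 / \<theta> / R + q / R^2 = (1 + w) / (R * \<theta>)" using assms by (simp add: w_def power2_eq_square field_simps)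
  also have "\<dots> \<le> (1 / (1 - w)) / (R * \<theta>)"
  proof -
    have "(1 + w) * (1 - w) \<le> 1" by (simp add: algebra_simps)
    then have "1 + w \<le> 1 / (1 - w)" using w1 by (simp add: pos_le_divide_eq)
    then show ?thesis using assms by (intro divide_right_mono) auto
  qed
  also have "\<dots> = 1 / (R * \<theta> * (1 - w))" by simp
  also have "\<dots> \<le> 1 / \<theta>'" using assms eq by (intro divide_left_mono) auto
  finally show ?thesis .
qed

lemma recip_step_lower:
  fixes \<theta> :: real
  assumes "0 < \<theta>" "0 < R" "0 < q" "R * \<theta> - q * \<theta>^2 \<le> \<theta>'" "q * \<theta> / R \<le> e" "e \<le> 1/2"
  shows "0 < \<theta>'" "1 / \<theta>' \<le> 1 / \<theta> / R + q * (1 + 2 * e) / R^2"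
proof -
  define w where "w = q * \<theta> / R"
  have w: "0 < w" "w \<le> e" using assms by (simp_all add: w_def)
  have eq: "R * \<theta> - q * \<theta>^2 = R * \<theta> * (1 - w)" using assms by (simp add: w_def power2_eq_square field_simps)
  have p: "0 < R * \<theta> * (1 - w)" using assms w by simp
  then show "0 < \<theta>'" using assms eq by linarith
  have "1 / \<theta>' \<le> 1 / (R * \<theta> * (1 - w))" using assms eq p by (intro divide_left_mono) auto
  also have "\<dots> = (1 / (1 - w)) / (R * \<theta>)" by simp
  \<comment> \<open>The converse estimate for \<open>w \<le> e \<le> 1/2\<close>; the excess factor
    tends to 1 with \<open>e\<close>.\<close>
  also have "\<dots> \<le> (1 + (1 + 2 * e) * w) / (R * \<theta>)"
  proof -
    have "(1 + 2 * e) * w \<le> 2 * e" using mult_mono[of "1 + 2 * e" 2 w e] w assms by simp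
    then have "0 \<le> w * (2 * e - (1 + 2 * e) * w)" using w by simp
    then have "1 \<le> (1 + (1 + 2 * e) * w) * (1 - w)" by (simp add: algebra_simps)
    then have "1 / (1 - w) \<le> 1 + (1 + 2 * e) * w" using w assms by (simp add: pos_divide_le_eq)
    then show ?thesis using assms by (intro divide_right_mono) auto
  qed
  also have "\<dots> = 1 / \<theta> / R + q * (1 + 2 * e) / R^2"
    using assms by (simp add: w_def power2_eq_square field_simps)
  finally show "1 / \<theta>' \<le> 1 / \<theta> / R + q * (1 + 2 * e) / R^2" .
qed

lemma geom_Suc: "0 \<le> g \<Longrightarrow> geom g (Suc n) = 1 + geom g n / (1 + g)"
  unfolding geom_def sum_divide_distrib by (subst sum.lessThan_Suc_shift) (simp add: mult.commute)

lemma geom_nonneg: "0 \<le> g \<Longrightarrow> 0 \<le> geom g n"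
  by (simp add: geom_def sum_nonneg)

lemma linear_rec_lower:
  assumes g: "0 \<le> g" and p: "\<And>m. m < n \<Longrightarrow> p m / (1 + g) + B \<le> p (Suc m)"
  shows "p 0 / (1 + g) ^ n + B * geom g n \<le> p n"
  using p
proof (induction n)
  case 0
  then show ?case by (simp add: geom_def)
next
  case (Suc n)
  have "(p 0 / (1 + g) ^ n + B * geom g n) / (1 + g) + B \<le> p n / (1 + g) + B"
    using Suc g by (intro add_right_mono divide_right_mono) auto
  also have "\<dots> \<le> p (Suc n)" by (rule Suc.prems) simp
  finally show ?case using g by (simp add: geom_Suc add_divide_distrib algebra_simps)
qed

lemma linear_rec_upper:
  assumes g: "0 \<le> g" and p: "\<And>m. m < n \<Longrightarrow> p (Suc m) \<le> p m / (1 + g) + B"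
  shows "p n \<le> p 0 / (1 + g) ^ n + B * geom g n"
proof -
  have "(- p 0) / (1 + g) ^ n + (- B) * geom g n \<le> - p n"
  proof (rule linear_rec_lower[OF g, where p = "\<lambda>m. - p m"])
    fix m assume "m < n"
    from p[OF this] show "(- p m) / (1 + g) + (- B) \<le> - p (Suc m)" by simp
  qed
  then show ?thesis by simp
qed

lemma riccati_upper:
  assumes q: "0 < q" "0 \<le> \<sigma>" and z: "\<And>m. m \<le> n \<Longrightarrow> 0 < z m"
    and rec: "\<And>m. m < n \<Longrightarrow> z (Suc m) \<le> (1 + \<tau>) * z m - q * (z m)^2 + \<sigma>"
  shows "z n \<le> rbound \<tau> q \<sigma> q (z 0) n"
proof -
  define g where "g = rgap \<tau> q \<sigma>"
  define h where "h = rshift \<tau> q \<sigma>"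
  have g: "0 \<le> g" and h: "0 \<le> h" using q by (auto simp: g_def h_def rgap_nonneg rshift_nonneg)
  define p where "p m = 1 / (z m + h)" for m
  have "p m / (1 + g) + q / (1 + g)^2 \<le> p (Suc m)" if "m < n" for m
    unfolding p_def
  proof (rule recip_step_upper)
    show "z (Suc m) + h \<le> (1 + g) * (z m + h) - q * (z m + h)^2"
      using rec[OF that] riccati_shift[OF q, of \<tau> "z m"] by (simp add: g_def h_def)
  qed (use z[of m] z[of "Suc m"] that h g q in auto)
  from linear_rec_lower[where p = p and n = n and B = "q / (1 + g)^2", OF g this]
  have le: "p 0 / (1 + g) ^ n + q / (1 + g)^2 * geom g n \<le> p n" by blast
  have pos: "0 < p 0 / (1 + g) ^ n + q / (1 + g)^2 * geom g n"
    using z[of 0] h g q geom_nonneg[OF g, of n] by (intro add_pos_nonneg) (auto simp: p_def)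
  have zn: "0 < z n + h" using z[of n] h by simp
  have "z n + h = 1 / p n" by (simp add: p_def)
  also have "\<dots> \<le> 1 / (p 0 / (1 + g) ^ n + q / (1 + g)^2 * geom g n)"
    using le pos by (intro divide_left_mono) auto
  finally show ?thesis unfolding rbound_def p_def g_def h_def by simp
qed

lemma riccati_lower:
  assumes q: "0 < q" "0 \<le> \<sigma>" and z: "\<And>m. m \<le> n \<Longrightarrow> 0 < z m"
    and rec: "\<And>m. m < n \<Longrightarrow> (1 + \<tau>) * z m - q * (z m)^2 + \<sigma> \<le> z (Suc m)"
    and e: "\<And>m. m < n \<Longrightarrow> q * (z m + rshift \<tau> q \<sigma>) \<le> e" "e \<le> 1/2"
  shows "rbound \<tau> q \<sigma> (q * (1 + 2 * e)) (z 0) n \<le> z n"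
proof -
  define g where "g = rgap \<tau> q \<sigma>"
  define h where "h = rshift \<tau> q \<sigma>"
  have g: "0 \<le> g" and h: "0 \<le> h" using q by (auto simp: g_def h_def rgap_nonneg rshift_nonneg)
  define p where "p m = 1 / (z m + h)" for m
  have "p (Suc m) \<le> p m / (1 + g) + q * (1 + 2 * e) / (1 + g)^2" if "m < n" for m
    unfolding p_def
  proof (rule recip_step_lower(2))
    show "(1 + g) * (z m + h) - q * (z m + h)^2 \<le> z (Suc m) + h"
      using rec[OF that] riccati_shift[OF q, of \<tau> "z m"] by (simp add: g_def h_def)
    have "q * (z m + h) / (1 + g) \<le> q * (z m + h) / 1"
      using z[of m] that h g q by (intro divide_left_mono) auto
    then show "q * (z m + h) / (1 + g) \<le> e" using e(1)[OF that] by (simp add: h_def)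
  qed (use z[of m] that h g q e in auto)
  from linear_rec_upper[where p = p and n = n and B = "q * (1 + 2 * e) / (1 + g)^2", OF g this]
  have le: "p n \<le> p 0 / (1 + g) ^ n + q * (1 + 2 * e) / (1 + g)^2 * geom g n" by blast
  have zn: "0 < z n + h" using z[of n] h by simp
  then have pn: "0 < p n" by (simp add: p_def)
  have "1 / (p 0 / (1 + g) ^ n + q * (1 + 2 * e) / (1 + g)^2 * geom g n) \<le> 1 / p n"
    using le pn by (intro divide_left_mono) auto
  also have "\<dots> = z n + h" by (simp add: p_def)
  finally show ?thesis unfolding rbound_def p_def g_def h_def by simp
qed

text \<open>\<open>\<beta>\<close> is the time scale, n or 1/(\<open>\<rho>\<close> - 1). The limit
  \<open>e\<close> collects what remains of the starting value, \<open>S\<close> the accumulated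
  quadratic term, and \<open>x\<close> the rescaled shift.\<close>

lemma tendsto_rbound:
  fixes \<beta> \<tau> Q q \<sigma> B z :: "nat \<Rightarrow> real" and n :: "nat \<Rightarrow> nat"
  assumes \<beta>: "\<forall>\<^sub>F k in sequentially. 0 < \<beta> k" and Q: "\<And>k. 0 < Q k"
    and x: "(\<lambda>k. \<beta> k * Q k * rshift (\<tau> k) (q k) (\<sigma> k)) \<longlonglongrightarrow> x"
    and g: "(\<lambda>k. rgap (\<tau> k) (q k) (\<sigma> k)) \<longlonglongrightarrow> 0"
    and e: "(\<lambda>k. 1 / (\<beta> k * Q k * (z k + rshift (\<tau> k) (q k) (\<sigma> k))) / (1 + rgap (\<tau> k) (q k) (\<sigma> k)) ^ n k) \<longlonglongrightarrow> e"
    and B: "(\<lambda>k. B k / Q k) \<longlonglongrightarrow> 1"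
    and S: "(\<lambda>k. geom (rgap (\<tau> k) (q k) (\<sigma> k)) (n k) / \<beta> k) \<longlonglongrightarrow> S"
    and eS: "e + S \<noteq> 0"
  shows "(\<lambda>k. \<beta> k * Q k * rbound (\<tau> k) (q k) (\<sigma> k) (B k) (z k) (n k)) \<longlonglongrightarrow> 1 / (e + S) - x"
proof -
  define gk where "gk k = rgap (\<tau> k) (q k) (\<sigma> k)" for k
  define h where "h k = rshift (\<tau> k) (q k) (\<sigma> k)" for k
  have "(\<lambda>k. 1 / (1 / (\<beta> k * Q k * (z k + h k)) / (1 + gk k) ^ n k + B k / Q k / (1 + gk k)^2 * (geom (gk k) (n k) / \<beta> k))
      - \<beta> k * Q k * h k) \<longlonglongrightarrow> 1 / (e + 1 / (1 + 0)^2 * S) - x"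
    by (intro tendsto_intros x[folded h_def] g[folded gk_def] e[folded h_def gk_def] B S[folded gk_def]) (use eS in auto)
  then have lim: "(\<lambda>k. 1 / (1 / (\<beta> k * Q k * (z k + h k)) / (1 + gk k) ^ n k + B k / Q k / (1 + gk k)^2 * (geom (gk k) (n k) / \<beta> k))
      - \<beta> k * Q k * h k) \<longlonglongrightarrow> 1 / (e + S) - x" by simp
  have eq: "1 / (1 / (\<beta> k * Q k * (z k + h k)) / (1 + gk k) ^ n k + B k / Q k / (1 + gk k)^2 * (geom (gk k) (n k) / \<beta> k))
      = \<beta> k * Q k * (1 / (1 / (z k + h k) / (1 + gk k) ^ n k + B k / (1 + gk k)^2 * geom (gk k) (n k)))" if "0 < \<beta> k" for k
  proof -
    have "1 / (\<beta> k * Q k * (z k + h k)) / (1 + gk k) ^ n k + B k / Q k / (1 + gk k)^2 * (geom (gk k) (n k) / \<beta> k)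
      = (1 / (z k + h k) / (1 + gk k) ^ n k + B k / (1 + gk k)^2 * geom (gk k) (n k)) / (\<beta> k * Q k)"
      using that Q[of k] by (simp add: add_divide_distrib mult_ac)
    then show ?thesis by simp
  qed
  show ?thesis unfolding rbound_def gk_def[symmetric] h_def[symmetric] right_diff_distrib
    by (rule Lim_transform_eventually[OF lim]) (use \<beta> in eventually_elim, simp only: eq)
qed

section \<open>Powers, geometric sums and a diagonal choice\<close>

lemma tendsto_one_plus_power:
  fixes g :: "nat \<Rightarrow> real" and m :: "nat \<Rightarrow> nat"
  assumes g: "\<And>k. 0 \<le> g k" "g \<longlonglongrightarrow> 0" and mg: "(\<lambda>k. real (m k) * g k) \<longlonglongrightarrow> w"
  shows "(\<lambda>k. (1 + g k) ^ m k) \<longlonglongrightarrow> exp w"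
proof -
  have l: "(\<lambda>k. real (m k) * ln (1 + g k)) \<longlonglongrightarrow> w"
  proof (rule tendsto_sandwich)
    show "\<forall>\<^sub>F k in sequentially. real (m k) * g k - real (m k) * g k * g k \<le> real (m k) * ln (1 + g k)"
    proof -
      have "\<forall>\<^sub>F k in sequentially. g k < 1" using g(2) by (rule order_tendstoD) simp
      then show ?thesis
      proof eventually_elim
        case (elim k)
        have "g k - (g k)^2 \<le> ln (1 + g k)" using g(1)[of k] elim by (intro ln_one_plus_pos_lower_bound) auto
        then have "real (m k) * (g k - (g k)^2) \<le> real (m k) * ln (1 + g k)" by (intro mult_left_mono) auto
        then show ?case by (simp add: power2_eq_square algebra_simps)
      qed
    qed
    show "\<forall>\<^sub>F k in sequentially. real (m k) * ln (1 + g k) \<le> real (m k) * g k"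
      using g(1) by (intro always_eventually allI mult_left_mono ln_add_one_self_le_self) auto
    show "(\<lambda>k. real (m k) * g k - real (m k) * g k * g k) \<longlonglongrightarrow> w"
      using tendsto_diff[OF mg tendsto_mult[OF mg g(2)]] by simp
  qed (rule mg)
  have "(1 + g k) ^ m k = exp (real (m k) * ln (1 + g k))" for k
    using g(1)[of k] by (simp add: exp_of_nat_mult add_pos_nonneg)
  then show ?thesis using tendsto_exp[OF l] by simp
qed

lemma geom_eq: "g > 0 \<Longrightarrow> geom g n = (1 - 1 / (1 + g) ^ n) * (1 + g) / g"
proof (induction n)
  case (Suc n)
  define R where "R = 1 + g"
  define c where "c = 1 / R ^ n"
  have R: "0 < R" "g = R - 1" "R \<noteq> 1" using Suc by (simp_all add: R_def)
  have "geom g (Suc n) = 1 + (1 - c) * R / g / R"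
    using Suc by (simp add: geom_Suc R_def c_def)
  also have "\<dots> = (1 - c / R) * R / g" unfolding R(2) using R(1,3) by (simp add: field_simps)
  also have "c / R = 1 / R ^ Suc n" by (simp add: c_def)
  finally show ?case by (simp add: R_def)
qed (simp add: geom_def)

text \<open>The integral of exp(-w x) over [0, 1], continued to w = 0: the limit of geometric sums
  divided by n.\<close>

definition egap :: "real \<Rightarrow> real" where "egap w = (if w = 0 then 1 else (1 - exp (- w)) / w)"

lemma egap_pos: "0 \<le> w \<Longrightarrow> 0 < egap w"
  by (simp add: egap_def)

text \<open>For \<open>w = 0\<close> the gap may vanish along the sequence, so the closed form is
  replaced by bounding each summand between the last power and 1. The length \<open>m\<close>
  differs from \<open>n\<close> by the burn-in.\<close>

lemma tendsto_geom:
  fixes g :: "nat \<Rightarrow> real" and n m :: "nat \<Rightarrow> nat"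
  assumes g: "\<And>k. 0 \<le> g k" "g \<longlonglongrightarrow> 0" and n: "filterlim n at_top sequentially"
    and ng: "(\<lambda>k. real (n k) * g k) \<longlonglongrightarrow> w" and mn: "(\<lambda>k. real (m k) / real (n k)) \<longlonglongrightarrow> 1"
  shows "(\<lambda>k. geom (g k) (m k) / real (n k)) \<longlonglongrightarrow> egap w"
proof -
  have npos: "\<forall>\<^sub>F k in sequentially. 0 < n k" by (rule eventually_compose_filterlim[OF eventually_gt_at_top n])
  have mg: "(\<lambda>k. real (m k) * g k) \<longlonglongrightarrow> w"
  proof -
    have "(\<lambda>k. (real (m k) / real (n k)) * (real (n k) * g k)) \<longlonglongrightarrow> w" using tendsto_mult[OF mn ng] by simp
    then show ?thesis
      by (rule Lim_transform_eventually) (use npos in eventually_elim, simp)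
  qed
  note pw = tendsto_one_plus_power[OF g mg]
  have w0: "0 \<le> w" using mg by (rule tendsto_lowerbound) (use g in auto)
  show ?thesis
  proof (cases "w = 0")
    case True
    have "(\<lambda>k. (real (m k) / real (n k)) * (1 / (1 + g k) ^ m k)) \<longlonglongrightarrow> 1 * (1 / exp w)"
      by (intro tendsto_intros mn pw) simp
    then have low: "(\<lambda>k. (real (m k) / real (n k)) * (1 / (1 + g k) ^ m k)) \<longlonglongrightarrow> 1" using True by simp
    have A: "1 / (1 + g k) ^ m k * real (m k) \<le> geom (g k) (m k)" for k
    proof -
      have "(\<Sum>j<m k. 1 / (1 + g k) ^ m k) \<le> geom (g k) (m k)" unfolding geom_def
        using g(1)[of k] by (intro sum_mono divide_left_mono power_increasing) auto
      then show ?thesis by (simp add: mult.commute)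
    qed
    have B: "geom (g k) (m k) \<le> real (m k)" for k
    proof -
      have "geom (g k) (m k) \<le> (\<Sum>j<m k. 1)" unfolding geom_def
        using g(1)[of k] by (intro sum_mono) (auto simp: one_le_power)
      then show ?thesis by simp
    qed
    have "(real (m k) / real (n k)) * (1 / (1 + g k) ^ m k) \<le> geom (g k) (m k) / real (n k)" for k
      using divide_right_mono[OF A, of "real (n k)" k] by (simp add: mult.commute)
    moreover have "geom (g k) (m k) / real (n k) \<le> real (m k) / real (n k)" for k
      using divide_right_mono[OF B, of "real (n k)" k] by simp
    ultimately have "\<forall>\<^sub>F k in sequentially. (real (m k) / real (n k)) * (1 / (1 + g k) ^ m k) \<le> geom (g k) (m k) / real (n k)"
      "\<forall>\<^sub>F k in sequentially. geom (g k) (m k) / real (n k) \<le> real (m k) / real (n k)"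
      by simp_all
    from tendsto_sandwich[OF this low mn] show ?thesis using True by (simp add: egap_def)
  next
    case False
    then have w: "0 < w" using w0 by simp
    have ev: "\<forall>\<^sub>F k in sequentially. 0 < real (n k) * g k" by (rule order_tendstoD(1)[OF ng w])
    have "(\<lambda>k. (1 - 1 / (1 + g k) ^ m k) * (1 + g k) / (real (n k) * g k)) \<longlonglongrightarrow> (1 - 1 / exp w) * (1 + 0) / w"
      by (intro tendsto_intros pw g ng) (use w in auto)
    then have "(\<lambda>k. (1 - 1 / (1 + g k) ^ m k) * (1 + g k) / (real (n k) * g k)) \<longlonglongrightarrow> egap w"
      using w by (simp add: egap_def exp_minus divide_inverse)
    then show ?thesis
      by (rule Lim_transform_eventually)
        (use ev in eventually_elim, auto simp: geom_eq zero_less_mult_iff mult_ac)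
  qed
qed

text \<open>\<open>d k\<close> is the largest level whose threshold has been passed by
  \<open>k\<close>, so the precision tends to zero just slowly enough. \<open>Pr\<close> need not be
  monotone in \<open>e\<close>, because \<open>d k\<close> itself is an admissible level.\<close>

lemma eventually_diagonal:
  assumes "\<And>e::real. e > 0 \<Longrightarrow> eventually (Pr e) sequentially"
  shows "\<exists>e. (\<forall>k. 0 < e k \<and> e k < 1/2) \<and> e \<longlonglongrightarrow> 0 \<and> (\<forall>\<^sub>F k in sequentially. Pr (e k) k)"
proof -
  \<comment> \<open>The offset makes even the first precision, 1/3, smaller than 1/2.\<close>
  have "\<exists>K. \<forall>k\<ge>K. Pr (1 / real (Suc (j + 2))) k" for j
    using assms[of "1 / real (Suc (j + 2))"] by (auto simp: eventually_sequentially)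
  then obtain K where K: "\<And>j k. K j \<le> k \<Longrightarrow> Pr (1 / real (Suc (j + 2))) k" by metis
  define J where "J k = {j. j \<le> k \<and> K j \<le> k}" for k
  define d where "d k = (if J k = {} then 0 else Max (J k))" for k
  have fin: "finite (J k)" for k unfolding J_def by (rule finite_subset[of _ "{..k}"]) auto
  have ge: "j \<le> d k" if "max j (K j) \<le> k" for j k
  proof -
    have "j \<in> J k" using that by (simp add: J_def)
    then show ?thesis using fin[of k] by (auto simp: d_def)
  qed
  have dtop: "filterlim d at_top sequentially"
    unfolding filterlim_at_top eventually_sequentially using ge by blast
  show ?thesis
  proof (intro exI[of _ "\<lambda>k. 1 / real (Suc (d k + 2))"] conjI)
    show "(\<lambda>k. 1 / real (Suc (d k + 2))) \<longlonglongrightarrow> 0"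
      using filterlim_compose[OF LIMSEQ_ignore_initial_segment[OF LIMSEQ_inverse_real_of_nat, of 2] dtop] by (simp add: inverse_eq_divide)
    show "\<forall>\<^sub>F k in sequentially. Pr (1 / real (Suc (d k + 2))) k"
      unfolding eventually_sequentially
    proof (intro exI[of _ "K 0"] allI impI)
      fix k assume "K 0 \<le> k"
      then have "0 \<in> J k" by (simp add: J_def)
      then have "d k \<in> J k" using Max_in[OF fin[of k]] by (auto simp: d_def)
      then show "Pr (1 / real (Suc (d k + 2))) k" by (intro K) (simp add: J_def)
    qed
  qed simp
qed

section \<open>Limits when the criticality parameter is of order one over n\<close>

lemma one_plus_tendsto: "(e :: nat \<Rightarrow> real) \<longlonglongrightarrow> 0 \<Longrightarrow> (\<lambda>k. 1 + e k) \<longlonglongrightarrow> 1"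
  using tendsto_add[OF tendsto_const[of 1], of e 0] by simp

context near_critical
begin

lemma Q_pos: "0 < Q k" using Q_lo[of k] c0_pos by linarith

lemma Q_mult_null: "f \<longlonglongrightarrow> 0 \<Longrightarrow> (\<lambda>k. Q k * f k) \<longlonglongrightarrow> 0"
proof (rule Lim_null_comparison)
  assume f: "f \<longlonglongrightarrow> (0::real)"
  show "\<forall>\<^sub>F k in sequentially. norm (Q k * f k) \<le> C * \<bar>f k\<bar>"
    using Q_hi Q_pos by (intro always_eventually allI) (auto simp: abs_mult abs_of_pos intro!: mult_right_mono)
  show "(\<lambda>k. C * \<bar>f k\<bar>) \<longlonglongrightarrow> 0" using tendsto_mult[OF tendsto_const tendsto_rabs[OF f]] by simp
qed

lemma tau_lim: "(\<lambda>k. \<rho> k - 1) \<longlonglongrightarrow> 0"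
  using tendsto_diff[OF rho_lim tendsto_const[of 1]] by simp

lemma rgap_pert: "rgap \<tau> (Q k * (1 + e1)) (\<sigma> * (1 + e2)) = sqrt (\<tau>^2 + 4 * (Q k * \<sigma> * ((1 + e1) * (1 + e2))))"
  by (simp add: rgap_def algebra_simps)

lemma rshift_pert: "x * Q k * rshift \<tau> (Q k * f) \<sigma> = x * (rgap \<tau> (Q k * f) \<sigma> - \<tau>) / (2 * f)"
  using Q_pos[of k] by (simp add: rshift_def)

context
  fixes s :: "nat \<Rightarrow> real^'d" and z :: "nat \<Rightarrow> nat \<Rightarrow> real^'d" and n :: "nat \<Rightarrow> nat"
  assumes r: "regular s z" and zpos: "\<And>k m. 0 < v k \<bullet> z k m"
    and sig: "(\<lambda>k. v k \<bullet> (1 - s k)) \<longlonglongrightarrow> 0" and n: "filterlim n at_top sequentially"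
begin

lemma sig_nonneg: "0 \<le> v k \<bullet> (1 - s k)"
  using r unfolding regular_def by (intro ip_nonneg cubeD one_minus_cube) auto

text \<open>The expansion at precision \<open>e k\<close> squeezes the projection, from time
  \<open>N k\<close> on, between Riccati recursions whose coefficients are multiplied by factors
  close to 1. \<open>A e N k\<close> records that the burn-in and the value reached after it are
  negligible at precision \<open>e\<close>, and \<open>Lim\<close> says that every such perturbation
  has the same limit.\<close>

lemma riccati_limit:
  fixes A :: "real \<Rightarrow> nat \<Rightarrow> nat \<Rightarrow> bool"
  assumes \<beta>: "\<forall>\<^sub>F k in sequentially. 0 < \<beta> k" and A: "\<And>e N. e > 0 \<Longrightarrow> \<forall>\<^sub>F k in sequentially. A e N k"
    and Lim: "\<And>e1 e2 e3 e N. e1 \<longlonglongrightarrow> 0 \<Longrightarrow> e2 \<longlonglongrightarrow> 0 \<Longrightarrow> e3 \<longlonglongrightarrow> 0 \<Longrightarrow> e \<longlonglongrightarrow> 0 \<Longrightarrow>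
       \<forall>k. 0 < e k \<and> -1 < e1 k \<and> -1 < e2 k \<Longrightarrow>
       \<forall>\<^sub>F k in sequentially. N k \<le> n k \<and> A (e k) (N k) k \<Longrightarrow>
       (\<lambda>k. \<beta> k * Q k * rbound (\<rho> k - 1) (Q k * (1 + e1 k)) (v k \<bullet> (1 - s k) * (1 + e2 k)) (Q k * (1 + e3 k))
          (v k \<bullet> z k (N k)) (n k - N k)) \<longlonglongrightarrow> L"
  shows "(\<lambda>k. \<beta> k * Q k * (v k \<bullet> z k (n k))) \<longlonglongrightarrow> L"
proof -
  define \<sigma> where "\<sigma> k = v k \<bullet> (1 - s k)" for k
  define Z where "Z k m = v k \<bullet> z k m" for k m
  \<comment> \<open>All demands at precision \<open>e\<close>; the last clause is the smallness
    condition of \<open>riccati_lower\<close>.\<close>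
  define Pr where "Pr e k \<longleftrightarrow> (\<exists>N. N \<le> n k \<and> A e N k \<and>
     (\<forall>m\<ge>N. \<bar>Z k (Suc m) - (\<rho> k * Z k m - Q k * (Z k m)^2 + \<sigma> k)\<bar> \<le> e * (Q k * (Z k m)^2 + \<sigma> k)) \<and>
     (\<forall>m\<ge>N. Q k * (1 + e) * (Z k m + rshift (\<rho> k - 1) (Q k * (1 + e)) (\<sigma> k * (1 - e))) \<le> e))" for e k
  have "eventually (Pr e) sequentially" if e: "e > 0" for e
  proof -
    obtain N1 where N1: "\<forall>\<^sub>F k in sequentially. \<forall>m\<ge>N1. \<bar>Z k (Suc m) - (\<rho> k * Z k m - Q k * (Z k m)^2 + \<sigma> k)\<bar>
       \<le> e * (Q k * (Z k m)^2 + \<sigma> k)"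
      using regular_expansion[OF r e] unfolding Z_def \<sigma>_def by blast
    \<comment> \<open>The projection and the shift will both be at most \<open>e'\<close>, and
      \<open>Q (1 + e)\<close> times their sum is then at most \<open>e\<close>.\<close>
    define e' where "e' = e / (2 * (C * (1 + e)))"
    have e': "0 < e'" using e C_ge1 by (simp add: e'_def)
    obtain N2 where N2: "\<forall>\<^sub>F k in sequentially. \<forall>m\<ge>N2. Z k m \<le> e' \<and> \<sigma> k \<le> e' * Z k m"
      using r e' unfolding regular_def Z_def \<sigma>_def by blast
    have "(\<lambda>k. \<rho> k * 0 + sqrt ((\<rho> k - 1)^2 + 4 * (Q k * \<sigma> k * ((1 + e) * (1 + - e))))) \<longlonglongrightarrow> 1 * 0 + sqrt (0^2 + 4 * (0 * ((1 + e) * (1 + - e))))"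
      by (intro tendsto_intros tau_lim rho_lim Q_mult_null sig[folded \<sigma>_def])
    then have g0: "(\<lambda>k. rgap (\<rho> k - 1) (Q k * (1 + e)) (\<sigma> k * (1 + - e))) \<longlonglongrightarrow> 0"
      unfolding rgap_pert by simp
    have "(\<lambda>k. \<bar>rgap (\<rho> k - 1) (Q k * (1 + e)) (\<sigma> k * (1 + - e)) - (\<rho> k - 1)\<bar> / (2 * c0)) \<longlonglongrightarrow> \<bar>0 - 0\<bar> / (2 * c0)"
      by (intro tendsto_intros g0 tau_lim) (use c0_pos in simp)
    then have "(\<lambda>k. \<bar>rgap (\<rho> k - 1) (Q k * (1 + e)) (\<sigma> k * (1 + - e)) - (\<rho> k - 1)\<bar> / (2 * c0)) \<longlonglongrightarrow> 0" by simp
    then have ev: "\<forall>\<^sub>F k in sequentially. \<bar>rgap (\<rho> k - 1) (Q k * (1 + e)) (\<sigma> k * (1 + - e)) - (\<rho> k - 1)\<bar> / (2 * c0) < e'"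
      using e' by (rule order_tendstoD)
    have nN: "\<forall>\<^sub>F k in sequentially. max N1 N2 \<le> n k"
      by (rule eventually_compose_filterlim[OF eventually_ge_at_top n])
    show ?thesis using N1 N2 ev nN A[OF e, of "max N1 N2"]
    proof eventually_elim
      case (elim k)
      have "rshift (\<rho> k - 1) (Q k * (1 + e)) (\<sigma> k * (1 - e)) \<le> e'"
      proof -
        have "rshift (\<rho> k - 1) (Q k * (1 + e)) (\<sigma> k * (1 - e))
           \<le> \<bar>rgap (\<rho> k - 1) (Q k * (1 + e)) (\<sigma> k * (1 + - e)) - (\<rho> k - 1)\<bar> / (2 * (Q k * (1 + e)))"
          unfolding rshift_def using Q_pos[of k] e by (intro divide_right_mono) auto
        also have "\<dots> \<le> \<bar>rgap (\<rho> k - 1) (Q k * (1 + e)) (\<sigma> k * (1 + - e)) - (\<rho> k - 1)\<bar> / (2 * c0)"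
        proof (intro divide_left_mono mult_left_mono)
          show "c0 \<le> Q k * (1 + e)" using Q_lo[of k] e Q_pos[of k] mult_mono[of c0 "Q k" 1 "1 + e"] by simp
        qed (use c0_pos Q_pos[of k] e in auto)
        finally show ?thesis using elim(3) by linarith
      qed
      then have *: "Q k * (1 + e) * (Z k m + rshift (\<rho> k - 1) (Q k * (1 + e)) (\<sigma> k * (1 - e))) \<le> e" if "max N1 N2 \<le> m" for m
      proof -
        have "Z k m + rshift (\<rho> k - 1) (Q k * (1 + e)) (\<sigma> k * (1 - e)) \<le> 2 * e'"
          using elim(2) that \<open>rshift _ _ _ \<le> e'\<close> by auto
        then have "Q k * (1 + e) * (Z k m + rshift (\<rho> k - 1) (Q k * (1 + e)) (\<sigma> k * (1 - e))) \<le> Q k * (1 + e) * (2 * e')"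
          using Q_pos[of k] e by (intro mult_left_mono) auto
        also have "\<dots> \<le> C * (1 + e) * (2 * e')" using Q_hi[of k] e e' by (intro mult_right_mono) auto
        also have "\<dots> = e" using e C_ge1 by (simp add: e'_def)
        finally show ?thesis .
      qed
      show ?case unfolding Pr_def
        by (intro exI[of _ "max N1 N2"] conjI) (use elim * in auto)
    qed
  qed
  then obtain e where e: "\<forall>k. 0 < e k \<and> e k < 1/2" "e \<longlonglongrightarrow> 0" "\<forall>\<^sub>F k in sequentially. Pr (e k) k"
    using eventually_diagonal[of Pr] by blast
  have "\<exists>N. \<forall>k. Pr (e k) k \<longrightarrow> N k \<le> n k \<and> A (e k) (N k) k \<and>
     (\<forall>m\<ge>N k. \<bar>Z k (Suc m) - (\<rho> k * Z k m - Q k * (Z k m)^2 + \<sigma> k)\<bar> \<le> e k * (Q k * (Z k m)^2 + \<sigma> k)) \<and>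
     (\<forall>m\<ge>N k. Q k * (1 + e k) * (Z k m + rshift (\<rho> k - 1) (Q k * (1 + e k)) (\<sigma> k * (1 - e k))) \<le> e k)"
    unfolding Pr_def by (intro choice) blast
  then obtain N where N: "\<And>k. Pr (e k) k \<Longrightarrow> N k \<le> n k \<and> A (e k) (N k) k \<and>
     (\<forall>m\<ge>N k. \<bar>Z k (Suc m) - (\<rho> k * Z k m - Q k * (Z k m)^2 + \<sigma> k)\<bar> \<le> e k * (Q k * (Z k m)^2 + \<sigma> k)) \<and>
     (\<forall>m\<ge>N k. Q k * (1 + e k) * (Z k m + rshift (\<rho> k - 1) (Q k * (1 + e k)) (\<sigma> k * (1 - e k))) \<le> e k)"
    by blast
  have NA: "\<forall>\<^sub>F k in sequentially. N k \<le> n k \<and> A (e k) (N k) k"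
    using e(3) by eventually_elim (use N in blast)
  have e1: "\<forall>k. 0 < e k \<and> -1 < e k \<and> -1 < - e k" "\<forall>k. 0 < e k \<and> -1 < - e k \<and> -1 < e k"
  proof -
    have "0 < e k \<and> -1 < e k \<and> -1 < - e k" for k using spec[OF e(1), of k] by auto
    then show "\<forall>k. 0 < e k \<and> -1 < e k \<and> -1 < - e k" "\<forall>k. 0 < e k \<and> -1 < - e k \<and> -1 < e k" by auto
  qed
  have me: "(\<lambda>k. - e k) \<longlonglongrightarrow> 0" using tendsto_minus[OF e(2)] by simp
  have e3: "(\<lambda>k. (1 + e k) * (1 + 2 * e k) - 1) \<longlonglongrightarrow> 0"
  proof -
    have "(\<lambda>k. (1 + e k) * (1 + 2 * e k) - 1) \<longlonglongrightarrow> (1 + 0) * (1 + 2 * 0) - 1" by (intro tendsto_intros e)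
    then show ?thesis by simp
  qed
  \<comment> \<open>For the lower bound Q is increased and the source decreased, for the upper bound
    the reverse; the factor \<open>1 + 2 * e\<close> of the reciprocal step enters only the
    increment.\<close>
  let ?lo = "\<lambda>k. \<beta> k * Q k * rbound (\<rho> k - 1) (Q k * (1 + e k)) (\<sigma> k * (1 + - e k)) (Q k * (1 + ((1 + e k) * (1 + 2 * e k) - 1))) (Z k (N k)) (n k - N k)"
  let ?hi = "\<lambda>k. \<beta> k * Q k * rbound (\<rho> k - 1) (Q k * (1 + - e k)) (\<sigma> k * (1 + e k)) (Q k * (1 + - e k)) (Z k (N k)) (n k - N k)"
  have lo: "?lo \<longlonglongrightarrow> L" unfolding Z_def \<sigma>_def by (rule Lim[OF e(2) me e3 e(2) e1(1) NA])
  have hi: "?hi \<longlonglongrightarrow> L" unfolding Z_def \<sigma>_def by (rule Lim[OF me e(2) me e(2) e1(2) NA])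
  have "\<forall>\<^sub>F k in sequentially. ?lo k \<le> \<beta> k * Q k * Z k (n k) \<and> \<beta> k * Q k * Z k (n k) \<le> ?hi k"
    using e(3) \<beta>
  proof eventually_elim
    case (elim k)
    have ek: "0 < e k" "e k < 1/2" using e(1) elim by auto
    note Nk = N[OF elim(1)]
    have Zp: "0 < Z k m" for m unfolding Z_def by (rule zpos)
    have s0: "0 \<le> \<sigma> k" unfolding \<sigma>_def by (rule sig_nonneg)
    have ex: "\<bar>Z k (Suc m) - (\<rho> k * Z k m - Q k * (Z k m)^2 + \<sigma> k)\<bar> \<le> e k * (Q k * (Z k m)^2 + \<sigma> k)" if "N k \<le> m" for m
      using Nk that by blast
    have "Z k (N k + (n k - N k)) \<le> rbound (\<rho> k - 1) (Q k * (1 + - e k)) (\<sigma> k * (1 + e k)) (Q k * (1 + - e k)) (Z k (N k + 0)) (n k - N k)"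
    proof (rule riccati_upper[where z = "\<lambda>m. Z k (N k + m)"])
      fix m
      show "Z k (N k + Suc m) \<le> (1 + (\<rho> k - 1)) * Z k (N k + m) - Q k * (1 + - e k) * (Z k (N k + m))^2 + \<sigma> k * (1 + e k)"
        using ex[of "N k + m"] by (simp add: algebra_simps abs_le_iff)
    qed (use Zp Q_pos[of k] ek s0 in auto)
    moreover have "rbound (\<rho> k - 1) (Q k * (1 + e k)) (\<sigma> k * (1 + - e k)) (Q k * (1 + e k) * (1 + 2 * e k)) (Z k (N k + 0)) (n k - N k)
        \<le> Z k (N k + (n k - N k))"
    proof (rule riccati_lower[where z = "\<lambda>m. Z k (N k + m)"])
      fix m
      show "(1 + (\<rho> k - 1)) * Z k (N k + m) - Q k * (1 + e k) * (Z k (N k + m))^2 + \<sigma> k * (1 + - e k) \<le> Z k (N k + Suc m)"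
        using ex[of "N k + m"] by (simp add: algebra_simps abs_le_iff)
      show "Q k * (1 + e k) * (Z k (N k + m) + rshift (\<rho> k - 1) (Q k * (1 + e k)) (\<sigma> k * (1 + - e k))) \<le> e k"
        using Nk by simp
    qed (use Zp Q_pos[of k] ek s0 in auto)
    ultimately show ?case using Nk elim(2) Q_pos[of k] by (auto simp: mult.assoc intro!: mult_left_mono)
  qed
  then show ?thesis unfolding Z_def[symmetric]
    by (intro tendsto_sandwich[OF _ _ lo hi]) (auto elim: eventually_mono)
qed


text \<open>In units of n the gap tends to \<open>w\<close> and Q times the shift to
  \<open>(w - lam) / 2\<close>. Removing \<open>N k \<le> e k * n k\<close> steps does not change
  the limits.\<close>

lemma ode_scaling:
  assumes nt: "(\<lambda>k. real (n k) * (\<rho> k - 1)) \<longlonglongrightarrow> lam"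
    and nq: "(\<lambda>k. (real (n k))^2 * (Q k * (v k \<bullet> (1 - s k)))) \<longlonglongrightarrow> kap"
    and e12: "e1 \<longlonglongrightarrow> 0" "e2 \<longlonglongrightarrow> 0" "\<forall>k. -1 < e1 k \<and> -1 < e2 k"
    and N: "e \<longlonglongrightarrow> 0" "\<forall>\<^sub>F k in sequentially. N k \<le> n k \<and> real (N k) \<le> e k * real (n k)"
  defines "g \<equiv> \<lambda>k. rgap (\<rho> k - 1) (Q k * (1 + e1 k)) (v k \<bullet> (1 - s k) * (1 + e2 k))" and "w \<equiv> sqrt (lam^2 + 4 * kap)"
  shows "g \<longlonglongrightarrow> 0" "0 \<le> w"
    "(\<lambda>k. real (n k) * Q k * rshift (\<rho> k - 1) (Q k * (1 + e1 k)) (v k \<bullet> (1 - s k) * (1 + e2 k))) \<longlonglongrightarrow> (w - lam) / 2"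
    "(\<lambda>k. geom (g k) (n k - N k) / real (n k)) \<longlonglongrightarrow> egap w"
    "(\<lambda>k. (1 + g k) ^ (n k - N k)) \<longlonglongrightarrow> exp w"
proof -
  note o = one_plus_tendsto[OF e12(1)] one_plus_tendsto[OF e12(2)]
  have npos: "\<forall>\<^sub>F k in sequentially. 0 < n k" by (rule eventually_compose_filterlim[OF eventually_gt_at_top n])
  have ng_eq: "real (n k) * g k = sqrt ((real (n k) * (\<rho> k - 1))^2 + 4 * ((real (n k))^2 * (Q k * (v k \<bullet> (1 - s k))) * ((1 + e1 k) * (1 + e2 k))))" for k
  proof -
    have "real (n k) * g k = sqrt ((real (n k))^2) * g k" by simp
    also have "\<dots> = sqrt ((real (n k))^2 * ((\<rho> k - 1)^2 + 4 * (Q k * (v k \<bullet> (1 - s k)) * ((1 + e1 k) * (1 + e2 k)))))"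
      unfolding g_def rgap_pert real_sqrt_mult ..
    also have "x^2 * (t^2 + 4 * (a * b)) = (x * t)^2 + 4 * (x^2 * a * b)" for x t a b :: real
      by (simp add: power_mult_distrib distrib_left mult_ac)
    finally show ?thesis .
  qed
  have "(\<lambda>k. real (n k) * g k) \<longlonglongrightarrow> sqrt (lam^2 + 4 * (kap * (1 * 1)))"
    unfolding ng_eq by (intro tendsto_intros nt nq o)
  then have ng: "(\<lambda>k. real (n k) * g k) \<longlonglongrightarrow> w" by (simp add: w_def)
  have g0: "0 \<le> g k" for k unfolding g_def using Q_pos[of k] sig_nonneg[of k] spec[OF e12(3), of k]
    by (intro rgap_nonneg mult_nonneg_nonneg) auto
  show w0: "0 \<le> w" by (rule tendsto_lowerbound[OF ng]) (use g0 in auto)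
  have "(\<lambda>k. real (n k) * g k * (1 / real (n k))) \<longlonglongrightarrow> w * 0"
    by (intro tendsto_mult ng lim_1_over_n[THEN filterlim_compose] n)
  then have "(\<lambda>k. real (n k) * g k * (1 / real (n k))) \<longlonglongrightarrow> 0" by simp
  then show gl: "g \<longlonglongrightarrow> 0"
    by (rule Lim_transform_eventually) (use npos in eventually_elim, simp)
  have "(\<lambda>k. (real (n k) * g k - real (n k) * (\<rho> k - 1)) / (2 * (1 + e1 k))) \<longlonglongrightarrow> (w - lam) / (2 * 1)"
    by (intro tendsto_intros ng nt o) simp
  then show "(\<lambda>k. real (n k) * Q k * rshift (\<rho> k - 1) (Q k * (1 + e1 k)) (v k \<bullet> (1 - s k) * (1 + e2 k))) \<longlonglongrightarrow> (w - lam) / 2"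
    unfolding rshift_pert g_def by (simp add: right_diff_distrib)
  have nN: "(\<lambda>k. real (n k - N k) / real (n k)) \<longlonglongrightarrow> 1"
  proof (rule tendsto_sandwich)
    show "\<forall>\<^sub>F k in sequentially. 1 - e k \<le> real (n k - N k) / real (n k)"
      using N(2) npos by eventually_elim (simp add: of_nat_diff field_simps)
    show "\<forall>\<^sub>F k in sequentially. real (n k - N k) / real (n k) \<le> 1"
      using npos by eventually_elim simp
    show "(\<lambda>k. 1 - e k) \<longlonglongrightarrow> 1" using tendsto_diff[OF tendsto_const[of 1] N(1)] by simp
  qed simp
  show "(\<lambda>k. geom (g k) (n k - N k) / real (n k)) \<longlonglongrightarrow> egap w"
    by (rule tendsto_geom[OF g0 gl n ng nN])
  have "(\<lambda>k. (real (n k - N k) / real (n k)) * (real (n k) * g k)) \<longlonglongrightarrow> w" using tendsto_mult[OF nN ng] by simp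
  then have "(\<lambda>k. real (n k - N k) * g k) \<longlonglongrightarrow> w"
    by (rule Lim_transform_eventually) (use npos in eventually_elim, simp)
  then show "(\<lambda>k. (1 + g k) ^ (n k - N k)) \<longlonglongrightarrow> exp w" by (rule tendsto_one_plus_power[OF g0 gl])
qed

lemma eventually_n_ge: "e > 0 \<Longrightarrow> \<forall>\<^sub>F k in sequentially. c \<le> e * real (n k)"
proof -
  assume e: "e > 0"
  have "\<forall>\<^sub>F k in sequentially. nat \<lceil>c / e\<rceil> \<le> n k" by (rule eventually_compose_filterlim[OF eventually_ge_at_top n])
  then show ?thesis
  proof eventually_elim
    case (elim k)
    then have "c / e \<le> real (n k)" by linarith
    then show ?case using e by (simp add: pos_divide_le_eq mult.commute)
  qed
qed

text \<open>The starting value is large on the scale 1/n, so its reciprocal contributes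
  nothing.\<close>

lemma ode_limit_from_infinity:
  assumes nt: "(\<lambda>k. real (n k) * (\<rho> k - 1)) \<longlonglongrightarrow> lam"
    and nq: "(\<lambda>k. (real (n k))^2 * (Q k * (v k \<bullet> (1 - s k)))) \<longlonglongrightarrow> kap"
    and start: "\<And>N. \<exists>c>0. \<forall>k. c \<le> v k \<bullet> z k N"
  defines "w \<equiv> sqrt (lam^2 + 4 * kap)"
  shows "(\<lambda>k. real (n k) * Q k * (v k \<bullet> z k (n k))) \<longlonglongrightarrow> 1 / egap w - (w - lam) / 2"
proof (rule riccati_limit[where A = "\<lambda>e N k. real N \<le> e * real (n k) \<and> 1 \<le> e * (real (n k) * (v k \<bullet> z k N))"])
  show "\<forall>\<^sub>F k in sequentially. 0 < real (n k)"
    using eventually_compose_filterlim[OF eventually_gt_at_top n, of 0] by simp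
  fix e :: real and N assume e: "e > 0"
  obtain c where c: "c > 0" "\<And>k. c \<le> v k \<bullet> z k N" using start[of N] by blast
  show "\<forall>\<^sub>F k in sequentially. real N \<le> e * real (n k) \<and> 1 \<le> e * (real (n k) * (v k \<bullet> z k N))"
    using eventually_n_ge[OF e, of "real N"] eventually_n_ge[OF e, of "1 / c"]
  proof eventually_elim
    case (elim k)
    have "1 = 1 / c * c" using c by simp
    also have "\<dots> \<le> e * real (n k) * (v k \<bullet> z k N)" using elim c e by (intro mult_mono) auto
    finally show ?case using elim by (simp add: mult.assoc)
  qed
next
  fix e1 e2 e3 e :: "nat \<Rightarrow> real" and N
  assume e: "e1 \<longlonglongrightarrow> 0" "e2 \<longlonglongrightarrow> 0" "e3 \<longlonglongrightarrow> 0" "e \<longlonglongrightarrow> 0" "\<forall>k. 0 < e k \<and> -1 < e1 k \<and> -1 < e2 k"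
    and N: "\<forall>\<^sub>F k in sequentially. N k \<le> n k \<and> real (N k) \<le> e k * real (n k) \<and> 1 \<le> e k * (real (n k) * (v k \<bullet> z k (N k)))"
  have e12: "\<forall>k. -1 < e1 k \<and> -1 < e2 k" using e(5) by blast
  have N1: "\<forall>\<^sub>F k in sequentially. N k \<le> n k \<and> real (N k) \<le> e k * real (n k)"
    using N by eventually_elim blast
  note sc = ode_scaling[OF nt nq e(1,2) e12 e(4) N1, folded w_def]
  let ?g = "\<lambda>k. rgap (\<rho> k - 1) (Q k * (1 + e1 k)) (v k \<bullet> (1 - s k) * (1 + e2 k))"
  let ?h = "\<lambda>k. rshift (\<rho> k - 1) (Q k * (1 + e1 k)) (v k \<bullet> (1 - s k) * (1 + e2 k))"
  have pos: "0 \<le> ?g k \<and> 0 \<le> ?h k" for k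
    using Q_pos[of k] sig_nonneg[of k] spec[OF e(5), of k] by (auto intro!: rgap_nonneg rshift_nonneg)
  have st: "(\<lambda>k. 1 / (real (n k) * Q k * (v k \<bullet> z k (N k) + ?h k)) / (1 + ?g k) ^ (n k - N k)) \<longlonglongrightarrow> 0"
  proof (rule Lim_null_comparison)
    show "(\<lambda>k. e k / c0) \<longlonglongrightarrow> 0" using tendsto_divide[OF e(4) tendsto_const[of c0]] c0_pos by simp
    show "\<forall>\<^sub>F k in sequentially. norm (1 / (real (n k) * Q k * (v k \<bullet> z k (N k) + ?h k)) / (1 + ?g k) ^ (n k - N k)) \<le> e k / c0"
      using N
    proof eventually_elim
      case (elim k)
      let ?Z = "v k \<bullet> z k (N k)"
      have nk: "0 < real (n k)" using elim by (cases "n k = 0") auto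
      have ek: "0 < e k" using e(5) by blast
      have Z: "0 < ?Z" by (rule zpos)
      have "c0 \<le> c0 * (e k * (real (n k) * ?Z))" using mult_left_mono[of 1 "e k * (real (n k) * ?Z)" c0] elim c0_pos by auto
      also have "\<dots> \<le> e k * (real (n k) * Q k * (?Z + ?h k))"
      proof -
        have "c0 * ?Z \<le> Q k * (?Z + ?h k)" using Q_lo[of k] pos[of k] Z c0_pos by (intro mult_mono) auto
        then have "e k * real (n k) * (c0 * ?Z) \<le> e k * real (n k) * (Q k * (?Z + ?h k))"
          using ek nk by (intro mult_left_mono) auto
        then show ?thesis by (simp add: mult_ac)
      qed
      finally have le: "c0 \<le> e k * (real (n k) * Q k * (?Z + ?h k))" .
      have D: "0 < real (n k) * Q k * (?Z + ?h k)" using nk Q_pos[of k] Z pos[of k] by (simp add: add_pos_nonneg)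
      have "1 / (real (n k) * Q k * (?Z + ?h k)) / (1 + ?g k) ^ (n k - N k) \<le> 1 / (real (n k) * Q k * (?Z + ?h k)) / 1"
        using D pos[of k] by (intro divide_left_mono) (auto simp: one_le_power)
      also have "\<dots> \<le> e k / c0" using le D c0_pos by (simp add: field_simps)
      finally show ?case using D pos[of k] by simp
    qed
  qed
  have B: "(\<lambda>k. Q k * (1 + e3 k) / Q k) \<longlonglongrightarrow> 1" using one_plus_tendsto[OF e(3)] Q_pos by (simp add: less_imp_neq[THEN not_sym])
  have nb: "\<forall>\<^sub>F k in sequentially. 0 < real (n k)"
    using eventually_compose_filterlim[OF eventually_gt_at_top n, of 0] by simp
  have "(\<lambda>k. real (n k) * Q k * rbound (\<rho> k - 1) (Q k * (1 + e1 k)) (v k \<bullet> (1 - s k) * (1 + e2 k)) (Q k * (1 + e3 k))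
          (v k \<bullet> z k (N k)) (n k - N k)) \<longlonglongrightarrow> 1 / (0 + egap w) - (w - lam) / 2"
    by (rule tendsto_rbound[OF nb Q_pos sc(3) sc(1) st B sc(4)]) (use egap_pos[OF sc(2)] in simp)
  then show "(\<lambda>k. real (n k) * Q k * rbound (\<rho> k - 1) (Q k * (1 + e1 k)) (v k \<bullet> (1 - s k) * (1 + e2 k)) (Q k * (1 + e3 k))
          (v k \<bullet> z k (N k)) (n k - N k)) \<longlonglongrightarrow> 1 / egap w - (w - lam) / 2" by simp
qed

text \<open>The starting value is small on the scale 1/n, so the shifted start is the shift itself;
  its reciprocal survives, damped by exp(-w).\<close>

lemma ode_limit_from_zero:
  assumes nt: "(\<lambda>k. real (n k) * (\<rho> k - 1)) \<longlonglongrightarrow> lam"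
    and nq: "(\<lambda>k. (real (n k))^2 * (Q k * (v k \<bullet> (1 - s k)))) \<longlonglongrightarrow> kap" and kap: "kap > 0"
    and start: "\<And>N. \<exists>c. \<forall>k. v k \<bullet> z k N \<le> c * (v k \<bullet> (1 - s k))"
  defines "w \<equiv> sqrt (lam^2 + 4 * kap)"
  shows "(\<lambda>k. real (n k) * Q k * (v k \<bullet> z k (n k))) \<longlonglongrightarrow> 1 / (1 / ((w - lam) / 2) / exp w + egap w) - (w - lam) / 2"
proof (rule riccati_limit[where A = "\<lambda>e N k. real N \<le> e * real (n k) \<and> real (n k) * (v k \<bullet> z k N) \<le> e"])
  show nb: "\<forall>\<^sub>F k in sequentially. 0 < real (n k)"
    using eventually_compose_filterlim[OF eventually_gt_at_top n, of 0] by simp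
  have ns: "(\<lambda>k. real (n k) * (v k \<bullet> (1 - s k))) \<longlonglongrightarrow> 0"
  proof (rule Lim_null_comparison)
    have "(\<lambda>k. (real (n k))^2 * (Q k * (v k \<bullet> (1 - s k))) * (1 / real (n k)) / c0) \<longlonglongrightarrow> kap * 0 / c0"
      by (intro tendsto_intros nq lim_1_over_n[THEN filterlim_compose] n) (use c0_pos in simp)
    then show "(\<lambda>k. (real (n k))^2 * (Q k * (v k \<bullet> (1 - s k))) * (1 / real (n k)) / c0) \<longlonglongrightarrow> 0" by simp
    show "\<forall>\<^sub>F k in sequentially. norm (real (n k) * (v k \<bullet> (1 - s k))) \<le> (real (n k))^2 * (Q k * (v k \<bullet> (1 - s k))) * (1 / real (n k)) / c0"
      using nb
    proof eventually_elim
      case (elim k)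
      have "c0 * (real (n k) * (v k \<bullet> (1 - s k))) \<le> Q k * (real (n k) * (v k \<bullet> (1 - s k)))"
        using Q_lo[of k] sig_nonneg[of k] by (intro mult_right_mono) auto
      then show ?case using elim c0_pos sig_nonneg[of k] by (simp add: power2_eq_square field_simps)
    qed
  qed
  fix e :: real and N assume e: "e > 0"
  obtain c where c: "\<And>k. v k \<bullet> z k N \<le> c * (v k \<bullet> (1 - s k))" using start[of N] by blast
  have "(\<lambda>k. c * (real (n k) * (v k \<bullet> (1 - s k)))) \<longlonglongrightarrow> c * 0" by (intro tendsto_intros ns)
  then have "\<forall>\<^sub>F k in sequentially. c * (real (n k) * (v k \<bullet> (1 - s k))) < e" using e by (intro order_tendstoD(2)) auto
  then show "\<forall>\<^sub>F k in sequentially. real N \<le> e * real (n k) \<and> real (n k) * (v k \<bullet> z k N) \<le> e"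
    using eventually_n_ge[OF e, of "real N"]
  proof eventually_elim
    case (elim k)
    have "real (n k) * (v k \<bullet> z k N) \<le> real (n k) * (c * (v k \<bullet> (1 - s k)))" by (intro mult_left_mono c) simp
    then show ?case using elim by (simp add: mult_ac)
  qed
next
  fix e1 e2 e3 e :: "nat \<Rightarrow> real" and N
  assume e: "e1 \<longlonglongrightarrow> 0" "e2 \<longlonglongrightarrow> 0" "e3 \<longlonglongrightarrow> 0" "e \<longlonglongrightarrow> 0" "\<forall>k. 0 < e k \<and> -1 < e1 k \<and> -1 < e2 k"
    and N: "\<forall>\<^sub>F k in sequentially. N k \<le> n k \<and> real (N k) \<le> e k * real (n k) \<and> real (n k) * (v k \<bullet> z k (N k)) \<le> e k"
  have e12: "\<forall>k. -1 < e1 k \<and> -1 < e2 k" using e(5) by blast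
  have N1: "\<forall>\<^sub>F k in sequentially. N k \<le> n k \<and> real (N k) \<le> e k * real (n k)"
    using N by eventually_elim blast
  note sc = ode_scaling[OF nt nq e(1,2) e12 e(4) N1, folded w_def]
  let ?g = "\<lambda>k. rgap (\<rho> k - 1) (Q k * (1 + e1 k)) (v k \<bullet> (1 - s k) * (1 + e2 k))"
  let ?h = "\<lambda>k. rshift (\<rho> k - 1) (Q k * (1 + e1 k)) (v k \<bullet> (1 - s k) * (1 + e2 k))"
  \<comment> \<open>Positive \<open>kap\<close> keeps the limiting shift away from zero, so its
    reciprocal converges.\<close>
  have wl: "0 < (w - lam) / 2"
  proof -
    have "\<bar>lam\<bar> = sqrt (lam^2)" by simp
    also have "\<dots> < w" unfolding w_def using kap by (intro real_sqrt_less_mono) simp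
    finally show ?thesis by simp
  qed
  have nz: "(\<lambda>k. Q k * (real (n k) * (v k \<bullet> z k (N k)))) \<longlonglongrightarrow> 0"
  proof (rule Q_mult_null, rule Lim_null_comparison[OF _ e(4)])
    show "\<forall>\<^sub>F k in sequentially. norm (real (n k) * (v k \<bullet> z k (N k))) \<le> e k"
      using N by eventually_elim (use zpos in \<open>simp add: less_imp_le\<close>)
  qed
  have "(\<lambda>k. Q k * (real (n k) * (v k \<bullet> z k (N k))) + real (n k) * Q k * ?h k) \<longlonglongrightarrow> 0 + (w - lam) / 2"
    by (intro tendsto_add nz sc(3))
  then have nh: "(\<lambda>k. real (n k) * Q k * (v k \<bullet> z k (N k) + ?h k)) \<longlonglongrightarrow> (w - lam) / 2"
    by (simp add: algebra_simps)
  have st: "(\<lambda>k. 1 / (real (n k) * Q k * (v k \<bullet> z k (N k) + ?h k)) / (1 + ?g k) ^ (n k - N k)) \<longlonglongrightarrow> 1 / ((w - lam) / 2) / exp w"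
    by (intro tendsto_intros nh sc(5)) (use wl in auto)
  have B: "(\<lambda>k. Q k * (1 + e3 k) / Q k) \<longlonglongrightarrow> 1" using one_plus_tendsto[OF e(3)] Q_pos by (simp add: less_imp_neq[THEN not_sym])
  have nb: "\<forall>\<^sub>F k in sequentially. 0 < real (n k)"
    using eventually_compose_filterlim[OF eventually_gt_at_top n, of 0] by simp
  have ne: "0 < 1 / ((w - lam) / 2) / exp w + egap w" using wl egap_pos[OF sc(2)] by (intro add_pos_pos) auto
  show "(\<lambda>k. real (n k) * Q k * rbound (\<rho> k - 1) (Q k * (1 + e1 k)) (v k \<bullet> (1 - s k) * (1 + e2 k)) (Q k * (1 + e3 k))
          (v k \<bullet> z k (N k)) (n k - N k)) \<longlonglongrightarrow> 1 / (1 / ((w - lam) / 2) / exp w + egap w) - (w - lam) / 2"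
    by (rule tendsto_rbound[OF nb Q_pos sc(3) sc(1) st B sc(4)]) (use ne in simp)
qed

end

end

section \<open>Strongly supercritical limits\<close>

text \<open>Since \<open>(1 + t/3)^2 \<le> 1 + t\<close> on [0, 1], Bernoulli's inequality for
  \<open>1 + t/3\<close> may be squared. The quadratic growth makes n t negligible against
  \<open>(1 + t)^n\<close>.\<close>

lemma power_ge_square:
  fixes t :: real
  assumes "0 \<le> t" "t \<le> 1" shows "(real n * t)^2 / 9 \<le> (1 + t) ^ n"
proof -
  have "t^2 \<le> t" using assms by (simp add: power2_eq_square mult_left_le)
  then have "(1 + t / 3)^2 \<le> 1 + t" using assms by (simp add: power2_eq_square field_simps)
  then have "((1 + t / 3)^2) ^ n \<le> (1 + t) ^ n" by (intro power_mono) auto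
  moreover have "((1 + t / 3)^2) ^ n = ((1 + t / 3) ^ n)^2" by (simp flip: power_mult add: mult.commute)
  moreover have "(real n * t / 3)^2 \<le> ((1 + t / 3) ^ n)^2"
    using Bernoulli_inequality[of "t / 3" n] assms by (intro power_mono) auto
  moreover have "(real n * t / 3)^2 = (real n * t)^2 / 9" by (simp add: power_divide)
  ultimately show ?thesis by linarith
qed

lemma diff_quotient: "t \<noteq> 0 \<Longrightarrow> 1 / t * (x - t) = x / t - 1" "t \<noteq> 0 \<Longrightarrow> t * (x / t - 1) = x - t"
  for t x :: real
  by (simp_all add: field_simps)

context near_critical
begin

context
  fixes s :: "nat \<Rightarrow> real^'d" and z :: "nat \<Rightarrow> nat \<Rightarrow> real^'d" and n :: "nat \<Rightarrow> nat"
  assumes r: "regular s z" and zpos: "\<And>k m. 0 < v k \<bullet> z k m"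
    and sig: "(\<lambda>k. v k \<bullet> (1 - s k)) \<longlonglongrightarrow> 0" and n: "filterlim n at_top sequentially"
    and sup: "\<And>k. 1 < \<rho> k" and ntau: "filterlim (\<lambda>k. real (n k) * (\<rho> k - 1)) at_top sequentially"
begin

lemma tau_pos: "0 < \<rho> k - 1" using sup[of k] by simp

text \<open>With a source small against \<open>(\<rho> - 1)^2 / Q\<close>, the gap is asymptotic to
  \<open>\<rho> - 1\<close>, the shift vanishes on this scale, and the geometric sum approaches its
  full value.\<close>

lemma super_scaling:
  assumes q0: "(\<lambda>k. Q k * (v k \<bullet> (1 - s k)) / (\<rho> k - 1)^2) \<longlonglongrightarrow> 0"
    and e12: "e1 \<longlonglongrightarrow> 0" "e2 \<longlonglongrightarrow> 0" "\<forall>k. -1 < e1 k \<and> -1 < e2 k"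
    and N: "e \<longlonglongrightarrow> 0" "\<forall>\<^sub>F k in sequentially. N k \<le> n k \<and> real (N k) * (\<rho> k - 1) \<le> e k"
  defines "g \<equiv> \<lambda>k. rgap (\<rho> k - 1) (Q k * (1 + e1 k)) (v k \<bullet> (1 - s k) * (1 + e2 k))"
  shows "(\<lambda>k. g k / (\<rho> k - 1)) \<longlonglongrightarrow> 1" "g \<longlonglongrightarrow> 0" "\<And>k. \<rho> k - 1 \<le> g k"
    "(\<lambda>k. 1 / (\<rho> k - 1) * Q k * rshift (\<rho> k - 1) (Q k * (1 + e1 k)) (v k \<bullet> (1 - s k) * (1 + e2 k))) \<longlonglongrightarrow> 0"
    "(\<lambda>k. geom (g k) (n k - N k) / (1 / (\<rho> k - 1))) \<longlonglongrightarrow> 1"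
    "\<And>k. (g k / (\<rho> k - 1))^2 = 1 + 4 * (Q k * (v k \<bullet> (1 - s k)) / (\<rho> k - 1)^2 * ((1 + e1 k) * (1 + e2 k)))"
proof -
  note o = one_plus_tendsto[OF e12(1)] one_plus_tendsto[OF e12(2)]
  have nn: "0 \<le> Q k * (v k \<bullet> (1 - s k)) * ((1 + e1 k) * (1 + e2 k))" for k
    using Q_pos[of k] sig_nonneg[OF r zpos sig n, of k] spec[OF e12(3), of k] by (intro mult_nonneg_nonneg) auto
  have sq: "(g k)^2 = (\<rho> k - 1)^2 + 4 * (Q k * (v k \<bullet> (1 - s k)) * ((1 + e1 k) * (1 + e2 k)))" for k
    unfolding g_def rgap_pert using nn[of k] by (simp add: real_sqrt_pow2)
  show ge: "\<rho> k - 1 \<le> g k" for k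
    using rgap_ge[of "Q k * (1 + e1 k)" "v k \<bullet> (1 - s k) * (1 + e2 k)" "\<rho> k - 1"] Q_pos[of k] sig_nonneg[OF r zpos sig n, of k] spec[OF e12(3), of k]
    by (simp add: g_def)
  then have gpos: "0 < g k" for k using tau_pos[of k] by (rule less_le_trans[rotated])
  show sq': "(g k / (\<rho> k - 1))^2 = 1 + 4 * (Q k * (v k \<bullet> (1 - s k)) / (\<rho> k - 1)^2 * ((1 + e1 k) * (1 + e2 k)))" for k
    using tau_pos[of k] unfolding power_divide sq by (simp add: add_divide_distrib)
  have eq: "g k / (\<rho> k - 1) = sqrt (1 + 4 * (Q k * (v k \<bullet> (1 - s k)) / (\<rho> k - 1)^2 * ((1 + e1 k) * (1 + e2 k))))" for k
    unfolding sq'[symmetric] using gpos[of k] tau_pos[of k] by simp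
  have "(\<lambda>k. g k / (\<rho> k - 1)) \<longlonglongrightarrow> sqrt (1 + 4 * (0 * (1 * 1)))" unfolding eq by (intro tendsto_intros q0 o)
  then show gt: "(\<lambda>k. g k / (\<rho> k - 1)) \<longlonglongrightarrow> 1" by simp
  have "(\<lambda>k. g k / (\<rho> k - 1) * (\<rho> k - 1)) \<longlonglongrightarrow> 1 * 0" by (intro tendsto_mult gt tau_lim)
  then show g0: "g \<longlonglongrightarrow> 0" using tau_pos by (simp add: less_imp_neq[THEN not_sym])
  have "(\<lambda>k. (g k / (\<rho> k - 1) - 1) / (2 * (1 + e1 k))) \<longlonglongrightarrow> (1 - 1) / (2 * 1)" by (intro tendsto_intros gt o) simp
  moreover have "1 / (\<rho> k - 1) * (g k - (\<rho> k - 1)) / (2 * (1 + e1 k)) = (g k / (\<rho> k - 1) - 1) / (2 * (1 + e1 k))" for k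
    using diff_quotient(1)[of "\<rho> k - 1" "g k"] tau_pos[of k] by simp
  ultimately show "(\<lambda>k. 1 / (\<rho> k - 1) * Q k * rshift (\<rho> k - 1) (Q k * (1 + e1 k)) (v k \<bullet> (1 - s k) * (1 + e2 k))) \<longlonglongrightarrow> 0"
    unfolding rshift_pert g_def[symmetric] by (simp add: g_def)
  have "filterlim (\<lambda>k. (1 + g k) ^ (n k - N k)) at_top sequentially"
  proof (rule filterlim_at_top_mono)
    have "filterlim (\<lambda>k. - e k + real (n k) * (\<rho> k - 1)) at_top sequentially"
      by (rule filterlim_tendsto_add_at_top[OF tendsto_minus[OF N(1)] ntau])
    then show "filterlim (\<lambda>k. real (n k) * (\<rho> k - 1) - e k) at_top sequentially" by simp
    show "\<forall>\<^sub>F k in sequentially. real (n k) * (\<rho> k - 1) - e k \<le> (1 + g k) ^ (n k - N k)"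
      using N(2)
    proof eventually_elim
      case (elim k)
      have "real (n k) * (\<rho> k - 1) - e k \<le> real (n k - N k) * (\<rho> k - 1)"
        using elim by (simp add: of_nat_diff left_diff_distrib)
      also have "\<dots> \<le> real (n k - N k) * g k" by (intro mult_left_mono ge) simp
      also have "\<dots> \<le> (1 + g k) ^ (n k - N k)"
        using Bernoulli_inequality[of "g k" "n k - N k"] gpos[of k] by simp
      finally show ?case .
    qed
  qed
  then have pw: "(\<lambda>k. inverse ((1 + g k) ^ (n k - N k))) \<longlonglongrightarrow> 0" by (rule tendsto_inverse_0_at_top)
  have "(\<lambda>k. (1 - inverse ((1 + g k) ^ (n k - N k))) * (1 + g k) / (g k / (\<rho> k - 1))) \<longlonglongrightarrow> (1 - 0) * (1 + 0) / 1"
    by (intro tendsto_intros pw g0 gt) simp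
  moreover have "(1 - inverse ((1 + g k) ^ (n k - N k))) * (1 + g k) / (g k / (\<rho> k - 1)) = geom (g k) (n k - N k) / (1 / (\<rho> k - 1))" for k
    by (simp add: geom_eq[OF gpos] inverse_eq_divide)
  ultimately show "(\<lambda>k. geom (g k) (n k - N k) / (1 / (\<rho> k - 1))) \<longlonglongrightarrow> 1" by simp
qed

lemma super_limit_from_infinity:
  assumes q0: "(\<lambda>k. Q k * (v k \<bullet> (1 - s k)) / (\<rho> k - 1)^2) \<longlonglongrightarrow> 0"
    and start: "\<And>N. \<exists>c>0. \<forall>k. c \<le> v k \<bullet> z k N"
  shows "(\<lambda>k. 1 / (\<rho> k - 1) * Q k * (v k \<bullet> z k (n k))) \<longlonglongrightarrow> 1"
proof (rule riccati_limit[OF r zpos sig n, where A = "\<lambda>e N k. real N * (\<rho> k - 1) \<le> e \<and> \<rho> k - 1 \<le> e * (v k \<bullet> z k N)"])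
  show "\<forall>\<^sub>F k in sequentially. 0 < 1 / (\<rho> k - 1)" using tau_pos by simp
  fix e :: real and N assume e: "e > 0"
  obtain c where c: "c > 0" "\<And>k. c \<le> v k \<bullet> z k N" using start[of N] by blast
  have "(\<lambda>k. real N * (\<rho> k - 1)) \<longlonglongrightarrow> real N * 0" by (intro tendsto_intros tau_lim)
  then have 1: "\<forall>\<^sub>F k in sequentially. real N * (\<rho> k - 1) < e" using e by (intro order_tendstoD(2)) auto
  have 2: "\<forall>\<^sub>F k in sequentially. \<rho> k - 1 < e * c" using c e by (intro order_tendstoD(2)[OF tau_lim]) auto
  show "\<forall>\<^sub>F k in sequentially. real N * (\<rho> k - 1) \<le> e \<and> \<rho> k - 1 \<le> e * (v k \<bullet> z k N)"
    using 1 2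
  proof eventually_elim
    case (elim k)
    have "e * c \<le> e * (v k \<bullet> z k N)" using e c by (intro mult_left_mono) auto
    then show ?case using elim by simp
  qed
next
  fix e1 e2 e3 e :: "nat \<Rightarrow> real" and N
  assume e: "e1 \<longlonglongrightarrow> 0" "e2 \<longlonglongrightarrow> 0" "e3 \<longlonglongrightarrow> 0" "e \<longlonglongrightarrow> 0" "\<forall>k. 0 < e k \<and> -1 < e1 k \<and> -1 < e2 k"
    and N: "\<forall>\<^sub>F k in sequentially. N k \<le> n k \<and> real (N k) * (\<rho> k - 1) \<le> e k \<and> \<rho> k - 1 \<le> e k * (v k \<bullet> z k (N k))"
  have e12: "\<forall>k. -1 < e1 k \<and> -1 < e2 k" using e(5) by blast
  have N1: "\<forall>\<^sub>F k in sequentially. N k \<le> n k \<and> real (N k) * (\<rho> k - 1) \<le> e k" using N by eventually_elim blast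
  note sc = super_scaling[OF q0 e(1,2) e12 e(4) N1]
  let ?g = "\<lambda>k. rgap (\<rho> k - 1) (Q k * (1 + e1 k)) (v k \<bullet> (1 - s k) * (1 + e2 k))"
  let ?h = "\<lambda>k. rshift (\<rho> k - 1) (Q k * (1 + e1 k)) (v k \<bullet> (1 - s k) * (1 + e2 k))"
  have pos: "0 \<le> ?g k \<and> 0 \<le> ?h k" for k
    using Q_pos[of k] sig_nonneg[OF r zpos sig n, of k] spec[OF e(5), of k] by (auto intro!: rgap_nonneg rshift_nonneg)
  have st: "(\<lambda>k. 1 / (1 / (\<rho> k - 1) * Q k * (v k \<bullet> z k (N k) + ?h k)) / (1 + ?g k) ^ (n k - N k)) \<longlonglongrightarrow> 0"
  proof (rule Lim_null_comparison)
    show "(\<lambda>k. e k / c0) \<longlonglongrightarrow> 0" using tendsto_divide[OF e(4) tendsto_const[of c0]] c0_pos by simp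
    show "\<forall>\<^sub>F k in sequentially. norm (1 / (1 / (\<rho> k - 1) * Q k * (v k \<bullet> z k (N k) + ?h k)) / (1 + ?g k) ^ (n k - N k)) \<le> e k / c0"
      using N
    proof eventually_elim
      case (elim k)
      let ?Z = "v k \<bullet> z k (N k)"
      have Z: "0 < ?Z" by (rule zpos)
      define x where "x = 1 / (\<rho> k - 1) * Q k * (?Z + ?h k)"
      have D: "0 < x" using tau_pos[of k] Q_pos[of k] Z pos[of k] by (simp add: x_def add_pos_nonneg)
      have "1 / x / (1 + ?g k) ^ (n k - N k) \<le> 1 / x / 1"
        using D pos[of k] by (intro divide_left_mono) (auto simp: one_le_power)
      also have "\<dots> = (\<rho> k - 1) / (Q k * (?Z + ?h k))" by (simp add: x_def)
      also have "\<dots> \<le> e k * ?Z / (c0 * ?Z)"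
        using elim Q_lo[of k] pos[of k] Z c0_pos tau_pos[of k] by (intro frac_le mult_mono) auto
      also have "\<dots> = e k / c0" using Z by simp
      finally have "norm (1 / x / (1 + ?g k) ^ (n k - N k)) \<le> e k / c0" using D pos[of k] by simp
      then show ?case unfolding x_def .
    qed
  qed
  have B: "(\<lambda>k. Q k * (1 + e3 k) / Q k) \<longlonglongrightarrow> 1" using one_plus_tendsto[OF e(3)] Q_pos by (simp add: less_imp_neq[THEN not_sym])
  have nb: "\<forall>\<^sub>F k in sequentially. 0 < 1 / (\<rho> k - 1)" using tau_pos by simp
  have "(\<lambda>k. 1 / (\<rho> k - 1) * Q k * rbound (\<rho> k - 1) (Q k * (1 + e1 k)) (v k \<bullet> (1 - s k) * (1 + e2 k)) (Q k * (1 + e3 k))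
          (v k \<bullet> z k (N k)) (n k - N k)) \<longlonglongrightarrow> 1 / (0 + 1) - 0"
    by (rule tendsto_rbound[OF nb Q_pos sc(4) sc(2) st B sc(5)]) simp
  then show "(\<lambda>k. 1 / (\<rho> k - 1) * Q k * rbound (\<rho> k - 1) (Q k * (1 + e1 k)) (v k \<bullet> (1 - s k) * (1 + e2 k)) (Q k * (1 + e3 k))
          (v k \<bullet> z k (N k)) (n k - N k)) \<longlonglongrightarrow> 1" by simp
qed

lemma super_growth:
  "filterlim (\<lambda>k. \<rho> k ^ n k) at_top sequentially" "(\<lambda>k. real (n k) * (\<rho> k - 1) / \<rho> k ^ n k) \<longlonglongrightarrow> 0"
proof -
  show "filterlim (\<lambda>k. \<rho> k ^ n k) at_top sequentially"
  proof (rule filterlim_at_top_mono[OF ntau], rule always_eventually, rule allI)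
    fix k show "real (n k) * (\<rho> k - 1) \<le> \<rho> k ^ n k"
      using Bernoulli_inequality[of "\<rho> k - 1" "n k"] tau_pos[of k] by simp
  qed
  show "(\<lambda>k. real (n k) * (\<rho> k - 1) / \<rho> k ^ n k) \<longlonglongrightarrow> 0"
  proof (rule Lim_null_comparison)
    have "(\<lambda>k. 9 * inverse (real (n k) * (\<rho> k - 1))) \<longlonglongrightarrow> 9 * 0"
      by (intro tendsto_intros tendsto_inverse_0_at_top ntau)
    then show "(\<lambda>k. 9 * inverse (real (n k) * (\<rho> k - 1))) \<longlonglongrightarrow> 0" by simp
    have "\<forall>\<^sub>F k in sequentially. 0 < real (n k) * (\<rho> k - 1)"
      using ntau by (rule eventually_compose_filterlim[OF eventually_gt_at_top])
    then show "\<forall>\<^sub>F k in sequentially. norm (real (n k) * (\<rho> k - 1) / \<rho> k ^ n k) \<le> 9 * inverse (real (n k) * (\<rho> k - 1))"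
    proof eventually_elim
      case (elim k)
      define y where "y = real (n k) * (\<rho> k - 1)"
      have "y^2 / 9 \<le> \<rho> k ^ n k" using power_ge_square[of "\<rho> k - 1" "n k"] tau_pos[of k] rho_hi[of k] by (simp add: y_def)
      moreover have y: "0 < y" using elim by (simp add: y_def)
      ultimately have "y / \<rho> k ^ n k \<le> y / (y^2 / 9)" using rho_pos[of k]
        by (intro divide_left_mono mult_pos_pos) auto
      also have "\<dots> = 9 * inverse y" using y by (simp add: power2_eq_square field_simps)
      finally show ?case using elim rho_pos[of k] by (simp add: y_def)
    qed
  qed
qed

lemma super_source_null:
  assumes qT: "(\<lambda>k. Q k * (v k \<bullet> (1 - s k)) / (\<rho> k - 1)^2 * \<rho> k ^ n k) \<longlonglongrightarrow> T"
  shows "(\<lambda>k. Q k * (v k \<bullet> (1 - s k)) / (\<rho> k - 1)^2) \<longlonglongrightarrow> 0"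
proof -
  have "(\<lambda>k. Q k * (v k \<bullet> (1 - s k)) / (\<rho> k - 1)^2 * \<rho> k ^ n k * inverse (\<rho> k ^ n k)) \<longlonglongrightarrow> T * 0"
    by (intro tendsto_mult qT tendsto_inverse_0_at_top super_growth(1))
  moreover have "x * \<rho> k ^ n k * inverse (\<rho> k ^ n k) = x" for x k using rho_pos[of k] by simp
  ultimately show ?thesis by (simp only: mult_zero_right)
qed

text \<open>The shift is of order source / (\<open>\<rho>\<close> - 1), that is T
  \<open>\<rho>^(-n)\<close> on the scale of the positive fixed point, and n steps multiply it by
  about \<open>\<rho>^n\<close>; hence 1/T remains from the start. The condition \<open>A\<close>
  makes the value after the burn-in negligible against the shift.\<close>

lemma super_limit_from_zero:
  assumes qT: "(\<lambda>k. Q k * (v k \<bullet> (1 - s k)) / (\<rho> k - 1)^2 * \<rho> k ^ n k) \<longlonglongrightarrow> T" and T: "T > 0"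
    and start: "\<And>N. \<exists>c. \<forall>k. v k \<bullet> z k N \<le> c * (v k \<bullet> (1 - s k))" and spos: "\<And>k. 0 < v k \<bullet> (1 - s k)"
  shows "(\<lambda>k. 1 / (\<rho> k - 1) * Q k * (v k \<bullet> z k (n k))) \<longlonglongrightarrow> 1 / (1 / T + 1)"
proof (rule riccati_limit[OF r zpos sig n, where A = "\<lambda>e N k. real N * (\<rho> k - 1) \<le> e \<and> (\<rho> k - 1) * (v k \<bullet> z k N) \<le> e * (v k \<bullet> (1 - s k))"])
  show "\<forall>\<^sub>F k in sequentially. 0 < 1 / (\<rho> k - 1)" using tau_pos by simp
  fix e :: real and N assume e: "e > 0"
  obtain c where c: "\<And>k. v k \<bullet> z k N \<le> c * (v k \<bullet> (1 - s k))" using start[of N] by blast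
  have "(\<lambda>k. real N * (\<rho> k - 1)) \<longlonglongrightarrow> real N * 0" by (intro tendsto_intros tau_lim)
  then have 1: "\<forall>\<^sub>F k in sequentially. real N * (\<rho> k - 1) < e" using e by (intro order_tendstoD(2)) auto
  have "(\<lambda>k. c * (\<rho> k - 1)) \<longlonglongrightarrow> c * 0" by (intro tendsto_intros tau_lim)
  then have 2: "\<forall>\<^sub>F k in sequentially. c * (\<rho> k - 1) < e" using e by (intro order_tendstoD(2)) auto
  show "\<forall>\<^sub>F k in sequentially. real N * (\<rho> k - 1) \<le> e \<and> (\<rho> k - 1) * (v k \<bullet> z k N) \<le> e * (v k \<bullet> (1 - s k))"
    using 1 2
  proof eventually_elim
    case (elim k)
    have "(\<rho> k - 1) * (v k \<bullet> z k N) \<le> (\<rho> k - 1) * (c * (v k \<bullet> (1 - s k)))"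
      using tau_pos[of k] by (intro mult_left_mono c) auto
    also have "\<dots> = c * (\<rho> k - 1) * (v k \<bullet> (1 - s k))" by simp
    also have "\<dots> \<le> e * (v k \<bullet> (1 - s k))" using elim spos[of k] by (intro mult_right_mono) auto
    finally show ?case using elim by simp
  qed
next
  fix e1 e2 e3 e :: "nat \<Rightarrow> real" and N
  assume e: "e1 \<longlonglongrightarrow> 0" "e2 \<longlonglongrightarrow> 0" "e3 \<longlonglongrightarrow> 0" "e \<longlonglongrightarrow> 0" "\<forall>k. 0 < e k \<and> -1 < e1 k \<and> -1 < e2 k"
    and N: "\<forall>\<^sub>F k in sequentially. N k \<le> n k \<and> real (N k) * (\<rho> k - 1) \<le> e k \<and> (\<rho> k - 1) * (v k \<bullet> z k (N k)) \<le> e k * (v k \<bullet> (1 - s k))"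
  have e12: "\<forall>k. -1 < e1 k \<and> -1 < e2 k" using e(5) by blast
  have N1: "\<forall>\<^sub>F k in sequentially. N k \<le> n k \<and> real (N k) * (\<rho> k - 1) \<le> e k" using N by eventually_elim blast
  note sc = super_scaling[OF super_source_null[OF qT] e(1,2) e12 e(4) N1]
  note o = one_plus_tendsto[OF e(1)] one_plus_tendsto[OF e(2)]
  define g where "g k = rgap (\<rho> k - 1) (Q k * (1 + e1 k)) (v k \<bullet> (1 - s k) * (1 + e2 k))" for k
  define h where "h k = rshift (\<rho> k - 1) (Q k * (1 + e1 k)) (v k \<bullet> (1 - s k) * (1 + e2 k))" for k
  define q where "q k = Q k * (v k \<bullet> (1 - s k)) / (\<rho> k - 1)^2" for k
  define f where "f k = (1 + e1 k) * (1 + e2 k)" for k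
  note sc = sc[folded g_def h_def q_def, folded f_def]
  have pos: "0 < g k" for k using sc(3)[of k] tau_pos[of k] by linarith
  have f1: "f \<longlonglongrightarrow> 1" using tendsto_mult[OF o] by (simp add: f_def[abs_def])
  \<comment> \<open>The difference of squares avoids the cancellation between \<open>g\<close> and
    \<open>\<rho> - 1\<close> and shows that \<open>g - (\<rho> - 1)\<close> is proportional to the
    source.\<close>
  have gq: "g k / (\<rho> k - 1) - 1 = 4 * (q k * f k) / (g k / (\<rho> k - 1) + 1)" for k
  proof -
    have "(g k / (\<rho> k - 1) - 1) * (g k / (\<rho> k - 1) + 1) = (g k / (\<rho> k - 1))^2 - 1" by (simp add: power2_eq_square algebra_simps)
    also have "\<dots> = 4 * (q k * f k)" unfolding sc(6) by simp
    finally have *: "(g k / (\<rho> k - 1) - 1) * (g k / (\<rho> k - 1) + 1) = 4 * (q k * f k)" .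
    have "0 < g k / (\<rho> k - 1) + 1" using pos[of k] tau_pos[of k] by (simp add: add_pos_pos)
    then show ?thesis using * by (simp add: eq_divide_eq)
  qed
  have h_eq: "1 / (\<rho> k - 1) * Q k * h k = (g k / (\<rho> k - 1) - 1) / (2 * (1 + e1 k))" for k
    unfolding h_def rshift_pert g_def[symmetric] using diff_quotient(1)[of "\<rho> k - 1" "g k"] tau_pos[of k] by simp
  have "(\<lambda>k. 4 * ((q k * \<rho> k ^ n k) * f k) / (g k / (\<rho> k - 1) + 1) / (2 * (1 + e1 k))) \<longlonglongrightarrow> 4 * (T * 1) / (1 + 1) / (2 * 1)"
    by (intro tendsto_intros qT[folded q_def] f1 sc(1) o) auto
  moreover have "4 * ((q k * \<rho> k ^ n k) * f k) / (g k / (\<rho> k - 1) + 1) / (2 * (1 + e1 k)) = \<rho> k ^ n k * (1 / (\<rho> k - 1) * Q k * h k)" for k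
    unfolding h_eq gq by simp
  ultimately have hT: "(\<lambda>k. \<rho> k ^ n k * (1 / (\<rho> k - 1) * Q k * h k)) \<longlonglongrightarrow> T" by simp
  have zT: "(\<lambda>k. \<rho> k ^ n k * (1 / (\<rho> k - 1) * Q k * (v k \<bullet> z k (N k)))) \<longlonglongrightarrow> 0"
  proof (rule Lim_null_comparison)
    have "(\<lambda>k. e k * (q k * \<rho> k ^ n k)) \<longlonglongrightarrow> 0 * T" by (intro tendsto_mult e qT[folded q_def])
    then show "(\<lambda>k. e k * (q k * \<rho> k ^ n k)) \<longlonglongrightarrow> 0" by simp
    show "\<forall>\<^sub>F k in sequentially. norm (\<rho> k ^ n k * (1 / (\<rho> k - 1) * Q k * (v k \<bullet> z k (N k)))) \<le> e k * (q k * \<rho> k ^ n k)"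
      using N
    proof eventually_elim
      case (elim k)
      have "(v k \<bullet> z k (N k)) / (\<rho> k - 1) \<le> e k * (v k \<bullet> (1 - s k)) / (\<rho> k - 1)^2"
        using elim tau_pos[of k] by (simp add: power2_eq_square divide_le_eq pos_le_divide_eq mult_ac)
      then have 1: "\<rho> k ^ n k * Q k * ((v k \<bullet> z k (N k)) / (\<rho> k - 1)) \<le> \<rho> k ^ n k * Q k * (e k * (v k \<bullet> (1 - s k)) / (\<rho> k - 1)^2)"
        using Q_pos[of k] rho_pos[of k] by (intro mult_left_mono) auto
      have 2: "0 \<le> \<rho> k ^ n k * Q k * ((v k \<bullet> z k (N k)) / (\<rho> k - 1))"
        using Q_pos[of k] rho_pos[of k] zpos[of k "N k"] tau_pos[of k] by simp
      have 3: "\<rho> k ^ n k * (1 / (\<rho> k - 1) * Q k * (v k \<bullet> z k (N k))) = \<rho> k ^ n k * Q k * ((v k \<bullet> z k (N k)) / (\<rho> k - 1))"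
        "\<rho> k ^ n k * Q k * (e k * (v k \<bullet> (1 - s k)) / (\<rho> k - 1)^2) = e k * (q k * \<rho> k ^ n k)"
        by (simp_all add: q_def mult_ac)
      show ?case unfolding 3(1) real_norm_def abs_of_nonneg[OF 2] using 1 3(2) by linarith
    qed
  qed
  have sum: "(\<lambda>k. \<rho> k ^ n k * (1 / (\<rho> k - 1) * Q k * (v k \<bullet> z k (N k) + h k))) \<longlonglongrightarrow> T"
    using tendsto_add[OF zT hT] by (simp add: distrib_left)
  have pwN: "(\<lambda>k. (1 + g k) ^ N k) \<longlonglongrightarrow> exp 0"
  proof (rule tendsto_one_plus_power)
    show "0 \<le> g k" for k using pos[of k] by simp
    show "g \<longlonglongrightarrow> 0" by (rule sc(2))
    have "(\<lambda>k. real (N k) * (\<rho> k - 1)) \<longlonglongrightarrow> 0"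
    proof (rule Lim_null_comparison[OF _ e(4)])
      show "\<forall>\<^sub>F k in sequentially. norm (real (N k) * (\<rho> k - 1)) \<le> e k"
        using N by eventually_elim (use tau_pos in \<open>simp add: abs_mult less_imp_le\<close>)
    qed
    from tendsto_mult[OF this sc(1)] show "(\<lambda>k. real (N k) * g k) \<longlonglongrightarrow> 0" using tau_pos by (simp add: less_imp_neq[THEN not_sym])
  qed
  \<comment> \<open>\<open>(1 + g)^n\<close> and \<open>\<rho>^n\<close> are asymptotic although n
    (\<open>\<rho>\<close> - 1) is unbounded: n (g - (\<open>\<rho>\<close> - 1)) is of order n
    (\<open>\<rho>\<close> - 1) / \<open>\<rho>^n\<close>, which tends to zero.\<close>
  have pwn: "(\<lambda>k. (1 + (g k - (\<rho> k - 1)) / \<rho> k) ^ n k) \<longlonglongrightarrow> exp 0"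
  proof (rule tendsto_one_plus_power)
    show "0 \<le> (g k - (\<rho> k - 1)) / \<rho> k" for k using sc(3)[of k] rho_pos[of k] by simp
    have "(\<lambda>k. (g k - (\<rho> k - 1)) / \<rho> k) \<longlonglongrightarrow> (0 - 0) / 1" by (intro tendsto_divide tendsto_diff sc(2) tau_lim rho_lim) simp
    then show "(\<lambda>k. (g k - (\<rho> k - 1)) / \<rho> k) \<longlonglongrightarrow> 0" by simp
    have "(\<lambda>k. (real (n k) * (\<rho> k - 1) / \<rho> k ^ n k) * (4 * ((q k * \<rho> k ^ n k) * f k) / (g k / (\<rho> k - 1) + 1)) / \<rho> k) \<longlonglongrightarrow> 0 * (4 * (T * 1) / (1 + 1)) / 1"
      by (intro tendsto_intros super_growth(2) qT[folded q_def] f1 sc(1) rho_lim) auto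
    moreover have "(real (n k) * (\<rho> k - 1) / \<rho> k ^ n k) * (4 * ((q k * \<rho> k ^ n k) * f k) / (g k / (\<rho> k - 1) + 1)) / \<rho> k
        = real (n k) * ((g k - (\<rho> k - 1)) / \<rho> k)" for k
    proof -
      have "(real (n k) * (\<rho> k - 1) / \<rho> k ^ n k) * (4 * ((q k * \<rho> k ^ n k) * f k) / (g k / (\<rho> k - 1) + 1))
         = real (n k) * (\<rho> k - 1) * (4 * (q k * f k) / (g k / (\<rho> k - 1) + 1))" using rho_pos[of k] by simp
      also have "\<dots> = real (n k) * (g k - (\<rho> k - 1))" unfolding gq[symmetric] using diff_quotient(2)[of "\<rho> k - 1" "g k"] tau_pos[of k] by (simp add: mult.assoc)
      finally show ?thesis by simp
    qed
    ultimately show "(\<lambda>k. real (n k) * ((g k - (\<rho> k - 1)) / \<rho> k)) \<longlonglongrightarrow> 0" by simp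
  qed
  have "(\<lambda>k. 1 / (\<rho> k ^ n k * (1 / (\<rho> k - 1) * Q k * (v k \<bullet> z k (N k) + h k))) / ((1 + (g k - (\<rho> k - 1)) / \<rho> k) ^ n k / (1 + g k) ^ N k))
     \<longlonglongrightarrow> 1 / T / (exp 0 / exp 0)"
    by (intro tendsto_intros sum pwn pwN) (use T in auto)
  then have st0: "(\<lambda>k. 1 / (\<rho> k ^ n k * (1 / (\<rho> k - 1) * Q k * (v k \<bullet> z k (N k) + h k))) / ((1 + (g k - (\<rho> k - 1)) / \<rho> k) ^ n k / (1 + g k) ^ N k))
     \<longlonglongrightarrow> 1 / T" by simp
  have st: "(\<lambda>k. 1 / (1 / (\<rho> k - 1) * Q k * (v k \<bullet> z k (N k) + h k)) / (1 + g k) ^ (n k - N k)) \<longlonglongrightarrow> 1 / T"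
  proof (rule Lim_transform_eventually[OF st0])
    show "\<forall>\<^sub>F k in sequentially. 1 / (\<rho> k ^ n k * (1 / (\<rho> k - 1) * Q k * (v k \<bullet> z k (N k) + h k))) / ((1 + (g k - (\<rho> k - 1)) / \<rho> k) ^ n k / (1 + g k) ^ N k)
      = 1 / (1 / (\<rho> k - 1) * Q k * (v k \<bullet> z k (N k) + h k)) / (1 + g k) ^ (n k - N k)"
      using N
    proof eventually_elim
      case (elim k)
      have a: "1 + (g k - (\<rho> k - 1)) / \<rho> k = (1 + g k) / \<rho> k" using rho_pos[of k] by (simp add: field_simps)
      have b: "(1 + g k) ^ n k = (1 + g k) ^ N k * (1 + g k) ^ (n k - N k)" using elim by (simp flip: power_add)
      have R: "\<rho> k ^ n k \<noteq> 0" "(1 + g k) ^ N k \<noteq> 0" using rho_pos[of k] pos[of k] by auto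
      have "((1 + g k) / \<rho> k) ^ n k / (1 + g k) ^ N k = (1 + g k) ^ (n k - N k) / \<rho> k ^ n k"
        unfolding power_divide b using R by simp
      then show ?case unfolding a using R by simp
    qed
  qed
  have B: "(\<lambda>k. Q k * (1 + e3 k) / Q k) \<longlonglongrightarrow> 1" using one_plus_tendsto[OF e(3)] Q_pos by (simp add: less_imp_neq[THEN not_sym])
  have nb: "\<forall>\<^sub>F k in sequentially. 0 < 1 / (\<rho> k - 1)" using tau_pos by simp
  have "1 / T + 1 \<noteq> 0" using T by (smt (verit) divide_pos_pos)
  then have "(\<lambda>k. 1 / (\<rho> k - 1) * Q k * rbound (\<rho> k - 1) (Q k * (1 + e1 k)) (v k \<bullet> (1 - s k) * (1 + e2 k)) (Q k * (1 + e3 k))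
          (v k \<bullet> z k (N k)) (n k - N k)) \<longlonglongrightarrow> 1 / (1 / T + 1) - 0"
    by (intro tendsto_rbound[OF nb Q_pos sc(4)[unfolded h_def] sc(2)[unfolded g_def] st[unfolded g_def h_def] B sc(5)[unfolded g_def]])
  then show "(\<lambda>k. 1 / (\<rho> k - 1) * Q k * rbound (\<rho> k - 1) (Q k * (1 + e1 k)) (v k \<bullet> (1 - s k) * (1 + e2 k)) (Q k * (1 + e3 k))
          (v k \<bullet> z k (N k)) (n k - N k)) \<longlonglongrightarrow> 1 / (1 / T + 1)" by simp
qed

end

end

section \<open>Strongly subcritical limits\<close>

lemma tendsto_one_minus_power:
  fixes t :: "nat \<Rightarrow> real" and l :: "nat \<Rightarrow> nat"
  assumes t: "\<forall>\<^sub>F k in sequentially. 0 \<le> t k" "t \<longlonglongrightarrow> 0" and lt: "(\<lambda>k. real (l k) * t k) \<longlonglongrightarrow> T"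
  shows "(\<lambda>k. (1 - t k) ^ l k) \<longlonglongrightarrow> exp (- T)"
proof -
  have half: "\<forall>\<^sub>F k in sequentially. t k < 1/2" using t(2) by (rule order_tendstoD) simp
  have "(\<lambda>k. real (l k) * ln (1 - t k)) \<longlonglongrightarrow> - T"
  proof (rule tendsto_sandwich)
    show "\<forall>\<^sub>F k in sequentially. - (real (l k) * t k) - 2 * (real (l k) * t k * t k) \<le> real (l k) * ln (1 - t k)"
      using t(1) half
    proof eventually_elim
      case (elim k)
      have "- t k - 2 * (t k)^2 \<le> ln (1 - t k)" using elim by (intro ln_one_minus_pos_lower_bound) auto
      then have "real (l k) * (- t k - 2 * (t k)^2) \<le> real (l k) * ln (1 - t k)" by (intro mult_left_mono) auto
      then show ?case by (simp add: power2_eq_square algebra_simps)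
    qed
    show "\<forall>\<^sub>F k in sequentially. real (l k) * ln (1 - t k) \<le> - (real (l k) * t k)"
      using half
    proof eventually_elim
      case (elim k)
      have "ln (1 - t k) \<le> - t k" using ln_le_minus_one[of "1 - t k"] elim by simp
      then have "real (l k) * ln (1 - t k) \<le> real (l k) * (- t k)" by (intro mult_left_mono) auto
      then show ?case by simp
    qed
    have "(\<lambda>k. - (real (l k) * t k) - 2 * (real (l k) * t k * t k)) \<longlonglongrightarrow> - T - 2 * (T * 0)"
      by (intro tendsto_intros lt t(2))
    then show "(\<lambda>k. - (real (l k) * t k) - 2 * (real (l k) * t k * t k)) \<longlonglongrightarrow> - T" by simp
    show "(\<lambda>k. - (real (l k) * t k)) \<longlonglongrightarrow> - T" by (intro tendsto_intros lt)
  qed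
  from tendsto_exp[OF this] show ?thesis
  proof (rule Lim_transform_eventually)
    show "\<forall>\<^sub>F k in sequentially. exp (real (l k) * ln (1 - t k)) = (1 - t k) ^ l k"
      using half by eventually_elim (simp add: exp_of_nat_mult)
  qed
qed

context near_critical
begin

text \<open>The one-step delay allows a bound for all m, also below U, where survival is still of
  order one. The next iterate, which is G of the present one, can thus absorb a defect proportional
  to the present projection.\<close>

lemma survival_comparable:
  obtains c where "c > 0" "\<And>k m j. c * (v k \<bullet> traj k 1 1 m) \<le> traj k 1 1 (Suc m) $ j"
proof -
  obtain c1 where c1: "c1 > 0" "\<And>k s m j. s \<in> cube \<Longrightarrow> U \<le> m \<Longrightarrow> c1 * (v k \<bullet> traj k s 1 m) \<le> traj k s 1 m $ j"
    by (rule y_comparable) (rule that; assumption)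
  obtain c2 where c2: "c2 > 0" "\<And>k x. x \<in> cube \<Longrightarrow> c2 * (v k \<bullet> x) \<le> v k \<bullet> G k x"
    by (rule G_ip_lower) (rule that; assumption)
  obtain c3 where c3: "c3 > 0" "\<And>k. c3 \<le> v k \<bullet> traj k 1 1 U" using survival_lower[of U] by blast
  define c where "c = min (c1 * c2) (c1 * c3 / Cd)"
  have c: "c > 0" using c1 c2 c3 Cd_pos by (simp add: c_def)
  show thesis
  proof (rule that[OF c])
    fix k m j
    have W: "0 \<le> v k \<bullet> traj k 1 1 m" "v k \<bullet> traj k 1 1 m \<le> Cd"
      using traj_cube[OF one_cube one_cube, of k m] by (auto intro: ip_nonneg cubeD ip_cube_le)
    show "c * (v k \<bullet> traj k 1 1 m) \<le> traj k 1 1 (Suc m) $ j"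
    proof (cases "U \<le> Suc m")
      case True
      have "c * (v k \<bullet> traj k 1 1 m) \<le> c1 * c2 * (v k \<bullet> traj k 1 1 m)" using W by (intro mult_right_mono) (auto simp: c_def)
      also have "\<dots> \<le> c1 * (v k \<bullet> traj k 1 1 (Suc m))"
        using mult_left_mono[OF c2(2)[OF traj_cube[OF one_cube one_cube], of k k m], of c1] c1 by (simp add: traj_Suc mult.assoc)
      also have "\<dots> \<le> traj k 1 1 (Suc m) $ j" by (rule c1(2)[OF one_cube True])
      finally show ?thesis .
    next
      case False
      have "c * (v k \<bullet> traj k 1 1 m) \<le> c1 * c3 / Cd * Cd" using W c c1 c3 Cd_pos by (intro mult_mono) (auto simp: c_def)
      also have "\<dots> = c1 * c3" using Cd_pos by simp
      also have "\<dots> \<le> c1 * (v k \<bullet> traj k 1 1 U)" using c1 c3 by (intro mult_left_mono) auto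
      also have "\<dots> \<le> traj k 1 1 U $ j" by (rule c1(2)[OF one_cube]) simp
      also have "\<dots> \<le> traj k 1 1 (Suc m) $ j" using y_antimono[OF one_cube, of "Suc m" U k] False by (simp add: less_eq_vec_def)
      finally show ?thesis .
    qed
  qed
qed

lemma survival_pos: "0 < v k \<bullet> traj k 1 1 m"
  using survival_lower[of m] by (meson less_le_trans)

text \<open>One factor c0 is lost in passing from the deviation to a coordinate, another in dividing
  by the coordinate of u; hence \<open>c0^2\<close> in \<open>e'\<close>.\<close>

lemma align_comp:
  assumes pos: "\<forall>\<^sub>F k in sequentially. 0 < v k \<bullet> z k"
    and al: "\<And>e. e > 0 \<Longrightarrow> \<forall>\<^sub>F k in sequentially. dev k (z k) \<le> e * (v k \<bullet> z k)"
  shows "(\<lambda>k. z k $ j / ((v k \<bullet> z k) * u k $ j)) \<longlonglongrightarrow> 1"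
  unfolding tendsto_iff
proof (intro allI impI)
  fix e :: real assume e: "e > 0"
  define e' where "e' = e * c0^2 / 2"
  have e': "0 < e'" using e c0_pos by (simp add: e'_def)
  show "\<forall>\<^sub>F k in sequentially. dist (z k $ j / ((v k \<bullet> z k) * u k $ j)) 1 < e"
    using pos al[OF e']
  proof eventually_elim
    case (elim k)
    define Z where "Z = v k \<bullet> z k"
    have Z: "0 < Z * u k $ j" using elim u_pos by (simp add: Z_def)
    have "b \<noteq> 0 \<Longrightarrow> x / b - 1 = (x - b) / b" for x b :: real by (simp add: diff_divide_distrib)
    from this[of "Z * u k $ j" "z k $ j"] Z
    have "z k $ j / (Z * u k $ j) - 1 = (z k $ j - Z * u k $ j) / (Z * u k $ j)" by (metis less_irrefl)
    then have "\<bar>z k $ j / (Z * u k $ j) - 1\<bar> = \<bar>z k $ j - Z * u k $ j\<bar> / (Z * u k $ j)" using Z by simp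
    also have "\<dots> \<le> (e' * Z / c0) / (Z * c0)"
    proof (intro frac_le)
      show "\<bar>z k $ j - Z * u k $ j\<bar> \<le> e' * Z / c0"
        using dev_comp[where x = "z k" and j = j and k = k] elim c0_pos unfolding Z_def
        by (meson divide_right_mono less_imp_le order_trans)
      show "Z * c0 \<le> Z * u k $ j" using elim u_lo by (intro mult_left_mono) (auto simp: Z_def)
    qed (use elim c0_pos e' in \<open>auto simp: Z_def\<close>)
    also have "\<dots> = e / 2" using elim c0_pos by (simp add: e'_def Z_def power2_eq_square)
    finally show ?case using e by (simp add: dist_real_def Z_def)
  qed
qed

lemma regular_comp:
  assumes r: "regular s z" and zpos: "\<And>k m. 0 < v k \<bullet> z k m" and n: "filterlim n at_top sequentially"
  shows "(\<lambda>k. z k (n k) $ j / ((v k \<bullet> z k (n k)) * u k $ j)) \<longlonglongrightarrow> 1"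
proof (rule align_comp)
  show "\<forall>\<^sub>F k in sequentially. 0 < v k \<bullet> z k (n k)" using zpos by simp
  fix e :: real assume "e > 0"
  from regular_alignment[OF r this] obtain N where N: "\<forall>\<^sub>F k in sequentially. \<forall>m\<ge>N. dev k (z k m) \<le> e * (v k \<bullet> z k m)" by blast
  show "\<forall>\<^sub>F k in sequentially. dev k (z k (n k)) \<le> e * (v k \<bullet> z k (n k))"
    using N eventually_compose_filterlim[OF eventually_ge_at_top[of N] n] by eventually_elim blast
qed

text \<open>The difference \<open>\<delta> = y - x\<close> of the two trajectories carries the Laplace transform on survival.\<close>

definition gap :: "nat \<Rightarrow> real^'d \<Rightarrow> nat \<Rightarrow> real^'d" where
  "gap k s m = traj k s 1 m - traj k s (1 - s) m"

context
  fixes s :: "real^'d" assumes s: "s \<in> cube"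
begin

lemma y_split: "traj k s 1 m = traj k s (1 - s) m + gap k s m"
  by (simp add: gap_def)

lemma gap_nonneg: "0 \<le> gap k s m"
  using x_le_y[OF s, of k m] by (simp add: gap_def less_eq_vec_def)

lemma xy_cube: "traj k s 1 m \<in> cube" "traj k s (1 - s) m \<in> cube"
  by (intro traj_cube s one_cube one_minus_cube)+

lemma gap_cube: "gap k s m \<in> cube"
proof -
  have "gap k s m $ i \<le> 1" for i
  proof -
    have "traj k s 1 m $ i \<le> 1" "0 \<le> traj k s (1 - s) m $ i" using xy_cube[of k m] by (auto simp: cube_def)
    then show ?thesis by (simp add: gap_def)
  qed
  then show ?thesis using gap_nonneg[of k m] by (simp add: cube_def less_eq_vec_def)
qed

text \<open>The source cancels in the difference and survives only as the factor
  \<open>s\<close>.\<close>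

lemma gap_Suc: "gap k s (Suc m) = s * (G k (traj k s (1 - s) m + gap k s m) - G k (traj k s (1 - s) m))"
  by (simp add: gap_def traj_Suc step_def vec_eq_iff algebra_simps)

lemma mixed_args: "0 \<le> traj k s (1 - s) m" "0 \<le> gap k s m" "traj k s (1 - s) m + gap k s m \<le> 1"
  using xy_cube[of k m] gap_nonneg[of k m] by (auto simp: y_split[symmetric] cubeD)

lemma increment_bounds:
  "0 \<le> G k (traj k s (1 - s) m + gap k s m) - G k (traj k s (1 - s) m)"
  "G k (traj k s (1 - s) m + gap k s m) - G k (traj k s (1 - s) m) \<le> G k (gap k s m)"
proof -
  have "traj k s (1 - s) m \<le> traj k s (1 - s) m + gap k s m" using gap_nonneg[of k m] by (simp add: less_eq_vec_def)
  then have "G k (traj k s (1 - s) m) \<le> G k (traj k s (1 - s) m + gap k s m)"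
    by (intro G_mono mixed_args)
  then show "0 \<le> G k (traj k s (1 - s) m + gap k s m) - G k (traj k s (1 - s) m)" by (simp add: less_eq_vec_def)
  show "G k (traj k s (1 - s) m + gap k s m) - G k (traj k s (1 - s) m) \<le> G k (gap k s m)"
    using G_sub[OF mixed_args, of k k m] by (simp add: less_eq_vec_def algebra_simps)
qed

text \<open>An increment of G is at most G of the increment, so the difference obeys the survival
  recursion as an inequality.\<close>

lemma gap_le_survival: "gap k s m \<le> traj k 1 1 m"
proof (induction m)
  case 0
  then show ?case using s by (simp add: gap_def cubeD)
next
  case (Suc m)
  let ?I = "G k (traj k s (1 - s) m + gap k s m) - G k (traj k s (1 - s) m)"
  have "gap k s (Suc m) \<le> ?I"
    using increment_bounds(1)[of k m] s unfolding gap_Suc less_eq_vec_def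
    by (auto simp: cube_def intro!: mult_left_le_one_le)
  also have "\<dots> \<le> G k (gap k s m)" by (rule increment_bounds)
  also have "\<dots> \<le> G k (traj k 1 1 m)"
    using Suc traj_cube[OF one_cube one_cube, of k m] by (intro G_mono gap_nonneg) (auto intro: cubeD)
  finally show ?case by (simp add: traj_Suc)
qed

lemma one_minus_s_le: "1 - s $ j \<le> (v k \<bullet> (1 - s)) / c0"
  using comp_le[of "1 - s" j k] s by (simp add: cubeD one_minus_cube)

text \<open>The new difference is \<open>M d\<close> minus three nonnegative terms: the defect of
  \<open>d\<close> itself, the subadditivity defect of \<open>x\<close> and \<open>d\<close>, and
  the loss through \<open>1 - s\<close>. Only the second matters to leading order; by alignment its
  projection is 2 Q times those of \<open>x\<close> and \<open>d\<close>.\<close>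

lemma gap_step_vn: "vn k (gap k s (Suc m) - M k *v gap k s m)
   \<le> (C2 * (v k \<bullet> gap k s m) + C2 * (v k \<bullet> traj k s (1 - s) m) + 2 * (v k \<bullet> (1 - s)) / c0) * (v k \<bullet> gap k s m)"
  and gap_step: "\<bar>v k \<bullet> gap k s (Suc m) - (\<rho> k - 2 * Q k * (v k \<bullet> traj k s (1 - s) m)) * (v k \<bullet> gap k s m)\<bar>
   \<le> 2 * (v k \<bullet> (1 - s)) / c0 * (v k \<bullet> gap k s m) + C2 * (v k \<bullet> gap k s m)^2
     + C * ((v k \<bullet> traj k s (1 - s) m) * (v k \<bullet> gap k s m) * (v k \<bullet> traj k s (1 - s) m + v k \<bullet> gap k s m))
     + C * (dev k (traj k s (1 - s) m) * (v k \<bullet> gap k s m) + (v k \<bullet> traj k s (1 - s) m) * dev k (gap k s m))"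
proof -
  define x where "x = traj k s (1 - s) m"
  define d where "d = gap k s m"
  define X where "X = v k \<bullet> x"
  define V where "V = v k \<bullet> d"
  have xd: "0 \<le> x" "0 \<le> d" "x + d \<le> 1" unfolding x_def d_def by (rule mixed_args)+
  have dc: "d \<in> cube" unfolding d_def by (rule gap_cube)
  have XV: "0 \<le> X" "0 \<le> V" using xd by (auto simp: X_def V_def intro: ip_nonneg)
  define D where "D = G k x + G k d - G k (x + d)"
  have D: "0 \<le> D" using G_sub[OF xd, of k] by (simp add: D_def less_eq_vec_def)
  have vD: "v k \<bullet> D \<le> C2 * X * V"
    using ip_const_le[of D "C * (X * V)" k] G_mix1[OF xd] XV C_ge1 by (simp add: D_def X_def V_def C2_def mult_ac)
  define I where "I = G k (x + d) - G k x"
  have I: "0 \<le> I" "I \<le> G k d" using increment_bounds[of k m] by (auto simp: I_def x_def d_def)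
  have vI: "v k \<bullet> I \<le> 2 * V"
  proof -
    have "v k \<bullet> I \<le> v k \<bullet> (M k *v d)" using I(2) G_lin[OF dc, of k] by (intro ip_mono) (rule order_trans)
    also have "\<dots> \<le> 2 * V" unfolding v_M V_def[symmetric] using rho_hi XV by (intro mult_right_mono)
    finally show ?thesis .
  qed
  have sI: "0 \<le> (1 - s) * I" using I(1) s by (auto simp: less_eq_vec_def cube_def)
  have vsI: "v k \<bullet> ((1 - s) * I) \<le> 2 * (v k \<bullet> (1 - s)) / c0 * V"
  proof -
    have "v k \<bullet> (I * (1 - s)) \<le> (v k \<bullet> (1 - s)) / c0 * (v k \<bullet> I)"
      by (rule ip_mult_le[OF I(1)]) (use one_minus_s_le in simp)
    also have "\<dots> \<le> (v k \<bullet> (1 - s)) / c0 * (2 * V)"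
      using vI c0_pos s by (intro mult_left_mono divide_nonneg_nonneg ip_nonneg) (auto intro: cubeD one_minus_cube)
    finally show ?thesis by (simp add: mult.commute)
  qed
  have Nd: "0 \<le> M k *v d - G k d" "v k \<bullet> (M k *v d - G k d) \<le> C2 * V^2"
    using defect_bounds[OF dc, of k] by (auto simp: V_def)
  have eq: "gap k s (Suc m) = M k *v d - ((M k *v d - G k d) + D + (1 - s) * I)"
    unfolding gap_Suc x_def[symmetric] d_def[symmetric]
    by (simp add: D_def I_def vec_eq_iff algebra_simps)
  have "vn k (gap k s (Suc m) - M k *v d) = v k \<bullet> ((M k *v d - G k d) + D + (1 - s) * I)"
  proof -
    have "gap k s (Suc m) - M k *v d = - ((M k *v d - G k d) + D + (1 - s) * I)" unfolding eq by simp
    moreover have "0 \<le> (M k *v d - G k d) + D + (1 - s) * I" using Nd(1) D sI by (auto simp: less_eq_vec_def)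
    ultimately show ?thesis by (simp only: vn_minus vn_eq)
  qed
  also have "\<dots> \<le> C2 * V^2 + C2 * X * V + 2 * (v k \<bullet> (1 - s)) / c0 * V"
    unfolding inner_add_right using Nd(2) vD vsI by linarith
  also have "\<dots> = (C2 * V + C2 * X + 2 * (v k \<bullet> (1 - s)) / c0) * V" by (simp add: power2_eq_square distrib_right)
  finally show "vn k (gap k s (Suc m) - M k *v gap k s m)
   \<le> (C2 * (v k \<bullet> gap k s m) + C2 * (v k \<bullet> traj k s (1 - s) m) + 2 * (v k \<bullet> (1 - s)) / c0) * (v k \<bullet> gap k s m)"
    by (simp add: d_def V_def X_def x_def)
  have e1: "v k \<bullet> gap k s (Suc m) = \<rho> k * V - v k \<bullet> (M k *v d - G k d) - v k \<bullet> D - v k \<bullet> ((1 - s) * I)"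
    unfolding eq inner_diff_right inner_add_right v_M V_def by simp
  have "\<bar>v k \<bullet> D - bb k x d\<bar> \<le> C * (X * V * (X + V))" using G_mix2[OF xd, of k] by (simp add: D_def X_def V_def)
  moreover have "\<bar>bb k x d - 2 * Q k * X * V\<bar> \<le> C * (dev k x * V + X * dev k d)"
    using bb_align[OF xd(1,2), of k] by (simp add: X_def V_def)
  moreover have "0 \<le> v k \<bullet> (M k *v d - G k d)" "0 \<le> v k \<bullet> ((1 - s) * I)" using Nd(1) sI by (auto intro: ip_nonneg)
  moreover have "(\<rho> k - 2 * Q k * X) * V = \<rho> k * V - 2 * Q k * X * V" by (simp add: left_diff_distrib)
  ultimately have "\<bar>v k \<bullet> gap k s (Suc m) - (\<rho> k - 2 * Q k * X) * V\<bar>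
    \<le> 2 * (v k \<bullet> (1 - s)) / c0 * V + C2 * V^2 + C * (X * V * (X + V)) + C * (dev k x * V + X * dev k d)"
    using Nd(2) vsI unfolding e1 abs_le_iff by linarith
  then show "\<bar>v k \<bullet> gap k s (Suc m) - (\<rho> k - 2 * Q k * (v k \<bullet> traj k s (1 - s) m)) * (v k \<bullet> gap k s m)\<bar>
   \<le> 2 * (v k \<bullet> (1 - s)) / c0 * (v k \<bullet> gap k s m) + C2 * (v k \<bullet> gap k s m)^2
     + C * ((v k \<bullet> traj k s (1 - s) m) * (v k \<bullet> gap k s m) * (v k \<bullet> traj k s (1 - s) m + v k \<bullet> gap k s m))
     + C * (dev k (traj k s (1 - s) m) * (v k \<bullet> gap k s m) + (v k \<bullet> traj k s (1 - s) m) * dev k (gap k s m))"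
    by (simp add: d_def V_def X_def x_def)
qed

end

text \<open>The source enters the step error multiplied by the difference itself, so its smallness
  suffices and no comparison of its size with the difference is involved.\<close>

lemma gap_alignment:
  assumes s: "\<And>k. s k \<in> cube" and sig: "(\<lambda>k. v k \<bullet> (1 - s k)) \<longlonglongrightarrow> 0" and e: "e > 0"
  shows "\<exists>N. \<forall>\<^sub>F k in sequentially. \<forall>m\<ge>N. dev k (gap k (s k) m) \<le> e * (v k \<bullet> gap k (s k) m)"
proof -
  obtain L e' where e': "e' > 0" and L: "\<And>k z. \<forall>i\<le>L. 0 \<le> z i \<Longrightarrow>
     \<forall>i<L. vn k (z (Suc i) - M k *v z i) \<le> e' * (v k \<bullet> z i) \<Longrightarrow> dev k (z L) \<le> e * (v k \<bullet> z L)"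
    by (rule alignment[OF e]) (rule that; assumption)
  define e2 where "e2 = e' / (4 * C2)"
  have e2: "0 < e2" using e' C2_ge1 by (simp add: e2_def)
  obtain N where N: "\<forall>\<^sub>F k in sequentially. \<forall>m\<ge>N. v k \<bullet> traj k (s k) 1 m \<le> e2" using y_small[OF s sig e2] by blast
  have ev: "\<forall>\<^sub>F k in sequentially. v k \<bullet> (1 - s k) < e' * c0 / 4" using e' c0_pos by (intro order_tendstoD(2)[OF sig]) simp
  show ?thesis
  proof (rule exI[of _ "N + L"], use N ev in eventually_elim, intro allI impI)
    fix k m assume *: "\<forall>m\<ge>N. v k \<bullet> traj k (s k) 1 m \<le> e2" "v k \<bullet> (1 - s k) < e' * c0 / 4" and m: "N + L \<le> m"
    have "dev k ((\<lambda>i. gap k (s k) (m - L + i)) L) \<le> e * (v k \<bullet> (\<lambda>i. gap k (s k) (m - L + i)) L)"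
    proof (rule L[where z = "\<lambda>i. gap k (s k) (m - L + i)" and k = k]; intro allI impI)
      fix i show "0 \<le> gap k (s k) (m - L + i)" by (rule gap_nonneg[OF s])
    next
      fix i
      define V where "V = v k \<bullet> gap k (s k) (m - L + i)"
      define X where "X = v k \<bullet> traj k (s k) (1 - s k) (m - L + i)"
      have V: "0 \<le> V" "0 \<le> X" unfolding V_def X_def by (intro ip_nonneg gap_nonneg s cubeD xy_cube)+
      have "X + V = v k \<bullet> traj k (s k) 1 (m - L + i)" unfolding y_split[OF s] by (simp add: V_def X_def inner_add_right)
      then have XV: "X + V \<le> e2" using * m by simp
      have "C2 * V + C2 * X + 2 * (v k \<bullet> (1 - s k)) / c0 \<le> e'"
      proof -
        have "C2 * (X + V) \<le> C2 * e2" using XV C2_ge1 by (intro mult_left_mono) auto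
        also have "\<dots> = e' / 4" using C2_ge1 by (simp add: e2_def)
        finally have "C2 * V + C2 * X \<le> e' / 4" by (simp add: distrib_left)
        moreover have "2 * (v k \<bullet> (1 - s k)) / c0 \<le> e' / 2" using *(2) c0_pos by (simp add: pos_divide_le_eq)
        ultimately show ?thesis using e' by linarith
      qed
      then have "(C2 * V + C2 * X + 2 * (v k \<bullet> (1 - s k)) / c0) * V \<le> e' * V" using V by (intro mult_right_mono) auto
      then show "vn k (gap k (s k) (m - L + Suc i) - M k *v gap k (s k) (m - L + i)) \<le> e' * (v k \<bullet> gap k (s k) (m - L + i))"
        using gap_step_vn[OF s, of k k "m - L + i"] by (simp add: V_def X_def)
    qed
    then show "dev k (gap k (s k) m) \<le> e * (v k \<bullet> gap k (s k) m)" using m by simp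
  qed
qed

end

section \<open>The difference relative to survival in the subcritical range\<close>

context near_critical
begin

text \<open>A lower bound for the survival difference, propagated componentwise: the subadditivity defect
  is controlled by \<open>x\<close> and the concavity of \<open>G\<close> along rays absorbs the accumulated loss.\<close>

lemma gap_lower:
  obtains B where "B > 0" "\<And>k s b m. s \<in> cube \<Longrightarrow> v k \<bullet> (1 - s) \<le> b \<Longrightarrow> \<forall>m. v k \<bullet> traj k s (1 - s) m \<le> b \<Longrightarrow>
     (1 - B * (real m + 1) * b) *\<^sub>R traj k 1 1 m \<le> gap k s m"
proof -
  obtain c where c: "c > 0" "\<And>k m j. c * (v k \<bullet> traj k 1 1 m) \<le> traj k 1 1 (Suc m) $ j"
    by (rule survival_comparable) (rule that; assumption)
  \<comment> \<open>\<open>1 / c0\<close> accounts for the factor \<open>s \<ge> 1 - b / c0\<close>,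
    and \<open>C / c\<close> for the subadditivity defect absorbed by the next survival
    iterate.\<close>
  define B where "B = 1 / c0 + C / c"
  have B: "B > 0" using c0_pos C_ge1 c by (simp add: B_def add_pos_pos)
  show thesis
  proof (rule that[OF B])
    fix k s b m
    assume s: "s \<in> (cube :: (real^'d) set)" and b: "v k \<bullet> (1 - s) \<le> b" "\<forall>m. v k \<bullet> traj k s (1 - s) m \<le> b"
    have b0: "0 \<le> b" using b(1) ip_nonneg[OF cubeD(1)[OF one_minus_cube[OF s]], of k] by linarith
    have s_lo: "1 - b / c0 \<le> s $ j" for j
      using one_minus_s_le[OF s, of j k] b(1) c0_pos divide_right_mono[of "v k \<bullet> (1 - s)" b c0] by simp
    show "(1 - B * (real m + 1) * b) *\<^sub>R traj k 1 1 m \<le> gap k s m"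
    proof (induction m)
      case 0
      have "b / c0 \<le> B * b" using b0 C_ge1 c by (simp add: B_def distrib_right)
      then have "1 - B * b \<le> s $ j" for j using s_lo[of j] by linarith
      then show ?case by (simp add: gap_def less_eq_vec_def)
    next
      case (Suc m)
      define rr where "rr = 1 - B * (real m + 1) * b"
      \<comment> \<open>Once the coefficient is negative the bound is trivial, as the difference is
        nonnegative; until then \<open>rr\<close> lies in [0, 1] and scaling along rays
        applies.\<close>
      show ?case
      proof (cases "1 - B * (real (Suc m) + 1) * b < 0")
        case True
        have "(1 - B * (real (Suc m) + 1) * b) * traj k 1 1 (Suc m) $ j \<le> 0" for j
          using True traj_cube[OF one_cube one_cube, of k "Suc m"] by (intro mult_nonpos_nonneg) (auto simp: cube_def)
        then show ?thesis using gap_nonneg[OF s, of k "Suc m"] unfolding less_eq_vec_def by (auto intro: order_trans)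
      next
        case False
        have BB: "0 \<le> B * (real m + 1) * b" "0 \<le> B * b" using B b0 by auto
        have split: "B * (real (Suc m) + 1) * b = B * (real m + 1) * b + B * b" by (simp add: algebra_simps)
        have rr: "0 \<le> rr" "rr \<le> 1" "B * b \<le> 1" using False BB split by (auto simp: rr_def)
        define D where "D = traj k 1 1 m"
        define x where "x = traj k s (1 - s) m"
        define d where "d = gap k s m"
        define W where "W = v k \<bullet> D"
        define X where "X = v k \<bullet> x"
        have Dc: "D \<in> cube" unfolding D_def by (intro traj_cube one_cube)
        have rD: "0 \<le> rr *\<^sub>R D" "rr *\<^sub>R D \<le> d" using rr Dc Suc
          by (auto simp: less_eq_vec_def cube_def rr_def D_def d_def)
        have xd: "0 \<le> x" "0 \<le> d" "x + d \<le> 1" unfolding x_def d_def by (rule mixed_args[OF s])+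
        have xrD: "x + rr *\<^sub>R D \<le> x + d" using rD(2) by (simp add: less_eq_vec_def)
        note xrD = xrD order_trans[OF xrD xd(3)]
        have X: "0 \<le> X" "X \<le> b" using xd b(2) by (auto simp: X_def x_def intro: ip_nonneg)
        have W: "0 \<le> W" using Dc by (auto simp: W_def intro: ip_nonneg cubeD)
        have xrD0: "0 \<le> x + rr *\<^sub>R D" using xd(1) rD(1) by (auto simp: less_eq_vec_def intro: add_nonneg_nonneg)
        have "(1 - B * (real (Suc m) + 1) * b) * G k D $ j \<le> gap k s (Suc m) $ j" for j
        proof -
          have GD: "0 \<le> G k D $ j" using G_nth_bounds[OF Dc] by simp
          have "c * W \<le> G k D $ j" using c(2)[of k m j] by (simp add: W_def D_def traj_Suc)
          then have Wle: "W \<le> G k D $ j / c" using c(1) by (simp add: pos_le_divide_eq mult.commute)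
          have "C * (X * (v k \<bullet> (rr *\<^sub>R D))) = rr * (C * X * W)" by (simp add: W_def)
          also have "\<dots> \<le> rr * (C * b * (G k D $ j / c))"
            using rr X W Wle C_ge1 GD c by (intro mult_left_mono mult_mono) auto
          also have "\<dots> = rr * (C / c * b) * G k D $ j" by simp
          finally have mix: "C * (X * (v k \<bullet> (rr *\<^sub>R D))) \<le> rr * (C / c * b) * G k D $ j" .
          have "rr * G k D $ j \<le> G k (rr *\<^sub>R D) $ j"
            using G_scale[OF Dc rr(1,2), of k] by (simp add: less_eq_vec_def)
          moreover have "G k x $ j + G k (rr *\<^sub>R D) $ j - G k (x + rr *\<^sub>R D) $ j \<le> C * (X * (v k \<bullet> (rr *\<^sub>R D)))"
            using G_mix1[OF xd(1) rD(1) xrD(2), of k j] by (simp add: X_def)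
          moreover have "G k (x + rr *\<^sub>R D) $ j \<le> G k (x + d) $ j"
            using G_mono[OF xrD0 xrD(1) xd(3), of k] by (simp add: less_eq_vec_def)
          ultimately have I: "rr * (1 - C / c * b) * G k D $ j \<le> G k (x + d) $ j - G k x $ j"
            using mix by (simp add: algebra_simps)
          have cb: "C / c * b \<le> 1"
          proof -
            have "C / c * b \<le> B * b" using b0 c0_pos by (intro mult_right_mono) (auto simp: B_def)
            then show ?thesis using rr(3) by linarith
          qed
          have bb: "0 \<le> C / c * b" "0 \<le> b / c0" using b0 c0_pos c C_ge1 by auto
          have "(1 - B * (real (Suc m) + 1) * b) * G k D $ j = (rr - (b / c0 + C / c * b)) * G k D $ j"
            unfolding split rr_def by (simp add: B_def distrib_right)
          also have "\<dots> \<le> ((1 - b / c0) * (rr * (1 - C / c * b))) * G k D $ j"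
          proof (rule mult_right_mono[OF _ GD])
            have "rr - (y1 + y2) \<le> (1 - y1) * (rr * (1 - y2))" if "0 \<le> y1" "0 \<le> y2" for y1 y2
            proof -
              have "rr * (y1 + y2) \<le> 1 * (y1 + y2)" using rr that by (intro mult_right_mono) auto
              moreover have "0 \<le> rr * (y1 * y2)" using rr that by simp
              ultimately show ?thesis by (simp add: algebra_simps)
            qed
            from this[OF bb(2,1)] show "rr - (b / c0 + C / c * b) \<le> (1 - b / c0) * (rr * (1 - C / c * b))" .
          qed
          also have "\<dots> = (1 - b / c0) * (rr * (1 - C / c * b) * G k D $ j)" by simp
          also have "\<dots> \<le> s $ j * (rr * (1 - C / c * b) * G k D $ j)"
            using s_lo rr cb GD by (intro mult_right_mono mult_nonneg_nonneg) auto
          also have "\<dots> \<le> s $ j * (G k (x + d) $ j - G k x $ j)"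
            using I s by (intro mult_left_mono) (auto simp: cube_def)
          also have "\<dots> = gap k s (Suc m) $ j" unfolding gap_Suc[OF s] by (simp add: x_def d_def)
          finally show ?thesis .
        qed
        then show ?thesis by (simp add: less_eq_vec_def traj_Suc D_def)
      qed
    qed
  qed
qed

context
  fixes s :: "nat \<Rightarrow> real^'d" and n :: "nat \<Rightarrow> nat" and T :: real
  assumes s: "\<And>k. s k \<in> cube" and n: "filterlim n at_top sequentially"
    and sub: "\<And>k. \<rho> k < 1" and ntau: "filterlim (\<lambda>k. real (n k) * (1 - \<rho> k)) at_top sequentially"
    and src: "(\<lambda>k. 2 * Q k * real (n k) * ((v k \<bullet> (1 - s k)) / (1 - \<rho> k))) \<longlonglongrightarrow> T" and T: "T > 0"
    and spos: "\<And>k. 0 < v k \<bullet> (1 - s k)"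
begin

text \<open>The fixed point of the linear recursion with factor \<open>\<rho>\<close> and this
  source, hence an upper bound of \<open>x\<close> at all times.\<close>

definition xbar :: "nat \<Rightarrow> real" where "xbar k = (v k \<bullet> (1 - s k)) / (1 - \<rho> k)"

lemma xbar_pos: "0 < xbar k"
  using spos[of k] sub[of k] by (simp add: xbar_def)

lemma sig_eq: "v k \<bullet> (1 - s k) = (1 - \<rho> k) * xbar k"
  using sub[of k] by (simp add: xbar_def)

lemma sig_le_xbar: "v k \<bullet> (1 - s k) \<le> xbar k"
  using xbar_pos[of k] rho_lo[of k] sub[of k] by (simp add: sig_eq mult_left_le_one_le)

lemma x_le_xbar: "v k \<bullet> traj k (s k) (1 - s k) m \<le> xbar k"
proof (induction m)
  case 0
  then show ?case using sig_le_xbar by simp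
next
  case (Suc m)
  have "v k \<bullet> traj k (s k) (1 - s k) (Suc m) \<le> v k \<bullet> (1 - s k) + \<rho> k * (v k \<bullet> traj k (s k) (1 - s k) m)"
    unfolding traj_Suc by (rule step_upper[OF s xy_cube(2)[OF s]])
  also have "\<dots> \<le> (1 - \<rho> k) * xbar k + \<rho> k * xbar k"
    unfolding sig_eq using Suc rho_pos[of k] by (intro add_left_mono mult_left_mono) auto
  finally show ?case by (simp add: algebra_simps)
qed

lemma n_xbar_bound: "\<forall>\<^sub>F k in sequentially. real (n k) * xbar k \<le> (T + 1) / (2 * c0)"
proof -
  have "\<forall>\<^sub>F k in sequentially. 2 * Q k * real (n k) * xbar k < T + 1"
    unfolding xbar_def by (rule order_tendstoD(2)[OF src]) simp
  then show ?thesis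
  proof eventually_elim
    case (elim k)
    have "c0 * (2 * real (n k) * xbar k) \<le> Q k * (2 * real (n k) * xbar k)"
      using Q_lo[of k] xbar_pos[of k] by (intro mult_right_mono) auto
    then show ?case using elim c0_pos by (simp add: pos_le_divide_eq mult_ac)
  qed
qed

text \<open>All four follow from boundedness of n times \<open>xbar\<close> together with n (1 -
  \<open>\<rho>\<close>) tending to infinity and \<open>\<rho>\<close> tending to 1.\<close>

lemma xbar_null: "xbar \<longlonglongrightarrow> 0" and xbar_ratio_null: "(\<lambda>k. xbar k / (1 - \<rho> k)) \<longlonglongrightarrow> 0"
  and n_sig_null: "(\<lambda>k. real (n k) * (v k \<bullet> (1 - s k))) \<longlonglongrightarrow> 0" and sig_null: "(\<lambda>k. v k \<bullet> (1 - s k)) \<longlonglongrightarrow> 0"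
proof -
  define K where "K = (T + 1) / (2 * c0)"
  have npos: "\<forall>\<^sub>F k in sequentially. 0 < n k" by (rule eventually_compose_filterlim[OF eventually_gt_at_top n])
  have "(\<lambda>k. K * (1 / real (n k))) \<longlonglongrightarrow> K * 0" by (intro tendsto_intros lim_1_over_n[THEN filterlim_compose] n)
  then have l1: "(\<lambda>k. K * (1 / real (n k))) \<longlonglongrightarrow> 0" by simp
  show x0: "xbar \<longlonglongrightarrow> 0"
  proof (rule Lim_null_comparison[OF _ l1])
    show "\<forall>\<^sub>F k in sequentially. norm (xbar k) \<le> K * (1 / real (n k))"
      using n_xbar_bound[folded K_def] npos
      by eventually_elim (use xbar_pos in \<open>simp add: pos_le_divide_eq mult.commute less_imp_le\<close>)
  qed
  have "(\<lambda>k. K * inverse (real (n k) * (1 - \<rho> k))) \<longlonglongrightarrow> K * 0" by (intro tendsto_intros tendsto_inverse_0_at_top ntau)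
  then have l2: "(\<lambda>k. K * inverse (real (n k) * (1 - \<rho> k))) \<longlonglongrightarrow> 0" by simp
  show "(\<lambda>k. xbar k / (1 - \<rho> k)) \<longlonglongrightarrow> 0"
  proof (rule Lim_null_comparison[OF _ l2])
    show "\<forall>\<^sub>F k in sequentially. norm (xbar k / (1 - \<rho> k)) \<le> K * inverse (real (n k) * (1 - \<rho> k))"
      using n_xbar_bound[folded K_def] npos
    proof eventually_elim
      case (elim k)
      have "xbar k \<le> K / real (n k)" using elim by (simp add: pos_le_divide_eq mult.commute)
      then have "xbar k / (1 - \<rho> k) \<le> K / real (n k) / (1 - \<rho> k)" using sub[of k] by (intro divide_right_mono) auto
      then show ?case using xbar_pos[of k] sub[of k] by (simp add: divide_inverse)
    qed
  qed
  have "(\<lambda>k. K * (1 - \<rho> k)) \<longlonglongrightarrow> K * (1 - 1)" by (intro tendsto_intros rho_lim)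
  then have l3: "(\<lambda>k. K * (1 - \<rho> k)) \<longlonglongrightarrow> 0" by simp
  show "(\<lambda>k. real (n k) * (v k \<bullet> (1 - s k))) \<longlonglongrightarrow> 0"
  proof (rule Lim_null_comparison[OF _ l3])
    show "\<forall>\<^sub>F k in sequentially. norm (real (n k) * (v k \<bullet> (1 - s k))) \<le> K * (1 - \<rho> k)"
      using n_xbar_bound
    proof eventually_elim
      case (elim k)
      have "real (n k) * (v k \<bullet> (1 - s k)) = real (n k) * xbar k * (1 - \<rho> k)" by (simp add: sig_eq)
      also have "\<dots> \<le> K * (1 - \<rho> k)" using elim sub[of k] by (intro mult_right_mono) (auto simp: K_def)
      finally show ?case using spos[of k] by simp
    qed
  qed
  show "(\<lambda>k. v k \<bullet> (1 - s k)) \<longlonglongrightarrow> 0"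
    by (rule Lim_null_comparison[OF _ x0]) (use spos sig_le_xbar in \<open>simp add: less_imp_le\<close>)
qed

text \<open>The reciprocal of the survival projection grows at least quadratically: by
  \<open>c\<close> per step from the quadratic term, and this linear growth is amplified by
  \<open>1 - \<rho>\<close>. So n W is of order 1 / (n (1 - \<open>\<rho>\<close>)) after a positive
  fraction of the n steps.\<close>

lemma survival_small:
  assumes nu: "nu > 0" and e: "e > 0"
  shows "\<forall>\<^sub>F k in sequentially. \<forall>m. nu * real (n k) \<le> real m \<longrightarrow> real (n k) * (v k \<bullet> traj k 1 1 m) \<le> e"
proof -
  obtain c where c: "c > 0" "\<And>k s m. s \<in> cube \<Longrightarrow> U \<le> m \<Longrightarrow>
    v k \<bullet> traj k s 1 (Suc m) \<le> v k \<bullet> (1 - s) + \<rho> k * (v k \<bullet> traj k s 1 m) - c * (v k \<bullet> traj k s 1 m)^2"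
    by (rule y_drop) (rule that; assumption)
  \<comment> \<open>The estimate below produces half of this constant, from
    \<open>i (i - 1) / 2 \<ge> nu^2 n^2 / 16\<close>.\<close>
  define A where "A = 32 / (c * nu^2)"
  have "(\<lambda>k. A * inverse (real (n k) * (1 - \<rho> k))) \<longlonglongrightarrow> A * 0" by (intro tendsto_intros tendsto_inverse_0_at_top ntau)
  then have 1: "\<forall>\<^sub>F k in sequentially. A * inverse (real (n k) * (1 - \<rho> k)) < e" using e by (intro order_tendstoD(2)) auto
  have 2: "\<forall>\<^sub>F k in sequentially. nat \<lceil>(real U + 4) * 2 / nu\<rceil> \<le> n k" by (rule eventually_compose_filterlim[OF eventually_ge_at_top n])
  have 3: "\<forall>\<^sub>F k in sequentially. 0 < real (n k) * (1 - \<rho> k)" by (rule eventually_compose_filterlim[OF eventually_gt_at_top ntau])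
  show ?thesis using 1 2 3
  proof (eventually_elim, intro allI impI)
    fix k m
    assume *: "A * inverse (real (n k) * (1 - \<rho> k)) < e" "nat \<lceil>(real U + 4) * 2 / nu\<rceil> \<le> n k" "0 < real (n k) * (1 - \<rho> k)"
      and m: "nu * real (n k) \<le> real m"
    define W where "W i = v k \<bullet> traj k 1 1 i" for i
    have W: "0 < W i" for i unfolding W_def by (rule survival_pos)
    have "(real U + 4) * 2 / nu \<le> real (n k)" using *(2) by linarith
    then have nb: "(real U + 4) * 2 \<le> nu * real (n k)" using nu by (simp add: pos_divide_le_eq mult.commute)
    define i where "i = m - U"
    have i: "U + i = m" "nu * real (n k) / 2 \<le> real i" "nu * real (n k) / 4 \<le> real i - 1" "4 \<le> real i"
      using nb m by (auto simp: i_def of_nat_diff)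
    define g where "g = 1 - \<rho> k"
    have g: "0 < g" using sub by (simp add: g_def)
    have stepp: "1 / W (U + j) * (1 + g) + c \<le> 1 / W (U + Suc j)" for j
    proof -
      have "1 / W (U + j) / \<rho> k + c / (\<rho> k)^2 \<le> 1 / W (Suc (U + j))"
        by (rule recip_step_upper) (use W rho_pos c c(2)[OF one_cube, of "U + j" k] in \<open>auto simp: W_def\<close>)
      moreover have "1 + g \<le> 1 / \<rho> k"
      proof -
        have "(1 + g) * \<rho> k = 1 - g^2" by (simp add: g_def power2_eq_square algebra_simps)
        then have "(1 + g) * \<rho> k \<le> 1" by simp
        then show ?thesis using rho_pos[of k] by (simp add: pos_le_divide_eq)
      qed
      then have "1 / W (U + j) * (1 + g) \<le> 1 / W (U + j) * (1 / \<rho> k)" using W[of "U + j"] by (intro mult_left_mono) auto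
      moreover have "c \<le> c / (\<rho> k)^2"
      proof -
        have "(\<rho> k)^2 \<le> 1" using rho_pos[of k] sub[of k] by (simp add: power_le_one)
        then show ?thesis using c rho_pos[of k] by (simp add: pos_le_divide_eq mult_left_le)
      qed
      ultimately show ?thesis by simp
    qed
    have lin: "c * real j \<le> 1 / W (U + j)" for j
    proof (induction j)
      case (Suc j)
      have "1 / W (U + j) * 1 \<le> 1 / W (U + j) * (1 + g)" using W[of "U + j"] g by (intro mult_left_mono) auto
      then show ?case using stepp[of j] Suc by (simp add: algebra_simps)
    qed (use W[of U] in \<open>simp add: less_imp_le\<close>)
    \<comment> \<open>Feeding the linear bound into the factor \<open>1 + g\<close> adds
      \<open>c * j * g\<close> in each step.\<close>
    have quadr: "c * g * (real j * (real j - 1) / 2) \<le> 1 / W (U + j)" for j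
    proof (induction j)
      case (Suc j)
      have "c * real j * g \<le> 1 / W (U + j) * g" using lin[of j] g by (intro mult_right_mono) auto
      moreover have "1 / W (U + j) * (1 + g) = 1 / W (U + j) + 1 / W (U + j) * g" by (simp add: distrib_left)
      ultimately have "c * g * (real j * (real j - 1) / 2) + c * real j * g + c \<le> 1 / W (U + Suc j)"
        using stepp[of j] Suc by linarith
      moreover have "c * g * (real (Suc j) * (real (Suc j) - 1) / 2) = c * g * (real j * (real j - 1) / 2) + c * real j * g"
        by (simp add: field_simps)
      ultimately show ?case using c by linarith
    qed (use W[of U] in \<open>simp add: less_imp_le\<close>)
    have "0 < (real U + 4) * 2" by simp
    then have nn: "0 < nu * real (n k)" using nb by (rule less_le_trans)
    have "c * g * ((nu * real (n k) / 2) * (nu * real (n k) / 4) / 2) \<le> c * g * (real i * (real i - 1) / 2)"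
      using c g i nn by (intro mult_left_mono divide_right_mono mult_mono) auto
    also have "\<dots> \<le> 1 / W m" using quadr[of i] i(1) by simp
    finally have "c * g * nu^2 * (real (n k))^2 / 16 \<le> 1 / W m" by (simp add: power2_eq_square mult_ac)
    moreover have P: "0 < c * g * nu^2 * (real (n k))^2 / 16" using c g nu nn by (simp add: zero_less_mult_iff)
    ultimately have "W m \<le> 1 / (c * g * nu^2 * (real (n k))^2 / 16)" using W[of m] by (simp add: field_simps)
    then have "real (n k) * W m \<le> real (n k) * (1 / (c * g * nu^2 * (real (n k))^2 / 16))" by (intro mult_left_mono) auto
    also have "\<dots> = 16 / (c * nu^2) * inverse (real (n k) * g)"
    proof -
      have "x * (1 / (c * g * nu^2 * x^2 / 16)) = 16 / (c * nu^2) * inverse (x * g)" if "0 < x" for x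
        using c(1) g nu that by (simp add: power2_eq_square field_simps)
      moreover have "0 < real (n k)" using nn nu by (simp add: zero_less_mult_iff)
      ultimately show ?thesis by blast
    qed
    also have "\<dots> \<le> A * inverse (real (n k) * (1 - \<rho> k))"
      unfolding A_def g_def using less_imp_le[OF positive_imp_inverse_positive[OF *(3)]] c(1) nu
      by (intro mult_right_mono divide_right_mono) (simp_all del: inverse_mult_distrib)
    finally show "real (n k) * (v k \<bullet> traj k 1 1 m) \<le> e" using *(1) by (simp add: W_def)
  qed
qed

text \<open>Since \<open>x \<le> xbar\<close>, the quadratic loss is at most
  \<open>C2 * xbar * x\<close>, so \<open>x\<close> dominates a linear recursion with rate
  \<open>b\<close>. Its fixed point is asymptotic to \<open>xbar\<close> and is nearly reached after
  \<open>nu * n\<close> steps.\<close>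

lemma x_plateau:
  assumes nu: "nu > 0" and e: "e > 0"
  shows "\<forall>\<^sub>F k in sequentially. \<forall>m. nu * real (n k) \<le> real m \<longrightarrow>
     \<bar>2 * Q k * real (n k) * (v k \<bullet> traj k (s k) (1 - s k) m) - T\<bar> \<le> e"
proof -
  \<comment> \<open>The relative losses against \<open>xbar\<close>: weakening of the source,
    enlargement of the rate from \<open>1 - \<rho>\<close> to \<open>b\<close>, and incomplete
    relaxation.\<close>
  define f where "f k = (1 - 2 * xbar k / c0) * (1 / (1 + C2 * (xbar k / (1 - \<rho> k)))) * (1 - inverse (1 + nu * (real (n k) * (1 - \<rho> k))))" for k
  have top: "filterlim (\<lambda>k. 1 + nu * (real (n k) * (1 - \<rho> k))) at_top sequentially"
    by (intro filterlim_tendsto_add_at_top[OF tendsto_const] filterlim_tendsto_pos_mult_at_top[OF tendsto_const nu ntau])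
  have "f \<longlonglongrightarrow> (1 - 2 * 0 / c0) * (1 / (1 + C2 * 0)) * (1 - 0)"
    unfolding f_def by (intro tendsto_intros xbar_null xbar_ratio_null tendsto_inverse_0_at_top top) (use c0_pos in auto)
  then have f1: "f \<longlonglongrightarrow> 1" by simp
  have lim: "(\<lambda>k. 2 * Q k * real (n k) * xbar k * f k) \<longlonglongrightarrow> T * 1"
    by (intro tendsto_mult[OF _ f1]) (use src in \<open>simp add: xbar_def\<close>)
  have 1: "\<forall>\<^sub>F k in sequentially. T - e < 2 * Q k * real (n k) * xbar k * f k" by (rule order_tendstoD(1)[OF lim]) (use e in simp)
  have 2: "\<forall>\<^sub>F k in sequentially. 2 * Q k * real (n k) * xbar k < T + e"
    unfolding xbar_def by (rule order_tendstoD(2)[OF src]) (use e in simp)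
  have 3: "\<forall>\<^sub>F k in sequentially. 1 - \<rho> k + C2 * xbar k < 1"
  proof -
    have "(\<lambda>k. 1 - \<rho> k + C2 * xbar k) \<longlonglongrightarrow> 1 - 1 + C2 * 0" by (intro tendsto_intros rho_lim xbar_null)
    then show ?thesis by (intro order_tendstoD(2)) auto
  qed
  have 4: "\<forall>\<^sub>F k in sequentially. xbar k < c0 / 2" by (rule order_tendstoD(2)[OF xbar_null]) (use c0_pos in simp)
  show ?thesis using 1 2 3 4
  proof (eventually_elim, intro allI impI)
    fix k m
    assume *: "T - e < 2 * Q k * real (n k) * xbar k * f k" "2 * Q k * real (n k) * xbar k < T + e"
      "1 - \<rho> k + C2 * xbar k < 1" "xbar k < c0 / 2" and m: "nu * real (n k) \<le> real m"
    define X where "X i = v k \<bullet> traj k (s k) (1 - s k) i" for i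
    define \<sigma> where "\<sigma> = v k \<bullet> (1 - s k)"
    define b where "b = 1 - \<rho> k + C2 * xbar k"
    have b: "0 < b" "b < 1" "1 - \<rho> k \<le> b" using sub[of k] xbar_pos[of k] C2_ge1 *(3) by (auto simp: b_def add_pos_pos)
    define h where "h = \<sigma> * (1 - 2 * xbar k / c0) / b"
    have h: "0 \<le> h" using spos[of k] *(4) c0_pos b by (auto simp: h_def \<sigma>_def field_simps)
    have X0: "0 \<le> X i" "X i \<le> xbar k" for i
      unfolding X_def by (rule ip_nonneg[OF cubeD(1)[OF xy_cube(2)[OF s]]], rule x_le_xbar)
    have "h * (1 - (1 - b) ^ i) \<le> X i" for i
    proof (induction i)
      case (Suc i)
      have "\<sigma> * (1 - 2 * X i / c0) + \<rho> k * X i - C2 * (X i)^2 \<le> X (Suc i)"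
        unfolding X_def \<sigma>_def traj_Suc by (rule step_lower[OF s xy_cube(2)[OF s]])
      moreover have "\<sigma> * (1 - 2 * xbar k / c0) \<le> \<sigma> * (1 - 2 * X i / c0)"
        using X0[of i] spos[of k] c0_pos by (intro mult_left_mono diff_left_mono divide_right_mono) (auto simp: \<sigma>_def)
      moreover have "C2 * (X i)^2 \<le> C2 * xbar k * X i"
        using X0[of i] C2_ge1 by (simp add: power2_eq_square mult_right_mono mult_left_mono)
      moreover have "(1 - b) * X i = \<rho> k * X i - C2 * xbar k * X i" by (simp add: b_def algebra_simps)
      moreover have "\<sigma> * (1 - 2 * xbar k / c0) = b * h" using b by (simp add: h_def)
      ultimately have "b * h + (1 - b) * X i \<le> X (Suc i)" by linarith
      moreover have "(1 - b) * (h * (1 - (1 - b) ^ i)) \<le> (1 - b) * X i" using Suc b by (intro mult_left_mono) auto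
      moreover have "h * (1 - (1 - b) ^ Suc i) = b * h + (1 - b) * (h * (1 - (1 - b) ^ i))" by (simp add: algebra_simps)
      ultimately show ?case by linarith
    qed (use X0 in simp)
    note Xlow = this
    \<comment> \<open>Relaxation with an explicit rate: \<open>(1 - b) (1 + b) \<le> 1\<close>, and
      Bernoulli's inequality for \<open>1 + b\<close>.\<close>
    have "(1 - b) ^ m \<le> inverse (1 + nu * (real (n k) * (1 - \<rho> k)))"
    proof -
      have "(1 - b) ^ m * (1 + b) ^ m \<le> 1" using b by (simp flip: power_mult_distrib) (simp add: power_le_one algebra_simps mult_le_one)
      then have "(1 - b) ^ m \<le> 1 / (1 + b) ^ m" using b by (simp add: pos_le_divide_eq)
      also have "\<dots> \<le> 1 / (1 + nu * (real (n k) * (1 - \<rho> k)))"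
      proof (rule divide_left_mono)
        have "nu * real (n k) * (1 - \<rho> k) \<le> real m * b" using m b sub[of k] nu by (intro mult_mono) auto
        then show "1 + nu * (real (n k) * (1 - \<rho> k)) \<le> (1 + b) ^ m" using Bernoulli_inequality[of b m] b by (simp add: mult.assoc)
        show "0 < (1 + b) ^ m * (1 + nu * (real (n k) * (1 - \<rho> k)))" using b nu sub[of k] by (intro mult_pos_pos add_pos_nonneg) auto
      qed simp
      finally show ?thesis by (simp add: inverse_eq_divide)
    qed
    then have "h * (1 - inverse (1 + nu * (real (n k) * (1 - \<rho> k)))) \<le> h * (1 - (1 - b) ^ m)" using h by (intro mult_left_mono) auto
    then have "h * (1 - inverse (1 + nu * (real (n k) * (1 - \<rho> k)))) \<le> X m" using Xlow[of m] by linarith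
    moreover have "h * (1 - inverse (1 + nu * (real (n k) * (1 - \<rho> k)))) = xbar k * f k"
    proof -
      have "b = (1 - \<rho> k) * (1 + C2 * (xbar k / (1 - \<rho> k)))" using sub[of k] by (simp add: b_def field_simps)
      then have "h = xbar k * ((1 - 2 * xbar k / c0) * (1 / (1 + C2 * (xbar k / (1 - \<rho> k)))))"
        using sub[of k] by (simp add: h_def \<sigma>_def sig_eq)
      then show ?thesis by (simp add: f_def)
    qed
    ultimately have "xbar k * f k \<le> X m" by simp
    then have "2 * Q k * real (n k) * (xbar k * f k) \<le> 2 * Q k * real (n k) * X m" using Q_pos[of k] by (intro mult_left_mono) auto
    moreover have "2 * Q k * real (n k) * X m \<le> 2 * Q k * real (n k) * xbar k" using Q_pos[of k] X0[of m] by (intro mult_left_mono) auto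
    ultimately show "\<bar>2 * Q k * real (n k) * (v k \<bullet> traj k (s k) (1 - s k) m) - T\<bar> \<le> e"
      using * by (simp add: X_def[symmetric] abs_le_iff mult.assoc)
  qed
qed


text \<open>About n steps follow, so each multiplier must be known up to \<open>e / n\<close>. This
  works because n times the source and n times D tend to zero, while n times \<open>x\<close> is
  bounded and meets only further small factors.\<close>

lemma sub_one_step:
  assumes e: "e > 0" and nu: "nu > 0"
  shows "\<forall>\<^sub>F k in sequentially. \<forall>m. nu * real (n k) \<le> real m \<longrightarrow>
     v k \<bullet> gap k (s k) (Suc m) \<le> (\<rho> k - (T - e) / real (n k)) * (v k \<bullet> gap k (s k) m) \<and>
     (\<rho> k - (T + e) / real (n k)) * (v k \<bullet> gap k (s k) m) \<le> v k \<bullet> gap k (s k) (Suc m) \<and>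
     (\<rho> k - e / real (n k)) * (v k \<bullet> traj k 1 1 m) \<le> v k \<bullet> traj k 1 1 (Suc m)"
proof -
  define K where "K = (T + 1) / (2 * c0)"
  \<comment> \<open>Coefficients of the source, of the quadratic defect, of the cubic and alignment
    errors (each \<open>2 * C * K\<close>), and of the plateau error.\<close>
  define S where "S = 2 / c0 + C2 + 4 * C * K + 1"
  define e' where "e' = e / S"
  have K: "0 < K" using T c0_pos by (simp add: K_def)
  have S: "1 \<le> S" "C2 \<le> S" "0 < S"   proof -
    have "0 < 2 / c0" "0 < 4 * C * K" using c0_pos C_ge1 K by auto
    then show "1 \<le> S" "C2 \<le> S" "0 < S" using C2_ge1 unfolding S_def by linarith+
  qed
  have e': "0 < e'" "e' * S = e" using e S by (auto simp: e'_def)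
  obtain N1 where N1: "\<forall>\<^sub>F k in sequentially. \<forall>m\<ge>N1. dev k (traj k (s k) (1 - s k) m) \<le> e' * (v k \<bullet> traj k (s k) (1 - s k) m)"
    using regular_alignment[OF regular_xy(1)[OF s sig_null] e'(1)] by blast
  obtain N2 where N2: "\<forall>\<^sub>F k in sequentially. \<forall>m\<ge>N2. dev k (gap k (s k) m) \<le> e' * (v k \<bullet> gap k (s k) m)"
    using gap_alignment[OF s sig_null e'(1)] by blast
  have n1: "\<forall>\<^sub>F k in sequentially. nat \<lceil>(real (max N1 N2) + 1) / nu\<rceil> \<le> n k" by (rule eventually_compose_filterlim[OF eventually_ge_at_top n])
  have n0: "\<forall>\<^sub>F k in sequentially. 0 < n k" by (rule eventually_compose_filterlim[OF eventually_gt_at_top n])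
  have sg: "\<forall>\<^sub>F k in sequentially. real (n k) * (v k \<bullet> (1 - s k)) < e'" by (rule order_tendstoD(2)[OF n_sig_null e'(1)])
  have xb: "\<forall>\<^sub>F k in sequentially. xbar k < e'" by (rule order_tendstoD(2)[OF xbar_null e'(1)])
  show ?thesis
    using N1 N2 n1 n0 sg xb n_xbar_bound[folded K_def] survival_small[OF nu e'(1)] x_plateau[OF nu e'(1)]
  proof (eventually_elim, intro allI impI)
    fix k m
    assume N1: "\<forall>m\<ge>N1. dev k (traj k (s k) (1 - s k) m) \<le> e' * (v k \<bullet> traj k (s k) (1 - s k) m)"
      and N2: "\<forall>m\<ge>N2. dev k (gap k (s k) m) \<le> e' * (v k \<bullet> gap k (s k) m)"
      and n1: "nat \<lceil>(real (max N1 N2) + 1) / nu\<rceil> \<le> n k" and n0: "0 < n k"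
      and sg: "real (n k) * (v k \<bullet> (1 - s k)) < e'" and xb: "xbar k < e'" and nx: "real (n k) * xbar k \<le> K"
      and ws: "\<forall>m. nu * real (n k) \<le> real m \<longrightarrow> real (n k) * (v k \<bullet> traj k 1 1 m) \<le> e'"
      and xp: "\<forall>m. nu * real (n k) \<le> real m \<longrightarrow> \<bar>2 * Q k * real (n k) * (v k \<bullet> traj k (s k) (1 - s k) m) - T\<bar> \<le> e'"
      and m: "nu * real (n k) \<le> real m"
    define X where "X = v k \<bullet> traj k (s k) (1 - s k) m"
    define V where "V = v k \<bullet> gap k (s k) m"
    define W where "W = v k \<bullet> traj k 1 1 m"
    define \<sigma> where "\<sigma> = v k \<bullet> (1 - s k)"
    define l where "l = real (n k)"
    have "(real (max N1 N2) + 1) / nu \<le> real (n k)" using n1 by linarith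
    then have "real (max N1 N2) + 1 \<le> nu * real (n k)" using nu by (simp add: pos_divide_le_eq mult.commute)
    then have mN: "N1 \<le> m" "N2 \<le> m" using m by linarith+
    have l: "1 \<le> l" using n0 by (simp add: l_def)
    have XV: "0 \<le> X" "0 \<le> V" "V \<le> W" "X \<le> xbar k" "0 < W" "0 < \<sigma>"
      unfolding X_def V_def W_def \<sigma>_def
      by (rule ip_nonneg[OF cubeD(1)[OF xy_cube(2)[OF s]]], rule ip_nonneg[OF gap_nonneg[OF s]],
          rule ip_mono[OF gap_le_survival[OF s]], rule x_le_xbar, rule survival_pos, rule spos)
    have lW: "l * W \<le> e'" using ws m by (simp add: l_def W_def)
    have "l * X \<le> l * xbar k" using XV l by (intro mult_left_mono) auto
    then have lX: "l * X \<le> K" using nx unfolding l_def by linarith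
    have ls: "l * \<sigma> \<le> e'" using sg by (simp add: l_def \<sigma>_def)
    have "l * V \<le> l * W" using XV l by (intro mult_left_mono) auto
    then have lV: "l * V \<le> e'" using lW by linarith
    have V1: "V \<le> e'" using mult_right_mono[OF l XV(2)] lV by simp
    define err where "err = 2 * \<sigma> / c0 * V + C2 * V^2 + C * (X * V * (X + V)) + C * (dev k (traj k (s k) (1 - s k) m) * V + X * dev k (gap k (s k) m))"
    have st: "\<bar>v k \<bullet> gap k (s k) (Suc m) - (\<rho> k - 2 * Q k * X) * V\<bar> \<le> err"
      using gap_step[OF s, of k k m] by (simp add: err_def X_def V_def \<sigma>_def)
    have "l * err \<le> (2 / c0 + C2 + 4 * C * K) * e' * V"
    proof -
      have 1: "l * (2 * \<sigma> / c0 * V) \<le> 2 / c0 * e' * V"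
      proof -
        have "l * (2 * \<sigma> / c0 * V) = 2 / c0 * (l * \<sigma>) * V" by simp
        also have "\<dots> \<le> 2 / c0 * e' * V" using ls c0_pos XV by (intro mult_right_mono mult_left_mono) auto
        finally show ?thesis .
      qed
      have 2: "l * (C2 * V^2) \<le> C2 * e' * V"
      proof -
        have "l * (C2 * V^2) = C2 * (l * V) * V" by (simp add: power2_eq_square)
        also have "\<dots> \<le> C2 * e' * V" using lV C2_ge1 XV by (intro mult_right_mono mult_left_mono) auto
        finally show ?thesis .
      qed
      have 3: "l * (C * (X * V * (X + V))) \<le> 2 * C * K * e' * V"
      proof -
        have "l * (C * (X * V * (X + V))) = C * (l * X) * (X + V) * V" by simp
        also have "\<dots> \<le> C * K * (2 * e') * V"
          using lX V1 XV xb C_ge1 K e' l by (intro mult_right_mono mult_mono mult_left_mono) auto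
        finally show ?thesis by (simp add: mult_ac)
      qed
      have 4: "l * (C * (dev k (traj k (s k) (1 - s k) m) * V + X * dev k (gap k (s k) m))) \<le> 2 * C * K * e' * V"
      proof -
        have "dev k (traj k (s k) (1 - s k) m) * V + X * dev k (gap k (s k) m) \<le> (e' * X) * V + X * (e' * V)"
          using N1 N2 mN XV by (intro add_mono mult_right_mono mult_left_mono) (auto simp: X_def V_def)
        then have "l * (C * (dev k (traj k (s k) (1 - s k) m) * V + X * dev k (gap k (s k) m))) \<le> l * (C * ((e' * X) * V + X * (e' * V)))"
          using l C_ge1 by (intro mult_left_mono) auto
        also have "\<dots> = 2 * C * (l * X) * e' * V" by (simp add: algebra_simps)
        also have "\<dots> \<le> 2 * C * K * e' * V" using lX C_ge1 e' XV by (intro mult_right_mono mult_left_mono) auto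
        finally show ?thesis .
      qed
      show ?thesis unfolding err_def distrib_left using 1 2 3 4 by (simp add: algebra_simps)
    qed
    moreover have "\<bar>l * (2 * Q k * X) - T\<bar> * V \<le> e' * V"
      using xp m XV by (intro mult_right_mono) (auto simp: X_def l_def mult_ac)
    moreover have "(2 / c0 + C2 + 4 * C * K) * e' * V + e' * V = e * V"
    proof -
      have "(2 / c0 + C2 + 4 * C * K) * e' * V + e' * V = e' * S * V" by (simp add: S_def algebra_simps)
      then show ?thesis using e'(2) by simp
    qed
    ultimately have tot: "l * err + \<bar>l * (2 * Q k * X) - T\<bar> * V \<le> e * V" by linarith
    have main: "\<bar>l * (v k \<bullet> gap k (s k) (Suc m)) - (l * \<rho> k - T) * V\<bar> \<le> e * V"
    proof -
      have "l * (v k \<bullet> gap k (s k) (Suc m)) - (l * \<rho> k - T) * V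
        = l * (v k \<bullet> gap k (s k) (Suc m) - (\<rho> k - 2 * Q k * X) * V) - (l * (2 * Q k * X) - T) * V"
        by (simp add: algebra_simps)
      moreover have "\<bar>l * (v k \<bullet> gap k (s k) (Suc m) - (\<rho> k - 2 * Q k * X) * V)\<bar> \<le> l * err"
        using st l by (simp add: abs_mult)
      moreover have "\<bar>(l * (2 * Q k * X) - T) * V\<bar> = \<bar>l * (2 * Q k * X) - T\<bar> * V" using XV by (simp add: abs_mult)
      ultimately show ?thesis using tot unfolding abs_le_iff by linarith
    qed
    have div: "x \<le> (\<rho> k - b / l) * y \<longleftrightarrow> l * x \<le> (l * \<rho> k - b) * y" "(\<rho> k - b / l) * y \<le> x \<longleftrightarrow> (l * \<rho> k - b) * y \<le> l * x" for x y b
    proof -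
      have eq: "(l * \<rho> k - b) * y = l * ((\<rho> k - b / l) * y)" using l by (simp add: field_simps)
      have "0 < l" using l by simp
      then show "x \<le> (\<rho> k - b / l) * y \<longleftrightarrow> l * x \<le> (l * \<rho> k - b) * y" "(\<rho> k - b / l) * y \<le> x \<longleftrightarrow> (l * \<rho> k - b) * y \<le> l * x"
        unfolding eq by (simp_all only: mult_le_cancel_left_pos)
    qed
    have "(\<rho> k - e / l) * W \<le> v k \<bullet> traj k 1 1 (Suc m)"
    proof -
      have "C2 * (l * W) * W \<le> S * e' * W" using lW S C2_ge1 XV e' l by (intro mult_right_mono mult_mono) auto
      also have "S * e' * W = e * W" using e'(2) by (simp add: mult.commute)
      finally have "C2 * (l * W) * W \<le> e * W" .
      moreover have "\<rho> k * W - C2 * W^2 \<le> v k \<bullet> traj k 1 1 (Suc m)"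
        using step_lower[OF one_cube traj_cube[OF one_cube one_cube], of k k m] by (simp add: W_def traj_Suc)
      then have "l * (\<rho> k * W - C2 * W^2) \<le> l * (v k \<bullet> traj k 1 1 (Suc m))" using l by (intro mult_left_mono) auto
      ultimately show ?thesis unfolding div by (simp add: power2_eq_square algebra_simps)
    qed
    moreover have "v k \<bullet> gap k (s k) (Suc m) \<le> (\<rho> k - (T - e) / l) * V" "(\<rho> k - (T + e) / l) * V \<le> v k \<bullet> gap k (s k) (Suc m)"
      unfolding div using main by (simp_all add: abs_le_iff algebra_simps)
    ultimately show "v k \<bullet> gap k (s k) (Suc m) \<le> (\<rho> k - (T - e) / real (n k)) * (v k \<bullet> gap k (s k) m) \<and>
     (\<rho> k - (T + e) / real (n k)) * (v k \<bullet> gap k (s k) m) \<le> v k \<bullet> gap k (s k) (Suc m) \<and>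
     (\<rho> k - e / real (n k)) * (v k \<bullet> traj k 1 1 m) \<le> v k \<bullet> traj k 1 1 (Suc m)"
      by (simp add: l_def V_def W_def)
  qed
qed

text \<open>The burn-in costs the ratio at most a factor \<open>1 - e\<close> by
  \<open>gap_lower\<close>. From then on every step multiplies it by 1 - T/n up to o(1/n), and n -
  o(n) steps remain.\<close>

lemma sub_ratio_limit: "(\<lambda>k. (v k \<bullet> gap k (s k) (n k)) / (v k \<bullet> traj k 1 1 (n k))) \<longlonglongrightarrow> exp (- T)"
proof -
  define V where "V k m = v k \<bullet> gap k (s k) m" for k m
  define W where "W k m = v k \<bullet> traj k 1 1 m" for k m
  have W: "0 < W k m" for k m unfolding W_def by (rule survival_pos)
  have V: "0 \<le> V k m" "V k m \<le> W k m" for k m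
    unfolding V_def W_def by (rule ip_nonneg[OF gap_nonneg[OF s]], rule ip_mono[OF gap_le_survival[OF s]])
  have n0: "\<forall>\<^sub>F k in sequentially. 0 < n k" by (rule eventually_compose_filterlim[OF eventually_gt_at_top n])
  obtain B where B: "B > 0" "\<And>k s b m. s \<in> cube \<Longrightarrow> v k \<bullet> (1 - s) \<le> b \<Longrightarrow> \<forall>m. v k \<bullet> traj k s (1 - s) m \<le> b \<Longrightarrow>
     (1 - B * (real m + 1) * b) *\<^sub>R traj k 1 1 m \<le> gap k s m"
    by (rule gap_lower) (rule that; assumption)
  have VB: "(1 - B * (real m + 1) * xbar k) * W k m \<le> V k m" for k m
  proof -
    have "(1 - B * (real m + 1) * xbar k) *\<^sub>R traj k 1 1 m \<le> gap k (s k) m"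
      by (rule B(2)[OF s sig_le_xbar]) (use x_le_xbar in blast)
    from ip_mono[OF this, of k] show ?thesis by (simp add: V_def W_def)
  qed
  define K where "K = (T + 1) / (2 * c0)"
  have K: "0 < K" using T c0_pos by (simp add: K_def)
  define Pr where "Pr e k \<longleftrightarrow> (\<exists>m0. m0 \<le> n k \<and> real m0 \<le> e * real (n k) \<and> (1 - e) * W k m0 \<le> V k m0 \<and>
     (\<forall>m\<ge>m0. V k (Suc m) \<le> (\<rho> k - (T - e) / real (n k)) * V k m \<and> (\<rho> k - (T + e) / real (n k)) * V k m \<le> V k (Suc m)
        \<and> (\<rho> k - e / real (n k)) * W k m \<le> W k (Suc m)))" for e k
  have "eventually (Pr e) sequentially" if e: "e > 0" for e
  proof -
    \<comment> \<open>In turn: the burn-in fits into \<open>n k\<close>, it takes at most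
      \<open>e * n k\<close> steps, and the loss through \<open>B\<close> is at most
      \<open>e\<close>.\<close>
    define nu where "nu = min (1/2) (min (e / 2) (e / (2 * B * K)))"
    have nu: "0 < nu" "nu \<le> 1/2" "nu \<le> e / 2" "nu \<le> e / (2 * B * K)" using e B K by (auto simp: nu_def)
    have xb: "\<forall>\<^sub>F k in sequentially. xbar k < e / (4 * B)" using e B by (intro order_tendstoD(2)[OF xbar_null]) simp
    have nb: "\<forall>\<^sub>F k in sequentially. nat \<lceil>2 / e\<rceil> + 2 \<le> n k" by (rule eventually_compose_filterlim[OF eventually_ge_at_top n])
    show ?thesis using sub_one_step[OF e nu(1)] xb nb n_xbar_bound[folded K_def]
    proof eventually_elim
      case (elim k)
      define m0 where "m0 = nat \<lceil>nu * real (n k)\<rceil>"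
      have "0 \<le> nu * real (n k)" using nu by simp
      then have m0: "nu * real (n k) \<le> real m0" "real m0 \<le> nu * real (n k) + 1" unfolding m0_def by linarith+
      have ne: "2 / e \<le> real (n k)" "2 \<le> real (n k)" using elim(3) by linarith+
      have "nu * real (n k) \<le> e / 2 * real (n k)" using nu by (intro mult_right_mono) auto
      moreover have "1 \<le> e / 2 * real (n k)" using ne e by (simp add: field_simps)
      ultimately have m0e: "real m0 \<le> e * real (n k)" using m0 by linarith
      have "nu * real (n k) \<le> 1/2 * real (n k)" using nu by (intro mult_right_mono) auto
      then have m0n: "m0 \<le> n k" using m0 ne by linarith
      have "B * (real m0 + 1) * xbar k \<le> e"
      proof -
        have "B * (real m0 + 1) * xbar k \<le> B * (nu * real (n k) + 2) * xbar k"
          using m0 B xbar_pos[of k] by (intro mult_right_mono mult_left_mono) auto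
        also have "\<dots> = B * nu * (real (n k) * xbar k) + 2 * B * xbar k" by (simp add: algebra_simps)
        also have "\<dots> \<le> B * (e / (2 * B * K)) * K + 2 * B * (e / (4 * B))"
          using elim(2,4) nu B K xbar_pos[of k] by (intro add_mono mult_mono mult_left_mono) auto
        also have "\<dots> = e" using B K by (simp add: field_simps)
        finally show ?thesis .
      qed
      then have "(1 - e) * W k m0 \<le> (1 - B * (real m0 + 1) * xbar k) * W k m0" using W[of k m0] by (intro mult_right_mono) auto
      also note VB[of m0 k]
      finally have st: "(1 - e) * W k m0 \<le> V k m0" .
      have "V k (Suc m) \<le> (\<rho> k - (T - e) / real (n k)) * V k m \<and> (\<rho> k - (T + e) / real (n k)) * V k m \<le> V k (Suc m)
        \<and> (\<rho> k - e / real (n k)) * W k m \<le> W k (Suc m)" if "m0 \<le> m" for m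
      proof -
        have "nu * real (n k) \<le> real m" using m0(1) that by linarith
        then show ?thesis using elim(1) unfolding V_def W_def by blast
      qed
      then show ?case unfolding Pr_def using m0n m0e st by blast
    qed
  qed
  then obtain e where e: "\<forall>k. 0 < e k \<and> e k < 1/2" "e \<longlonglongrightarrow> 0" "\<forall>\<^sub>F k in sequentially. Pr (e k) k"
    using eventually_diagonal[of Pr] by blast
  have "\<exists>M. \<forall>k. Pr (e k) k \<longrightarrow> M k \<le> n k \<and> real (M k) \<le> e k * real (n k) \<and> (1 - e k) * W k (M k) \<le> V k (M k) \<and>
     (\<forall>m\<ge>M k. V k (Suc m) \<le> (\<rho> k - (T - e k) / real (n k)) * V k m \<and> (\<rho> k - (T + e k) / real (n k)) * V k m \<le> V k (Suc m)
        \<and> (\<rho> k - e k / real (n k)) * W k m \<le> W k (Suc m))"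
    unfolding Pr_def by (intro choice) blast
  then obtain M where M: "\<And>k. Pr (e k) k \<Longrightarrow> M k \<le> n k \<and> real (M k) \<le> e k * real (n k) \<and> (1 - e k) * W k (M k) \<le> V k (M k) \<and>
     (\<forall>m\<ge>M k. V k (Suc m) \<le> (\<rho> k - (T - e k) / real (n k)) * V k m \<and> (\<rho> k - (T + e k) / real (n k)) * V k m \<le> V k (Suc m)
        \<and> (\<rho> k - e k / real (n k)) * W k m \<le> W k (Suc m))" by blast
  define l where "l k = n k - M k" for k
  have ln: "(\<lambda>k. real (l k) / real (n k)) \<longlonglongrightarrow> 1"
  proof (rule tendsto_sandwich)
    show "\<forall>\<^sub>F k in sequentially. 1 - e k \<le> real (l k) / real (n k)"
      using e(3) n0
    proof eventually_elim
      case (elim k)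
      then show ?case using M[OF elim(1)] by (simp add: l_def of_nat_diff field_simps)
    qed
    show "\<forall>\<^sub>F k in sequentially. real (l k) / real (n k) \<le> 1"
      using n0 by eventually_elim (simp add: l_def)
    show "(\<lambda>k. 1 - e k) \<longlonglongrightarrow> 1" using tendsto_diff[OF tendsto_const[of 1] e(2)] by simp
  qed simp
  have n_inv: "(\<lambda>k. 1 / real (n k)) \<longlonglongrightarrow> 0" by (rule filterlim_compose[OF lim_1_over_n n])
  \<comment> \<open>\<open>1 - t1\<close> is the upper multiplier of V over the lower one of W;
    \<open>1 - t2\<close> is the lower multiplier of V over the upper one of W, which is
    \<open>\<rho>\<close>.\<close>
  define t1 where "t1 k = (T - 2 * e k) * (1 / real (n k)) / (\<rho> k - e k * (1 / real (n k)))" for k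
  define t2 where "t2 k = (T + e k) * (1 / real (n k)) / \<rho> k" for k
  have t1_0: "t1 \<longlonglongrightarrow> 0" and lt1: "(\<lambda>k. real (l k) * t1 k) \<longlonglongrightarrow> T"
  proof -
    have "t1 \<longlonglongrightarrow> (T - 2 * 0) * 0 / (1 - 0 * 0)" unfolding t1_def by (intro tendsto_intros n_inv e(2) rho_lim) simp
    then show "t1 \<longlonglongrightarrow> 0" by simp
    have "(\<lambda>k. (T - 2 * e k) * (real (l k) / real (n k)) / (\<rho> k - e k * (1 / real (n k)))) \<longlonglongrightarrow> (T - 2 * 0) * 1 / (1 - 0 * 0)"
      by (intro tendsto_intros n_inv e(2) rho_lim ln) simp
    then show "(\<lambda>k. real (l k) * t1 k) \<longlonglongrightarrow> T" by (simp add: t1_def mult_ac)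
  qed
  have t2_0: "t2 \<longlonglongrightarrow> 0" and lt2: "(\<lambda>k. real (l k) * t2 k) \<longlonglongrightarrow> T"
  proof -
    have "t2 \<longlonglongrightarrow> (T + 0) * 0 / 1" unfolding t2_def by (intro tendsto_intros n_inv e(2) rho_lim) simp
    then show "t2 \<longlonglongrightarrow> 0" by simp
    have "(\<lambda>k. (T + e k) * (real (l k) / real (n k)) / \<rho> k) \<longlonglongrightarrow> (T + 0) * 1 / 1"
      by (intro tendsto_intros e(2) rho_lim ln) simp
    then show "(\<lambda>k. real (l k) * t2 k) \<longlonglongrightarrow> T" by (simp add: t2_def mult_ac)
  qed
  have big: "\<forall>\<^sub>F k in sequentially. nat \<lceil>2 * (T + 1)\<rceil> + 2 \<le> n k" by (rule eventually_compose_filterlim[OF eventually_ge_at_top n])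
  have eT: "\<forall>\<^sub>F k in sequentially. 2 * e k < T"
  proof -
    have "(\<lambda>k. 2 * e k) \<longlonglongrightarrow> 2 * 0" by (intro tendsto_intros e(2))
    then show ?thesis using T by (intro order_tendstoD(2)) auto
  qed
  have facts: "\<forall>\<^sub>F k in sequentially. 0 < \<rho> k - e k * (1 / real (n k)) \<and> 0 \<le> \<rho> k - (T + e k) / real (n k) \<and> 0 \<le> t1 k \<and> 0 \<le> t2 k
      \<and> 0 \<le> \<rho> k - (T - e k) / real (n k)"
    using big eT
  proof eventually_elim
    case (elim k)
    have nk: "2 * (T + 1) \<le> real (n k)" "2 \<le> real (n k)" using elim(1) by linarith+
    have ek: "0 < e k" "e k < 1/2" using e(1) by auto
    have a: "e k * (1 / real (n k)) \<le> 1/2 * (1 / 2)" using nk ek by (intro mult_mono divide_left_mono) auto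
    have "(T + e k) / real (n k) \<le> 1/2" using nk ek by (simp add: pos_divide_le_eq)
    moreover have "(T - e k) / real (n k) \<le> (T + e k) / real (n k)" using ek by (intro divide_right_mono) auto
    ultimately have b: "0 \<le> \<rho> k - (T + e k) / real (n k)" "0 \<le> \<rho> k - (T - e k) / real (n k)" using rho_lo[of k] by linarith+
    have c: "0 < \<rho> k - e k * (1 / real (n k))" using a rho_lo[of k] by linarith
    have "0 \<le> t1 k" "0 \<le> t2 k" using c elim ek T rho_pos[of k] by (auto simp: t1_def t2_def)
    then show ?case using b c by blast
  qed
  have P1: "(\<lambda>k. (1 - t1 k) ^ l k) \<longlonglongrightarrow> exp (- T)"
    by (rule tendsto_one_minus_power[OF _ t1_0 lt1]) (use facts in \<open>eventually_elim, blast\<close>)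
  have P2: "(\<lambda>k. (1 - t2 k) ^ l k) \<longlonglongrightarrow> exp (- T)"
    by (rule tendsto_one_minus_power[OF _ t2_0 lt2]) (use facts in \<open>eventually_elim, blast\<close>)
  have P3: "(\<lambda>k. (1 - e k) * (1 - t2 k) ^ l k) \<longlonglongrightarrow> exp (- T)"
  proof -
    have "(\<lambda>k. (1 - e k) * (1 - t2 k) ^ l k) \<longlonglongrightarrow> (1 - 0) * exp (- T)" by (intro tendsto_intros P2 e(2))
    then show ?thesis by simp
  qed
  have "\<forall>\<^sub>F k in sequentially. (1 - e k) * (1 - t2 k) ^ l k \<le> V k (n k) / W k (n k) \<and> V k (n k) / W k (n k) \<le> (1 - t1 k) ^ l k"
    using facts e(3)
  proof eventually_elim
    case (elim k)
    note Mk = M[OF elim(2)]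
    have ek: "0 < e k" "e k < 1/2" using e(1) by auto
    define q where "q = \<rho> k - e k * (1 / real (n k))"
    define a where "a = \<rho> k - (T - e k) / real (n k)"
    define b where "b = \<rho> k - (T + e k) / real (n k)"
    have pos: "0 < q" "0 \<le> a" "0 \<le> b" using elim(1) by (auto simp: q_def a_def b_def)
    have Vup: "V k (M k + i) \<le> a ^ i * V k (M k)" for i
    proof (induction i)
      case (Suc i)
      have "V k (M k + Suc i) \<le> a * V k (M k + i)" using Mk by (simp add: a_def)
      also have "\<dots> \<le> a * (a ^ i * V k (M k))" using Suc pos by (intro mult_left_mono) auto
      finally show ?case by simp
    qed simp
    have Vlo: "b ^ i * V k (M k) \<le> V k (M k + i)" for i
    proof (induction i)
      case (Suc i)
      have "b * (b ^ i * V k (M k)) \<le> b * V k (M k + i)" using Suc pos by (intro mult_left_mono) auto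
      also have "\<dots> \<le> V k (M k + Suc i)" using Mk by (simp add: b_def)
      finally show ?case by simp
    qed simp
    have Wlo: "q ^ i * W k (M k) \<le> W k (M k + i)" for i
    proof (induction i)
      case (Suc i)
      have "q * (q ^ i * W k (M k)) \<le> q * W k (M k + i)" using Suc pos by (intro mult_left_mono) auto
      also have "\<dots> \<le> W k (M k + Suc i)" using Mk by (simp add: q_def)
      finally show ?case by simp
    qed simp
    have Wup: "W k (M k + i) \<le> \<rho> k ^ i * W k (M k)" for i
    proof (induction i)
      case (Suc i)
      have "W k (M k + Suc i) \<le> \<rho> k * W k (M k + i)"
        using step_upper[OF one_cube traj_cube[OF one_cube one_cube], of k k "M k + i"] by (simp add: W_def traj_Suc)
      also have "\<dots> \<le> \<rho> k * (\<rho> k ^ i * W k (M k))" using Suc rho_pos[of k] by (intro mult_left_mono) auto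
      finally show ?case by simp
    qed simp
    have nl: "n k = M k + l k" using Mk by (simp add: l_def)
    have WM: "0 < W k (M k)" by (rule W)
    have "V k (n k) / W k (n k) \<le> (a ^ l k * W k (M k)) / (q ^ l k * W k (M k))"
    proof (rule frac_le)
      have "V k (n k) \<le> a ^ l k * V k (M k)" unfolding nl by (rule Vup)
      also have "\<dots> \<le> a ^ l k * W k (M k)" using V pos by (intro mult_left_mono) auto
      finally show "V k (n k) \<le> a ^ l k * W k (M k)" .
      show "q ^ l k * W k (M k) \<le> W k (n k)" unfolding nl by (rule Wlo)
    qed (use pos WM in auto)
    also have "\<dots> = (a / q) ^ l k" using WM by (simp add: power_divide)
    also have "a / q = 1 - t1 k"
    proof -
      have a: "a = q - (T - 2 * e k) * (1 / real (n k))" by (simp add: a_def q_def diff_divide_distrib)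
      have t: "t1 k = (T - 2 * e k) * (1 / real (n k)) / q" unfolding t1_def q_def ..
      have "(q - x) / q = 1 - x / q" for x using pos(1) by (simp add: diff_divide_distrib)
      then show ?thesis unfolding a t .
    qed
    finally have up: "V k (n k) / W k (n k) \<le> (1 - t1 k) ^ l k" .
    have "(1 - e k) * (1 - t2 k) ^ l k = (b ^ l k * ((1 - e k) * W k (M k))) / (\<rho> k ^ l k * W k (M k))"
    proof -
      have "1 - t2 k = b / \<rho> k" using rho_pos[of k] by (simp add: t2_def b_def diff_divide_distrib)
      then show ?thesis using WM by (simp add: power_divide)
    qed
    also have "\<dots> \<le> V k (n k) / W k (n k)"
    proof (rule frac_le)
      have "b ^ l k * ((1 - e k) * W k (M k)) \<le> b ^ l k * V k (M k)" using Mk pos by (intro mult_left_mono) auto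
      also have "\<dots> \<le> V k (n k)" unfolding nl by (rule Vlo)
      finally show "b ^ l k * ((1 - e k) * W k (M k)) \<le> V k (n k)" .
      show "W k (n k) \<le> \<rho> k ^ l k * W k (M k)" unfolding nl by (rule Wup)
    qed (use V W in auto)
    finally show ?case using up by blast
  qed
  then show ?thesis unfolding V_def[symmetric] W_def[symmetric]
    by (intro tendsto_sandwich[OF _ _ P3 P1]) (auto elim: eventually_mono)
qed

lemma sub_limit: "(\<lambda>k. gap k (s k) (n k) $ j / traj k 1 1 (n k) $ j) \<longlonglongrightarrow> exp (- T)"
proof -
  define V where "V k = v k \<bullet> gap k (s k) (n k)" for k
  define W where "W k = v k \<bullet> traj k 1 1 (n k)" for k
  have W: "0 < W k" for k unfolding W_def by (rule survival_pos)
  have VW: "(\<lambda>k. V k / W k) \<longlonglongrightarrow> exp (- T)" unfolding V_def W_def by (rule sub_ratio_limit)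
  have "\<forall>\<^sub>F k in sequentially. 0 < V k / W k" by (rule order_tendstoD(1)[OF VW]) simp
  then have Vpos: "\<forall>\<^sub>F k in sequentially. 0 < V k"
    by eventually_elim (use W in \<open>simp add: pos_less_divide_eq\<close>)
  have g: "(\<lambda>k. gap k (s k) (n k) $ j / (V k * u k $ j)) \<longlonglongrightarrow> 1" unfolding V_def
  proof (rule align_comp)
    show "\<forall>\<^sub>F k in sequentially. 0 < v k \<bullet> gap k (s k) (n k)" using Vpos by (simp add: V_def)
    fix e :: real assume "e > 0"
    from gap_alignment[OF s sig_null this] obtain N where
      N: "\<forall>\<^sub>F k in sequentially. \<forall>m\<ge>N. dev k (gap k (s k) m) \<le> e * (v k \<bullet> gap k (s k) m)" by blast
    show "\<forall>\<^sub>F k in sequentially. dev k (gap k (s k) (n k)) \<le> e * (v k \<bullet> gap k (s k) (n k))"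
      using N eventually_compose_filterlim[OF eventually_ge_at_top[of N] n] by eventually_elim blast
  qed
  have d: "(\<lambda>k. traj k 1 1 (n k) $ j / (W k * u k $ j)) \<longlonglongrightarrow> 1" unfolding W_def
    by (rule regular_comp[OF regular_survival survival_pos n])
  have "(\<lambda>k. (gap k (s k) (n k) $ j / (V k * u k $ j)) * (V k / W k) / (traj k 1 1 (n k) $ j / (W k * u k $ j))) \<longlonglongrightarrow> 1 * exp (- T) / 1"
    by (intro tendsto_intros g d VW) simp
  then have lim: "(\<lambda>k. (gap k (s k) (n k) $ j / (V k * u k $ j)) * (V k / W k) / (traj k 1 1 (n k) $ j / (W k * u k $ j))) \<longlonglongrightarrow> exp (- T)"
    by simp
  show ?thesis
    by (rule Lim_transform_eventually[OF lim]) (use Vpos in eventually_elim, use W u_pos in \<open>simp add: less_imp_neq[THEN not_sym]\<close>)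
qed

end

end

section \<open>The Perron root at the extinction probabilities\<close>

context near_critical
begin

lemma tendsto_ip: "(\<And>j. (\<lambda>m. f m $ j) \<longlonglongrightarrow> w $ j) \<Longrightarrow> (\<lambda>m. v k \<bullet> f m) \<longlonglongrightarrow> v k \<bullet> w"
  unfolding inner_vec_real by (intro tendsto_sum tendsto_mult tendsto_const)

lemma tendsto_dev: "(\<And>j. (\<lambda>m. f m $ j) \<longlonglongrightarrow> w $ j) \<Longrightarrow> (\<lambda>m. dev k (f m)) \<longlonglongrightarrow> dev k w"
  unfolding dev_def vn_def by (simp, intro tendsto_sum tendsto_mult tendsto_const tendsto_rabs tendsto_diff tendsto_ip)

lemma eventually_le_null:
  fixes f :: "nat \<Rightarrow> real"
  assumes "\<And>k. 0 \<le> f k" "\<And>e. e > 0 \<Longrightarrow> \<forall>\<^sub>F k in sequentially. f k \<le> e"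
  shows "f \<longlonglongrightarrow> 0"
  unfolding tendsto_iff
proof (intro allI impI)
  fix e :: real assume "e > 0"
  then have "\<forall>\<^sub>F k in sequentially. f k \<le> e / 2" by (intro assms(2)) simp
  then show "\<forall>\<^sub>F k in sequentially. dist (f k) 0 < e"
    by eventually_elim (use assms(1) \<open>e > 0\<close> in \<open>auto simp: dist_real_def intro: le_less_trans\<close>)
qed

context
  fixes w :: "nat \<Rightarrow> real^'d"
  assumes sup: "\<And>k. 1 < \<rho> k" and w: "\<And>k j. (\<lambda>m. traj k 1 1 m $ j) \<longlonglongrightarrow> w k $ j"
begin

lemma survival_limit_nonneg: "0 \<le> w k"
  unfolding less_eq_vec_def
proof
  fix j show "0 $ j \<le> w k $ j"
    using traj_cube[OF one_cube one_cube, of k] by (intro tendsto_lowerbound[OF w]) (auto simp: cube_def)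
qed

text \<open>Letting m tend to infinity in the expansion gives the approximate fixed point equation
  for the limit L; division by L requires \<open>L > 0\<close>.\<close>

lemma survival_limit_bounds:
  assumes e: "e > 0"
  shows "\<forall>\<^sub>F k in sequentially. 0 < v k \<bullet> w k \<and> \<bar>Q k * (v k \<bullet> w k) - (\<rho> k - 1)\<bar> \<le> e * (Q k * (v k \<bullet> w k)) \<and>
     dev k (w k) \<le> e * (v k \<bullet> w k)"
proof -
  obtain N1 where N1: "\<forall>\<^sub>F k in sequentially. \<forall>m\<ge>N1. \<bar>v k \<bullet> traj k 1 1 (Suc m) - (\<rho> k * (v k \<bullet> traj k 1 1 m) - Q k * (v k \<bullet> traj k 1 1 m)^2 + v k \<bullet> (1 - 1))\<bar>
      \<le> e * (Q k * (v k \<bullet> traj k 1 1 m)^2 + v k \<bullet> (1 - 1))"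
    using regular_expansion[OF regular_survival e] by blast
  obtain N2 where N2: "\<forall>\<^sub>F k in sequentially. \<forall>m\<ge>N2. dev k (traj k 1 1 m) \<le> e * (v k \<bullet> traj k 1 1 m)"
    using regular_alignment[OF regular_survival e] by blast
  show ?thesis using N1 N2
  proof eventually_elim
    case (elim k)
    define W where "W m = v k \<bullet> traj k 1 1 m" for m
    define L where "L = v k \<bullet> w k"
    have W: "0 < W m" for m unfolding W_def by (rule survival_pos)
    have WL: "W \<longlonglongrightarrow> L" unfolding W_def L_def by (rule tendsto_ip[OF w])
    have ex: "\<bar>W (Suc m) - (\<rho> k * W m - Q k * (W m)^2)\<bar> \<le> e * (Q k * (W m)^2)" if "N1 \<le> m" for m
      using elim(1) that by (simp add: W_def)
    \<comment> \<open>Survival decreases in m, so its expansion cannot predict growth; the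
      projection therefore stays above almost (\<open>\<rho>\<close> - 1) / Q.\<close>
    have low: "(\<rho> k - 1) / (Q k * (1 + e)) \<le> W m" if "N1 \<le> m" for m
    proof -
      have "W (Suc m) \<le> W m" unfolding W_def by (intro ip_mono y_Suc_le one_cube)
      then have "\<rho> k * W m - Q k * (W m)^2 - e * (Q k * (W m)^2) \<le> W m" using ex[OF that] unfolding abs_le_iff by linarith
      then have "(\<rho> k - 1) * W m \<le> (Q k * (1 + e) * W m) * W m" by (simp add: power2_eq_square algebra_simps)
      then have "\<rho> k - 1 \<le> Q k * (1 + e) * W m" using W[of m] by simp
      then show ?thesis using Q_pos[of k] e by (simp add: pos_divide_le_eq mult_ac)
    qed
    have "(\<rho> k - 1) / (Q k * (1 + e)) \<le> L"
      by (rule tendsto_lowerbound[OF WL]) (use low in \<open>auto simp: eventually_sequentially\<close>)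
    moreover have "0 < (\<rho> k - 1) / (Q k * (1 + e))" using sup[of k] Q_pos[of k] e by simp
    ultimately have L: "0 < L" by linarith
    have "\<bar>L - (\<rho> k * L - Q k * L^2)\<bar> \<le> e * (Q k * L^2)"
    proof (rule tendsto_le[OF sequentially_bot])
      show "(\<lambda>m. \<bar>W (Suc m) - (\<rho> k * W m - Q k * (W m)^2)\<bar>) \<longlonglongrightarrow> \<bar>L - (\<rho> k * L - Q k * L^2)\<bar>"
        by (intro tendsto_intros WL LIMSEQ_Suc)
      show "(\<lambda>m. e * (Q k * (W m)^2)) \<longlonglongrightarrow> e * (Q k * L^2)" by (intro tendsto_intros WL)
      show "\<forall>\<^sub>F m in sequentially. \<bar>W (Suc m) - (\<rho> k * W m - Q k * (W m)^2)\<bar> \<le> e * (Q k * (W m)^2)"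
        using ex by (auto simp: eventually_sequentially)
    qed
    moreover have "L - (\<rho> k * L - Q k * L^2) = (Q k * L - (\<rho> k - 1)) * L" by (simp add: power2_eq_square algebra_simps)
    moreover have "e * (Q k * L^2) = e * (Q k * L) * L" by (simp add: power2_eq_square)
    ultimately have "\<bar>Q k * L - (\<rho> k - 1)\<bar> * L \<le> e * (Q k * L) * L" using L by (simp add: abs_mult)
    then have b: "\<bar>Q k * L - (\<rho> k - 1)\<bar> \<le> e * (Q k * L)" using L by simp
    have "dev k (w k) \<le> e * L"
    proof (rule tendsto_le[OF sequentially_bot])
      show "(\<lambda>m. dev k (traj k 1 1 m)) \<longlonglongrightarrow> dev k (w k)" by (rule tendsto_dev[OF w])
      show "(\<lambda>m. e * W m) \<longlonglongrightarrow> e * L" by (intro tendsto_intros WL)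
      show "\<forall>\<^sub>F m in sequentially. dev k (traj k 1 1 m) \<le> e * W m"
        using elim(2) unfolding W_def eventually_sequentially by blast
    qed
    then show ?case using L b by (simp add: L_def)
  qed
qed

lemma survival_limit_scaled: "(\<lambda>k. Q k * (v k \<bullet> w k) / (\<rho> k - 1)) \<longlonglongrightarrow> 1"
  and survival_limit_null: "(\<lambda>k. v k \<bullet> w k) \<longlonglongrightarrow> 0"
  and survival_limit_dev: "(\<lambda>k. dev k (w k) / (v k \<bullet> w k)) \<longlonglongrightarrow> 0"
proof -
  have "(\<lambda>k. \<bar>(\<rho> k - 1) / (Q k * (v k \<bullet> w k)) - 1\<bar>) \<longlonglongrightarrow> 0"
  proof (rule eventually_le_null)
    fix e :: real assume "e > 0"
    from survival_limit_bounds[OF this]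
    show "\<forall>\<^sub>F k in sequentially. \<bar>(\<rho> k - 1) / (Q k * (v k \<bullet> w k)) - 1\<bar> \<le> e"
    proof eventually_elim
      case (elim k)
      define q where "q = Q k * (v k \<bullet> w k)"
      have q: "0 < q" using elim Q_pos[of k] by (simp add: q_def)
      have "(\<rho> k - 1) / q - 1 = - ((q - (\<rho> k - 1)) / q)" using q by (simp add: field_simps)
      then have "\<bar>(\<rho> k - 1) / q - 1\<bar> = \<bar>q - (\<rho> k - 1)\<bar> / q" using q by (simp only: abs_minus_cancel abs_divide abs_of_pos)
      also have "\<dots> \<le> e" using elim q by (simp add: q_def[symmetric] pos_divide_le_eq)
      finally show ?case by (simp add: q_def)
    qed
  qed simp
  then have "(\<lambda>k. (\<rho> k - 1) / (Q k * (v k \<bullet> w k)) - 1) \<longlonglongrightarrow> 0" by (rule tendsto_rabs_zero_cancel)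
  then have "(\<lambda>k. (\<rho> k - 1) / (Q k * (v k \<bullet> w k))) \<longlonglongrightarrow> 1" by (rule LIM_zero_cancel)
  from tendsto_inverse[OF this] show sc: "(\<lambda>k. Q k * (v k \<bullet> w k) / (\<rho> k - 1)) \<longlonglongrightarrow> 1" by simp
  have Wn: "0 \<le> v k \<bullet> w k" for k by (rule ip_nonneg[OF survival_limit_nonneg])
  show "(\<lambda>k. v k \<bullet> w k) \<longlonglongrightarrow> 0"
  proof (rule Lim_null_comparison)
    have "(\<lambda>k. Q k * (v k \<bullet> w k) / (\<rho> k - 1) * (\<rho> k - 1) / c0) \<longlonglongrightarrow> 1 * 0 / c0"
      by (intro tendsto_intros sc tau_lim) (use c0_pos in simp)
    then show "(\<lambda>k. Q k * (v k \<bullet> w k) / (\<rho> k - 1) * (\<rho> k - 1) / c0) \<longlonglongrightarrow> 0" by simp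
    show "\<forall>\<^sub>F k in sequentially. norm (v k \<bullet> w k) \<le> Q k * (v k \<bullet> w k) / (\<rho> k - 1) * (\<rho> k - 1) / c0"
    proof (intro always_eventually allI)
      fix k
      have "c0 * (v k \<bullet> w k) \<le> Q k * (v k \<bullet> w k)" using Q_lo Wn by (intro mult_right_mono)
      then show "norm (v k \<bullet> w k) \<le> Q k * (v k \<bullet> w k) / (\<rho> k - 1) * (\<rho> k - 1) / c0"
        using sup[of k] c0_pos Wn[of k] by (simp add: pos_le_divide_eq mult.commute)
    qed
  qed
  show "(\<lambda>k. dev k (w k) / (v k \<bullet> w k)) \<longlonglongrightarrow> 0"
  proof (rule eventually_le_null)
    fix e :: real assume "e > 0"
    from survival_limit_bounds[OF this] show "\<forall>\<^sub>F k in sequentially. dev k (w k) / (v k \<bullet> w k) \<le> e"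
      by eventually_elim (simp add: pos_divide_le_eq)
  qed (use dev_nonneg Wn in simp)
qed

text \<open>Projecting \<open>A u' = r u'\<close> on v gives \<open>\<rho> - r\<close> as the
  second-derivative form at \<open>w\<close> and \<open>u'\<close> divided by the projection of
  \<open>u'\<close>. Both vectors are aligned with u, so this is about 2 Q times the projection of
  \<open>w\<close>, that is 2 (\<open>\<rho>\<close> - 1).\<close>

lemma perron_root_at_extinction:
  fixes A :: "nat \<Rightarrow> real^'d^'d" and r :: "nat \<Rightarrow> real" and u' :: "nat \<Rightarrow> real^'d"
  assumes A1: "\<And>k x. 0 \<le> x \<Longrightarrow> vn k (A k *v x - M k *v x) \<le> K * (v k \<bullet> w k) * (v k \<bullet> x)"
    and A2: "\<And>k x. 0 \<le> x \<Longrightarrow> \<bar>v k \<bullet> (A k *v x) - \<rho> k * (v k \<bullet> x) + bb k (w k) x\<bar> \<le> K * (v k \<bullet> w k)^2 * (v k \<bullet> x)"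
    and ev: "\<forall>\<^sub>F k in sequentially. A k *v u' k = r k *\<^sub>R u' k \<and> 0 \<le> u' k \<and> 0 < v k \<bullet> u' k \<and> 0 < r k"
    and K: "0 < K"
  shows "(\<lambda>k. (1 - r k) / (\<rho> k - 1)) \<longlonglongrightarrow> 1"
proof -
  define W where "W k = v k \<bullet> w k" for k
  define p where "p k = v k \<bullet> u' k" for k
  have Wpos: "\<forall>\<^sub>F k in sequentially. 0 < W k"
    using survival_limit_bounds[of 1] by (auto simp: W_def elim: eventually_mono)
  have al: "\<forall>\<^sub>F k in sequentially. dev k (u' k) / p k \<le> e" if e: "e > 0" for e
  proof -
    obtain L e' where e': "e' > 0" and L: "\<And>k z. \<forall>i\<le>L. 0 \<le> z i \<Longrightarrow>
       \<forall>i<L. vn k (z (Suc i) - M k *v z i) \<le> e' * (v k \<bullet> z i) \<Longrightarrow> dev k (z L) \<le> e * (v k \<bullet> z L)"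
      by (rule alignment[OF e]) (rule that; assumption)
    have "(\<lambda>k. K * W k) \<longlonglongrightarrow> K * 0" unfolding W_def by (intro tendsto_intros survival_limit_null)
    then have "\<forall>\<^sub>F k in sequentially. K * W k < e'" using e' by (intro order_tendstoD(2)) auto
    then show ?thesis using ev
    proof eventually_elim
      case (elim k)
      \<comment> \<open>The powers of \<open>r\<close> times the eigenvector form an exact orbit of
        \<open>A\<close>, hence nearly an orbit of \<open>M\<close>.\<close>
      have "dev k ((\<lambda>i. r k ^ i *\<^sub>R u' k) L) \<le> e * (v k \<bullet> (\<lambda>i. r k ^ i *\<^sub>R u' k) L)"
      proof (rule L[where z = "\<lambda>i. r k ^ i *\<^sub>R u' k" and k = k]; intro allI impI)
        fix i show "0 \<le> r k ^ i *\<^sub>R u' k" using elim by (auto simp: less_eq_vec_def)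
      next
        fix i
        have "r k ^ Suc i *\<^sub>R u' k - M k *v (r k ^ i *\<^sub>R u' k) = r k ^ i *\<^sub>R (A k *v u' k - M k *v u' k)"
          using elim by (simp add: matrix_vector_mult_scaleR scaleR_right_diff_distrib mult.commute)
        then have "vn k (r k ^ Suc i *\<^sub>R u' k - M k *v (r k ^ i *\<^sub>R u' k)) = r k ^ i * vn k (A k *v u' k - M k *v u' k)"
          using elim by (simp only: vn_scale) simp
        also have "\<dots> \<le> r k ^ i * (K * W k * p k)" using elim A1[of "u' k" k] by (intro mult_left_mono) (auto simp: W_def p_def)
        also have "\<dots> \<le> r k ^ i * (e' * p k)" using elim by (intro mult_left_mono mult_right_mono) (auto simp: p_def)
        finally show "vn k (r k ^ Suc i *\<^sub>R u' k - M k *v (r k ^ i *\<^sub>R u' k)) \<le> e' * (v k \<bullet> r k ^ i *\<^sub>R u' k)"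
          by (simp add: p_def mult_ac)
      qed
      moreover have "dev k (r k ^ L *\<^sub>R u' k) = r k ^ L * dev k (u' k)"
      proof -
        have "r k ^ L *\<^sub>R u' k - (v k \<bullet> (r k ^ L *\<^sub>R u' k)) *\<^sub>R u k = r k ^ L *\<^sub>R (u' k - (v k \<bullet> u' k) *\<^sub>R u k)"
          by (simp add: scaleR_right_diff_distrib)
        then show ?thesis unfolding dev_def using elim by (simp only: vn_scale) simp
      qed
      ultimately have "r k ^ L * dev k (u' k) \<le> r k ^ L * (e * p k)" by (simp add: p_def mult_ac)
      then have "dev k (u' k) \<le> e * p k" using elim by simp
      then show ?case using elim by (simp add: p_def pos_divide_le_eq)
    qed
  qed
  define F where "F k = (if 0 < p k then dev k (u' k) / p k else 0)" for k
  have F0: "F \<longlonglongrightarrow> 0"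
  proof (rule eventually_le_null)
    fix e :: real assume "e > 0"
    from al[OF this] show "\<forall>\<^sub>F k in sequentially. F k \<le> e" by eventually_elim (use \<open>e > 0\<close> in \<open>simp add: F_def\<close>)
  qed (simp add: F_def dev_nonneg)
  define E where "E k = dev k (w k) / W k" for k
  have E0: "E \<longlonglongrightarrow> 0" unfolding E_def W_def by (rule survival_limit_dev)
  define y where "y k = Q k * W k / (\<rho> k - 1)" for k
  have y: "y \<longlonglongrightarrow> 1" unfolding y_def W_def by (rule survival_limit_scaled)
  have err: "(\<lambda>k. (\<rho> k - r k) / (\<rho> k - 1) - 2 * y k) \<longlonglongrightarrow> 0"
  proof (rule Lim_null_comparison)
    have "(\<lambda>k. y k * (K * W k + C * (E k + F k)) / c0) \<longlonglongrightarrow> 1 * (K * 0 + C * (0 + 0)) / c0"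
      unfolding W_def by (intro tendsto_intros y E0 F0 survival_limit_null) (use c0_pos in simp)
    then show "(\<lambda>k. y k * (K * W k + C * (E k + F k)) / c0) \<longlonglongrightarrow> 0" by simp
    show "\<forall>\<^sub>F k in sequentially. norm ((\<rho> k - r k) / (\<rho> k - 1) - 2 * y k) \<le> y k * (K * W k + C * (E k + F k)) / c0"
      using ev Wpos
    proof eventually_elim
      case (elim k)
      have p: "0 < p k" using elim by (simp add: p_def)
      have a: "v k \<bullet> (A k *v u' k) = r k * p k" using elim by (simp add: p_def)
      have "\<bar>r k * p k - \<rho> k * p k + bb k (w k) (u' k)\<bar> \<le> K * (W k)^2 * p k"
        using A2[of "u' k" k] elim unfolding a by (simp add: p_def W_def)
      moreover have "\<bar>bb k (w k) (u' k) - 2 * Q k * W k * p k\<bar> \<le> C * (W k * (E k + F k) * p k)"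
      proof -
        have "dev k (w k) * p k + W k * dev k (u' k) = W k * (E k + F k) * p k"
          using p elim by (simp add: E_def F_def field_simps)
        then show ?thesis using bb_align[OF survival_limit_nonneg, of "u' k" k k] elim by (simp add: p_def W_def)
      qed
      moreover have "(\<rho> k - r k - 2 * Q k * W k) * p k = - (r k * p k - \<rho> k * p k + bb k (w k) (u' k)) + (bb k (w k) (u' k) - 2 * Q k * W k * p k)"
        by (simp add: algebra_simps)
      moreover have "(K * (W k)^2 + C * (W k * (E k + F k))) * p k = K * (W k)^2 * p k + C * (W k * (E k + F k) * p k)"
        by (simp add: algebra_simps)
      ultimately have 1: "\<bar>(\<rho> k - r k - 2 * Q k * W k) * p k\<bar> \<le> (K * (W k)^2 + C * (W k * (E k + F k))) * p k"
        by linarith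
      then have "\<bar>\<rho> k - r k - 2 * Q k * W k\<bar> * p k \<le> (K * (W k)^2 + C * (W k * (E k + F k))) * p k"
        using p by (simp add: abs_mult)
      then have "\<bar>\<rho> k - r k - 2 * Q k * W k\<bar> \<le> K * (W k)^2 + C * (W k * (E k + F k))"
        using p by (rule mult_right_le_imp_le)
      also have "\<dots> = W k * (K * W k + C * (E k + F k))" by (simp add: power2_eq_square algebra_simps)
      also have "\<dots> \<le> Q k * W k / c0 * (K * W k + C * (E k + F k))"
      proof (rule mult_right_mono)
        have "c0 * W k \<le> Q k * W k" using Q_lo[of k] elim by (intro mult_right_mono) auto
        then show "W k \<le> Q k * W k / c0" using c0_pos by (simp add: pos_le_divide_eq mult.commute)
        have "0 \<le> E k" "0 \<le> F k" using elim p dev_nonneg by (auto simp: E_def F_def)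
        then show "0 \<le> K * W k + C * (E k + F k)" using elim K C_ge1 by simp
      qed
      finally have "\<bar>\<rho> k - r k - 2 * Q k * W k\<bar> / (\<rho> k - 1) \<le> Q k * W k / c0 * (K * W k + C * (E k + F k)) / (\<rho> k - 1)"
        using sup[of k] by (intro divide_right_mono) auto
      moreover have "(\<rho> k - r k) / (\<rho> k - 1) - 2 * y k = (\<rho> k - r k - 2 * Q k * W k) / (\<rho> k - 1)"
        by (simp add: y_def diff_divide_distrib mult.assoc)
      moreover have "\<bar>(\<rho> k - r k - 2 * Q k * W k) / (\<rho> k - 1)\<bar> = \<bar>\<rho> k - r k - 2 * Q k * W k\<bar> / (\<rho> k - 1)"
        using sup[of k] by simp
      moreover have "Q k * W k / c0 * (K * W k + C * (E k + F k)) / (\<rho> k - 1) = y k * (K * W k + C * (E k + F k)) / c0"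
        by (simp add: y_def)
      ultimately show ?case by (simp only: real_norm_def)
    qed
  qed
  have "(\<lambda>k. (\<rho> k - r k) / (\<rho> k - 1) - 2 * y k + 2 * y k - 1) \<longlonglongrightarrow> 0 + 2 * 1 - 1" by (intro tendsto_intros err y)
  moreover have "(\<rho> k - r k) / (\<rho> k - 1) - 2 * y k + 2 * y k - 1 = (1 - r k) / (\<rho> k - 1)" for k
    using sup[of k] by (simp add: field_simps)
  ultimately show ?thesis by simp
qed

end

end

section \<open>Sequences in the class K\<close>

lemma less_eq_vecI: "(\<And>i. x$i \<le> (y::real^'d::finite)$i) \<Longrightarrow> x \<le> y"
  by (simp add: less_eq_vec_def)

lemma (in primitive_eigen) eigenvector_lower: "a \<le> r ^ U * u$i" "a * (\<Sum>j\<in>UNIV. v$j) \<le> r ^ U * v$i"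
proof -
  show "a \<le> r ^ U * u$i"
    using mpow_vec_ge[of u i] u_pos u_sum by (simp add: mpow_eigenvector[OF u_eig] less_imp_le)
  have "transpose A *v v = r *\<^sub>R v" using v_eig by simp
  from mpow_eigenvector[OF this] show "a * (\<Sum>j\<in>UNIV. v$j) \<le> r ^ U * v$i"
    using primitive_matrix.mpow_vec_ge[OF transpose_primitive, of v i] v_pos by (simp add: less_imp_le)
qed

locale critical_family =
  fixes P :: "nat \<Rightarrow> 'd::finite offspring" and a b c :: real and U :: nat
  assumes pos: "a > 0" "b > 0" "c > 0" "U \<ge> 1"
    and inK: "P k \<in> classK a b c U"
    and rho_lo': "1/2 \<le> rho (P k)" and rho_hi': "rho (P k) \<le> 2"
    and rho_lim': "(\<lambda>k. rho (P k)) \<longlonglongrightarrow> 1"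
begin

text \<open>The uniform constants: \<open>K3\<close> bounds third moments; \<open>cl\<close> bounds
  both eigenvectors below, \<open>2 ^ U\<close> bounding \<open>\<rho>^U\<close>; \<open>cc\<close>
  also bounds Q, half a sum of second derivatives weighted by three eigenvector entries;
  \<open>CC\<close> has one factor 1/cl for projecting on v and up to three for replacing coordinate
  sums by projections.\<close>

definition K3 :: real where "K3 = 8 + 9/2 * c"
definition cl :: real where "cl = min 1 (a / 2 ^ U)"
definition cc :: real where "cc = min cl (cl ^ 3 * b / 2)"
definition CC :: real where "CC = real CARD('d) * K3 * (1 / cl) ^ 4"

abbreviation A :: "nat \<Rightarrow> real^'d^'d" where "A k \<equiv> jac (P k) 1"
abbreviation uu :: "nat \<Rightarrow> real^'d" where "uu k \<equiv> uvec (P k)"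
abbreviation vv :: "nat \<Rightarrow> real^'d" where "vv k \<equiv> vvec (P k)"

lemma moments: "offspring_moments (P k) K3"
  unfolding K3_def by (rule classK_moments[OF inK])

lemma K3_ge1: "1 \<le> K3" using pos by (simp add: K3_def)

lemma cl: "0 < cl" "cl \<le> 1" using pos by (auto simp: cl_def)

lemma primitive: "primitive_matrix (A k) a U"
proof
  show "0 \<le> A k $ i $ j" for i j by (rule offspring_moments.jac1_bounds[OF moments])
  show "a \<le> mpow (A k) U $ i $ j" for i j using inK[of k] by (simp add: classK_def)
qed (use pos in auto)

lemma eigen: "primitive_eigen_norm (A k) a U (rho (P k)) (uu k) (vv k)"
  unfolding rho_def uvec_def vvec_def by (rule primitive_matrix.perron[OF primitive])

lemma eigen': "primitive_eigen (A k) a U (rho (P k)) (uu k) (vv k)"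
  by (rule primitive_eigen_norm.axioms(1)[OF eigen])

lemmas rho_pos = primitive_eigen.r_pos[OF eigen']
lemmas u_pos = primitive_eigen.u_pos[OF eigen']
lemmas v_pos = primitive_eigen.v_pos[OF eigen']
lemmas u_sum = primitive_eigen.u_sum[OF eigen']
lemmas uv_sum = primitive_eigen_norm.uv_sum[OF eigen]

lemma rho_pow: "rho (P k) ^ U \<le> 2 ^ U"
  using rho_hi' rho_pos by (intro power_mono) (auto simp: less_imp_le)

text \<open>\<open>A^U\<close> spreads the mass of an eigenvector over all coordinates. The
  coordinate sum of v is at least 1 because u is at most 1 and the pairing is 1; each product of
  entries is at most 1, which bounds v above.\<close>

lemma u_cl: "cl \<le> uu k $ j" and v_cl: "cl \<le> vv k $ j" and v_hi': "vv k $ j \<le> 1 / cl" and u_le1: "uu k $ j \<le> 1"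
proof -
  have "a \<le> 2 ^ U * uu k $ j"
    using primitive_eigen.eigenvector_lower(1)[OF eigen', of k j] mult_right_mono[OF rho_pow[of k], of "uu k $ j"] u_pos[of k j] by linarith
  then have "a / 2 ^ U \<le> uu k $ j" by (simp add: pos_divide_le_eq mult.commute)
  then show u: "cl \<le> uu k $ j" by (simp add: cl_def)
  show u1: "uu k $ j \<le> 1" for j
    using member_le_sum[of j UNIV "\<lambda>j. uu k $ j"] u_pos u_sum by (auto simp: less_imp_le)
  have "(\<Sum>i\<in>UNIV. uu k $ i * vv k $ i) \<le> (\<Sum>i\<in>UNIV. vv k $ i)"
    using u1 u_pos v_pos by (intro sum_mono mult_left_le_one_le) (auto simp: less_imp_le)
  then have "a * 1 \<le> a * (\<Sum>i\<in>UNIV. vv k $ i)" using pos uv_sum[of k] by (intro mult_left_mono) auto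
  also have "\<dots> \<le> rho (P k) ^ U * vv k $ j" by (rule primitive_eigen.eigenvector_lower(2)[OF eigen'])
  also have "\<dots> \<le> 2 ^ U * vv k $ j" using rho_pow v_pos by (intro mult_right_mono) (auto simp: less_imp_le)
  finally have "a / 2 ^ U \<le> vv k $ j" by (simp add: pos_divide_le_eq mult.commute)
  then show "cl \<le> vv k $ j" by (simp add: cl_def)
  have "cl * vv k $ j \<le> uu k $ j * vv k $ j" using u v_pos by (intro mult_right_mono) (auto simp: less_imp_le)
  also have "\<dots> \<le> 1" using member_le_sum[of j UNIV "\<lambda>j. uu k $ j * vv k $ j"] u_pos v_pos uv_sum[of k]
    by (auto simp: less_imp_le)
  finally show "vv k $ j \<le> 1 / cl" using cl by (simp add: pos_le_divide_eq mult.commute)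
qed

lemma vsum_le: "vsum (\<chi> i. \<bar>x$i\<bar>) \<le> 1 / cl * (\<Sum>i\<in>UNIV. vv k $ i * \<bar>x$i\<bar>)"
  unfolding sum_distrib_left
proof (rule sum_mono)
  fix i
  have "cl * \<bar>x$i\<bar> \<le> vv k $ i * \<bar>x$i\<bar>" using v_cl by (intro mult_right_mono) auto
  then show "(\<chi> i. \<bar>x$i\<bar>) $ i \<le> 1 / cl * (vv k $ i * \<bar>x$i\<bar>)" using cl by (simp add: pos_le_divide_eq mult.commute)
qed

lemma vsum_le_ip: "0 \<le> x \<Longrightarrow> vsum x \<le> 1 / cl * (vv k \<bullet> x)"
  using vsum_le[of x k] by (simp add: less_eq_vec_def inner_vec_real)

lemma vsum_nonneg: "0 \<le> x \<Longrightarrow> 0 \<le> vsum (x::real^'d)"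
  by (simp add: less_eq_vec_def sum_nonneg)

lemma abs_ip_le: "(\<And>j. \<bar>x$j\<bar> \<le> B) \<Longrightarrow> \<bar>vv k \<bullet> x\<bar> \<le> real CARD('d) * (1 / cl) * B"
proof -
  assume x: "\<And>j. \<bar>x$j\<bar> \<le> B"
  have B: "0 \<le> B" using x[of undefined] by (rule order_trans[rotated]) simp
  have "\<bar>vv k \<bullet> x\<bar> \<le> (\<Sum>j\<in>(UNIV::'d set). 1 / cl * B)" unfolding inner_vec_real
  proof (intro order_trans[OF sum_abs] sum_mono)
    fix j
    have "\<bar>vv k $ j * x $ j\<bar> = vv k $ j * \<bar>x $ j\<bar>" using v_pos[of k j] by (simp add: abs_mult)
    also have "\<dots> \<le> 1 / cl * B"
      by (rule mult_mono[OF v_hi' x]) (use cl in auto)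
    finally show "\<bar>vv k $ j * x $ j\<bar> \<le> 1 / cl * B" .
  qed
  then show ?thesis by simp
qed

lemma CC_bounds: "1 / cl \<le> CC" "K3 \<le> CC" "K3 * (1 / cl)^2 \<le> CC" "real CARD('d) * K3 * (1 / cl) ^ 3 \<le> CC" "1 \<le> CC"
  "real CARD('d) * K3 * (1 / cl) \<le> CC" "K3 * (1 / cl) \<le> CC"
proof -
  define E where "E = 1 / cl"
  have E: "1 \<le> E" using cl by (simp add: E_def)
  have d: "1 \<le> real CARD('d)" by (metis One_nat_def Suc_leI of_nat_1 of_nat_le_iff zero_less_card_finite)
  have dK: "1 \<le> real CARD('d) * K3" "K3 \<le> real CARD('d) * K3"
    using mult_mono[OF d K3_ge1] mult_right_mono[OF d, of K3] K3_ge1 by auto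
  have pw: "1 \<le> E ^ 4" "E \<le> E ^ 4" "E ^ 2 \<le> E ^ 4" "E ^ 3 \<le> E ^ 4"
    using power_increasing[of 0 4 E] power_increasing[of 1 4 E] power_increasing[of 2 4 E] power_increasing[of 3 4 E] E by auto
  have CC: "CC = (real CARD('d) * K3) * E ^ 4" by (simp add: CC_def E_def)
  have CCI: "x * y \<le> CC" if "x \<le> real CARD('d) * K3" "y \<le> E ^ 4" "0 \<le> y" for x y
    unfolding CC using that dK by (intro mult_mono) auto
  have "1 * E \<le> CC" "1 * 1 \<le> CC" "K3 * 1 \<le> CC" "K3 * E^2 \<le> CC" "(real CARD('d) * K3) * E ^ 3 \<le> CC" "(real CARD('d) * K3) * E \<le> CC" "K3 * E \<le> CC"
    by (rule CCI; use dK pw E in simp)+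
  then show "1 / cl \<le> CC" "K3 \<le> CC" "K3 * (1 / cl)^2 \<le> CC" "real CARD('d) * K3 * (1 / cl) ^ 3 \<le> CC" "1 \<le> CC" "real CARD('d) * K3 * (1 / cl) \<le> CC"
    "K3 * (1 / cl) \<le> CC"
    by (simp_all add: E_def)
qed

lemma bform_abs: "\<bar>bform (P k) x y $ j\<bar> \<le> K3 * (vsum (\<chi> i. \<bar>x$i\<bar>) * vsum (\<chi> i. \<bar>y$i\<bar>))"
proof -
  have "\<bar>bform (P k) x y $ j\<bar> \<le> (\<Sum>l\<in>UNIV. \<Sum>m\<in>UNIV. K3 * (\<bar>x$l\<bar> * \<bar>y$m\<bar>))"
    unfolding bform_def vec_lambda_beta
  proof (intro order_trans[OF sum_abs] sum_mono)
    fix l m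
    have "\<bar>bcoef (P k) j l m * x$l * y$m\<bar> = bcoef (P k) j l m * (\<bar>x$l\<bar> * \<bar>y$m\<bar>)"
      using offspring_moments.bcoef_bounds(1)[OF moments] by (simp add: abs_mult)
    also have "\<dots> \<le> K3 * (\<bar>x$l\<bar> * \<bar>y$m\<bar>)"
      using offspring_moments.bcoef_bounds(2)[OF moments] by (intro mult_right_mono) auto
    finally show "\<bar>bcoef (P k) j l m * x$l * y$m\<bar> \<le> K3 * (\<bar>x$l\<bar> * \<bar>y$m\<bar>)" .
  qed
  also have "\<dots> = K3 * (vsum (\<chi> i. \<bar>x$i\<bar>) * vsum (\<chi> i. \<bar>y$i\<bar>))"
    by (simp only: vec_lambda_beta sum_product) (simp only: sum_distrib_left)
  finally show ?thesis .
qed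

lemma bilinear_bform: "bilinear (\<lambda>x y. vv k \<bullet> bform (P k) x y)"
  unfolding bilinear_def
  by (auto intro!: linearI simp: inner_vec_real bform_def sum.distrib sum_distrib_left algebra_simps)

lemma Qpar_eq: "vv k \<bullet> bform (P k) (uu k) (uu k) = 2 * Qpar (P k)"
  by (simp add: Qpar_def bform_def inner_vec_real)

lemma Qpar_bounds: "cc \<le> Qpar (P k)" "Qpar (P k) \<le> CC"
proof -
  have "cl ^ 3 * b \<le> cl ^ 3 * (\<Sum>j\<in>UNIV. \<Sum>l\<in>UNIV. \<Sum>m\<in>UNIV. bcoef (P k) j l m)"
    using inK[of k] cl by (intro mult_left_mono) (auto simp: classK_def)
  also have "\<dots> \<le> (\<Sum>j\<in>UNIV. \<Sum>l\<in>UNIV. \<Sum>m\<in>UNIV. vv k $ j * (bcoef (P k) j l m * uu k $ l * uu k $ m))"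
    unfolding sum_distrib_left
  proof (intro sum_mono)
    fix j l m
    have "cl ^ 3 * bcoef (P k) j l m = cl * (bcoef (P k) j l m * cl * cl)" by (simp add: power3_eq_cube)
    also have "\<dots> \<le> vv k $ j * (bcoef (P k) j l m * uu k $ l * uu k $ m)"
      using offspring_moments.bcoef_bounds(1)[OF moments] cl u_cl v_cl u_pos v_pos
      by (intro mult_mono mult_nonneg_nonneg) (auto simp: less_imp_le)
    finally show "cl ^ 3 * bcoef (P k) j l m \<le> vv k $ j * (bcoef (P k) j l m * uu k $ l * uu k $ m)" .
  qed
  also have "\<dots> = 2 * Qpar (P k)" by (simp add: Qpar_def sum_distrib_left)
  finally show "cc \<le> Qpar (P k)" by (simp add: cc_def)
  have us: "vsum (\<chi> i. \<bar>uu k $ i\<bar>) = 1" using u_pos u_sum by (simp add: less_imp_le)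
  have "\<bar>vv k \<bullet> bform (P k) (uu k) (uu k)\<bar> \<le> real CARD('d) * (1 / cl) * K3"
    using bform_abs[of k "uu k" "uu k"] unfolding us by (intro abs_ip_le) simp
  moreover have "real CARD('d) * (1 / cl) * K3 = real CARD('d) * K3 * (1 / cl)" by simp
  ultimately have "\<bar>2 * Qpar (P k)\<bar> \<le> CC" using CC_bounds(6) unfolding Qpar_eq by linarith
  then show "Qpar (P k) \<le> CC" using CC_bounds(5) by linarith
qed

lemma cube_nth: "x \<in> cube \<Longrightarrow> 0 \<le> x$l" "x \<in> cube \<Longrightarrow> x$l \<le> 1"
  by (auto simp: cube_def)

text \<open>Every coordinate sum is traded for a projection at the price 1/cl, and every
  componentwise bound is projected on v at the price of the number of types times 1/cl.\<close>

sublocale near_critical "\<lambda>k. gmap (P k)" A "\<lambda>k x y. vv k \<bullet> bform (P k) x y" uu vv "\<lambda>k. rho (P k)" "\<lambda>k. Qpar (P k)" a cc CC U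
proof
  fix k
  interpret offspring_moments "P k" K3 by (rule moments)
  show "0 < cc" using cl pos by (simp add: cc_def)
  show "1 \<le> CC" by (rule CC_bounds)
  show "cc \<le> vv k $ j" "cc \<le> uu k $ j" for j using v_cl[of k j] u_cl[of k j] by (auto simp: cc_def)
  show "vv k $ j \<le> CC" for j using v_hi'[of k j] CC_bounds(1) by linarith
  show "vv k \<bullet> uu k = 1" using uv_sum[of k] by (simp add: inner_vec_real mult.commute)
  show "0 \<le> A k $ i $ j" "A k $ i $ j \<le> CC" for i j using jac1_bounds[of i j] CC_bounds(2) by linarith+
  show "vv k \<bullet> (A k *v x) = rho (P k) * (vv k \<bullet> x)" for x
    unfolding inner_vec_real by (rule primitive_eigen.left_sum[OF eigen'])
  show "A k *v uu k = rho (P k) *\<^sub>R uu k" by (rule primitive_eigen.u_eig[OF eigen'])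
  show "a \<le> mpow (A k) U $ i $ j" for i j by (rule primitive_matrix.mpow_ge[OF primitive])
  show "1/2 \<le> rho (P k)" "rho (P k) \<le> 2" by (rule rho_lo' rho_hi')+
  show "bilinear (\<lambda>x y. vv k \<bullet> bform (P k) x y)" by (rule bilinear_bform)
  show "vv k \<bullet> bform (P k) (uu k) (uu k) = 2 * Qpar (P k)" by (rule Qpar_eq)
  show "cc \<le> Qpar (P k)" "Qpar (P k) \<le> CC" by (rule Qpar_bounds)+
  have vs2: "vsum x ^ n \<le> (1 / cl) ^ n * (vv k \<bullet> x) ^ n" if "0 \<le> x" for x n
    using power_mono[OF vsum_le_ip[OF that, of k] vsum_nonneg[OF that], of n] by (simp only: power_mult_distrib)
  have ip0: "0 \<le> vv k \<bullet> x" if "0 \<le> x" for x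
    unfolding inner_vec_real using that v_pos by (intro sum_nonneg mult_nonneg_nonneg) (auto simp: less_eq_vec_def less_imp_le)
  have dK: "0 \<le> real CARD('d) * (1 / cl)" "0 \<le> K3" using cl K3_ge1 by auto
  {
    fix x :: "real^'d" assume x: "x \<in> cube"
    note x' = cube_nth(1)[OF x] cube_nth(2)[OF x]
    have x0: "0 \<le> x" using x' by (simp add: less_eq_vec_def)
    show "gmap (P k) x \<in> cube" using gmap_bounds[of x, OF x'] by (simp add: cube_def)
    show "gmap (P k) x \<le> A k *v x" by (intro less_eq_vecI gmap_le_linear x')
    show "(A k *v x - gmap (P k) x) $ j \<le> CC * (vv k \<bullet> x)\<^sup>2" for j
    proof -
      have "(A k *v x - gmap (P k) x) $ j \<le> K3 * vsum x ^ 2" using gmap_order1[of x j, OF x'] by simp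
      also have "\<dots> \<le> K3 * ((1 / cl)^2 * (vv k \<bullet> x)^2)" by (intro mult_left_mono vs2 x0 dK)
      also have "\<dots> = K3 * (1 / cl)^2 * (vv k \<bullet> x)^2" by simp
      also have "\<dots> \<le> CC * (vv k \<bullet> x)^2" by (intro mult_right_mono CC_bounds) simp
      finally show ?thesis .
    qed
    show "\<bar>vv k \<bullet> (A k *v x - gmap (P k) x) - vv k \<bullet> bform (P k) x x / 2\<bar> \<le> CC * (vv k \<bullet> x) ^ 3"
    proof -
      have "vv k \<bullet> (A k *v x - gmap (P k) x) - vv k \<bullet> bform (P k) x x / 2
         = vv k \<bullet> (A k *v x - gmap (P k) x - (1/2) *\<^sub>R bform (P k) x x)" by (simp add: inner_diff_right)
      also have "\<bar>\<dots>\<bar> \<le> real CARD('d) * (1 / cl) * (K3 * vsum x ^ 3)"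
        by (rule abs_ip_le) (use gmap_order2[of x, OF x'] in simp)
      also have "\<dots> \<le> real CARD('d) * (1 / cl) * (K3 * ((1 / cl)^3 * (vv k \<bullet> x)^3))" by (intro mult_left_mono vs2 x0 dK)
      also have "\<dots> = CC * (vv k \<bullet> x)^3" by (simp add: CC_def power4_eq_xxxx power3_eq_cube)
      finally show ?thesis .
    qed
    show "h *\<^sub>R gmap (P k) x \<le> gmap (P k) (h *\<^sub>R x)" if "0 \<le> h" "h \<le> 1" for h
      by (rule less_eq_vecI) (use gmap_scale[of x h, OF x' that] in simp)
  }
  {
    fix x y :: "real^'d" assume xy: "0 \<le> x" "0 \<le> y" "x + y \<le> 1"
    have x: "\<And>l. 0 \<le> x$l" and y: "\<And>l. 0 \<le> y$l" and s: "\<And>l. x$l + y$l \<le> 1"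
      using xy by (auto simp: less_eq_vec_def)
    have vs: "vsum x \<le> (1 / cl) * (vv k \<bullet> x)" "vsum y \<le> (1 / cl) * (vv k \<bullet> y)" "0 \<le> vsum x" "0 \<le> vsum y"
      by (intro vsum_le_ip vsum_nonneg xy)+
    have vp: "vsum x * vsum y \<le> (1 / cl * (vv k \<bullet> x)) * (1 / cl * (vv k \<bullet> y))"
      using vs cl ip0[OF xy(1)] by (intro mult_mono) auto
    show "gmap (P k) (x + y) \<le> gmap (P k) x + gmap (P k) y"
      by (rule less_eq_vecI) (use gmap_subadditive[of x y, OF x y s] in simp)
    show "(gmap (P k) x + gmap (P k) y - gmap (P k) (x + y)) $ j \<le> CC * ((vv k \<bullet> x) * (vv k \<bullet> y))" for j
    proof -
      have "(gmap (P k) x + gmap (P k) y - gmap (P k) (x + y)) $ j \<le> K3 * (vsum x * vsum y)"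
        using gmap_mixed[of x y, OF x y s] by simp
      also have "\<dots> \<le> K3 * ((1 / cl * (vv k \<bullet> x)) * (1 / cl * (vv k \<bullet> y)))" by (intro mult_left_mono vp dK)
      also have "\<dots> = K3 * (1 / cl)^2 * ((vv k \<bullet> x) * (vv k \<bullet> y))" by (simp add: power2_eq_square)
      also have "\<dots> \<le> CC * ((vv k \<bullet> x) * (vv k \<bullet> y))" by (intro mult_right_mono CC_bounds mult_nonneg_nonneg ip0 xy)
      finally show ?thesis .
    qed
    show "\<bar>vv k \<bullet> (gmap (P k) x + gmap (P k) y - gmap (P k) (x + y)) - vv k \<bullet> bform (P k) x y\<bar>
       \<le> CC * (vv k \<bullet> x * (vv k \<bullet> y) * (vv k \<bullet> x + vv k \<bullet> y))"
    proof -
      have "vv k \<bullet> (gmap (P k) x + gmap (P k) y - gmap (P k) (x + y)) - vv k \<bullet> bform (P k) x y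
         = vv k \<bullet> (gmap (P k) x + gmap (P k) y - gmap (P k) (x + y) - bform (P k) x y)" by (simp add: inner_diff_right)
      also have "\<bar>\<dots>\<bar> \<le> real CARD('d) * (1 / cl) * (K3 * (vsum x * vsum y * (vsum x + vsum y)))"
        by (rule abs_ip_le) (use gmap_mixed_order2[of x y, OF x y s] in simp)
      also have "\<dots> \<le> real CARD('d) * (1 / cl) * (K3 * ((1 / cl * (vv k \<bullet> x)) * (1 / cl * (vv k \<bullet> y)) * (1 / cl * (vv k \<bullet> x) + 1 / cl * (vv k \<bullet> y))))"
        using vs vp cl ip0[OF xy(1)] ip0[OF xy(2)] dK
        by (intro mult_left_mono mult_mono[OF vp] add_mono) auto
      also have "\<dots> = CC * (vv k \<bullet> x * (vv k \<bullet> y) * (vv k \<bullet> x + vv k \<bullet> y))"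
        by (simp add: CC_def power4_eq_xxxx distrib_left mult_ac add_divide_distrib)
      finally show ?thesis .
    qed
  }
  show "gmap (P k) x \<le> gmap (P k) y" if "0 \<le> x" "x \<le> y" "y \<le> 1" for x y
  proof (rule less_eq_vecI)
    fix i
    have "gmap (P k) x $ i \<le> gmap (P k) (x + (y - x)) $ i"
      by (rule gmap_mono) (use that in \<open>auto simp: less_eq_vec_def\<close>)
    then show "gmap (P k) x $ i \<le> gmap (P k) y $ i" by simp
  qed
  show "\<bar>vv k \<bullet> bform (P k) x y\<bar> \<le> CC * ((\<Sum>i\<in>UNIV. vv k $ i * \<bar>x $ i\<bar>) * (\<Sum>i\<in>UNIV. vv k $ i * \<bar>y $ i\<bar>))" for x y
  proof -
    define X where "X = (\<Sum>i\<in>UNIV. vv k $ i * \<bar>x $ i\<bar>)"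
    define Y where "Y = (\<Sum>i\<in>UNIV. vv k $ i * \<bar>y $ i\<bar>)"
    have XY: "0 \<le> X" "0 \<le> Y" unfolding X_def Y_def using v_pos by (auto intro!: sum_nonneg mult_nonneg_nonneg simp: less_imp_le)
    have "\<bar>vv k \<bullet> bform (P k) x y\<bar> \<le> real CARD('d) * (1 / cl) * (K3 * (vsum (\<chi> i. \<bar>x$i\<bar>) * vsum (\<chi> i. \<bar>y$i\<bar>)))"
      by (rule abs_ip_le[OF bform_abs])
    also have "\<dots> \<le> real CARD('d) * (1 / cl) * (K3 * ((1 / cl * X) * (1 / cl * Y)))"
      using vsum_le[of x k] vsum_le[of y k] cl XY dK
      by (intro mult_left_mono mult_mono) (auto simp: X_def Y_def intro!: sum_nonneg)
    also have "\<dots> = real CARD('d) * K3 * (1 / cl)^3 * (X * Y)" by (simp add: power3_eq_cube)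
    also have "\<dots> \<le> CC * (X * Y)" using XY by (intro mult_right_mono CC_bounds) auto
    finally show ?thesis by (simp add: X_def Y_def)
  qed
  show "cc \<le> vv k \<bullet> bform (P k) 1 1"
  proof -
    have "cl * b \<le> cl * (\<Sum>j\<in>UNIV. \<Sum>l\<in>UNIV. \<Sum>m\<in>UNIV. bcoef (P k) j l m)"
      using inK[of k] cl by (intro mult_left_mono) (auto simp: classK_def)
    also have "\<dots> \<le> vv k \<bullet> bform (P k) 1 1" unfolding sum_distrib_left inner_vec_real bform_def
      using v_cl bcoef_bounds by (auto intro!: sum_mono mult_right_mono sum_nonneg simp: sum_distrib_left)
    finally have "cl * b \<le> vv k \<bullet> bform (P k) 1 1" .
    moreover have "cl ^ 3 * b / 2 \<le> cl * b"
    proof -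
      have "cl ^ 3 \<le> cl ^ 1" using cl by (intro power_decreasing) auto
      then have "cl ^ 3 * b \<le> cl * b" using pos by (intro mult_right_mono) auto
      moreover have "0 \<le> cl * b" using cl pos by simp
      ultimately show ?thesis by linarith
    qed
    ultimately show ?thesis by (simp add: cc_def)
  qed
qed (use pos rho_lim' in auto)

end

text \<open>The shift cancels in the difference of the two limits; what remains is the closed form
  of the limiting \<open>y - x\<close>.\<close>

lemma ode_gap_value:
  fixes w lam :: real
  assumes w: "w > 0" "w > lam"
  shows "1 / egap w - 1 / (1 / ((w - lam) / 2) / exp w + egap w)
     = 2 * exp (- w) * w^2 / ((1 - exp (- w)) * (w * (1 + exp (- w)) - lam * (1 - exp (- w))))"
proof -
  define R where "R = exp (- w)"
  have R: "0 < R" "R < 1" using w by (auto simp: R_def)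
  define N where "N = w * (1 + R) - lam * (1 - R)"
  have "lam * (1 - R) \<le> w * (1 - R)" using w R by (intro mult_right_mono) auto
  moreover have "0 < w * R" using w R by simp
  ultimately have N: "0 < N" unfolding N_def by (simp add: algebra_simps)
  have "1 / ((w - lam) / 2) / exp w + egap w = 2 * R / (w - lam) + (1 - R) / w"
    using w by (simp add: egap_def R_def exp_minus inverse_eq_divide)
  also have "\<dots> = N / (w * (w - lam))" unfolding N_def using w by (simp add: field_simps)
  finally have e: "1 / ((w - lam) / 2) / exp w + egap w = N / (w * (w - lam))" .
  have "1 / egap w - 1 / (1 / ((w - lam) / 2) / exp w + egap w) = w / (1 - R) - w * (w - lam) / N"
    unfolding e using w by (simp add: egap_def R_def)
  also have "\<dots> = (w * N - w * (w - lam) * (1 - R)) / ((1 - R) * N)" using R N by (simp add: diff_frac_eq mult.commute)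
  also have "w * N - w * (w - lam) * (1 - R) = 2 * R * w^2" unfolding N_def by (simp add: algebra_simps power2_eq_square)
  finally show ?thesis unfolding R_def N_def .
qed

section \<open>From trajectory limits to the ratio of difference and survival\<close>

context near_critical
begin

lemma survival_le_y: "s \<in> cube \<Longrightarrow> traj k 1 1 m \<le> traj k s 1 m"
proof (induction m)
  case (Suc m)
  have "G k (traj k 1 1 m) \<le> G k (traj k s 1 m)"
    using Suc traj_cube[OF _ one_cube] by (intro G_mono) (auto simp: cubeD one_cube)
  moreover have "G k (traj k s 1 m) \<le> step k s (traj k s 1 m)" unfolding less_eq_vec_def
  proof
    fix i
    have "0 \<le> (1 - s$i) * (1 - G k (traj k s 1 m) $ i)"
      using Suc.prems G_nth_bounds(2)[OF traj_cube[OF Suc.prems one_cube]]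
      by (intro mult_nonneg_nonneg) (auto simp: cube_def)
    then show "G k (traj k s 1 m) $ i \<le> step k s (traj k s 1 m) $ i" by (simp add: step_def algebra_simps)
  qed
  ultimately show ?case by (simp add: traj_Suc step_one)
qed simp

context
  fixes s :: "nat \<Rightarrow> real^'d" and n :: "nat \<Rightarrow> nat"
  assumes s: "\<And>k. s k \<in> cube" and sig: "(\<lambda>k. v k \<bullet> (1 - s k)) \<longlonglongrightarrow> 0"
    and n: "filterlim n at_top sequentially" and spos: "\<And>k. 0 < v k \<bullet> (1 - s k)"
begin

lemma x_pos: "0 < v k \<bullet> traj k (s k) (1 - s k) m"
  using spos[of k] ip_mono[OF x_mono[OF s, of 0 m k k], of k] by simp

lemma y_lower: "\<exists>c>0. \<forall>k. c \<le> v k \<bullet> traj k (s k) 1 m"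
proof -
  obtain c where "c > 0" "\<And>k. c \<le> v k \<bullet> traj k 1 1 m" using survival_lower[of m] by blast
  then show ?thesis using ip_mono[OF survival_le_y[OF s]] by (meson order_trans)
qed

lemma y_pos: "0 < v k \<bullet> traj k (s k) 1 m"
  using y_lower[of m] by (meson less_le_trans)

lemma x_upper: "\<exists>c. \<forall>k. v k \<bullet> traj k (s k) (1 - s k) m \<le> c * (v k \<bullet> (1 - s k))"
  using x_crude_upper[OF s sig] by blast

text \<open>All three trajectories are asymptotic to their projections times u, so the entry of u
  and the common scale cancel in the quotient.\<close>

lemma gap_ratio_limit:
  assumes Y: "(\<lambda>k. \<beta> k * (v k \<bullet> traj k (s k) 1 (n k))) \<longlonglongrightarrow> LY"
    and X: "(\<lambda>k. \<beta> k * (v k \<bullet> traj k (s k) (1 - s k) (n k))) \<longlonglongrightarrow> LX"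
    and D: "(\<lambda>k. \<beta> k * (v k \<bullet> traj k 1 1 (n k))) \<longlonglongrightarrow> LD" and LD: "LD \<noteq> 0"
  shows "(\<lambda>k. gap k (s k) (n k) $ j / traj k 1 1 (n k) $ j) \<longlonglongrightarrow> (LY - LX) / LD"
proof -
  note [simp del] = mult_eq_0_iff
  let ?c = "\<lambda>z k. z k (n k) $ j / ((v k \<bullet> z k (n k)) * u k $ j)"
  let ?y = "\<lambda>k. traj k (s k) 1" and ?x = "\<lambda>k. traj k (s k) (1 - s k)" and ?d = "\<lambda>k. traj k 1 1"
  have lim: "(\<lambda>k. (\<beta> k * (v k \<bullet> ?y k (n k)) * ?c ?y k - \<beta> k * (v k \<bullet> ?x k (n k)) * ?c ?x k) / (\<beta> k * (v k \<bullet> ?d k (n k)) * ?c ?d k))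
     \<longlonglongrightarrow> (LY * 1 - LX * 1) / (LD * 1)"
    by (intro tendsto_divide tendsto_diff tendsto_mult X Y D
        regular_comp[OF regular_xy(1)[OF s sig] x_pos n] regular_comp[OF regular_xy(2)[OF s sig] y_pos n]
        regular_comp[OF regular_survival survival_pos n]) (use LD in simp)
  have "\<forall>\<^sub>F k in sequentially. \<beta> k * (v k \<bullet> ?d k (n k)) \<noteq> 0"
    using tendsto_imp_eventually_ne[OF D LD] .
  then have "\<forall>\<^sub>F k in sequentially. (\<beta> k * (v k \<bullet> ?y k (n k)) * ?c ?y k - \<beta> k * (v k \<bullet> ?x k (n k)) * ?c ?x k) / (\<beta> k * (v k \<bullet> ?d k (n k)) * ?c ?d k)
    = gap k (s k) (n k) $ j / traj k 1 1 (n k) $ j"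
  proof eventually_elim
    case (elim k)
    then have b: "\<beta> k \<noteq> 0" by auto
    have e: "\<beta> k * V * (zj / (V * u k $ j)) = \<beta> k / u k $ j * zj" if "0 < V" for V zj
      using that by simp
    have q: "\<beta> k / u k $ j \<noteq> 0" using b u_pos[of k j] by simp
    show ?case unfolding e[OF x_pos] e[OF y_pos] e[OF survival_pos] right_diff_distrib[symmetric] gap_def
      using q by (simp only: mult_divide_mult_cancel_left vector_minus_component simp_thms)
  qed
  then show ?thesis using lim by (simp only: mult_1_right) (rule Lim_transform_eventually; assumption)
qed

lemma ode_ratio:
  assumes nt: "(\<lambda>k. real (n k) * (\<rho> k - 1)) \<longlonglongrightarrow> lam"
    and nq: "(\<lambda>k. (real (n k))^2 * (Q k * (v k \<bullet> (1 - s k)))) \<longlonglongrightarrow> kap" and kap: "kap > 0"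
  defines "w \<equiv> sqrt (lam^2 + 4 * kap)"
  shows "(\<lambda>k. gap k (s k) (n k) $ j / traj k 1 1 (n k) $ j) \<longlonglongrightarrow>
    2 * exp (- w) * w^2 / ((1 - exp (- w)) * (w * (1 + exp (- w)) - lam * (1 - exp (- w))))
      / (1 / egap \<bar>lam\<bar> - (\<bar>lam\<bar> - lam) / 2)"
proof -
  \<comment> \<open>Survival is the source-free case, so the frequency is
    \<open>\<bar>lam\<bar>\<close>.\<close>
  have "(\<lambda>k. real (n k) * Q k * (v k \<bullet> traj k 1 1 (n k))) \<longlonglongrightarrow> 1 / egap (sqrt (lam^2 + 4 * 0)) - (sqrt (lam^2 + 4 * 0) - lam) / 2"
    by (rule ode_limit_from_infinity[OF regular_survival survival_pos _ n nt])
       (use survival_lower in simp_all)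
  then have D: "(\<lambda>k. real (n k) * Q k * (v k \<bullet> traj k 1 1 (n k))) \<longlonglongrightarrow> 1 / egap \<bar>lam\<bar> - (\<bar>lam\<bar> - lam) / 2" by simp
  \<comment> \<open>Survival is of exact order 1/n for every real \<open>lam\<close>, so the
    quotient of limits is meaningful.\<close>
  have Dpos: "1 / egap \<bar>lam\<bar> - (\<bar>lam\<bar> - lam) / 2 \<noteq> 0"
  proof -
    consider "lam = 0" | "lam > 0" | "lam < 0" by linarith
    then show ?thesis
    proof cases
      case 3
      have "1 / egap \<bar>lam\<bar> - (\<bar>lam\<bar> - lam) / 2 = - lam / (1 - exp lam) + lam"
        using 3 by (simp add: egap_def)
      also have "\<dots> = - lam * exp lam / (1 - exp lam)" using 3 by (simp add: field_simps)
      also have "\<dots> > 0" using 3 by (intro divide_pos_pos mult_pos_pos) auto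
      finally show ?thesis by simp
    qed (auto simp: egap_def)
  qed
  have wl: "w > \<bar>lam\<bar>" unfolding w_def using kap by (intro real_less_rsqrt) simp
  note Y = ode_limit_from_infinity[OF regular_xy(2)[OF s sig] y_pos sig n nt nq y_lower, folded w_def]
  note X = ode_limit_from_zero[OF regular_xy(1)[OF s sig] x_pos sig n nt nq kap x_upper, folded w_def]
  have e: "1 / egap w - (w - lam) / 2 - (1 / (1 / ((w - lam) / 2) / exp w + egap w) - (w - lam) / 2)
    = 2 * exp (- w) * w^2 / ((1 - exp (- w)) * (w * (1 + exp (- w)) - lam * (1 - exp (- w))))"
    using wl ode_gap_value[of w lam] by linarith
  show ?thesis using gap_ratio_limit[OF Y X D Dpos, of j] unfolding e .
qed

lemma super_ratio:
  assumes sup: "\<And>k. 1 < \<rho> k" and ntau: "filterlim (\<lambda>k. real (n k) * (\<rho> k - 1)) at_top sequentially"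
    and qT: "(\<lambda>k. Q k * (v k \<bullet> (1 - s k)) / (\<rho> k - 1)^2 * \<rho> k ^ n k) \<longlonglongrightarrow> T" and T: "T > 0"
  shows "(\<lambda>k. gap k (s k) (n k) $ j / traj k 1 1 (n k) $ j) \<longlonglongrightarrow> 1 / (1 + T)"
proof -
  have D: "(\<lambda>k. 1 / (\<rho> k - 1) * Q k * (v k \<bullet> traj k 1 1 (n k))) \<longlonglongrightarrow> 1"
    by (rule super_limit_from_infinity[OF regular_survival survival_pos _ n sup ntau])
       (use survival_lower in simp_all)
  note q0 = super_source_null[OF regular_xy(2)[OF s sig] y_pos sig n sup ntau qT]
  note Y = super_limit_from_infinity[OF regular_xy(2)[OF s sig] y_pos sig n sup ntau q0 y_lower]
  note X = super_limit_from_zero[OF regular_xy(1)[OF s sig] x_pos sig n sup ntau qT T x_upper spos]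
  have "(1 - 1 / (1 / T + 1)) / 1 = 1 / (1 + T)" using T by (simp add: field_simps)
  then show ?thesis using gap_ratio_limit[OF Y X D, of j] by simp
qed

end

end

lemma null_mult_bounded:
  fixes f g :: "nat \<Rightarrow> real"
  assumes f: "f \<longlonglongrightarrow> 0" and g: "\<And>k. \<bar>g k\<bar> \<le> B"
  shows "(\<lambda>k. f k * g k) \<longlonglongrightarrow> 0"
proof (rule Lim_null_comparison)
  show "\<forall>\<^sub>F k in sequentially. norm (f k * g k) \<le> \<bar>f k\<bar> * B"
    using g by (auto simp: abs_mult intro!: mult_left_mono always_eventually)
  show "(\<lambda>k. \<bar>f k\<bar> * B) \<longlonglongrightarrow> 0" using tendsto_mult_right[OF tendsto_rabs_zero[OF f], of B] by simp
qed

lemma mpow_bounded: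
  fixes A :: "nat \<Rightarrow> real^'d::finite^'d"
  assumes "\<And>k i j. \<bar>A k $ i $ j\<bar> \<le> B"
  shows "\<exists>B'. \<forall>k i j. \<bar>mpow (A k) n $ i $ j\<bar> \<le> B'"
proof (induction n)
  case 0
  show ?case by (intro exI[of _ 1]) (auto simp: mat_def)
next
  case (Suc n)
  then obtain B' where B': "\<And>k i j. \<bar>mpow (A k) n $ i $ j\<bar> \<le> B'" by blast
  have "\<bar>mpow (A k) (Suc n) $ i $ j\<bar> \<le> (\<Sum>l\<in>(UNIV::'d set). B * B')" for k i j
    unfolding mpow.simps matrix_matrix_mult_def vec_lambda_beta
    using assms B' order_trans[OF abs_ge_zero assms] by (intro order_trans[OF sum_abs] sum_mono) (simp add: abs_mult mult_mono)
  then show ?case by blast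
qed

text \<open>Used to transfer the lower bound on the U-th power from the mean matrices to those at
  the extinction probabilities.\<close>

lemma mpow_diff_null:
  fixes A A' :: "nat \<Rightarrow> real^'d::finite^'d"
  assumes A: "\<And>k i j. \<bar>A k $ i $ j\<bar> \<le> B" and d: "\<And>i j. (\<lambda>k. A' k $ i $ j - A k $ i $ j) \<longlonglongrightarrow> 0"
  shows "(\<lambda>k. mpow (A' k) n $ i $ j - mpow (A k) n $ i $ j) \<longlonglongrightarrow> 0"
proof (induction n arbitrary: i j)
  case (Suc n)
  obtain B' where B': "\<And>k i j. \<bar>mpow (A k) n $ i $ j\<bar> \<le> B'" using mpow_bounded[of A B n, OF A] by blast
  have e: "mpow (A' k) (Suc n) $ i $ j - mpow (A k) (Suc n) $ i $ j = (\<Sum>l\<in>UNIV.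
      (A' k $ i $ l - A k $ i $ l) * (mpow (A' k) n $ l $ j - mpow (A k) n $ l $ j)
      + (A' k $ i $ l - A k $ i $ l) * mpow (A k) n $ l $ j
      + (mpow (A' k) n $ l $ j - mpow (A k) n $ l $ j) * A k $ i $ l)" for k
    unfolding mpow.simps matrix_matrix_mult_def vec_lambda_beta sum_subtractf[symmetric]
    by (intro sum.cong refl) (simp add: algebra_simps)
  show ?case unfolding e
    by (intro tendsto_null_sum tendsto_add_zero tendsto_mult_zero Suc.IH d null_mult_bounded[OF d B'] null_mult_bounded[OF Suc.IH A])
qed simp

lemma bcoef_sym: "bcoef p k l m = bcoef p k m l"
proof -
  have "ff2 i l m = ff2 i m l" for i by (cases "l = m") (simp_all add: ff2_def)
  then show ?thesis by (simp add: bcoef_def)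
qed

section \<open>The root at the extinction probabilities, below and above criticality\<close>

context critical_family
begin

lemma step_gs: "step k s = gs (P k) s"
  by (rule ext) (simp add: step_def gs_def)

lemma traj_gs: "traj k s x m = (gs (P k) s ^^ m) x"
  by (simp add: traj_def step_gs)

lemma survival_limit: "(\<lambda>m. traj k 1 1 m $ j) \<longlonglongrightarrow> (1 - ext_prob (P k)) $ j"
proof -
  define X where "X m = 1 - traj k 1 1 m $ j" for m
  have X: "incseq X" "\<And>m. X m \<le> 1"
    using y_antimono[OF one_cube] traj_cube[OF one_cube one_cube] by (auto simp: X_def incseq_def less_eq_vec_def cube_def)
  have "X \<longlonglongrightarrow> (SUP m. X m)" by (rule LIMSEQ_incseq_SUP[OF _ X(1)]) (use X(2) in \<open>auto simp: bdd_above_def\<close>)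
  moreover have "(SUP m. X m) = ext_prob (P k) $ j"
    by (simp add: ext_prob_eq X_def traj_gs gs_one)
  ultimately have "(\<lambda>m. 1 - X m) \<longlonglongrightarrow> 1 - ext_prob (P k) $ j" by (intro tendsto_intros) simp
  then show ?thesis by (simp add: X_def)
qed

text \<open>The projection of survival decays at least like \<open>\<rho>^m\<close>, so extinction
  is certain and the two matrices coincide.\<close>

lemma rho_mu_subcritical:
  assumes "rho (P k) < 1"
  shows "rho_mu (P k) = rho (P k)"
proof -
  have up: "vv k \<bullet> traj k 1 1 m \<le> rho (P k) ^ m * (vv k \<bullet> 1)" for m
  proof (induction m)
    case (Suc m)
    have "vv k \<bullet> traj k 1 1 (Suc m) \<le> rho (P k) * (vv k \<bullet> traj k 1 1 m)"
      using step_upper[OF one_cube traj_cube[OF one_cube one_cube], of k k m] by (simp add: traj_Suc)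
    also have "\<dots> \<le> rho (P k) * (rho (P k) ^ m * (vv k \<bullet> 1))"
      using Suc rho_pos[of k] by (intro mult_left_mono) auto
    finally show ?case by simp
  qed simp
  have "(\<lambda>m. traj k 1 1 m $ j) \<longlonglongrightarrow> 0" for j
  proof (rule tendsto_sandwich[OF _ _ tendsto_const])
    have c: "0 \<le> traj k 1 1 m" for m using traj_cube[OF one_cube one_cube] by (intro cubeD)
    then show "\<forall>\<^sub>F m in sequentially. 0 \<le> traj k 1 1 m $ j" by (simp add: less_eq_vec_def)
    have "traj k 1 1 m $ j \<le> rho (P k) ^ m * (vv k \<bullet> 1) / cc" for m
      using comp_le[OF c, of m j k] divide_right_mono[OF up[of m], of cc] c0_pos by linarith
    then show "\<forall>\<^sub>F m in sequentially. traj k 1 1 m $ j \<le> rho (P k) ^ m * (vv k \<bullet> 1) / cc" by simp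
    have "(\<lambda>m. rho (P k) ^ m) \<longlonglongrightarrow> 0" using assms rho_pos[of k] by (intro LIMSEQ_realpow_zero) auto
    from tendsto_divide_zero[OF tendsto_mult_left_zero[OF this, of "vv k \<bullet> 1"], of cc]
    show "(\<lambda>m. rho (P k) ^ m * (vv k \<bullet> 1) / cc) \<longlonglongrightarrow> 0" .
  qed
  then have "(1 - ext_prob (P k)) $ j = 0" for j using LIMSEQ_unique[OF survival_limit] by blast
  then have "ext_prob (P k) = 1" by (simp add: vec_eq_iff)
  then show ?thesis by (simp add: rho_mu_def rho_def)
qed

context
  assumes sup: "\<And>k. 1 < rho (P k)"
begin

definition wlim :: "nat \<Rightarrow> real^'d" where "wlim k = 1 - ext_prob (P k)"

abbreviation Am :: "nat \<Rightarrow> real^'d^'d" where "Am k \<equiv> jac (P k) (ext_prob (P k))"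

lemma vn_const_le: "(\<And>i. \<bar>x $ i\<bar> \<le> B) \<Longrightarrow> 0 \<le> B \<Longrightarrow> vn k x \<le> Cd * B"
  using ip_const_le[of "\<chi> i. \<bar>x $ i\<bar>" B k] by (simp add: vn_def inner_vec_real)

lemma wlim: "(\<lambda>m. traj k 1 1 m $ j) \<longlonglongrightarrow> wlim k $ j"
  unfolding wlim_def by (rule survival_limit)

lemma wlim_bounds: "0 \<le> wlim k $ l" "wlim k $ l \<le> 1"
  using traj_cube[OF one_cube one_cube, of k]
  by (auto simp: cube_def intro: tendsto_lowerbound[OF wlim] tendsto_upperbound[OF wlim])

lemma wlim_vsum: "0 \<le> vsum (wlim k)" "vsum (wlim k) \<le> real CARD('d)" "vsum (wlim k) \<le> 1 / cl * (vv k \<bullet> wlim k)"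
proof -
  show "0 \<le> vsum (wlim k)" using wlim_bounds by (intro sum_nonneg) auto
  show "vsum (wlim k) \<le> real CARD('d)" using sum_mono[of UNIV "\<lambda>i. wlim k $ i" "\<lambda>_. 1"] wlim_bounds by simp
  show "vsum (wlim k) \<le> 1 / cl * (vv k \<bullet> wlim k)"
    using wlim_bounds by (intro vsum_le_ip) (auto simp: less_eq_vec_def)
qed

lemma Am_order1: "\<bar>Am k $ i $ l - A k $ i $ l + (\<Sum>m\<in>UNIV. bcoef (P k) i l m * wlim k $ m)\<bar> \<le> K3 * (vsum (wlim k))^2"
  and Am_nonneg: "0 \<le> Am k $ i $ l"
  using offspring_moments.jac_order1[OF moments[of k] wlim_bounds[of k], of i l] offspring_moments.jac_nonneg[OF moments[of k] wlim_bounds[of k], of i l]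
  by (simp_all add: wlim_def)

definition Bm :: real where "Bm = K3 * (1 + real CARD('d)) * (1 / cl)"

lemma Bm_nonneg: "0 \<le> Bm" unfolding Bm_def using K3_ge1 cl by (intro mult_nonneg_nonneg) auto

lemma Am_diff: "\<bar>Am k $ i $ l - A k $ i $ l\<bar> \<le> Bm * (vv k \<bullet> wlim k)"
proof -
  define S where "S = (\<Sum>m\<in>UNIV. bcoef (P k) i l m * wlim k $ m)"
  have "0 \<le> S" unfolding S_def using offspring_moments.bcoef_bounds(1)[OF moments] wlim_bounds by (intro sum_nonneg) auto
  moreover have "S \<le> K3 * vsum (wlim k)" unfolding S_def sum_distrib_left
    using offspring_moments.bcoef_bounds(2)[OF moments] wlim_bounds by (intro sum_mono mult_right_mono) auto
  moreover have "K3 * (vsum (wlim k))^2 \<le> K3 * (real CARD('d) * vsum (wlim k))"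
    unfolding power2_eq_square using wlim_vsum K3_ge1 by (intro mult_left_mono mult_right_mono) auto
  ultimately have "\<bar>Am k $ i $ l - A k $ i $ l\<bar> \<le> K3 * vsum (wlim k) + K3 * (real CARD('d) * vsum (wlim k))"
    using Am_order1[of k i l, folded S_def] by linarith
  also have "\<dots> = K3 * (1 + real CARD('d)) * vsum (wlim k)" by (simp add: algebra_simps)
  also have "\<dots> \<le> K3 * (1 + real CARD('d)) * (1 / cl * (vv k \<bullet> wlim k))"
    using wlim_vsum K3_ge1 by (intro mult_left_mono) auto
  finally show ?thesis by (simp add: Bm_def mult.assoc)
qed

lemma wlim_ip_nonneg: "0 \<le> vv k \<bullet> wlim k"
  using wlim_bounds by (intro ip_nonneg) (simp add: less_eq_vec_def)

text \<open>The projection argument takes a single constant; the two summands dominate the constants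
  of the two comparisons below.\<close>

definition Km :: real where "Km = Cd * Bm * (1 / cl)^3 + Cd * K3 * (1 / cl)^3"

lemma Am_vec_diff:
  assumes x: "0 \<le> x"
  shows "vn k (Am k *v x - A k *v x) \<le> Km * (vv k \<bullet> wlim k) * (vv k \<bullet> x)"
proof -
  have x': "\<And>l. 0 \<le> x $ l" using x by (simp add: less_eq_vec_def)
  define B where "B = Bm * (vv k \<bullet> wlim k) * (1 / cl * (vv k \<bullet> x))"
  have B: "0 \<le> B" unfolding B_def using Bm_nonneg wlim_ip_nonneg ip_nonneg[OF x] cl by (intro mult_nonneg_nonneg) auto
  have c: "\<bar>(Am k *v x - A k *v x) $ i\<bar> \<le> B" for i
  proof -
    have "\<bar>(Am k *v x - A k *v x) $ i\<bar> = \<bar>\<Sum>l\<in>UNIV. (Am k $ i $ l - A k $ i $ l) * x $ l\<bar>"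
      by (simp add: matrix_vec_nth sum_subtractf left_diff_distrib)
    also have "\<dots> \<le> (\<Sum>l\<in>UNIV. Bm * (vv k \<bullet> wlim k) * x $ l)"
      using x' Am_diff by (intro order_trans[OF sum_abs] sum_mono) (auto simp: abs_mult intro!: mult_right_mono)
    also have "\<dots> = Bm * (vv k \<bullet> wlim k) * vsum x" by (simp add: sum_distrib_left)
    also have "\<dots> \<le> B" unfolding B_def
      using Bm_nonneg wlim_ip_nonneg by (intro mult_left_mono vsum_le_ip x) auto
    finally show ?thesis .
  qed
  have "vn k (Am k *v x - A k *v x) \<le> Cd * B" using c B by (rule vn_const_le)
  also have "\<dots> = Cd * Bm * (1 / cl)^1 * ((vv k \<bullet> wlim k) * (vv k \<bullet> x))" by (simp add: B_def mult_ac)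
  also have "\<dots> \<le> Km * ((vv k \<bullet> wlim k) * (vv k \<bullet> x))"
  proof (rule mult_right_mono)
    have "(1 / cl)^1 \<le> (1 / cl)^3" using cl by (intro power_increasing) auto
    then have "Cd * Bm * (1 / cl)^1 \<le> Cd * Bm * (1 / cl)^3" using Cd_pos Bm_nonneg by (intro mult_left_mono) auto
    moreover have "0 \<le> Cd * K3 * (1 / cl)^3" using Cd_pos K3_ge1 cl by simp
    ultimately show "Cd * Bm * (1 / cl)^1 \<le> Km" by (simp add: Km_def)
    show "0 \<le> (vv k \<bullet> wlim k) * (vv k \<bullet> x)" by (intro mult_nonneg_nonneg wlim_ip_nonneg ip_nonneg x)
  qed
  finally show ?thesis by (simp add: mult.assoc)
qed

lemma Am_vec_order1:
  assumes x: "0 \<le> x"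
  shows "\<bar>vv k \<bullet> (Am k *v x) - rho (P k) * (vv k \<bullet> x) + vv k \<bullet> bform (P k) (wlim k) x\<bar> \<le> Km * (vv k \<bullet> wlim k)^2 * (vv k \<bullet> x)"
proof -
  have x': "\<And>l. 0 \<le> x $ l" using x by (simp add: less_eq_vec_def)
  define z where "z = Am k *v x - A k *v x + bform (P k) (wlim k) x"
  define B where "B = K3 * (1 / cl * (vv k \<bullet> wlim k))^2 * (1 / cl * (vv k \<bullet> x))"
  have B: "0 \<le> B" unfolding B_def using K3_ge1 ip_nonneg[OF x] cl by (intro mult_nonneg_nonneg) auto
  have c: "\<bar>z $ i\<bar> \<le> B" for i
  proof -
    have "bform (P k) (wlim k) x $ i = (\<Sum>l\<in>UNIV. (\<Sum>m\<in>UNIV. bcoef (P k) i l m * wlim k $ m) * x $ l)"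
      unfolding bform_def vec_lambda_beta sum_distrib_right
      using sum.swap[of "\<lambda>l m. bcoef (P k) i l m * wlim k $ l * x $ m" UNIV UNIV]
      by (simp only: bcoef_sym[of "P k" i])
    then have "\<bar>z $ i\<bar> = \<bar>\<Sum>l\<in>UNIV. (Am k $ i $ l - A k $ i $ l + (\<Sum>m\<in>UNIV. bcoef (P k) i l m * wlim k $ m)) * x $ l\<bar>"
      by (simp add: z_def matrix_vec_nth sum_subtractf sum.distrib left_diff_distrib distrib_right)
    also have "\<dots> \<le> (\<Sum>l\<in>UNIV. K3 * (vsum (wlim k))^2 * x $ l)"
      using x' Am_order1 by (intro order_trans[OF sum_abs] sum_mono) (auto simp: abs_mult intro!: mult_right_mono)
    also have "\<dots> = K3 * (vsum (wlim k))^2 * vsum x" by (simp add: sum_distrib_left)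
    also have "\<dots> \<le> B" unfolding B_def
      using K3_ge1 wlim_vsum vsum_nonneg[OF x] by (intro mult_mono mult_left_mono power_mono vsum_le_ip x) (auto simp: less_eq_vec_def wlim_bounds)
    finally show ?thesis .
  qed
  have "\<bar>vv k \<bullet> z\<bar> \<le> vn k z" by (rule ip_le_vn)
  also have "\<dots> \<le> Cd * B" using c B by (rule vn_const_le)
  also have "\<dots> = Cd * K3 * (1 / cl)^3 * ((vv k \<bullet> wlim k)^2 * (vv k \<bullet> x))"
    by (simp add: B_def power_mult_distrib power3_eq_cube power2_eq_square)
  also have "\<dots> \<le> Km * ((vv k \<bullet> wlim k)^2 * (vv k \<bullet> x))"
  proof (rule mult_right_mono)
    have "0 \<le> Cd * Bm * (1 / cl)^3" using Cd_pos Bm_nonneg cl by simp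
    then show "Cd * K3 * (1 / cl)^3 \<le> Km" by (simp add: Km_def)
    show "0 \<le> (vv k \<bullet> wlim k)^2 * (vv k \<bullet> x)" by (intro mult_nonneg_nonneg ip_nonneg x) simp
  qed
  also have "vv k \<bullet> z = vv k \<bullet> (Am k *v x) - rho (P k) * (vv k \<bullet> x) + vv k \<bullet> bform (P k) (wlim k) x"
    by (simp only: z_def inner_add_right inner_diff_right v_M)
  finally show ?thesis by (simp add: mult.assoc)
qed

text \<open>The survival limit tends to zero, so the U-th power of \<open>Am k\<close> approaches
  that of \<open>A k\<close>, and \<open>Am k\<close> is eventually primitive with constant a/2. Its
  Perron data are then a genuine positive eigenpair.\<close>

lemma rho_mu_supercritical: "(\<lambda>k. (1 - rho_mu (P k)) / (rho (P k) - 1)) \<longlonglongrightarrow> 1"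
proof (rule perron_root_at_extinction[OF sup wlim Am_vec_diff Am_vec_order1])
  have d: "(\<lambda>k. Am k $ i $ j - A k $ i $ j) \<longlonglongrightarrow> 0" for i j
  proof (rule Lim_null_comparison)
    show "\<forall>\<^sub>F k in sequentially. norm (Am k $ i $ j - A k $ i $ j) \<le> Bm * (vv k \<bullet> wlim k)" using Am_diff by simp
    show "(\<lambda>k. Bm * (vv k \<bullet> wlim k)) \<longlonglongrightarrow> 0"
      by (intro tendsto_mult_right_zero survival_limit_null[OF sup wlim])
  qed
  have "\<bar>A k $ i $ j\<bar> \<le> K3" for k i j using offspring_moments.jac1_bounds[OF moments, of k i j] by linarith
  note dU = mpow_diff_null[OF this d, of U]
  have "\<forall>\<^sub>F k in sequentially. \<forall>i j. - (a/2) < mpow (Am k) U $ i $ j - mpow (A k) U $ i $ j"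
    using pos by (intro eventually_all_finite order_tendstoD(1)[OF dU]) simp
  then show "\<forall>\<^sub>F k in sequentially. Am k *v perron_rvec (Am k) = rho_mu (P k) *\<^sub>R perron_rvec (Am k) \<and> 0 \<le> perron_rvec (Am k)
      \<and> 0 < vv k \<bullet> perron_rvec (Am k) \<and> 0 < rho_mu (P k)"
  proof eventually_elim
    case (elim k)
    have "primitive_matrix (Am k) (a / 2) U"
    proof
      show "a / 2 \<le> mpow (Am k) U $ i $ j" for i j
        using elim[rule_format, of i j] primitive_matrix.mpow_ge[OF primitive, of k i j] by linarith
    qed (use pos Am_nonneg in auto)
    from primitive_eigen_norm.axioms(1)[OF primitive_matrix.perron[OF this]]
    interpret primitive_eigen "Am k" "a / 2" U "rho_mu (P k)" "perron_rvec (Am k)" "perron_lvec (Am k)"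
      by (simp add: rho_mu_def)
    have "0 < vv k \<bullet> perron_rvec (Am k)" unfolding inner_vec_real
      by (intro sum_pos mult_pos_pos less_le_trans[OF cl(1) v_cl] u_pos) auto
    then show ?case using u_eig r_pos u_pos by (auto simp: less_eq_vec_def less_imp_le)
  qed
  have "0 < Cd * K3 * (1 / cl)^3" using Cd_pos K3_ge1 cl by simp
  moreover have "0 \<le> Cd * Bm * (1 / cl)^3" using Cd_pos Bm_nonneg cl by simp
  ultimately show "0 < Km" by (simp add: Km_def)
qed

end

end

section \<open>The conditioned Laplace transforms\<close>

text \<open>At \<open>x = 1 / r\<close> and \<open>x = r\<close> this is the positivity of the numerators of \<open>h_plus\<close> and \<open>h_minus\<close> at \<open>ln r\<close>.\<close>

lemma ln_quadratic:
  fixes x :: real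
  shows "1 < x \<Longrightarrow> 4 * x - x^2 - 3 < 2 * ln x" "0 < x \<Longrightarrow> x < 1 \<Longrightarrow> 2 * ln x < 4 * x - x^2 - 3"
proof -
  define g :: "real \<Rightarrow> real" where "g y = 2 * ln y - (4 * y - y^2 - 3)" for y
  have der: "\<exists>y. (g has_real_derivative y) (at z) \<and> y > 0" if "z > 0" "z \<noteq> 1" for z
  proof (intro exI conjI)
    show "(g has_real_derivative (2 / z - (4 - 2 * z))) (at z)"
      unfolding g_def using that by (auto intro!: derivative_eq_intros simp: divide_inverse)
    have "2 / z - (4 - 2 * z) = 2 * (z - 1)^2 / z" using that by (simp add: field_simps power2_eq_square)
    also have "\<dots> > 0" using that by simp
    finally show "0 < 2 / z - (4 - 2 * z)" .
  qed
  have cont: "continuous_on {p..q} g" if "0 < p" for p q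
    unfolding g_def using that by (intro continuous_intros) auto
  show "4 * x - x^2 - 3 < 2 * ln x" if "1 < x"
    using DERIV_pos_imp_increasing_open[OF that, of g] der cont[of 1 x] by (simp add: g_def)
  show "2 * ln x < 4 * x - x^2 - 3" if "0 < x" "x < 1"
    using DERIV_pos_imp_increasing_open[OF that(2), of g] der cont[OF that(1), of 1] that(1) by (simp add: g_def)
qed

lemma h_plus_pos:
  assumes r: "0 < r" "r < 1" shows "0 < h_plus (ln r)"
proof -
  have "4 * (1 / r) - (1 / r)^2 - 3 < 2 * ln (1 / r)" using r by (intro ln_quadratic(1)) simp
  then have "r * (4 * (1 / r) - (1 / r)^2 - 3) < r * (2 * ln (1 / r))" using r by simp
  moreover have "r * (4 * (1 / r) - (1 / r)^2 - 3) = 4 - 1 / r - 3 * r"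
    using r by (simp add: field_simps power2_eq_square)
  moreover have "r * (2 * ln (1 / r)) = - (2 * ln r * r)" using r by (simp add: ln_div)
  moreover have "(1 - r) * (1 / r - 3) = 1 / r + 3 * r - 4" using r by (simp add: field_simps)
  ultimately have "0 < (1 - r) * (1 / r - 3) - 2 * ln r * r" by linarith
  then show ?thesis using r by (simp add: h_plus_def exp_minus inverse_eq_divide)
qed

lemma h_minus_pos:
  assumes r: "0 < r" "r < 1" shows "0 < h_minus (ln r)"
proof -
  have "0 < (1 - r) * (r - 3) - 2 * ln r" using ln_quadratic(2)[OF r] by (simp add: algebra_simps power2_eq_square)
  then show ?thesis using r by (simp add: h_minus_def)
qed

lemma h_tendsto:
  assumes "0 < r" "r < 1" "(f \<longlongrightarrow> ln r) F"
  shows "((\<lambda>x. h_plus (f x)) \<longlongrightarrow> h_plus (ln r)) F" "((\<lambda>x. h_minus (f x)) \<longlongrightarrow> h_minus (ln r)) F"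
  unfolding h_plus_def h_minus_def using assms by (auto intro!: tendsto_eq_intros)

lemma power_theta_limit:
  fixes \<mu> :: "nat \<Rightarrow> real"
  assumes r: "0 < r" "r < 1" and n: "filterlim n at_top sequentially"
    and l: "(\<lambda>k. real (n k) * (1 - \<mu> k)) \<longlonglongrightarrow> - ln r"
  shows "(\<lambda>k. \<mu> k ^ n k) \<longlonglongrightarrow> r" "(\<lambda>k. real (n k) * ln (\<mu> k)) \<longlonglongrightarrow> ln r"
proof -
  define t where "t k = 1 - \<mu> k" for k
  have nn: "filterlim (\<lambda>k. real (n k)) at_top sequentially"
    by (rule filterlim_compose[OF filterlim_real_sequentially n])
  have lt: "(\<lambda>k. real (n k) * t k) \<longlonglongrightarrow> - ln r" using l by (simp add: t_def)
  have n0: "\<forall>\<^sub>F k in sequentially. 0 < real (n k)"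
    using nn unfolding filterlim_at_top_dense by blast
  have "(\<lambda>k. real (n k) * t k * inverse (real (n k))) \<longlonglongrightarrow> - ln r * 0"
    by (intro tendsto_mult lt tendsto_inverse_0_at_top nn)
  moreover have "\<forall>\<^sub>F k in sequentially. real (n k) * t k * inverse (real (n k)) = t k"
    using n0 by eventually_elim simp
  ultimately have t0: "t \<longlonglongrightarrow> 0" by (simp only: mult_zero_right) (rule Lim_transform_eventually; assumption)
  have "\<forall>\<^sub>F k in sequentially. 0 < real (n k) * t k" using r by (intro order_tendstoD(1)[OF lt]) simp
  then have tpos: "\<forall>\<^sub>F k in sequentially. 0 \<le> t k" by eventually_elim (simp add: zero_less_mult_iff)
  have "(\<lambda>k. (1 - t k) ^ n k) \<longlonglongrightarrow> exp (- (- ln r))"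
    by (rule tendsto_one_minus_power[OF tpos t0 lt])
  then show p: "(\<lambda>k. \<mu> k ^ n k) \<longlonglongrightarrow> r" using r by (simp add: t_def)
  have "\<forall>\<^sub>F k in sequentially. t k < 1" using t0 by (rule order_tendstoD) simp
  then have "\<forall>\<^sub>F k in sequentially. ln (\<mu> k ^ n k) = real (n k) * ln (\<mu> k)"
    by eventually_elim (simp add: t_def ln_realpow)
  moreover have "(\<lambda>k. ln (\<mu> k ^ n k)) \<longlonglongrightarrow> ln r" using r by (intro tendsto_ln p) simp
  ultimately show "(\<lambda>k. real (n k) * ln (\<mu> k)) \<longlonglongrightarrow> ln r" by (rule Lim_transform_eventually[rotated])
qed

text \<open>With \<open>w = - ln r * D\<close> the exponential exp(-w) is \<open>r powr D\<close>,
  and the common factors \<open>- ln r\<close> cancel.\<close>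

lemma ode_value_super:
  assumes r: "0 < r" "r < 1" and D: "D > 0" and w: "w = - ln r * D"
  shows "2 * exp (- w) * w^2 / ((1 - exp (- w)) * (w * (1 + exp (- w)) - (- ln r) * (1 - exp (- w))))
      / (1 / egap \<bar>- ln r\<bar> - (\<bar>- ln r\<bar> - (- ln r)) / 2)
    = 2 * (1 - r) * r powr D * D^2 / ((1 - r powr D) * (D - 1 + (D + 1) * r powr D))"
proof -
  define l where "l = - ln r"
  have l: "l > 0" "exp (- l) = r" using r by (auto simp: l_def)
  define R where "R = r powr D"
  have R: "exp (- w) = R" using r by (simp add: w R_def powr_def mult.commute)
  have "1 / egap \<bar>l\<bar> - (\<bar>l\<bar> - l) / 2 = l / (1 - r)" using l by (simp add: egap_def)
  moreover have "w * (1 + R) - l * (1 - R) = l * (D - 1 + (D + 1) * R)" by (simp add: w l_def algebra_simps)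
  moreover have "2 * R * (l * D)^2 / ((1 - R) * (l * X)) / (l / (1 - r)) = 2 * (1 - r) * R * D^2 / ((1 - R) * X)" for X
    using l by (simp add: power2_eq_square)
  ultimately show ?thesis unfolding R l_def[symmetric] R_def[symmetric] by (simp only: w l_def[symmetric])
qed

lemma ode_value_sub:
  assumes r: "0 < r" "r < 1" and D: "D > 0" and w: "w = - ln r * D"
  shows "2 * exp (- w) * w^2 / ((1 - exp (- w)) * (w * (1 + exp (- w)) - ln r * (1 - exp (- w))))
      / (1 / egap \<bar>ln r\<bar> - (\<bar>ln r\<bar> - ln r) / 2)
    = 2 * (1 - r) * r powr D * D^2 / (r * (1 - r powr D) * (D + 1 + (D - 1) * r powr D))"
proof -
  define l where "l = - ln r"
  have l: "l > 0" "exp (- l) = r" and ln: "ln r = - l" using r by (auto simp: l_def)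
  define R where "R = r powr D"
  have R: "exp (- w) = R" using r by (simp add: w R_def powr_def mult.commute)
  have "1 / egap \<bar>- l\<bar> - (\<bar>- l\<bar> - (- l)) / 2 = l / (1 - r) - l" using l by (simp add: egap_def)
  moreover have "l / (1 - r) - l = l * r / (1 - r)" using r by (simp add: field_simps)
  moreover have "w * (1 + R) - (- l) * (1 - R) = l * (D + 1 + (D - 1) * R)" by (simp add: w l_def algebra_simps)
  moreover have "2 * R * (l * D)^2 / ((1 - R) * (l * X)) / (l * r / (1 - r)) = 2 * (1 - r) * R * D^2 / (r * (1 - R) * X)" for X
    using l by (simp add: power2_eq_square mult_ac del: right_diff_distrib_numeral)
  ultimately show ?thesis unfolding R ln R_def[symmetric] by (simp only: w l_def[symmetric])
qed

lemma ode_value_critical: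
  assumes w: "w > (0::real)"
  shows "2 * exp (- w) * w^2 / ((1 - exp (- w)) * (w * (1 + exp (- w)) - 0 * (1 - exp (- w)))) / (1 / egap \<bar>0\<bar> - (\<bar>0\<bar> - 0) / 2)
    = w / sinh w"
proof -
  define R where "R = exp (- w)"
  have R: "0 < R" "R < 1" using w by (auto simp: R_def)
  have "sinh w = (1 / R - R) / 2" by (simp add: sinh_field_def R_def exp_minus inverse_eq_divide)
  also have "\<dots> = (1 - R) * (1 + R) / (2 * R)" using R by (simp add: field_simps)
  finally have s: "sinh w = (1 - R) * (1 + R) / (2 * R)" .
  show ?thesis unfolding s R_def[symmetric] using w R by (simp add: egap_def power2_eq_square)
qed

section \<open>Choice of the Laplace argument and the separate regimes\<close>

context critical_family
begin

context
  fixes n :: "nat \<Rightarrow> nat" and t :: "real^'d"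
  assumes n: "filterlim n at_top sequentially" and t: "\<And>l. 0 \<le> t $ l"
begin

text \<open>For t = 0 the source vanishes and the trajectory limits, which assume a positive source,
  do not apply. The quotient is 1 once the survival probability is positive, which holds
  eventually.\<close>

lemma Phi_zero:
  assumes "(\<Sum>l\<in>UNIV. t $ l) = 0"
  shows "(\<lambda>k. Phi (P k) (n k) (m k) t j) \<longlonglongrightarrow> 1"
proof -
  have t0: "t = 0" using assms t by (simp add: sum_nonneg_eq_0_iff vec_eq_iff)
  have "\<forall>\<^sub>F k in sequentially. traj k 1 1 (n k) $ j / ((vv k \<bullet> traj k 1 1 (n k)) * uu k $ j) \<noteq> 0"
    by (rule tendsto_imp_eventually_ne[OF regular_comp[OF regular_survival survival_pos n]]) simp
  then have "\<forall>\<^sub>F k in sequentially. 1 = Phi (P k) (n k) (m k) t j"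
  proof eventually_elim
    case (elim k)
    have "measure_pmf.expectation (gw_law (P k) j (n k)) (\<lambda>zy. exp (- (\<Sum>l\<in>UNIV. t$l * real (snd zy $ l) / m k $ l)) * (if fst zy \<noteq> 0 then 1 else 0))
      = measure_pmf.expectation (gw_law (P k) j (n k)) (indicator {zy. fst zy \<noteq> 0})"
      by (intro Bochner_Integration.integral_cong refl) (simp add: t0 indicator_def)
    also have "\<dots> = measure_pmf.prob (gw_law (P k) j (n k)) {zy. fst zy \<noteq> 0}" by simp
    finally have "Phi (P k) (n k) (m k) t j = traj k 1 1 (n k) $ j / traj k 1 1 (n k) $ j"
      by (simp only: Phi_def prob_survive traj_gs gs_one)
    then show ?case using elim by auto
  qed
  then show ?thesis by (rule Lim_transform_eventually[OF tendsto_const])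
qed

context
  fixes m :: "nat \<Rightarrow> real" and T :: real
  assumes m: "filterlim m at_top sequentially" and T: "T = (\<Sum>l\<in>UNIV. t $ l)" "T > 0"
begin

text \<open>The dummy value \<open>1\<close> keeps \<open>sv k\<close> inside the cube for the finitely many \<open>k\<close> with \<open>m k \<le> 0\<close>.\<close>

definition sv :: "nat \<Rightarrow> real^'d" where
  "sv k = (\<chi> l. exp (- (t $ l / ((if 0 < m k then m k else 1) * vv k $ l))))"

lemma sv_cube: "sv k \<in> cube"
  using t v_pos[of k] by (auto simp: sv_def cube_def less_imp_le)

lemma sv_src_pos: "0 < vv k \<bullet> (1 - sv k)"
proof -
  obtain i where i: "0 < t $ i"
    using T t by (metis less_irrefl order_le_less sum.not_neutral_contains_not_neutral)
  show ?thesis unfolding inner_vec_real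
  proof (rule sum_nonneg_pos)
    show "0 \<le> vv k $ l * (1 - sv k) $ l" for l
      using sv_cube[of k] v_pos[of k l] by (auto simp: cube_def less_imp_le)
    have "0 < t $ i / ((if 0 < m k then m k else 1) * vv k $ i)" using i v_pos[of k i] by auto
    then show "0 < vv k $ i * (1 - sv k) $ i" using v_pos[of k i] by (simp add: sv_def)
  qed
qed

lemma m_pos: "\<forall>\<^sub>F k in sequentially. 0 < m k"
  using m by (simp add: filterlim_at_top_dense)

text \<open>Normalising along v makes the weights cancel, so the entries of t add up to T. The
  bounds \<open>q / (1 + q) \<le> 1 - exp (- q) \<le> q\<close> are uniform in k because v is at
  least \<open>cl\<close>.\<close>

lemma sv_src_scaled: "(\<lambda>k. (vv k \<bullet> (1 - sv k)) * m k) \<longlonglongrightarrow> T"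
proof -
  have lim: "(\<lambda>k. vv k $ l * (1 - sv k) $ l * m k) \<longlonglongrightarrow> t $ l" for l
  proof (rule tendsto_sandwich)
    define q where "q k = t $ l / (m k * vv k $ l)" for k
    have b: "\<forall>\<^sub>F k in sequentially. t $ l / (1 + t $ l / cl * inverse (m k)) \<le> vv k $ l * (1 - sv k) $ l * m k \<and>
        vv k $ l * (1 - sv k) $ l * m k \<le> t $ l"
      using m_pos
    proof eventually_elim
      case (elim k)
      have s: "(1 - sv k) $ l = 1 - exp (- q k)" using elim by (simp add: sv_def q_def)
      have vm: "0 < vv k $ l * m k" using elim v_pos[of k l] by simp
      have q: "0 \<le> q k" using t elim v_pos[of k l] by (simp add: q_def less_imp_le)
      have tq: "vv k $ l * m k * q k = t $ l" using elim v_pos[of k l] by (simp add: q_def)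
      have "1 - exp (- q k) \<le> q k" using exp_ge_add_one_self[of "- q k"] by linarith
      from mult_left_mono[OF this less_imp_le[OF vm]] have up: "vv k $ l * m k * (1 - exp (- q k)) \<le> t $ l" unfolding tq .
      have "exp (- q k) \<le> 1 / (1 + q k)" using exp_ge_add_one_self[of "q k"] q
        by (simp add: exp_minus inverse_eq_divide frac_le)
      moreover have "1 - 1 / (1 + q k) = q k / (1 + q k)" using q by (simp add: field_simps)
      ultimately have "q k / (1 + q k) \<le> 1 - exp (- q k)" by linarith
      from mult_left_mono[OF this less_imp_le[OF vm]] have lo: "t $ l / (1 + q k) \<le> vv k $ l * m k * (1 - exp (- q k))"
        by (simp only: times_divide_eq_right tq)
      have "q k = t $ l * inverse (m k) * (1 / vv k $ l)" by (simp add: q_def divide_inverse)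
      also have "\<dots> \<le> t $ l * inverse (m k) * (1 / cl)"
        using t elim v_cl[of k l] cl by (intro mult_left_mono divide_left_mono) auto
      finally have "q k \<le> t $ l / cl * inverse (m k)" by simp
      then have "t $ l / (1 + t $ l / cl * inverse (m k)) \<le> t $ l / (1 + q k)"
        using q t by (intro divide_left_mono mult_pos_pos) auto
      from order_trans[OF this lo] show ?case using up by (simp only: s mult_ac simp_thms)
    qed
    show "\<forall>\<^sub>F k in sequentially. t $ l / (1 + t $ l / cl * inverse (m k)) \<le> vv k $ l * (1 - sv k) $ l * m k"
      "\<forall>\<^sub>F k in sequentially. vv k $ l * (1 - sv k) $ l * m k \<le> t $ l"
      using b by (auto elim: eventually_mono)
    have "(\<lambda>k. t $ l / (1 + t $ l / cl * inverse (m k))) \<longlonglongrightarrow> t $ l / (1 + t $ l / cl * 0)"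
      by (intro tendsto_intros tendsto_inverse_0_at_top m) simp
    then show "(\<lambda>k. t $ l / (1 + t $ l / cl * inverse (m k))) \<longlonglongrightarrow> t $ l" by simp
  qed simp
  have "(\<lambda>k. \<Sum>l\<in>UNIV. vv k $ l * (1 - sv k) $ l * m k) \<longlonglongrightarrow> (\<Sum>l\<in>UNIV. t $ l)"
    by (intro tendsto_sum lim)
  then show ?thesis unfolding inner_vec_real sum_distrib_right T(1) .
qed

lemma sv_src_null: "(\<lambda>k. vv k \<bullet> (1 - sv k)) \<longlonglongrightarrow> 0"
proof -
  have "(\<lambda>k. (vv k \<bullet> (1 - sv k)) * m k * inverse (m k)) \<longlonglongrightarrow> T * 0"
    by (intro tendsto_mult sv_src_scaled tendsto_inverse_0_at_top m)
  moreover have "\<forall>\<^sub>F k in sequentially. (vv k \<bullet> (1 - sv k)) * m k * inverse (m k) = vv k \<bullet> (1 - sv k)"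
    using m_pos by eventually_elim simp
  ultimately show ?thesis by (simp only: mult_zero_right) (rule Lim_transform_eventually; assumption)
qed

lemma Phi_limit:
  assumes L: "(\<lambda>k. gap k (sv k) (n k) $ j / traj k 1 1 (n k) $ j) \<longlonglongrightarrow> L"
  shows "(\<lambda>k. Phi (P k) (n k) (m k *\<^sub>R vv k) t j) \<longlonglongrightarrow> L"
proof -
  have "\<forall>\<^sub>F k in sequentially. gap k (sv k) (n k) $ j / traj k 1 1 (n k) $ j = Phi (P k) (n k) (m k *\<^sub>R vv k) t j"
    using m_pos
  proof eventually_elim
    case (elim k)
    have s: "(\<chi> l. exp (- t $ l / (m k *\<^sub>R vv k) $ l)) = sv k" using elim by (simp add: sv_def vec_eq_iff)
    have "0 \<le> t $ l / (m k *\<^sub>R vv k) $ l" for l using elim t v_pos[of k l] by (simp add: less_imp_le)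
    from Phi_eq[of t "m k *\<^sub>R vv k", OF this] show ?case
      unfolding s by (simp add: gap_def traj_gs gs_one)
  qed
  then show ?thesis by (rule Lim_transform_eventually[OF L])
qed

end

lemma n_at_top_real: "filterlim (\<lambda>k. real (n k)) at_top sequentially"
  by (rule filterlim_compose[OF filterlim_real_sequentially n])

text \<open>The normalisation enters only through the limit of n^2 Q / m. As Q is bounded below, m
  tends to infinity; hence m times the source tends to T and n^2 Q times the source to
  \<open>y0 * T\<close>.\<close>

lemma Phi_ode:
  assumes nt: "(\<lambda>k. real (n k) * (rho (P k) - 1)) \<longlonglongrightarrow> lam"
    and y: "(\<lambda>k. (real (n k))^2 * Qpar (P k) / m k) \<longlonglongrightarrow> y0" "y0 > 0"
    and T: "T = (\<Sum>l\<in>UNIV. t $ l)" "T > 0" and w: "w = sqrt (lam^2 + 4 * (y0 * T))"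
  shows "(\<lambda>k. Phi (P k) (n k) (m k *\<^sub>R vv k) t j) \<longlonglongrightarrow>
    2 * exp (- w) * w^2 / ((1 - exp (- w)) * (w * (1 + exp (- w)) - lam * (1 - exp (- w))))
      / (1 / egap \<bar>lam\<bar> - (\<bar>lam\<bar> - lam) / 2)"
proof -
  have "filterlim (\<lambda>k. cc * (real (n k))^2) at_top sequentially"
    by (rule filterlim_tendsto_pos_mult_at_top[OF tendsto_const c0_pos filterlim_pow_at_top[OF _ n_at_top_real]]) simp
  then have nQ: "filterlim (\<lambda>k. (real (n k))^2 * Qpar (P k)) at_top sequentially"
    by (rule filterlim_at_top_mono) (intro always_eventually allI, simp add: mult.commute[of _ "Qpar _"] mult_right_mono Q_lo)
  have "filterlim (\<lambda>k. inverse ((real (n k))^2 * Qpar (P k) / m k) * ((real (n k))^2 * Qpar (P k))) at_top sequentially"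
    by (rule filterlim_tendsto_pos_mult_at_top[OF tendsto_inverse[OF y(1)] _ nQ]) (use y(2) in auto)
  moreover have ypos: "\<forall>\<^sub>F k in sequentially. 0 < (real (n k))^2 * Qpar (P k) / m k"
    by (rule order_tendstoD(1)[OF y])
  then have "\<forall>\<^sub>F k in sequentially. inverse ((real (n k))^2 * Qpar (P k) / m k) * ((real (n k))^2 * Qpar (P k)) = m k"
    by eventually_elim (auto simp: zero_less_divide_iff)
  ultimately have m: "filterlim m at_top sequentially"
    by (simp cong: filterlim_cong)
  have "(\<lambda>k. ((real (n k))^2 * Qpar (P k) / m k) * ((vv k \<bullet> (1 - sv m k)) * m k)) \<longlonglongrightarrow> y0 * T"
    by (intro tendsto_mult y sv_src_scaled m T)
  moreover have "\<forall>\<^sub>F k in sequentially. ((real (n k))^2 * Qpar (P k) / m k) * ((vv k \<bullet> (1 - sv m k)) * m k)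
      = (real (n k))^2 * (Qpar (P k) * (vv k \<bullet> (1 - sv m k)))"
    using m_pos[OF m T] by eventually_elim simp
  ultimately have nq: "(\<lambda>k. (real (n k))^2 * (Qpar (P k) * (vv k \<bullet> (1 - sv m k)))) \<longlonglongrightarrow> y0 * T"
    by (rule Lim_transform_eventually)
  have "0 < y0 * T" using y T by simp
  from Phi_limit[OF m T ode_ratio[OF sv_cube[OF m T] sv_src_null[OF m T] n sv_src_pos[OF m T] nt nq this, folded w]]
  show ?thesis .
qed

lemma m_scale_limit:
  assumes r: "0 < r" "r < 1" and H: "(\<lambda>k. h (theta (P k) (n k))) \<longlonglongrightarrow> H" "H > 0"
    and l: "(\<lambda>k. real (n k) * (1 - rho_mu (P k))) \<longlonglongrightarrow> - ln r"
  shows "(\<lambda>k. (real (n k))^2 * Qpar (P k) / (Qpar (P k) * (1 - rho_mu (P k) ^ n k)^2 * h (theta (P k) (n k)) / (1 - rho_mu (P k))^2))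
    \<longlonglongrightarrow> (ln r)^2 / ((1 - r)^2 * H)"
proof -
  have "(\<lambda>k. (real (n k) * (1 - rho_mu (P k)))^2 / ((1 - rho_mu (P k) ^ n k)^2 * h (theta (P k) (n k)))) \<longlonglongrightarrow> (- ln r)^2 / ((1 - r)^2 * H)"
    by (intro tendsto_intros l H power_theta_limit[OF r n]) (use r H(2) in auto)
  moreover have "(real (n k) * (1 - rho_mu (P k)))^2 / (X * Y) = (real (n k))^2 * Qpar (P k) / (Qpar (P k) * X * Y / (1 - rho_mu (P k))^2)" for k X Y
    using Q_pos[of k] by (simp add: power_mult_distrib)
  ultimately show ?thesis by simp
qed

text \<open>Identifies the frequency \<open>w\<close> with \<open>- ln r\<close> times the square
  root that defines \<open>d_plus\<close> and \<open>d_minus\<close>.\<close>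

lemma ode_frequency:
  assumes r: "0 < r" "r < (1::real)" and H: "H > 0" and T: "T \<ge> 0"
  shows "sqrt ((ln r)^2 + 4 * ((ln r)^2 / ((1 - r)^2 * H) * T)) = - ln r * sqrt (1 + 4 * T / ((1 - r)^2 * H))"
    "0 < sqrt (1 + 4 * T / ((1 - r)^2 * H))"
proof -
  have "(ln r)^2 + 4 * ((ln r)^2 / ((1 - r)^2 * H) * T) = (ln r)^2 * (1 + 4 * T / ((1 - r)^2 * H))"
    by (simp add: distrib_left)
  then show "sqrt ((ln r)^2 + 4 * ((ln r)^2 / ((1 - r)^2 * H) * T)) = - ln r * sqrt (1 + 4 * T / ((1 - r)^2 * H))"
    using r by (simp add: real_sqrt_mult)
  have "0 \<le> 4 * T / ((1 - r)^2 * H)" using r H T by simp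
  then show "0 < sqrt (1 + 4 * T / ((1 - r)^2 * H))" by (simp only: real_sqrt_gt_0_iff)
qed

lemma T_nonneg: "0 \<le> (\<Sum>l\<in>UNIV. t $ l)"
  using t by (intro sum_nonneg) auto

lemma Phi_weakly_supercritical:
  assumes sup: "\<And>k. 1 < rho (P k)" and r: "0 < r" "r < 1"
    and l: "(\<lambda>k. real (n k) * (rho (P k) - 1)) \<longlonglongrightarrow> - ln r"
  defines "D \<equiv> d_plus (\<Sum>l\<in>UNIV. t $ l) r"
  shows "(\<lambda>k. Phi (P k) (n k) (m_pm h_plus (P k) (n k)) t j) \<longlonglongrightarrow>
    2 * (1 - r) * r powr D * D^2 / ((1 - r powr D) * (D - 1 + (D + 1) * r powr D))"
proof (cases "(\<Sum>l\<in>UNIV. t $ l) = 0")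
  case True
  have "D = 1" unfolding D_def True by (simp add: d_plus_def)
  then have "2 * (1 - r) * r powr D * D^2 / ((1 - r powr D) * (D - 1 + (D + 1) * r powr D)) = 1" using r by simp
  then show ?thesis using Phi_zero[OF True] by (simp only:)
next
  case False
  then have T: "0 < (\<Sum>l\<in>UNIV. t $ l)" using T_nonneg by simp
  have H: "0 < h_plus (ln r)" by (rule h_plus_pos[OF r])
  \<comment> \<open>The normalisation is given in terms of \<open>rho_mu\<close>, the assumption in
    terms of \<open>rho\<close>; their distances from 1 are asymptotic.\<close>
  have "(\<lambda>k. real (n k) * (rho (P k) - 1) * ((1 - rho_mu (P k)) / (rho (P k) - 1))) \<longlonglongrightarrow> - ln r * 1"
    by (intro tendsto_mult l rho_mu_supercritical[OF sup])
  moreover have "real (n k) * (rho (P k) - 1) * ((1 - rho_mu (P k)) / (rho (P k) - 1)) = real (n k) * (1 - rho_mu (P k))" for k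
    using sup[of k] by simp
  ultimately have nmu: "(\<lambda>k. real (n k) * (1 - rho_mu (P k))) \<longlonglongrightarrow> - ln r" by simp
  have th: "(\<lambda>k. h_plus (theta (P k) (n k))) \<longlonglongrightarrow> h_plus (ln r)"
    unfolding theta_def by (intro h_tendsto r power_theta_limit[OF r n nmu])
  have y0: "0 < (ln r)^2 / ((1 - r)^2 * h_plus (ln r))" using r H by simp
  have w: "- ln r * D = sqrt ((- ln r)^2 + 4 * ((ln r)^2 / ((1 - r)^2 * h_plus (ln r)) * (\<Sum>l\<in>UNIV. t $ l)))"
    unfolding power2_minus ode_frequency(1)[OF r H less_imp_le[OF T]] D_def d_plus_def ..
  have D: "0 < D" unfolding D_def d_plus_def by (rule ode_frequency(2)[OF r H less_imp_le[OF T]])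
  show ?thesis unfolding m_pm_def ode_value_super[OF r D refl, symmetric]
    by (rule Phi_ode[OF l m_scale_limit[OF r th H nmu] y0 refl T w])
qed

lemma Phi_weakly_subcritical:
  assumes sub: "\<And>k. rho (P k) < 1" and r: "0 < r" "r < 1"
    and l: "(\<lambda>k. real (n k) * (1 - rho (P k))) \<longlonglongrightarrow> - ln r"
  defines "D \<equiv> d_minus (\<Sum>l\<in>UNIV. t $ l) r"
  shows "(\<lambda>k. Phi (P k) (n k) (m_pm h_minus (P k) (n k)) t j) \<longlonglongrightarrow>
    2 * (1 - r) * r powr D * D^2 / (r * (1 - r powr D) * (D + 1 + (D - 1) * r powr D))"
proof (cases "(\<Sum>l\<in>UNIV. t $ l) = 0")
  case True
  have "D = 1" unfolding D_def True by (simp add: d_minus_def)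
  then have "2 * (1 - r) * r powr D * D^2 / (r * (1 - r powr D) * (D + 1 + (D - 1) * r powr D)) = 1" using r by simp
  then show ?thesis using Phi_zero[OF True] by (simp only:)
next
  case False
  then have T: "0 < (\<Sum>l\<in>UNIV. t $ l)" using T_nonneg by simp
  have H: "0 < h_minus (ln r)" by (rule h_minus_pos[OF r])
  have nmu: "(\<lambda>k. real (n k) * (1 - rho_mu (P k))) \<longlonglongrightarrow> - ln r"
    using l by (simp add: rho_mu_subcritical sub)
  have l': "(\<lambda>k. real (n k) * (rho (P k) - 1)) \<longlonglongrightarrow> ln r"
    using tendsto_minus[OF l] by (simp add: algebra_simps)
  have th: "(\<lambda>k. h_minus (theta (P k) (n k))) \<longlonglongrightarrow> h_minus (ln r)"
    unfolding theta_def by (intro h_tendsto r power_theta_limit[OF r n nmu])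
  have y0: "0 < (ln r)^2 / ((1 - r)^2 * h_minus (ln r))" using r H by simp
  have w: "- ln r * D = sqrt ((ln r)^2 + 4 * ((ln r)^2 / ((1 - r)^2 * h_minus (ln r)) * (\<Sum>l\<in>UNIV. t $ l)))"
    unfolding ode_frequency(1)[OF r H less_imp_le[OF T]] D_def d_minus_def ..
  have D: "0 < D" unfolding D_def d_minus_def by (rule ode_frequency(2)[OF r H less_imp_le[OF T]])
  show ?thesis unfolding m_pm_def ode_value_sub[OF r D refl, symmetric]
    by (rule Phi_ode[OF l' m_scale_limit[OF r th H nmu] y0 refl T w])
qed

lemma Phi_critical:
  assumes l: "(\<lambda>k. real (n k) * (rho (P k) - 1)) \<longlonglongrightarrow> 0" and T: "T = (\<Sum>l\<in>UNIV. t $ l)"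
  shows "(\<lambda>k. Phi (P k) (n k) ((2 * Qpar (P k) * real (n k)^2 / 3) *\<^sub>R vv k) t j) \<longlonglongrightarrow>
    (if T = 0 then 1 else sqrt (6 * T) / sinh (sqrt (6 * T)))"
proof (cases "T = 0")
  case True
  then show ?thesis using Phi_zero T by simp
next
  case False
  then have T0: "0 < T" using T_nonneg by (simp add: T)
  have "\<forall>\<^sub>F k in sequentially. 0 < real (n k)"
    using n_at_top_real unfolding filterlim_at_top_dense by blast
  \<comment> \<open>The factor 2/3 in the normalisation gives \<open>y0 = 3/2\<close>, hence
    \<open>w^2 = 6 T\<close>.\<close>
  then have "\<forall>\<^sub>F k in sequentially. 3/2 = (real (n k))^2 * Qpar (P k) / (2 * Qpar (P k) * real (n k)^2 / 3)"
    by eventually_elim (use Q_pos in \<open>simp add: less_imp_neq[symmetric]\<close>)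
  then have y: "(\<lambda>k. (real (n k))^2 * Qpar (P k) / (2 * Qpar (P k) * real (n k)^2 / 3)) \<longlonglongrightarrow> 3/2"
    by (rule Lim_transform_eventually[OF tendsto_const])
  have w: "sqrt (6 * T) = sqrt (0^2 + 4 * (3/2 * T))" by simp
  have w6: "0 < sqrt (6 * T)" using T0 by simp
  from Phi_ode[OF l y _ T T0 w] show ?thesis
    unfolding ode_value_critical[OF w6] using False by simp
qed

lemma Phi_strongly_subcritical:
  assumes sub: "\<And>k. rho (P k) < 1" and l: "filterlim (\<lambda>k. real (n k) * (1 - rho (P k))) at_top sequentially"
    and T: "T = (\<Sum>l\<in>UNIV. t $ l)"
  shows "(\<lambda>k. Phi (P k) (n k) ((2 * Qpar (P k) * real (n k) / (1 - rho (P k))) *\<^sub>R vv k) t j) \<longlonglongrightarrow> exp (- T)"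
proof (cases "T = 0")
  case True
  then show ?thesis using Phi_zero T by simp
next
  case False
  then have T0: "0 < T" using T_nonneg by (simp add: T)
  define m where "m k = 2 * Qpar (P k) * real (n k) / (1 - rho (P k))" for k
  have m: "filterlim m at_top sequentially"
  proof (rule filterlim_at_top_mono)
    show "filterlim (\<lambda>k. 2 * cc * real (n k)) at_top sequentially"
      by (rule filterlim_tendsto_pos_mult_at_top[OF tendsto_const _ n_at_top_real]) (use c0_pos in simp)
    have "2 * cc * real (n k) \<le> m k" for k
    proof -
      have "2 * cc * real (n k) \<le> 2 * Qpar (P k) * real (n k)" using Q_lo[of k] by (intro mult_right_mono) auto
      moreover have "2 * Qpar (P k) * real (n k) \<le> m k" unfolding m_def
        using sub[of k] rho_pos[of k] Q_pos[of k] by (intro le_divide_eq_1[THEN iffD2] mult_imp_le_div_pos mult_left_le) auto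
      ultimately show ?thesis by linarith
    qed
    then show "\<forall>\<^sub>F k in sequentially. 2 * cc * real (n k) \<le> m k" by simp
  qed
  \<comment> \<open>The normalisation is such that m times the source equals 2 Q n times the
    plateau, the quantity accumulated in the exponent.\<close>
  have "(\<lambda>k. 2 * Qpar (P k) * real (n k) * ((vv k \<bullet> (1 - sv m k)) / (1 - rho (P k)))) \<longlonglongrightarrow> T"
    using sv_src_scaled[OF m T T0] by (simp add: m_def mult_ac)
  from Phi_limit[OF m T T0 sub_limit[OF sv_cube[OF m T T0] n sub l this T0 sv_src_pos[OF m T T0]]]
  show ?thesis unfolding m_def .
qed

lemma Phi_strongly_supercritical:
  assumes sup: "\<And>k. 1 < rho (P k)" and l: "filterlim (\<lambda>k. real (n k) * (rho (P k) - 1)) at_top sequentially"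
    and T: "T = (\<Sum>l\<in>UNIV. t $ l)"
  shows "(\<lambda>k. Phi (P k) (n k) ((Qpar (P k) * rho (P k) ^ n k / (1 - rho (P k))^2) *\<^sub>R vv k) t j) \<longlonglongrightarrow> 1 / (1 + T)"
proof (cases "T = 0")
  case True
  then show ?thesis using Phi_zero T by simp
next
  case False
  then have T0: "0 < T" using T_nonneg by (simp add: T)
  define m where "m k = Qpar (P k) * rho (P k) ^ n k / (1 - rho (P k))^2" for k
  have m: "filterlim m at_top sequentially"
  proof (rule filterlim_at_top_mono)
    show "filterlim (\<lambda>k. cc * (real (n k) * (rho (P k) - 1))) at_top sequentially"
      by (rule filterlim_tendsto_pos_mult_at_top[OF tendsto_const c0_pos l])
    have "cc * (real (n k) * (rho (P k) - 1)) \<le> m k" for k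
    proof -
      have "real (n k) * (rho (P k) - 1) \<le> rho (P k) ^ n k"
        using Bernoulli_inequality[of "rho (P k) - 1" "n k"] sup[of k] by simp
      then have "cc * (real (n k) * (rho (P k) - 1)) \<le> Qpar (P k) * rho (P k) ^ n k"
        using Q_lo[of k] Q_pos[of k] sup[of k] by (intro mult_mono) auto
      moreover have "Qpar (P k) * rho (P k) ^ n k \<le> m k" unfolding m_def
      proof (rule mult_imp_le_div_pos)
        have "\<bar>1 - rho (P k)\<bar> \<le> 1" using sup[of k] rho_hi[of k] by simp
        then have "(1 - rho (P k))^2 \<le> 1" by (simp add: abs_square_le_1)
        then show "Qpar (P k) * rho (P k) ^ n k * (1 - rho (P k))^2 \<le> Qpar (P k) * rho (P k) ^ n k"
          using Q_pos[of k] rho_pos[of k] by (intro mult_left_le) auto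
      qed (use sup[of k] in simp)
      ultimately show ?thesis by linarith
    qed
    then show "\<forall>\<^sub>F k in sequentially. cc * (real (n k) * (rho (P k) - 1)) \<le> m k" by simp
  qed
  have "(\<lambda>k. Qpar (P k) * (vv k \<bullet> (1 - sv m k)) / (rho (P k) - 1)^2 * rho (P k) ^ n k) \<longlonglongrightarrow> T"
    using sv_src_scaled[OF m T T0] by (simp add: m_def mult_ac power2_commute[of 1])
  from Phi_limit[OF m T T0 super_ratio[OF sv_cube[OF m T T0] sv_src_null[OF m T T0] n sv_src_pos[OF m T T0] sup l this T0]]
  show ?thesis unfolding m_def .
qed

end

end

theorem theorem3:
  fixes a b c :: real and U :: nat and t :: "real^'d::finite"
    and nk :: "nat \<Rightarrow> nat" and P :: "nat \<Rightarrow> 'd offspring"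
  assumes "a > 0" and "b > 0" and "c > 0" and "U \<ge> 1"
    and H: "hypH TYPE('d) a b c U"
    and t_nonneg: "\<forall>l. t$l \<ge> 0"
    and n_inf: "filterlim nk at_top sequentially"
    and inK: "\<forall>k. P k \<in> classK a b c U"
    and rho_lim: "((\<lambda>k. rho (P k)) \<longlongrightarrow> 1) sequentially"
  shows
   "(\<forall>r. 0 < r \<and> r < 1 \<and> (\<forall>k. rho (P k) > 1) \<and>
        ((\<lambda>k. real (nk k) * \<bar>1 - rho (P k)\<bar>) \<longlongrightarrow> - ln r) sequentially \<longrightarrow>
      (\<forall>j. ((\<lambda>k. Phi (P k) (nk k) (m_pm h_plus (P k) (nk k)) t j) \<longlongrightarrow>
            (let D = d_plus (\<Sum>l\<in>UNIV. t$l) r in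
             2 * (1 - r) * r powr D * D^2 / ((1 - r powr D) * (D - 1 + (D + 1) * r powr D))))
           sequentially)) \<and>
    (\<forall>r. 0 < r \<and> r < 1 \<and> (\<forall>k. rho (P k) < 1) \<and>
        ((\<lambda>k. real (nk k) * \<bar>1 - rho (P k)\<bar>) \<longlongrightarrow> - ln r) sequentially \<longrightarrow>
      (\<forall>j. ((\<lambda>k. Phi (P k) (nk k) (m_pm h_minus (P k) (nk k)) t j) \<longlongrightarrow>
            (let D = d_minus (\<Sum>l\<in>UNIV. t$l) r in
             2 * (1 - r) * r powr D * D^2 / (r * (1 - r powr D) * (D + 1 + (D - 1) * r powr D))))
           sequentially)) \<and>
    (((\<lambda>k. real (nk k) * \<bar>1 - rho (P k)\<bar>) \<longlongrightarrow> 0) sequentially \<longrightarrow>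
      (\<forall>j. ((\<lambda>k. Phi (P k) (nk k) ((2 * Qpar (P k) * real (nk k)^2 / 3) *\<^sub>R vvec (P k)) t j) \<longlongrightarrow>
            (let T = (\<Sum>l\<in>UNIV. t$l) in
             if T = 0 then 1 else sqrt (6 * T) / sinh (sqrt (6 * T)))) sequentially)) \<and>
    ((\<forall>k. rho (P k) < 1) \<and> filterlim (\<lambda>k. real (nk k) * (1 - rho (P k))) at_top sequentially \<longrightarrow>
      (\<forall>j. ((\<lambda>k. Phi (P k) (nk k) ((2 * Qpar (P k) * real (nk k) / (1 - rho (P k))) *\<^sub>R vvec (P k)) t j)
            \<longlongrightarrow> exp (- (\<Sum>l\<in>UNIV. t$l))) sequentially)) \<and>
    ((\<forall>k. rho (P k) > 1) \<and> filterlim (\<lambda>k. real (nk k) * (rho (P k) - 1)) at_top sequentially \<longrightarrow>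
      (\<forall>j. ((\<lambda>k. Phi (P k) (nk k) ((Qpar (P k) * rho (P k) ^ (nk k) / (1 - rho (P k))^2) *\<^sub>R vvec (P k)) t j)
            \<longlongrightarrow> 1 / (1 + (\<Sum>l\<in>UNIV. t$l))) sequentially))"
proof -
  \<comment> \<open>The locale asks for roots in [1/2, 2] at every index, so an initial segment is
    cut off; limits are unaffected by the shift \<open>k0\<close>.\<close>
  have "\<forall>\<^sub>F k in sequentially. 1/2 < rho (P k) \<and> rho (P k) < 2"
    using rho_lim by (intro eventually_conj order_tendstoD[OF rho_lim]) auto
  then obtain k0 where k0: "\<And>k. 1/2 < rho (P (k + k0)) \<and> rho (P (k + k0)) < 2"
    unfolding eventually_sequentially by (metis le_add2)
  interpret critical_family "\<lambda>k. P (k + k0)" a b c U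
  proof
    show "1 / 2 \<le> rho (P (k + k0))" "rho (P (k + k0)) \<le> 2" for k using k0[of k] by auto
    show "(\<lambda>k. rho (P (k + k0))) \<longlonglongrightarrow> 1" by (rule LIMSEQ_ignore_initial_segment[OF rho_lim])
  qed (use assms in auto)
  have n: "filterlim (\<lambda>k. nk (k + k0)) at_top sequentially"
    by (rule filterlim_compose[OF n_inf filterlim_add_const_nat_at_top])
  have t: "\<And>l. 0 \<le> t $ l" using t_nonneg by blast
  define T where "T = (\<Sum>l\<in>UNIV. t $ l)"
  have lim: "(\<lambda>k. real (nk (k + k0)) * \<bar>1 - rho (P (k + k0))\<bar>) \<longlonglongrightarrow> L"
    if "(\<lambda>k. real (nk k) * \<bar>1 - rho (P k)\<bar>) \<longlonglongrightarrow> L" for L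
    by (rule LIMSEQ_ignore_initial_segment[OF that])
  have top: "filterlim (\<lambda>k. f (k + k0)) at_top sequentially" if "filterlim f at_top sequentially" for f :: "nat \<Rightarrow> real"
    by (rule filterlim_compose[OF that filterlim_add_const_nat_at_top])
  show ?thesis
    unfolding Let_def T_def[symmetric]
  proof (intro conjI allI impI; (elim conjE)?)
    fix r j assume r: "0 < r" "r < 1" and sup: "\<forall>k. 1 < rho (P k)"
      and l: "(\<lambda>k. real (nk k) * \<bar>1 - rho (P k)\<bar>) \<longlonglongrightarrow> - ln r"
    have ab: "\<bar>1 - rho (P k)\<bar> = rho (P k) - 1" for k using sup[rule_format, of k] by simp
    have lim': "(\<lambda>k. real (nk (k + k0)) * (rho (P (k + k0)) - 1)) \<longlonglongrightarrow> - ln r"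
      using lim[OF l] unfolding ab .
    have sup': "1 < rho (P (k + k0))" for k using sup by blast
    show "(\<lambda>k. Phi (P k) (nk k) (m_pm h_plus (P k) (nk k)) t j) \<longlonglongrightarrow> 2 * (1 - r) * r powr d_plus T r * (d_plus T r)\<^sup>2 /
        ((1 - r powr d_plus T r) * (d_plus T r - 1 + (d_plus T r + 1) * r powr d_plus T r))"
      by (rule LIMSEQ_offset[of _ k0], rule Phi_weakly_supercritical[OF n t sup' r lim', folded T_def])
  next
    fix r j assume r: "0 < r" "r < 1" and sub: "\<forall>k. rho (P k) < 1"
      and l: "(\<lambda>k. real (nk k) * \<bar>1 - rho (P k)\<bar>) \<longlonglongrightarrow> - ln r"
    have ab: "\<bar>1 - rho (P k)\<bar> = 1 - rho (P k)" for k using sub[rule_format, of k] by simp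
    have lim': "(\<lambda>k. real (nk (k + k0)) * (1 - rho (P (k + k0)))) \<longlonglongrightarrow> - ln r"
      using lim[OF l] unfolding ab .
    have sub': "rho (P (k + k0)) < 1" for k using sub by blast
    show "(\<lambda>k. Phi (P k) (nk k) (m_pm h_minus (P k) (nk k)) t j) \<longlonglongrightarrow> 2 * (1 - r) * r powr d_minus T r * (d_minus T r)\<^sup>2 /
        (r * (1 - r powr d_minus T r) * (d_minus T r + 1 + (d_minus T r - 1) * r powr d_minus T r))"
      by (rule LIMSEQ_offset[of _ k0], rule Phi_weakly_subcritical[OF n t sub' r lim', folded T_def])
  next
    fix j assume l: "(\<lambda>k. real (nk k) * \<bar>1 - rho (P k)\<bar>) \<longlonglongrightarrow> 0"
    \<comment> \<open>No sign of \<open>rho - 1\<close> is given here; the limit zero of the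
      absolute value yields that of the signed quantity.\<close>
    have "(\<lambda>k. real (nk (k + k0)) * (rho (P (k + k0)) - 1)) \<longlonglongrightarrow> 0"
      by (rule tendsto_rabs_zero_cancel) (use lim[OF l] in \<open>simp add: abs_mult abs_minus_commute\<close>)
    from Phi_critical[OF n t this T_def, of j]
    show "(\<lambda>k. Phi (P k) (nk k) ((2 * Qpar (P k) * (real (nk k))\<^sup>2 / 3) *\<^sub>R vvec (P k)) t j) \<longlonglongrightarrow>
        (if T = 0 then 1 else sqrt (6 * T) / sinh (sqrt (6 * T)))"
      by (rule LIMSEQ_offset[of _ k0])
  next
    fix j assume sub: "\<forall>k. rho (P k) < 1" and l: "filterlim (\<lambda>k. real (nk k) * (1 - rho (P k))) at_top sequentially"
    have sub': "rho (P (k + k0)) < 1" for k using sub by blast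
    show "(\<lambda>k. Phi (P k) (nk k) ((2 * Qpar (P k) * real (nk k) / (1 - rho (P k))) *\<^sub>R vvec (P k)) t j) \<longlonglongrightarrow> exp (- T)"
      by (rule LIMSEQ_offset[of _ k0], rule Phi_strongly_subcritical[OF n t sub' top[OF l] T_def])
  next
    fix j assume sup: "\<forall>k. 1 < rho (P k)" and l: "filterlim (\<lambda>k. real (nk k) * (rho (P k) - 1)) at_top sequentially"
    have sup': "1 < rho (P (k + k0))" for k using sup by blast
    show "(\<lambda>k. Phi (P k) (nk k) ((Qpar (P k) * rho (P k) ^ nk k / (1 - rho (P k))\<^sup>2) *\<^sub>R vvec (P k)) t j) \<longlonglongrightarrow> 1 / (1 + T)"
      by (rule LIMSEQ_offset[of _ k0], rule Phi_strongly_supercritical[OF n t sup' top[OF l] T_def])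
  qed
qed

end
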